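(* Let $\lambda\in\Lambda_n$. Then: (a) for every $w\in\mathfrak R(\lambda)$ there is a sign $\eta_w\in\{1,-1\}$ such that $\eta_w C_w\in Z_w+\hat{\mathcal N}^\lambda\subseteq\mathcal N^\lambda$; (b) $\mathcal N^\lambda$ equals the $A$-span of all $C_w$ such that $w\in\mathfrak R(\mu)$ for some $\mu\in\Lambda_n$ with $\lambda\trianglelefteq\mu$.
   Context: Hecke algebra and Kazhdan–Lusztig basis. Let $W=\mathfrak S_n$ act on $\{1,\dots,n\}$ on the left, with Coxeter generators $S=\{s_1,\dots,s_{n-1}\}$, $s_i=(i,i+1)$. Let $l$ be the length function and $\varepsilon_w=(-1)^{l(w)}$. Let $A=\mathbb Z[v,v^{-1}]$ with ring involution $a\mapsto\bar a$, $\bar v=v^{-1}$. The Iwahori–Hecke algebra $\mathcal H$ is free over $A$ with basis $\{T_w\}$ and multiplication $T_sT_w=T_{sw}$ if $l(sw)=l(w)+1$, $T_sT_w=T_{sw}+(v-v^{-1})T_w$ if $l(sw)=l(w)-1$. Let $h\mapsto\bar h$ be the ring involution of $\mathcal H$ with $\overline{\sum a_wT_w}=\sum\bar a_wT_{w^{-1}}^{-1}$. For $w\in W$, $C_w$ is the unique element with $\overline{C_w}=C_w$ and $C_w-T_w\in\sum_y v\mathbb Z[v]T_y$; $\{C_w\}$ is an $A$-basis of $\mathcal H$. Partitions. $\Lambda_n$ is the set of partitions of $n$, with dominance order: $\lambda\trianglelefteq\mu$ iff $\lambda_1+\dots+\lambda_i\le\mu_1+\dots+\mu_i$ for all $i$;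 $\lambda\triangleleft\mu$ means $\lambda\trianglelefteq\mu$, $\lambda\ne\mu$. For $\lambda$ with parts $\lambda_1\ge\lambda_2\ge\cdots$, $\mathfrak S_\lambda$ is the Young subgroup generated by the $s_k$ with $k\notin\{\lambda_1+\dots+\lambda_i: i\ge1\}$, $w_\lambda$ its longest element, $X_\lambda$ the set of elements of minimal length in their left coset $x\mathfrak S_\lambda$, and $P_\lambda=\sum_{u\in\mathfrak S_\lambda}v^{2l(u)}$. Characters and leading coefficients. $K=\mathbb R(v)$, $\mathcal H_K=K\otimes_A\mathcal H$ (split semisimple). Its irreducible characters are labelled $\chi_\lambda$ ($\lambda\in\Lambda_n$) so that for every $\lambda$ the character induced from the sign representation $T_u\mapsto\varepsilon_uv^{-l(u)}$ ($u\in\mathfrak S_\lambda$) of the parabolic subalgebra spanned by $\{T_u:u\in\mathfrak S_\lambda\}$ is $\chi_\lambda$ plus a sum of $\chi_\mu$ with $\lambda\triangleleft\mu$. Let $d_\lambda=\chi_\lambda(T_1)$ and $a(\lambda)=l(w_\lambda)$. Let $\mathcal O\subset K$ be the localization of $\mathbb R[v]$ at the ideal $(v)$, $\mathfrak p=v\mathcal O$; the constant term of $f\in\mathcal O$ is its value at $v=0$. For each $\lambda$ a matrix representation $\mathfrak X_\lambda:\mathcal H_K\to M_{d_\lambda}(K)$ affording $\chi_\lambda$ is fixed which is orthogonal (there is an invertible diagonal matrix $P$ with diagonal entries in $1+v\mathbb R[v]$ and $\mathfrak X_\lambda(T_{w^{-1}})=P^{-1}\mathfrak X_\lambda(T_w)^{tr}P$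 for all $w$); then $v^{a(\lambda)}\mathfrak X_\lambda^{ij}(T_w)$ and $v^{a(\lambda)}\mathfrak X^{ij}_\lambda(C_w)$ lie in $\mathcal O$ and have the same constant term, written $\varepsilon_wc^{ij}_{w,\lambda}$ (leading matrix coefficients), and the $\mathfrak X_\lambda$ are chosen so that all $c^{ij}_{w,\lambda}\in\mathbb Z$. Then for every $\lambda$ and $1\le i,j\le d_\lambda$ there is a unique $w=:\mathbf w_\lambda(i,j)$ with $c^{ij}_{w,\lambda}\ne0$, and $(\lambda,i,j)\mapsto\mathbf w_\lambda(i,j)$ is a bijection onto $\mathfrak S_n$. Set $\mathfrak R(\lambda)=\{\mathbf w_\lambda(i,j):1\le i,j\le d_\lambda\}$. The $\mathfrak X_\lambda$ are normalized so that $\mathbf w_\lambda(1,1)=w_\lambda$; then $\mathbf w_\lambda(i,1)=x_iw_\lambda$ for uniquely determined $x_i\in X_\lambda$, with $x_1=1$. $Z_w$. For $w=\mathbf w_\lambda(i,j)\in\mathfrak R(\lambda)$, set $Z_w=P_\lambda^{-1}\,\varepsilon_{w_\lambda}v^{l(w_\lambda)}C_{x_iw_\lambda}C_{w_\lambda x_j^{-1}}\in\mathcal H_K$. Murphy-type basis. For $\lambda\in\Lambda_n$, a $\lambda$-tableau is a bijection $\mathfrak t$ from $[\lambda]=\{(i,j):1\le j\le\lambda_i\}$ to $\{1,\dots,n\}$; it is row-standard if entries increase along rows, standard if they increase along rows and columns; $\mathbb T(\lambda)$ is the set of standard $\lambda$-tableaux; $\mathfrak t^\lambda$ is the tableau with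 $1,\dots,n$ entered row by row from the top; $(w.\mathfrak t)(i,j)=w(\mathfrak t(i,j))$; for row-standard $\mathfrak t$, $d(\mathfrak t)$ is the unique element of $X_\lambda$ with $\mathfrak t=d(\mathfrak t).\mathfrak t^\lambda$. For $\mathfrak s,\mathfrak t\in\mathbb T(\lambda)$ put $\tilde y_{\mathfrak s\mathfrak t}=T_{d(\mathfrak s)}C_{w_\lambda}T_{d(\mathfrak t)^{-1}}$. $\mathcal N^\lambda$ is the $A$-span of all $\tilde y_{\mathfrak s\mathfrak t}$ with $\mathfrak s,\mathfrak t\in\mathbb T(\mu)$, $\lambda\trianglelefteq\mu$; $\hat{\mathcal N}^\lambda$ is the same with $\lambda\triangleleft\mu$. (These $\tilde y_{\mathfrak s\mathfrak t}$ form an $A$-basis of $\mathcal H$ and $\mathcal N^\lambda,\hat{\mathcal N}^\lambda$ are two-sided ideals.) *)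

theory Defs
  imports "HOL-Computational_Algebra.Polynomial_Factorial" "HOL-Combinatorics.Permutations"
begin

type_synonym K = "real poly fract"

definition vK :: K where "vK = to_fract [:0, 1:]"

definition Kpoly :: "real poly \<Rightarrow> K" where "Kpoly p = to_fract p"

definition peval_inv :: "real poly \<Rightarrow> K" where
  "peval_inv p = poly (map_poly (\<lambda>c. to_fract [:c:]) p) (inverse vK)"

definition barK :: "K \<Rightarrow> K" where
  "barK x = (THE y. \<exists>p q. q \<noteq> 0 \<and> x = Kpoly p / Kpoly q \<and> y = peval_inv p / peval_inv q)"

definition int_poly :: "real poly \<Rightarrow> bool" where
  "int_poly p \<longleftrightarrow> (\<forall>i. coeff p i \<in> \<int>)"

definition inA :: "K \<Rightarrow> bool" where
  "inA x \<longleftrightarrow> (\<exists>p k. int_poly p \<and> x = Kpoly p / vK ^ k)"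

definition in_vZv :: "K \<Rightarrow> bool" where
  "in_vZv x \<longleftrightarrow> (\<exists>p. int_poly p \<and> coeff p 0 = 0 \<and> x = Kpoly p)"

definition const0 :: "K \<Rightarrow> real" where
  "const0 x = (THE c. \<exists>p q. poly q 0 \<noteq> 0 \<and> x = Kpoly p / Kpoly q \<and> c = poly p 0 / poly q 0)"

type_synonym perm = "nat \<Rightarrow> nat"

definition Sym :: "nat \<Rightarrow> perm set" where
  "Sym n = {w. w permutes {1..n}}"

definition sgen :: "nat \<Rightarrow> perm" where
  "sgen i = (\<lambda>k. if k = i then i + 1 else if k = i + 1 then i else k)"

definition wordprod :: "nat list \<Rightarrow> perm" where
  "wordprod is = foldr (\<lambda>i f. sgen i \<circ> f) is id"

definition len :: "nat \<Rightarrow> perm \<Rightarrow> nat" where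
  "len n w = (LEAST k. \<exists>is. length is = k \<and> set is \<subseteq> {1..<n} \<and> wordprod is = w)"

definition sgnK :: "nat \<Rightarrow> perm \<Rightarrow> K" where
  "sgnK n w = (-1) ^ len n w"

definition redword :: "nat \<Rightarrow> perm \<Rightarrow> nat list" where
  "redword n w = (SOME is. length is = len n w \<and> set is \<subseteq> {1..<n} \<and> wordprod is = w)"

section \<open>Iwahori--Hecke algebra (elements of H_K as coefficient functions on S_n)\<close>

type_synonym hecke = "perm \<Rightarrow> K"

definition hT :: "perm \<Rightarrow> hecke" where
  "hT w = (\<lambda>y. if y = w then 1 else 0)"

definition hsmul :: "K \<Rightarrow> hecke \<Rightarrow> hecke" where
  "hsmul a h = (\<lambda>y. a * h y)"

definition hadd :: "hecke \<Rightarrow> hecke \<Rightarrow> hecke" where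
  "hadd h g = (\<lambda>y. h y + g y)"

definition mulTs :: "nat \<Rightarrow> nat \<Rightarrow> hecke \<Rightarrow> hecke" where
  "mulTs n i h = (\<lambda>y. h (sgen i \<circ> y)
      + (if len n (sgen i \<circ> y) < len n y then (vK - inverse vK) * h y else 0))"

text \<open>Left multiplication by T_(s_i)^-1 = T_(s_i) - (v - v^-1).\<close>
definition mulTsinv :: "nat \<Rightarrow> nat \<Rightarrow> hecke \<Rightarrow> hecke" where
  "mulTsinv n i h = (\<lambda>y. mulTs n i h y - (vK - inverse vK) * h y)"

definition mulT :: "nat \<Rightarrow> perm \<Rightarrow> hecke \<Rightarrow> hecke" where
  "mulT n x h = foldr (mulTs n) (redword n x) h"

definition hmul :: "nat \<Rightarrow> hecke \<Rightarrow> hecke \<Rightarrow> hecke" where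
  "hmul n h g = (\<lambda>y. \<Sum>x\<in>Sym n. h x * mulT n x g y)"

text \<open>Bar involution: sum a_w T_w \<mapsto> sum bar(a_w) T_(w^-1)^-1.\<close>
definition hbar :: "nat \<Rightarrow> hecke \<Rightarrow> hecke" where
  "hbar n h = (\<lambda>y. \<Sum>w\<in>Sym n. barK (h w) * foldr (mulTsinv n) (redword n w) (hT id) y)"

definition inH :: "nat \<Rightarrow> hecke \<Rightarrow> bool" where
  "inH n h \<longleftrightarrow> (\<forall>w. w \<notin> Sym n \<longrightarrow> h w = 0) \<and> (\<forall>w. inA (h w))"

definition KL :: "nat \<Rightarrow> perm \<Rightarrow> hecke" where
  "KL n w = (THE c. inH n c \<and> hbar n c = c \<and> (\<forall>y. in_vZv (c y - hT w y)))"

definition spanA :: "hecke set \<Rightarrow> hecke set" where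
  "spanA S = {h. \<exists>F f. finite F \<and> F \<subseteq> S \<and> (\<forall>b. inA (f b)) \<and> h = (\<lambda>y. \<Sum>b\<in>F. f b * b y)}"

definition partitions :: "nat \<Rightarrow> nat list set" where
  "partitions n = {la. sorted_wrt (\<ge>) la \<and> 0 \<notin> set la \<and> sum_list la = n}"

definition dominates :: "nat list \<Rightarrow> nat list \<Rightarrow> bool" (infix "\<unlhd>" 50) where
  "la \<unlhd> mu \<longleftrightarrow> (\<forall>i. sum_list (take i la) \<le> sum_list (take i mu))"

definition sdominates :: "nat list \<Rightarrow> nat list \<Rightarrow> bool" (infix "\<lhd>" 50) where
  "la \<lhd> mu \<longleftrightarrow> la \<unlhd> mu \<and> la \<noteq> mu"

definition youngJ :: "nat \<Rightarrow> nat list \<Rightarrow> nat set" where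
  "youngJ n la = {k \<in> {1..<n}. k \<notin> {sum_list (take i la) | i. i \<ge> 1}}"

definition young :: "nat \<Rightarrow> nat list \<Rightarrow> perm set" where
  "young n la = {wordprod is | is. set is \<subseteq> youngJ n la}"

definition wlong :: "nat \<Rightarrow> nat list \<Rightarrow> perm" where
  "wlong n la = (THE w. w \<in> young n la \<and> (\<forall>u\<in>young n la. len n u \<le> len n w))"

definition Xmin :: "nat \<Rightarrow> nat list \<Rightarrow> perm set" where
  "Xmin n la = {x \<in> Sym n. \<forall>u\<in>young n la. len n x \<le> len n (x \<circ> u)}"

definition Ppoly :: "nat \<Rightarrow> nat list \<Rightarrow> K" where
  "Ppoly n la = (\<Sum>u\<in>young n la. vK ^ (2 * len n u))"

definition diagram :: "nat list \<Rightarrow> (nat \<times> nat) set" where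
  "diagram la = {(i, j). 1 \<le> i \<and> i \<le> length la \<and> 1 \<le> j \<and> j \<le> la ! (i - 1)}"

definition std_tableaux :: "nat \<Rightarrow> nat list \<Rightarrow> (nat \<times> nat \<Rightarrow> nat) set" where
  "std_tableaux n la = {t. bij_betw t (diagram la) {1..n} \<and> (\<forall>c. c \<notin> diagram la \<longrightarrow> t c = 0)
     \<and> (\<forall>i j. (i, j) \<in> diagram la \<and> (i, j + 1) \<in> diagram la \<longrightarrow> t (i, j) < t (i, j + 1))
     \<and> (\<forall>i j. (i, j) \<in> diagram la \<and> (i + 1, j) \<in> diagram la \<longrightarrow> t (i, j) < t (i + 1, j))}"

definition tab0 :: "nat list \<Rightarrow> nat \<times> nat \<Rightarrow> nat" where
  "tab0 la = (\<lambda>(i, j). if (i, j) \<in> diagram la then sum_list (take (i - 1) la) + j else 0)"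

definition dtab :: "nat \<Rightarrow> nat list \<Rightarrow> (nat \<times> nat \<Rightarrow> nat) \<Rightarrow> perm" where
  "dtab n la t = (THE x. x \<in> Xmin n la \<and> (\<forall>c\<in>diagram la. t c = x (tab0 la c)))"

definition ytilde :: "nat \<Rightarrow> nat list \<Rightarrow> (nat \<times> nat \<Rightarrow> nat) \<Rightarrow> (nat \<times> nat \<Rightarrow> nat) \<Rightarrow> hecke" where
  "ytilde n la s t = hmul n (hmul n (hT (dtab n la s)) (KL n (wlong n la))) (hT (inv (dtab n la t)))"

definition Nideal :: "nat \<Rightarrow> nat list \<Rightarrow> hecke set" where
  "Nideal n la = spanA {ytilde n mu s t | mu s t. mu \<in> partitions n \<and> la \<unlhd> mu
      \<and> s \<in> std_tableaux n mu \<and> t \<in> std_tableaux n mu}"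

definition Nhat :: "nat \<Rightarrow> nat list \<Rightarrow> hecke set" where
  "Nhat n la = spanA {ytilde n mu s t | mu s t. mu \<in> partitions n \<and> la \<lhd> mu
      \<and> s \<in> std_tableaux n mu \<and> t \<in> std_tableaux n mu}"

text \<open>A matrix representation of dimension d is given by its values on the basis T_w;
  matrices are functions indexed by {1..d}.\<close>
type_synonym matrep = "perm \<Rightarrow> nat \<Rightarrow> nat \<Rightarrow> K"

definition is_matrep :: "nat \<Rightarrow> nat \<Rightarrow> matrep \<Rightarrow> bool" where
  "is_matrep n d X \<longleftrightarrow>
     (\<forall>i\<in>{1..d}. \<forall>j\<in>{1..d}. X id i j = (if i = j then 1 else 0)) \<and>
     (\<forall>x\<in>Sym n. \<forall>y\<in>Sym n. \<forall>i\<in>{1..d}. \<forall>j\<in>{1..d}.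
        (\<Sum>w\<in>Sym n. hmul n (hT x) (hT y) w * X w i j) = (\<Sum>k=1..d. X x i k * X y k j))"

definition vecs :: "nat \<Rightarrow> (nat \<Rightarrow> K) set" where
  "vecs d = {u. \<forall>k. k \<notin> {1..d} \<longrightarrow> u k = 0}"

definition matvec :: "nat \<Rightarrow> (nat \<Rightarrow> nat \<Rightarrow> K) \<Rightarrow> (nat \<Rightarrow> K) \<Rightarrow> nat \<Rightarrow> K" where
  "matvec d M u = (\<lambda>i. if i \<in> {1..d} then (\<Sum>k=1..d. M i k * u k) else 0)"

definition irreducible_rep :: "nat \<Rightarrow> nat \<Rightarrow> matrep \<Rightarrow> bool" where
  "irreducible_rep n d X \<longleftrightarrow> is_matrep n d X \<and> d \<ge> 1 \<and>
     (\<forall>U. U \<subseteq> vecs d \<and> (\<lambda>_. 0) \<in> U \<and> (\<forall>u\<in>U. \<forall>u'\<in>U. (\<lambda>k. u k + u' k) \<in> U)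
        \<and> (\<forall>a. \<forall>u\<in>U. (\<lambda>k. a * u k) \<in> U) \<and> (\<forall>w\<in>Sym n. \<forall>u\<in>U. matvec d (X w) u \<in> U)
        \<longrightarrow> U = {\<lambda>_. 0} \<or> U = vecs d)"

definition character :: "nat \<Rightarrow> matrep \<Rightarrow> perm \<Rightarrow> K" where
  "character d X w = (\<Sum>i=1..d. X w i i)"

text \<open>Character (on T_w) induced from the sign representation T_u \<mapsto> eps_u v^-l(u) of the
  parabolic subalgebra of the Young subgroup; module basis T_x \<otimes> 1, x in X_la.\<close>
definition ind_sign :: "nat \<Rightarrow> nat list \<Rightarrow> perm \<Rightarrow> K" where
  "ind_sign n la w = (\<Sum>x\<in>Xmin n la. \<Sum>u\<in>young n la.
      mulT n w (hT x) (x \<circ> u) * sgnK n u * inverse (vK ^ len n u))"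

definition orthogonal_rep :: "nat \<Rightarrow> nat \<Rightarrow> matrep \<Rightarrow> bool" where
  "orthogonal_rep n d X \<longleftrightarrow> (\<exists>P :: nat \<Rightarrow> K.
     (\<forall>i\<in>{1..d}. \<exists>p. P i = Kpoly p \<and> coeff p 0 = 1) \<and>
     (\<forall>w\<in>Sym n. \<forall>i\<in>{1..d}. \<forall>j\<in>{1..d}. X (inv w) i j = X w j i * P j / P i))"

definition lcoeff :: "nat \<Rightarrow> nat list \<Rightarrow> matrep \<Rightarrow> perm \<Rightarrow> nat \<Rightarrow> nat \<Rightarrow> real" where
  "lcoeff n la X w i j = (-1) ^ len n w * const0 (vK ^ len n (wlong n la) * X w i j)"

definition wbold :: "nat \<Rightarrow> nat list \<Rightarrow> matrep \<Rightarrow> nat \<Rightarrow> nat \<Rightarrow> perm" where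
  "wbold n la X i j = (THE w. w \<in> Sym n \<and> lcoeff n la X w i j \<noteq> 0)"

definition Rcell :: "nat \<Rightarrow> nat list \<Rightarrow> nat \<Rightarrow> matrep \<Rightarrow> perm set" where
  "Rcell n la d X = {wbold n la X i j | i j. i \<in> {1..d} \<and> j \<in> {1..d}}"

definition xcos :: "nat \<Rightarrow> nat list \<Rightarrow> matrep \<Rightarrow> nat \<Rightarrow> perm" where
  "xcos n la X i = (THE x. x \<in> Xmin n la \<and> wbold n la X i 1 = x \<circ> wlong n la)"

definition Zelt :: "nat \<Rightarrow> nat list \<Rightarrow> matrep \<Rightarrow> nat \<Rightarrow> nat \<Rightarrow> hecke" where
  "Zelt n la X i j = hsmul (inverse (Ppoly n la) * sgnK n (wlong n la) * vK ^ len n (wlong n la))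
     (hmul n (KL n (xcos n la X i \<circ> wlong n la)) (KL n (wlong n la \<circ> inv (xcos n la X j))))"

definition standing_setup :: "nat \<Rightarrow> (nat list \<Rightarrow> nat) \<Rightarrow> (nat list \<Rightarrow> matrep) \<Rightarrow> bool" where
  "standing_setup n d X \<longleftrightarrow>
     (\<forall>la\<in>partitions n. irreducible_rep n (d la) (X la)) \<and>
     (\<forall>la\<in>partitions n. \<forall>mu\<in>partitions n. la \<noteq> mu \<longrightarrow>
        (\<lambda>w\<in>Sym n. character (d la) (X la) w) \<noteq> (\<lambda>w\<in>Sym n. character (d mu) (X mu) w)) \<and>
     (\<forall>la\<in>partitions n. \<exists>m :: nat list \<Rightarrow> nat. \<forall>w\<in>Sym n.
        ind_sign n la w = character (d la) (X la) w
          + (\<Sum>mu\<in>{mu\<in>partitions n. la \<lhd> mu}. of_nat (m mu) * character (d mu) (X mu) w)) \<and>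
     (\<forall>la\<in>partitions n. orthogonal_rep n (d la) (X la)) \<and>
     (\<forall>la\<in>partitions n. \<forall>w\<in>Sym n. \<forall>i\<in>{1..d la}. \<forall>j\<in>{1..d la}.
        lcoeff n la (X la) w i j \<in> \<int>) \<and>
     (\<forall>la\<in>partitions n. wbold n la (X la) 1 1 = wlong n la)"

end

theory Submission
  imports Defs
begin

text \<open>
  The trace forms and orthogonal representations involved are positive definite for the ordering of
  \<open>\<real>(v)\<close> in which \<open>v\<close> is a positive infinitesimal. Positivity and the decomposition of the
  induced sign characters show that the sign idempotent of the Young subgroup of \<open>\<lambda>\<close> acts as zero on
  \<open>\<chi>\<^sub>\<mu>\<close> unless \<open>\<lambda> \<unlhd> \<mu>\<close>; Garnir relations and a Nakayama argument in \<open>v\<close> show that it has rank one on \<open>\<chi>\<^sub>\<lambda>\<close>.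
  Hence the representations are absolutely irreducible, Schur's relations hold, and comparing the
  orders of the Schur elements with those of the Poincare polynomials gives \<open>a(\<lambda>) = l(w\<^sub>\<lambda>)\<close>. The leading
  matrix coefficients are then integers whose squares sum to one, so they single out the elements
  \<open>\<^bold>w\<^sub>\<lambda>(i,j)\<close>.

  The element \<open>Z_w\<close> is bar invariant and integral, it is killed by \<open>\<chi>\<^sub>\<nu>\<close> unless \<open>\<lambda> \<unlhd> \<nu>\<close>, and its leading
  coefficients at \<open>\<lambda>\<close> are those of \<open>\<plusminus> C_w\<close>. By downward induction on the dominance order, its
  coefficients in the Kazhdan--Lusztig basis outside the cells above \<open>\<lambda>\<close> have no pole at \<open>v = 0\<close>; being
  bar invariant they are constants, determined by the leading coefficients, which gives
  \<open>Z_w \<equiv> \<plusminus> C_w\<close> modulo the cells above \<open>\<lambda>\<close>. The Garnir relations also straighten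
  \<open>T_x C_(w\<^sub>\<lambda>)\<close> to standard tableaux, which identifies the spans of the two bases.
\<close>

section \<open>The field of rational functions\<close>

text \<open>The setup provides irreducibility over R(v) only, distinct orthogonal representations,
  triangularity of the induced sign characters and integrality of leading coefficients. Absolute
  irreducibility, the a-function and the fact that scaled matrix entries lie in the local ring are
  derived; until then \<open>const0\<close> and \<open>wbold\<close> are description operators about
  which nothing is known. So the vanishing of sign idempotents has to precede Schur's relations, and
  the norm \<open>Gram\<close> of a character stands in for the Schur element. The recurring device
  is to scale a finite family over K to minimal valuation 0 and to compare real constant terms. The
  end of the proof has to avoid a circle: membership in the ideals is tested by representations, but
  coefficients can be read off only when the elements of the higher cells are known to vanish in the
  lower representations. Both facts travel together in one induction (\<open>KL_good\<close>). For
  this reason straightening is stated inside the representations not strictly above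
  \<open>la\<close>; it becomes a congruence modulo \<open>Nhat\<close> through that
  induction.\<close>

lemma Kpoly_simps [simp]:
  "Kpoly 0 = 0" "Kpoly 1 = 1" "Kpoly (p + q) = Kpoly p + Kpoly q" "Kpoly (p - q) = Kpoly p - Kpoly q"
  "Kpoly (- p) = - Kpoly p" "Kpoly (p * q) = Kpoly p * Kpoly q"
  by (simp_all add: Kpoly_def)

lemma Kpoly_eq_iff [simp]: "Kpoly p = Kpoly q \<longleftrightarrow> p = q"
  by (simp add: Kpoly_def)

lemma Kpoly_eq_0_iff [simp]: "Kpoly p = 0 \<longleftrightarrow> p = 0"
  by (simp add: Kpoly_def)

lemma Kpoly_power [simp]: "Kpoly (p ^ k) = Kpoly p ^ k"
  by (induction k) simp_all

lemma vK_Kpoly: "vK = Kpoly [:0, 1:]"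
  by (simp add: vK_def Kpoly_def)

lemma vK_nonzero [simp]: "vK \<noteq> 0"
  by (simp add: vK_Kpoly)

lemma K_cases:
  obtains p q where "q \<noteq> 0" "x = Kpoly p / Kpoly q"
  by (cases x) (auto simp: Fract_conv_to_fract Kpoly_def)

text \<open>The local ring of R[v] at (v). On it \<open>const0\<close> is the residue map; elsewhere
  \<open>const0\<close> is an unspecified description, so its uses below come with a proof of
  membership here.\<close>

definition inO :: "K \<Rightarrow> bool" where
  "inO x \<longleftrightarrow> (\<exists>p q. poly q 0 \<noteq> 0 \<and> x = Kpoly p / Kpoly q)"

lemma inO_I: "poly q 0 \<noteq> 0 \<Longrightarrow> inO (Kpoly p / Kpoly q)"
  by (auto simp: inO_def)

lemma const0_quot:
  assumes "poly q 0 \<noteq> 0"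
  shows "const0 (Kpoly p / Kpoly q) = poly p 0 / poly q 0"
  unfolding const0_def
proof (rule the_equality)
  show "\<exists>p' q'. poly q' 0 \<noteq> 0 \<and> Kpoly p / Kpoly q = Kpoly p' / Kpoly q' \<and> poly p 0 / poly q 0 = poly p' 0 / poly q' 0"
    using assms by blast
next
  fix c assume "\<exists>p' q'. poly q' 0 \<noteq> 0 \<and> Kpoly p / Kpoly q = Kpoly p' / Kpoly q' \<and> c = poly p' 0 / poly q' 0"
  then obtain p' q' where *: "poly q' 0 \<noteq> 0" "Kpoly p / Kpoly q = Kpoly p' / Kpoly q'" "c = poly p' 0 / poly q' 0"
    by blast
  have nz: "q \<noteq> 0" "q' \<noteq> 0" using assms *(1) by auto
  then have "Kpoly (p * q') = Kpoly (p' * q)"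
    using *(2) by (simp add: field_simps)
  then have "p * q' = p' * q" by (simp only: Kpoly_eq_iff)
  then have "poly p 0 * poly q' 0 = poly p' 0 * poly q 0"
    by (metis poly_mult)
  then show "c = poly p 0 / poly q 0"
    using assms *(1) by (simp add: *(3) frac_eq_eq)
qed

lemma
  assumes "inO x" "inO y"
  shows inO_add: "inO (x + y)" and const0_add: "const0 (x + y) = const0 x + const0 y"
    and inO_mult: "inO (x * y)" and const0_mult: "const0 (x * y) = const0 x * const0 y"
proof -
  obtain p q p' q' where *: "poly q 0 \<noteq> 0" "x = Kpoly p / Kpoly q" "poly q' 0 \<noteq> 0" "y = Kpoly p' / Kpoly q'"
    using assms by (auto simp: inO_def)
  have nz: "q \<noteq> 0" "q' \<noteq> 0" using * by auto
  have a: "x + y = Kpoly (p * q' + p' * q) / Kpoly (q * q')"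
    using nz by (simp add: * field_simps)
  have m: "x * y = Kpoly (p * p') / Kpoly (q * q')" by (simp add: *)
  have z: "poly (q * q') 0 \<noteq> 0" using * by simp
  show "inO (x + y)" "inO (x * y)" unfolding a m using z by (blast intro: inO_I)+
  show "const0 (x + y) = const0 x + const0 y" "const0 (x * y) = const0 x * const0 y"
    unfolding a m const0_quot[OF z] unfolding *(2,4) using * by (simp_all add: const0_quot field_simps)
qed

lemma inO_Kpoly [simp]: "inO (Kpoly p)"
  using inO_I[of 1 p] by simp

lemma const0_Kpoly [simp]: "const0 (Kpoly p) = coeff p 0"
  using const0_quot[of 1 p] by (simp add: poly_0_coeff_0)

lemma inO_simps [simp]: "inO 0" "inO 1" "inO vK" "inO (-1)"
  and const0_simps [simp]: "const0 0 = 0" "const0 1 = 1" "const0 vK = 0" "const0 (-1) = -1"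
  using inO_Kpoly[of 0] inO_Kpoly[of 1] inO_Kpoly[of "[:0, 1:]"] const0_Kpoly[of 0] const0_Kpoly[of 1]
    inO_Kpoly[of "-1"] const0_Kpoly[of "-1"] const0_Kpoly[of "[:0, 1:]"]
  by (simp_all add: vK_Kpoly)

lemma inO_power: "inO x \<Longrightarrow> inO (x ^ k)"
  and const0_power: "inO x \<Longrightarrow> const0 (x ^ k) = const0 x ^ k"
proof -
  have "inO x \<Longrightarrow> inO (x ^ k) \<and> const0 (x ^ k) = const0 x ^ k"
    by (induction k) (auto simp: inO_mult const0_mult)
  then show "inO x \<Longrightarrow> inO (x ^ k)" "inO x \<Longrightarrow> const0 (x ^ k) = const0 x ^ k" by auto
qed

lemma inO_uminus: "inO x \<Longrightarrow> inO (- x)"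
  and const0_uminus: "inO x \<Longrightarrow> const0 (- x) = - const0 x"
  using inO_mult[of "-1" x] const0_mult[of "-1" x] by simp_all

lemma
  assumes "\<And>s. s \<in> S \<Longrightarrow> inO (f s)"
  shows inO_sum: "inO (\<Sum>s\<in>S. f s)" and const0_sum: "const0 (\<Sum>s\<in>S. f s) = (\<Sum>s\<in>S. const0 (f s))"
proof -
  have "inO (\<Sum>s\<in>S. f s) \<and> const0 (\<Sum>s\<in>S. f s) = (\<Sum>s\<in>S. const0 (f s))"
    using assms by (induction S rule: infinite_finite_induct) (auto simp: inO_add const0_add)
  then show "inO (\<Sum>s\<in>S. f s)" "const0 (\<Sum>s\<in>S. f s) = (\<Sum>s\<in>S. const0 (f s))" by auto
qed

lemma inO_inverse: "inO x \<Longrightarrow> const0 x \<noteq> 0 \<Longrightarrow> inO (inverse x)"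
  and const0_inverse: "inO x \<Longrightarrow> const0 x \<noteq> 0 \<Longrightarrow> const0 (inverse x) = inverse (const0 x)"
proof -
  assume x: "inO x" "const0 x \<noteq> 0"
  then obtain p q where *: "poly q 0 \<noteq> 0" "x = Kpoly p / Kpoly q" by (auto simp: inO_def)
  have p: "poly p 0 \<noteq> 0" using x * by (auto simp: const0_quot)
  have i: "inverse x = Kpoly q / Kpoly p" by (simp add: *)
  show "inO (inverse x)" unfolding i by (rule inO_I[OF p])
  show "const0 (inverse x) = inverse (const0 x)"
    unfolding i unfolding * using * p by (simp add: const0_quot)
qed

lemma inO_of_nat [simp]: "inO (of_nat k)" and const0_of_nat [simp]: "const0 (of_nat k) = of_nat k"
proof -
  have "inO (of_nat k) \<and> const0 (of_nat k) = of_nat k"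
    by (induction k) (auto simp: inO_add const0_add)
  then show "inO (of_nat k)" "const0 (of_nat k) = of_nat k" by auto
qed

lemma vK_powi_inO: "k \<ge> 0 \<Longrightarrow> inO (vK powi k)"
  by (simp add: power_int_def inO_power)

lemma vK_powi_const0: "k > 0 \<Longrightarrow> const0 (vK powi k) = 0"
  by (simp add: power_int_def const0_power)

text \<open>The local ring is a discrete valuation ring with uniformiser v: the order of vanishing
  at 0 is split off numerator and denominator separately.\<close>

lemma K_normal_form:
  assumes "x \<noteq> 0"
  obtains k :: int and u where "x = vK powi k * u" "inO u" "const0 u \<noteq> 0"
proof -
  have P: "\<exists>k r. p = [:0, 1:] ^ k * r \<and> poly r 0 \<noteq> 0" if "p \<noteq> 0" for p :: "real poly"
    using order_decomp[OF that, of 0] by (metis dvd_triv_left diff_zero minus_zero poly_eq_0_iff_dvd)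
  obtain p q where pq: "q \<noteq> 0" "x = Kpoly p / Kpoly q" by (rule K_cases)
  have "p \<noteq> 0" using assms pq by auto
  then obtain k r where k: "p = [:0, 1:] ^ k * r" "poly r 0 \<noteq> 0" using P by blast
  obtain l s where l: "q = [:0, 1:] ^ l * s" "poly s 0 \<noteq> 0" using P[OF pq(1)] by blast
  have nz: "r \<noteq> 0" "s \<noteq> 0" using k l by auto
  have "x = vK ^ k / vK ^ l * (Kpoly r / Kpoly s)"
    by (simp add: pq k l vK_Kpoly)
  also have "vK ^ k / vK ^ l = vK powi (int k - int l)"
    by (simp add: power_int_diff)
  finally have "x = vK powi (int k - int l) * (Kpoly r / Kpoly s)" .
  moreover have "inO (Kpoly r / Kpoly s)" "const0 (Kpoly r / Kpoly s) \<noteq> 0"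
    using k l by (auto intro: inO_I simp: const0_quot)
  ultimately show thesis by (rule that)
qed

text \<open>The exponent is minus the least valuation in the family. After this scaling a relation
  over K leaves a relation between real constant terms, not all of them zero.\<close>

lemma finite_family_normal_form:
  fixes f :: "'a \<Rightarrow> K"
  assumes "finite S" "\<exists>s\<in>S. f s \<noteq> 0"
  obtains k :: int where "\<And>s. s \<in> S \<Longrightarrow> inO (vK powi k * f s)" "\<exists>s\<in>S. const0 (vK powi k * f s) \<noteq> 0"
proof -
  have "\<forall>s\<in>S. \<exists>k u. f s \<noteq> 0 \<longrightarrow> f s = vK powi k * u \<and> inO u \<and> const0 u \<noteq> 0"
    using K_normal_form by metis
  then obtain k u where ku: "\<And>s. s \<in> S \<Longrightarrow> f s \<noteq> 0 \<Longrightarrow> f s = vK powi k s * u s \<and> inO (u s) \<and> const0 (u s) \<noteq> 0"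
    by metis
  let ?T = "{s\<in>S. f s \<noteq> 0}"
  define m where "m = Min (k ` ?T)"
  have fin: "finite (k ` ?T)" "k ` ?T \<noteq> {}" using assms by auto
  have m: "m \<in> k ` ?T" unfolding m_def using fin by (rule Min_in)
  have eq: "vK powi (- m) * f s = vK powi (k s - m) * u s" if "s \<in> ?T" for s
    using ku[of s] that by (simp add: power_int_diff power_int_minus field_simps)
  have "inO (vK powi (- m) * f s)" if "s \<in> S" for s
  proof (cases "f s = 0")
    case False
    then have "m \<le> k s" unfolding m_def using fin that by auto
    moreover have "s \<in> ?T" using False that by simp
    ultimately show ?thesis unfolding eq[OF \<open>s \<in> ?T\<close>] using False that ku[of s] by (simp add: inO_mult vK_powi_inO)
  qed simp
  moreover from m obtain s where s: "s \<in> ?T" "m = k s" by auto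
  then have "const0 (vK powi (- m) * f s) \<noteq> 0" unfolding eq[OF s(1)] using ku[of s] by simp
  ultimately show thesis using s that by blast
qed

text \<open>\<open>\<real>(v)\<close> is formally real, in the ordering in which \<open>v\<close> is a positive infinitesimal.\<close>

lemma sum_squares_zeroD:
  fixes f u :: "'a \<Rightarrow> K"
  assumes "finite S" "\<And>s. s \<in> S \<Longrightarrow> inO (u s)" "\<And>s. s \<in> S \<Longrightarrow> const0 (u s) > 0"
    and "(\<Sum>s\<in>S. f s * f s * u s) = 0" "s \<in> S"
  shows "f s = 0"
proof (rule ccontr)
  assume "f s \<noteq> 0"
  then obtain k where k: "\<And>s. s \<in> S \<Longrightarrow> inO (vK powi k * f s)" "\<exists>s\<in>S. const0 (vK powi k * f s) \<noteq> 0"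
    using finite_family_normal_form[OF assms(1)] assms(5) by blast
  let ?g = "\<lambda>s. vK powi k * f s"
  \<comment> \<open>The scaling enters squared. Afterwards the constant term of the sum is a sum of
    nonnegative reals, one of which is positive.\<close>
  have "0 = (vK powi k * vK powi k) * (\<Sum>s\<in>S. f s * f s * u s)" using assms(4) by simp
  also have "\<dots> = (\<Sum>s\<in>S. ?g s * ?g s * u s)"
    by (simp add: sum_distrib_left mult_ac)
  finally have "0 = const0 (\<Sum>s\<in>S. ?g s * ?g s * u s)" by simp
  also have "\<dots> = (\<Sum>s\<in>S. const0 (?g s) * const0 (?g s) * const0 (u s))"
    using k(1) assms(2) by (subst const0_sum) (auto simp: inO_mult const0_mult intro!: sum.cong)
  finally have "\<forall>s\<in>S. const0 (?g s) * const0 (?g s) * const0 (u s) = 0"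
    using assms(1,3) by (subst (asm) eq_commute, subst (asm) sum_nonneg_eq_0_iff) (auto simp: less_imp_le)
  then show False using k(2) assms(3) by fastforce
qed

subsection \<open>Laurent polynomials and the bar involution of the field\<close>

lemma int_poly_add: "int_poly p \<Longrightarrow> int_poly q \<Longrightarrow> int_poly (p + q)"
  and int_poly_mult: "int_poly p \<Longrightarrow> int_poly q \<Longrightarrow> int_poly (p * q)"
  and int_poly_uminus: "int_poly p \<Longrightarrow> int_poly (- p)"
  by (auto simp: int_poly_def coeff_mult)

lemma int_poly_pCons [simp]: "int_poly (pCons a p) \<longleftrightarrow> a \<in> \<int> \<and> int_poly p"
  by (auto simp: int_poly_def coeff_pCons split: nat.splits)

lemma int_poly_0 [simp]: "int_poly 0"
  by (simp add: int_poly_def)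

lemma int_poly_1 [simp]: "int_poly 1"
  by (simp add: one_pCons)

lemma int_poly_power: "int_poly p \<Longrightarrow> int_poly (p ^ k)"
  by (induction k) (auto intro: int_poly_mult)

lemma inA_I: "int_poly p \<Longrightarrow> inA (Kpoly p / vK ^ k)"
  by (auto simp: inA_def)

lemma inA_Kpoly: "int_poly p \<Longrightarrow> inA (Kpoly p)"
  using inA_I[of p 0] by simp

lemma
  assumes "inA x" "inA y"
  shows inA_add: "inA (x + y)" and inA_mult: "inA (x * y)"
proof -
  obtain p k q l where *: "int_poly p" "x = Kpoly p / vK ^ k" "int_poly q" "y = Kpoly q / vK ^ l"
    using assms by (auto simp: inA_def)
  have "x + y = Kpoly (p * [:0, 1:] ^ l + q * [:0, 1:] ^ k) / vK ^ (k + l)"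
    by (simp add: * field_simps power_add flip: vK_Kpoly)
  moreover have "int_poly (p * [:0, 1:] ^ l + q * [:0, 1:] ^ k)"
    using * by (intro int_poly_add int_poly_mult int_poly_power) auto
  ultimately show "inA (x + y)" by (simp only: inA_I)
  have "x * y = Kpoly (p * q) / vK ^ (k + l)"
    by (simp add: * field_simps power_add)
  then show "inA (x * y)" using * by (simp only: inA_I int_poly_mult)
qed

lemma inA_uminus: "inA x \<Longrightarrow> inA (- x)"
  by (metis Kpoly_simps(5) inA_def int_poly_uminus minus_divide_left)

lemma inA_diff: "inA x \<Longrightarrow> inA y \<Longrightarrow> inA (x - y)"
  using inA_add[of x "- y"] inA_uminus by simp

lemma inA_simps [simp]: "inA 0" "inA 1" "inA vK" "inA (inverse vK)" "inA (-1)"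
proof -
  show "inA 0" "inA 1" "inA (-1)" "inA vK"
    using inA_Kpoly[of 0] inA_Kpoly[of 1] inA_Kpoly[of "-1"] inA_Kpoly[of "[:0, 1:]"]
    by (simp_all add: vK_Kpoly int_poly_uminus)
  show "inA (inverse vK)" using inA_I[of 1 1] by (simp add: divide_inverse)
qed

lemma inA_power: "inA x \<Longrightarrow> inA (x ^ k)"
  by (induction k) (auto intro: inA_mult)

lemma inA_sum: "(\<And>s. s \<in> S \<Longrightarrow> inA (f s)) \<Longrightarrow> inA (\<Sum>s\<in>S. f s)"
  by (induction S rule: infinite_finite_induct) (auto intro: inA_add)

text \<open>A meets the local ring in Z[v]: if p / v^(k+1) has no pole at 0, then p(0) = 0 and one
  factor v cancels, and so on down to k = 0.\<close>

lemma inA_inO_Kpoly: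
  assumes "inA x" "inO x"
  obtains p where "int_poly p" "x = Kpoly p"
proof -
  obtain p k where pk: "int_poly p" "x = Kpoly p / vK ^ k" using assms by (auto simp: inA_def)
  have "int_poly p \<Longrightarrow> inO (Kpoly p / vK ^ k) \<Longrightarrow> \<exists>q. int_poly q \<and> Kpoly p / vK ^ k = Kpoly q" for p k
  proof (induction k arbitrary: p)
    case (Suc k)
    obtain a b where ab: "poly b 0 \<noteq> 0" "Kpoly p / vK ^ Suc k = Kpoly a / Kpoly b"
      using Suc.prems by (auto simp: inO_def)
    have "b \<noteq> 0" using ab by auto
    then have "Kpoly (p * b) = Kpoly (a * [:0, 1:] ^ Suc k)"
      using ab(2) by (simp add: field_simps flip: vK_Kpoly del: power_Suc)
    then have "p * b = a * [:0, 1:] ^ Suc k" by (simp only: Kpoly_eq_iff)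
    then have "poly (p * b) 0 = 0" by simp
    then have "poly p 0 = 0" using ab by simp
    then obtain q where q: "p = pCons 0 q"
      by (metis pCons_cases poly_0_coeff_0 coeff_pCons_0)
    have "Kpoly p = vK * Kpoly q"
      using Kpoly_simps(6)[of "[:0, 1:]" q] by (simp add: q vK_Kpoly del: Kpoly_simps)
    then have "Kpoly p / vK ^ Suc k = Kpoly q / vK ^ k" by simp
    then show ?case using Suc.IH[of q] Suc.prems q by auto
  qed auto
  then show thesis using pk assms(2) that by blast
qed

text \<open>Smallness splits into three conditions that propagate easily through sums and products;
  the conditions defining the Kazhdan-Lusztig basis are handled in this form.\<close>

lemma in_vZv_iff: "in_vZv x \<longleftrightarrow> inA x \<and> inO x \<and> const0 x = 0"
  by (metis const0_Kpoly inA_Kpoly inA_inO_Kpoly inO_Kpoly in_vZv_def)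

lemma peval_inv_pCons [simp]: "peval_inv (pCons a p) = Kpoly [:a:] + inverse vK * peval_inv p"
proof (cases "a = 0 \<and> p = 0")
  case False
  then have "pCons a p \<noteq> 0" by auto
  then show ?thesis by (auto simp: peval_inv_def map_poly_pCons Kpoly_def)
qed (auto simp: peval_inv_def)

lemma peval_inv_0 [simp]: "peval_inv 0 = 0"
  by (simp add: peval_inv_def)

lemma peval_inv_add [simp]: "peval_inv (p + q) = peval_inv p + peval_inv q"
proof (induction p arbitrary: q)
  case (pCons a p)
  obtain b q' where q: "q = pCons b q'" by (cases q)
  have "Kpoly [:a + b:] = Kpoly [:a:] + Kpoly [:b:]" by (simp flip: Kpoly_simps)
  then show ?case by (simp add: q pCons algebra_simps)
qed simp

lemma peval_inv_smult [simp]: "peval_inv (smult a p) = Kpoly [:a:] * peval_inv p"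
proof (induction p)
  case (pCons b p)
  have "Kpoly [:a * b:] = Kpoly [:a:] * Kpoly [:b:]" by (simp flip: Kpoly_simps(6))
  then show ?case by (simp add: pCons algebra_simps)
qed simp

lemma peval_inv_mult [simp]: "peval_inv (p * q) = peval_inv p * peval_inv q"
  by (induction p) (simp_all add: mult_pCons_left algebra_simps)

lemma peval_inv_1 [simp]: "peval_inv 1 = 1"
  by (simp add: one_pCons) (simp flip: one_pCons)

text \<open>After clearing denominators, bar is the reversal of coefficients. Hence
  \<open>peval_inv\<close> has no kernel, which makes \<open>barK\<close> well defined on
  quotients.\<close>

lemma peval_inv_reflect: "vK ^ degree p * peval_inv p = Kpoly (reflect_poly p)"
proof -
  have "peval_inv p = (\<Sum>i\<le>degree p. Kpoly [:coeff p i:] * inverse vK ^ i)" for p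
  proof (induction p)
    case (pCons a p)
    show ?case
    proof (cases "p = 0")
      case False
      then show ?thesis
        by (simp add: pCons.IH sum.atMost_Suc_shift sum_distrib_left mult_ac del: sum.atMost_Suc)
    qed simp
  qed simp
  then have "vK ^ degree p * peval_inv p = (\<Sum>i\<le>degree p. Kpoly [:coeff p i:] * (vK ^ degree p * inverse vK ^ i))"
    by (simp add: sum_distrib_left mult_ac)
  also have "\<dots> = (\<Sum>i\<le>degree p. Kpoly [:coeff p i:] * vK ^ (degree p - i))"
    by (intro sum.cong) (auto simp: power_diff field_simps)
  also have "\<dots> = (\<Sum>i\<le>degree p. Kpoly [:coeff p (degree p - i):] * vK ^ i)"
    by (rule sum.reindex_bij_witness[of _ "\<lambda>i. degree p - i" "\<lambda>i. degree p - i"]) auto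
  also have "\<dots> = Kpoly (\<Sum>i\<le>degree p. monom (coeff p (degree p - i)) i)"
  proof -
    have K: "Kpoly (sum f S) = (\<Sum>s\<in>S. Kpoly (f s))" for f :: "nat \<Rightarrow> real poly" and S
      by (induction S rule: infinite_finite_induct) auto
    have "monom c i = [:c:] * [:0, 1:] ^ i" for c :: real and i
      by (simp add: monom_altdef)
    then show ?thesis unfolding K vK_Kpoly by (simp only: Kpoly_simps Kpoly_power)
  qed
  also have "(\<Sum>i\<le>degree p. monom (coeff p (degree p - i)) i) = reflect_poly p"
    by (rule poly_eqI) (auto simp: coeff_sum coeff_reflect_poly sum.delta)
  finally show ?thesis .
qed

lemma peval_inv_eq_0_iff [simp]: "peval_inv p = 0 \<longleftrightarrow> p = 0"
  using peval_inv_reflect[of p]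
  by (metis Kpoly_eq_0_iff mult_eq_0_iff peval_inv_0 power_not_zero reflect_poly_eq_0_iff vK_nonzero)

lemma barK_quot:
  assumes "q \<noteq> 0"
  shows "barK (Kpoly p / Kpoly q) = peval_inv p / peval_inv q"
  unfolding barK_def
proof (rule the_equality)
  show "\<exists>p' q'. q' \<noteq> 0 \<and> Kpoly p / Kpoly q = Kpoly p' / Kpoly q' \<and> peval_inv p / peval_inv q = peval_inv p' / peval_inv q'"
    using assms by blast
next
  fix c assume "\<exists>p' q'. q' \<noteq> 0 \<and> Kpoly p / Kpoly q = Kpoly p' / Kpoly q' \<and> c = peval_inv p' / peval_inv q'"
  then obtain p' q' where *: "q' \<noteq> 0" "Kpoly p / Kpoly q = Kpoly p' / Kpoly q'" "c = peval_inv p' / peval_inv q'"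
    by blast
  have "Kpoly (p * q') = Kpoly (p' * q)"
    using *(1,2) assms by (simp add: field_simps)
  then have "p * q' = p' * q" by (simp only: Kpoly_eq_iff)
  then have "peval_inv p * peval_inv q' = peval_inv p' * peval_inv q"
    by (metis peval_inv_mult)
  then show "c = peval_inv p / peval_inv q"
    using assms *(1) by (simp add: *(3) frac_eq_eq)
qed

lemma barK_Kpoly [simp]: "barK (Kpoly p) = peval_inv p"
  using barK_quot[of 1 p] by simp

lemma barK_add [simp]: "barK (x + y) = barK x + barK y"
  and barK_mult [simp]: "barK (x * y) = barK x * barK y"
proof -
  obtain p q where x: "q \<noteq> 0" "x = Kpoly p / Kpoly q" by (rule K_cases)
  obtain p' q' where y: "q' \<noteq> 0" "y = Kpoly p' / Kpoly q'" by (rule K_cases)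
  have a: "x + y = Kpoly (p * q' + p' * q) / Kpoly (q * q')"
    using x y by (simp add: field_simps)
  have m: "x * y = Kpoly (p * p') / Kpoly (q * q')" by (simp add: x y)
  have nz: "q * q' \<noteq> 0" using x y by simp
  show "barK (x + y) = barK x + barK y" "barK (x * y) = barK x * barK y"
    unfolding a m barK_quot[OF nz] unfolding x(2) y(2) barK_quot[OF x(1)] barK_quot[OF y(1)]
    using x y by (simp_all add: field_simps)
qed

lemma barK_0 [simp]: "barK 0 = 0" and barK_1 [simp]: "barK 1 = 1"
  using barK_Kpoly[of 0] barK_Kpoly[of 1] by (simp_all del: barK_Kpoly)

lemma barK_uminus [simp]: "barK (- x) = - barK x"
  using barK_add[of x "- x"] by (simp add: eq_neg_iff_add_eq_0 add.commute del: barK_add)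

lemma barK_diff [simp]: "barK (x - y) = barK x - barK y"
  using barK_add[of x "- y"] by (simp del: barK_add)

lemma barK_vK [simp]: "barK vK = inverse vK"
proof -
  have "Kpoly [:1:] = 1" by (simp flip: one_pCons)
  then have "peval_inv [:0, 1:] = inverse vK" by simp
  then show ?thesis by (metis barK_Kpoly vK_Kpoly)
qed

lemma barK_inverse_vK [simp]: "barK (inverse vK) = vK"
proof -
  have "barK vK * barK (inverse vK) = 1" by (simp flip: barK_mult del: barK_vK)
  then show ?thesis by (simp add: field_simps)
qed

text \<open>Such an element is a polynomial p for which v^(deg p) p equals the reversal of p. The
  left side has degree 2 deg p, the right side at most deg p, so p is constant. This rigidity gives
  the uniqueness of \<open>KL\<close> and later determines the coefficients of Z_w.\<close>

lemma bar_invariant_const: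
  assumes "inA x" "inO x" "barK x = x"
  shows "x = Kpoly [:const0 x:]"
proof -
  obtain p where p: "int_poly p" "x = Kpoly p" using inA_inO_Kpoly assms by blast
  have "peval_inv p = Kpoly p" using assms(3) p by simp
  then have "Kpoly ([:0, 1:] ^ degree p * p) = Kpoly (reflect_poly p)"
    using peval_inv_reflect[of p] by (simp flip: vK_Kpoly)
  then have eq: "[:0, 1:] ^ degree p * p = reflect_poly p" by (simp only: Kpoly_eq_iff)
  have "degree p = 0"
  proof (cases "p = 0")
    case False
    then have "degree ([:0, 1:] ^ degree p * p) = degree p + degree p"
      by (subst degree_mult_eq) (auto simp: degree_power_eq)
    then show ?thesis using degree_reflect_poly_le[of p] eq by simp
  qed simp
  then obtain c where "p = [:c:]" by (rule degree_eq_zeroE)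
  then show ?thesis by (simp add: p)
qed

lemma bar_invariant_zero: "in_vZv x \<Longrightarrow> barK x = x \<Longrightarrow> x = 0"
  using bar_invariant_const[of x] by (simp add: in_vZv_iff)

section \<open>The symmetric group as a Coxeter group\<close>

lemma sgen_transpose: "sgen i = transpose i (i + 1)"
  by (auto simp: sgen_def transpose_def fun_eq_iff)

lemma sgen_sgen [simp]: "sgen i \<circ> sgen i = id" "sgen i (sgen i k) = k"
  by (auto simp: sgen_def fun_eq_iff)

lemma sgen_eq [simp]: "sgen i i = Suc i" "sgen i (Suc i) = i"
  by (auto simp: sgen_def)

lemma sgen_cancel [simp]: "sgen i \<circ> (sgen i \<circ> w) = w" "w \<circ> sgen i \<circ> sgen i = w"
  by (auto simp: sgen_def fun_eq_iff)

lemma sgen_left_eq_iff: "sgen i \<circ> y = (w :: perm) \<longleftrightarrow> y = sgen i \<circ> w"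
  using sgen_cancel(1)[of i y] sgen_cancel(1)[of i w] by auto

lemma sgen_right_eq_iff: "y \<circ> sgen i = (w :: perm) \<longleftrightarrow> y = w \<circ> sgen i"
  using sgen_cancel(2)[of y i] sgen_cancel(2)[of w i] by auto

lemma finite_Sym [simp]: "finite (Sym n)"
  by (simp add: Sym_def finite_permutations)

lemma sgen_Sym: "i \<in> {1..<n} \<Longrightarrow> sgen i \<in> Sym n"
  by (auto simp: Sym_def sgen_transpose intro!: permutes_swap_id)

lemma Sym_id [simp]: "id \<in> Sym n"
  by (simp add: Sym_def permutes_id)

lemma Sym_comp: "x \<in> Sym n \<Longrightarrow> y \<in> Sym n \<Longrightarrow> x \<circ> y \<in> Sym n"
  by (auto simp: Sym_def intro: permutes_compose)

lemma Sym_inv: "x \<in> Sym n \<Longrightarrow> inv x \<in> Sym n"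
  by (auto simp: Sym_def intro: permutes_inv)

lemma Sym_bij: "x \<in> Sym n \<Longrightarrow> bij x"
  by (auto simp: Sym_def permutes_bij)

lemma Sym_inv_comp [simp]: "x \<in> Sym n \<Longrightarrow> x \<circ> inv x = id" "x \<in> Sym n \<Longrightarrow> inv x \<circ> x = id"
  "x \<in> Sym n \<Longrightarrow> inv (inv x) = x"
  by (auto simp: Sym_def permutes_inv_o permutes_inv_inv)

lemma Sym_inv_app [simp]: "x \<in> Sym n \<Longrightarrow> x (inv x a) = a" "x \<in> Sym n \<Longrightarrow> inv x (x a) = a"
  by (auto simp: Sym_def permutes_inverses)

lemma Sym_inj: "x \<in> Sym n \<Longrightarrow> x a = x b \<longleftrightarrow> a = b"
  by (metis Sym_inv_app(2))

lemma Sym_range: "x \<in> Sym n \<Longrightarrow> x a \<in> {1..n} \<longleftrightarrow> a \<in> {1..n}"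
  using permutes_in_image[of x "{1..n}" a] by (simp only: Sym_def mem_Collect_eq)

lemma Sym_outside: "x \<in> Sym n \<Longrightarrow> a \<notin> {1..n} \<Longrightarrow> x a = a"
  by (auto simp: Sym_def permutes_not_in)

lemma Sym_comp_eq_left: "x \<in> Sym n \<Longrightarrow> x \<circ> y = z \<longleftrightarrow> y = inv x \<circ> z"
  by (metis Sym_inv_comp comp_assoc id_comp)

lemma Sym_comp_eq_right: "x \<in> Sym n \<Longrightarrow> y \<circ> x = z \<longleftrightarrow> y = z \<circ> inv x"
  by (metis Sym_inv_comp comp_assoc comp_id)

lemma Sym_inv_distrib: "x \<in> Sym n \<Longrightarrow> y \<in> Sym n \<Longrightarrow> inv (x \<circ> y) = inv y \<circ> inv x"
  by (simp add: Sym_bij o_inv_distrib)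

lemma inv_sgen [simp]: "inv (sgen i) = sgen i"
  by (rule inv_unique_comp) auto

lemma sgen_comp_Sym: "i \<in> {1..<n} \<Longrightarrow> sgen i \<circ> y \<in> Sym n \<longleftrightarrow> y \<in> Sym n"
  "i \<in> {1..<n} \<Longrightarrow> y \<circ> sgen i \<in> Sym n \<longleftrightarrow> y \<in> Sym n"
  by (metis Sym_comp sgen_Sym sgen_cancel)+

lemma wordprod_simps [simp]: "wordprod [] = id" "wordprod (i # is) = sgen i \<circ> wordprod is"
  by (simp_all add: wordprod_def)

lemma wordprod_append: "wordprod (is @ js) = wordprod is \<circ> wordprod js"
  by (induction "is") (auto simp: comp_assoc)

lemma wordprod_Sym: "set is \<subseteq> {1..<n} \<Longrightarrow> wordprod is \<in> Sym n"
  by (induction "is") (simp_all add: Sym_comp sgen_Sym)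

lemma wordprod_rev: "wordprod (rev is) = inv (wordprod is)"
proof (rule inv_unique_comp[symmetric])
  show "wordprod is \<circ> wordprod (rev is) = id"
    by (induction "is") (auto simp: wordprod_append fun_eq_iff)
  show "wordprod (rev is) \<circ> wordprod is = id"
    by (induction "is") (auto simp: wordprod_append fun_eq_iff)
qed

text \<open>Inversions by position. Their number is the length (\<open>len_invset\<close>), so that
  ascents and descents can be tested on the values of w.\<close>

definition invset :: "nat \<Rightarrow> perm \<Rightarrow> (nat \<times> nat) set" where
  "invset n w = {(a, b). 1 \<le> a \<and> a < b \<and> b \<le> n \<and> w b < w a}"

lemma finite_invset [simp]: "finite (invset n w)"
  by (rule finite_subset[of _ "{1..n} \<times> {1..n}"]) (auto simp: invset_def)

text \<open>Relabelling both positions by s_i carries the inversions of w to inversions of the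
  product; only the pair (i, i+1) is new.\<close>

lemma card_invset_ascent:
  assumes "w \<in> Sym n" "i \<in> {1..<n}" "w i < w (Suc i)"
  shows "card (invset n (w \<circ> sgen i)) = Suc (card (invset n w))"
proof -
  let ?f = "\<lambda>(a, b). (sgen i a, sgen i b)"
  have "invset n (w \<circ> sgen i) = insert (i, Suc i) (?f ` invset n w)"
  proof (intro equalityI subsetI)
    fix p assume p: "p \<in> invset n (w \<circ> sgen i)"
    obtain a b where ab: "p = (a, b)" by (cases p)
    have *: "1 \<le> a" "a < b" "b \<le> n" "w (sgen i b) < w (sgen i a)" using p by (auto simp: ab invset_def)
    show "p \<in> insert (i, Suc i) (?f ` invset n w)"
    proof (cases "a = i \<and> b = Suc i")
      case False
      then have "(sgen i a, sgen i b) \<in> invset n w"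
        using * assms(2) by (auto simp: invset_def sgen_def)
      moreover have "p = ?f (sgen i a, sgen i b)" by (simp add: ab)
      ultimately show ?thesis by blast
    qed (simp add: ab)
  next
    fix p assume "p \<in> insert (i, Suc i) (?f ` invset n w)"
    then consider "p = (i, Suc i)" | a b where "(a, b) \<in> invset n w" "p = (sgen i a, sgen i b)" by auto
    then show "p \<in> invset n (w \<circ> sgen i)"
    proof cases
      case 1
      then show ?thesis using assms by (auto simp: invset_def)
    next
      case 2
      then have "\<not> (a = i \<and> b = Suc i)" using assms by (auto simp: invset_def)
      then show ?thesis using 2 assms(2) by (auto simp: invset_def) (auto simp: sgen_def split: if_splits)
    qed
  qed
  moreover have "(i, Suc i) \<notin> ?f ` invset n w"
  proof
    assume "(i, Suc i) \<in> ?f ` invset n w"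
    then obtain a b where "(a, b) \<in> invset n w" "sgen i a = i" "sgen i b = Suc i" by auto
    then show False by (auto simp: invset_def sgen_def split: if_splits)
  qed
  moreover have "inj_on ?f (invset n w)"
    by (rule inj_on_inverseI[where g = ?f]) auto
  ultimately show ?thesis by (simp add: card_image)
qed

lemma card_invset_descent:
  assumes "w \<in> Sym n" "i \<in> {1..<n}" "w (Suc i) < w i"
  shows "card (invset n w) = Suc (card (invset n (w \<circ> sgen i)))"
  using card_invset_ascent[of "w \<circ> sgen i" n i] assms by (auto simp: sgen_comp_Sym)

lemma increasing_imp_mono:
  fixes f :: "nat \<Rightarrow> nat"
  assumes "\<And>k. a \<le> k \<Longrightarrow> k < b \<Longrightarrow> f k < f (Suc k)" "a < b"
  shows "f a < f b"
  using assms(2,1)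
proof (induction "b - a" arbitrary: b)
  case (Suc d)
  show ?case
  proof (cases "a < b - 1")
    case True
    then have "f a < f (b - 1)" using Suc by auto
    also have "\<dots> < f (Suc (b - 1))" by (rule Suc.prems) (use True in auto)
    finally show ?thesis using Suc.prems(1) by simp
  next
    case False
    then have "b = Suc a" using Suc.prems by simp
    then show ?thesis using Suc.prems by auto
  qed
qed simp

text \<open>Both w and its inverse are increasing, and an increasing permutation of 1..n moves no
  point down. So a \<le> w a and w a \<le> inv w (w a) = a.\<close>

lemma no_descent_imp_id:
  assumes "w \<in> Sym n" "\<And>i. i \<in> {1..<n} \<Longrightarrow> w i < w (Suc i)"
  shows "w = id"
proof -
  have mono: "w a < w b" if "1 \<le> a" "a < b" "b \<le> n" for a b
    by (rule increasing_imp_mono[of a b w, OF assms(2) that(2)]) (use that in auto)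
  have imono: "inv w a < inv w b" if "1 \<le> a" "a < b" "b \<le> n" for a b
  proof (rule ccontr)
    assume "\<not> ?thesis"
    moreover have "inv w a \<in> {1..n}" "inv w b \<in> {1..n}"
      using that Sym_range[OF Sym_inv[OF assms(1)]] by auto
    moreover have "inv w a \<noteq> inv w b" using that Sym_inj[OF Sym_inv[OF assms(1)]] by auto
    ultimately have "w (inv w b) < w (inv w a)" by (intro mono) auto
    then show False using that assms(1) by simp
  qed
  have ge: "a \<le> f a" if "f \<in> Sym n" "\<And>a b. 1 \<le> a \<Longrightarrow> a < b \<Longrightarrow> b \<le> n \<Longrightarrow> f a < f b" "1 \<le> a" "a \<le> n" for f :: perm and a
    using that(3,4)
  proof (induction a rule: dec_induct)
    case base
    then show ?case using Sym_range[OF that(1), of 1] by auto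
  next
    case (step k)
    then show ?case using that(2)[of k "Suc k"] by auto
  qed
  show ?thesis
  proof
    fix a show "w a = id a"
    proof (cases "a \<in> {1..n}")
      case True
      then have "w a \<in> {1..n}" using Sym_range assms(1) by blast
      then have "w a \<le> inv w (w a)" using ge[OF Sym_inv[OF assms(1)] imono, of "w a"] by auto
      moreover have "a \<le> w a" using ge[OF assms(1) mono] True by auto
      ultimately show ?thesis using assms(1) by simp
    qed (use assms(1) Sym_outside in auto)
  qed
qed

lemma wordprod_invset_le:
  assumes "set is \<subseteq> {1..<n}"
  shows "card (invset n (wordprod is)) \<le> length is"
  using assms
proof (induction "is" rule: rev_induct)
  case Nil
  have "invset n (\<lambda>a. a) = {}" by (auto simp: invset_def)
  then show ?case by simp
next
  case (snoc i "is")
  let ?w = "wordprod is"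
  have w: "?w \<in> Sym n" "i \<in> {1..<n}" using snoc by (simp_all add: wordprod_Sym)
  have "?w i \<noteq> ?w (Suc i)" using Sym_inj[OF w(1)] by simp
  then consider "?w i < ?w (Suc i)" | "?w (Suc i) < ?w i" by linarith
  then have "card (invset n (?w \<circ> sgen i)) \<le> Suc (card (invset n ?w))"
    using card_invset_ascent[OF w] card_invset_descent[OF w] by cases auto
  then show ?case using snoc by (simp add: wordprod_append comp_def)
qed

lemma exists_word_invset:
  assumes "w \<in> Sym n"
  shows "\<exists>is. length is = card (invset n w) \<and> set is \<subseteq> {1..<n} \<and> wordprod is = w"
  using assms
proof (induction "card (invset n w)" arbitrary: w rule: less_induct)
  case less
  show ?case
  proof (cases "\<forall>i\<in>{1..<n}. w i < w (Suc i)")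
    case True
    then have "w = id" using no_descent_imp_id less.prems by blast
    moreover have "invset n id = {}" by (auto simp: invset_def)
    ultimately show ?thesis by (auto intro!: exI[of _ "[]"])
  next
    case False
    then obtain i where i: "i \<in> {1..<n}" "w (Suc i) < w i"
      using Sym_inj[OF less.prems] by (metis linorder_neqE_nat n_not_Suc_n)
    let ?w = "w \<circ> sgen i"
    have c: "card (invset n w) = Suc (card (invset n ?w))" using card_invset_descent less.prems i by blast
    obtain "is" where "length is = card (invset n ?w)" "set is \<subseteq> {1..<n}" "wordprod is = ?w"
      using less.hyps[of ?w] c less.prems i by (auto simp: sgen_comp_Sym)
    then show ?thesis using i c by (intro exI[of _ "is @ [i]"]) (auto simp: wordprod_append)
  qed
qed

lemma len_invset: "w \<in> Sym n \<Longrightarrow> len n w = card (invset n w)"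
  unfolding len_def by (rule Least_equality) (use exists_word_invset wordprod_invset_le in auto)

lemma redword:
  assumes "w \<in> Sym n"
  shows "length (redword n w) = len n w" "set (redword n w) \<subseteq> {1..<n}" "wordprod (redword n w) = w"
proof -
  have "\<exists>is. length is = len n w \<and> set is \<subseteq> {1..<n} \<and> wordprod is = w"
    using exists_word_invset[OF assms] len_invset[OF assms] by simp
  from someI_ex[OF this] show "length (redword n w) = len n w" "set (redword n w) \<subseteq> {1..<n}" "wordprod (redword n w) = w"
    unfolding redword_def by auto
qed

lemma len_wordprod_le: "set is \<subseteq> {1..<n} \<Longrightarrow> len n (wordprod is) \<le> length is"
  using wordprod_invset_le len_invset wordprod_Sym by metis

lemma len_comp_le: "x \<in> Sym n \<Longrightarrow> y \<in> Sym n \<Longrightarrow> len n (x \<circ> y) \<le> len n x + len n y"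
  using len_wordprod_le[of "redword n x @ redword n y" n] redword[of x n] redword[of y n]
  by (simp add: wordprod_append)

lemma len_inv: "x \<in> Sym n \<Longrightarrow> len n (inv x) = len n x"
proof -
  have "len n (inv x) \<le> len n x" if "x \<in> Sym n" for x
    using len_wordprod_le[of "rev (redword n x)" n] redword[OF that] by (simp add: wordprod_rev)
  from this[of x] this[of "inv x"] show "x \<in> Sym n \<Longrightarrow> len n (inv x) = len n x"
    by (simp add: Sym_inv)
qed

lemma len_id [simp]: "len n id = 0"
  using len_wordprod_le[of "[]" n] by simp

lemma len_eq_0: "w \<in> Sym n \<Longrightarrow> len n w = 0 \<Longrightarrow> w = id"
  using redword[of w n] by simp

lemma len_right_ascent: "w \<in> Sym n \<Longrightarrow> i \<in> {1..<n} \<Longrightarrow> w i < w (Suc i) \<Longrightarrow> len n (w \<circ> sgen i) = Suc (len n w)"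
  using card_invset_ascent[of w n i] by (simp add: len_invset sgen_comp_Sym)

lemma len_right_descent: "w \<in> Sym n \<Longrightarrow> i \<in> {1..<n} \<Longrightarrow> w (Suc i) < w i \<Longrightarrow> len n w = Suc (len n (w \<circ> sgen i))"
  using card_invset_descent[of w n i] by (simp add: len_invset sgen_comp_Sym)

lemma right_descent_iff: "w \<in> Sym n \<Longrightarrow> i \<in> {1..<n} \<Longrightarrow> len n (w \<circ> sgen i) < len n w \<longleftrightarrow> w (Suc i) < w i"
  using len_right_ascent[of w n i] len_right_descent[of w n i] Sym_inj[of w n i "Suc i"]
  by (cases "w i" "w (Suc i)" rule: linorder_cases) auto

lemma len_right_cases:
  assumes "w \<in> Sym n" "i \<in> {1..<n}"
  shows "len n (w \<circ> sgen i) = Suc (len n w) \<or> len n w = Suc (len n (w \<circ> sgen i))"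
  using assms len_right_ascent[of w n i] len_right_descent[of w n i] Sym_inj[of w n i "Suc i"]
  by (cases "w i" "w (Suc i)" rule: linorder_cases) auto

lemma len_left_conv: "w \<in> Sym n \<Longrightarrow> i \<in> {1..<n} \<Longrightarrow> len n (sgen i \<circ> w) = len n (inv w \<circ> sgen i)"
  using len_inv[of "sgen i \<circ> w" n] by (simp add: sgen_comp_Sym Sym_inv_distrib[OF sgen_Sym, of i n w])

lemma len_left_cases:
  assumes "w \<in> Sym n" "i \<in> {1..<n}"
  shows "len n (sgen i \<circ> w) = Suc (len n w) \<or> len n w = Suc (len n (sgen i \<circ> w))"
  using len_right_cases[OF Sym_inv[OF assms(1)] assms(2)] len_left_conv[OF assms] len_inv[OF assms(1)] by auto

lemma left_descent_iff: "w \<in> Sym n \<Longrightarrow> i \<in> {1..<n} \<Longrightarrow> len n (sgen i \<circ> w) < len n w \<longleftrightarrow> inv w (Suc i) < inv w i"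
  using right_descent_iff[of "inv w" n i] len_left_conv[of w n i] len_inv[of w n] by (simp add: Sym_inv)

text \<open>s_i reverses the order of two distinct numbers only if they are i and i+1. If these are
  the values y j and y (j+1), then s_i y = y s_j, the excluded case. Commutation of left and right
  multiplication by generators rests on this.\<close>

lemma sgen_commute_or_descents:
  assumes "y \<in> Sym n" "i \<in> {1..<n}" "j \<in> {1..<n}" "sgen i \<circ> y \<noteq> y \<circ> sgen j"
  shows "len n (sgen i \<circ> y \<circ> sgen j) < len n (sgen i \<circ> y) \<longleftrightarrow> len n (y \<circ> sgen j) < len n y"
proof -
  have "len n (sgen i \<circ> y \<circ> sgen j) < len n (sgen i \<circ> y) \<longleftrightarrow> sgen i (y (Suc j)) < sgen i (y j)"
    using right_descent_iff[of "sgen i \<circ> y" n j] assms by (simp add: sgen_comp_Sym)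
  also have "\<dots> \<longleftrightarrow> y (Suc j) < y j"
  proof (cases "{y j, y (Suc j)} = {i, Suc i}")
    case True
    have inj: "y k = y l \<longleftrightarrow> k = l" for k l using Sym_inj assms(1) by blast
    have "sgen i \<circ> y = y \<circ> sgen j"
    proof
      fix k
      have c: "y j = i \<and> y (Suc j) = Suc i \<or> y j = Suc i \<and> y (Suc j) = i"
        using True by (simp add: doubleton_eq_iff)
      consider "k = j" | "k = Suc j" | "k \<noteq> j" "k \<noteq> Suc j" by blast
      then show "(sgen i \<circ> y) k = (y \<circ> sgen j) k"
      proof cases
        case 3
        then have "y k \<noteq> i" "y k \<noteq> Suc i" using c inj[of k j] inj[of k "Suc j"] by metis+
        then show ?thesis using 3 by (simp add: sgen_def)
      qed (use c in \<open>auto simp: sgen_def\<close>)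
    qed
    then show ?thesis using assms by simp
  next
    case False
    then show ?thesis by (auto simp: sgen_def)
  qed
  also have "\<dots> \<longleftrightarrow> len n (y \<circ> sgen j) < len n y"
    using right_descent_iff[OF assms(1,3)] by simp
  finally show ?thesis .
qed

subsection \<open>Parabolic subgroups and distinguished coset representatives\<close>

definition WJ :: "nat set \<Rightarrow> perm set" where
  "WJ J = {wordprod is | is. set is \<subseteq> J}"

text \<open>Defined by ascents because these are what the coset arguments test;
  \<open>minimal_rep_iff\<close> identifies the elements with those of minimal length in their left
  coset.\<close>

definition XJ :: "nat \<Rightarrow> nat set \<Rightarrow> perm set" where
  "XJ n J = {x \<in> Sym n. \<forall>k\<in>J. x k < x (Suc k)}"

text \<open>\<open>a\<close> and \<open>b\<close> lie in the same orbit of the parabolic subgroup generated by \<open>J\<close>.\<close>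

definition sblk :: "nat set \<Rightarrow> nat \<Rightarrow> nat \<Rightarrow> bool" where
  "sblk J a b \<longleftrightarrow> {min a b..<max a b} \<subseteq> J"

lemma young_WJ: "young n la = WJ (youngJ n la)"
  by (simp add: young_def WJ_def)

lemma youngJ_subset: "youngJ n la \<subseteq> {1..<n}"
  by (auto simp: youngJ_def)

lemma sblk_refl [simp]: "sblk J a a"
  by (simp add: sblk_def)

lemma sblk_sym: "sblk J a b \<Longrightarrow> sblk J b a"
  by (simp add: sblk_def min.commute max.commute)

lemma sblk_iff: "a \<le> b \<Longrightarrow> sblk J a b \<longleftrightarrow> (\<forall>k. a \<le> k \<longrightarrow> k < b \<longrightarrow> k \<in> J)"
  by (auto simp: sblk_def)

lemma sblk_trans: "sblk J a b \<Longrightarrow> sblk J b c \<Longrightarrow> sblk J a c"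
proof -
  assume *: "sblk J a b" "sblk J b c"
  have "{min a c..<max a c} \<subseteq> {min a b..<max a b} \<union> {min b c..<max b c}" by auto
  then show ?thesis using * unfolding sblk_def by blast
qed

lemma sblk_Suc: "k \<in> J \<Longrightarrow> sblk J k (Suc k)"
  by (simp add: sblk_def)

lemma sblk_sgen: "k \<in> J \<Longrightarrow> sblk J a (sgen k a)"
  by (auto simp: sgen_def sblk_def min_def max_def)

lemma WJ_id [simp]: "id \<in> WJ J"
  unfolding WJ_def by (rule CollectI, rule exI[of _ "[]"]) simp

lemma WJ_comp: "x \<in> WJ J \<Longrightarrow> y \<in> WJ J \<Longrightarrow> x \<circ> y \<in> WJ J"
proof -
  assume "x \<in> WJ J" "y \<in> WJ J"
  then obtain "is" js where "x = wordprod is" "set is \<subseteq> J" "y = wordprod js" "set js \<subseteq> J" by (auto simp: WJ_def)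
  then have "x \<circ> y = wordprod (is @ js)" "set (is @ js) \<subseteq> J" by (auto simp: wordprod_append)
  then show "x \<circ> y \<in> WJ J" unfolding WJ_def by blast
qed

lemma WJ_sgen: "k \<in> J \<Longrightarrow> sgen k \<in> WJ J"
  unfolding WJ_def by (rule CollectI, rule exI[of _ "[k]"]) simp

lemma WJ_inv: "x \<in> WJ J \<Longrightarrow> inv x \<in> WJ J"
  unfolding WJ_def by (smt (verit, ccfv_threshold) mem_Collect_eq set_rev wordprod_rev)

lemma WJ_mono: "J \<subseteq> J' \<Longrightarrow> WJ J \<subseteq> WJ J'"
  unfolding WJ_def by blast

lemma WJ_sgen_iff: "k \<in> J \<Longrightarrow> w \<circ> sgen k \<in> WJ J \<longleftrightarrow> w \<in> WJ J" "k \<in> J \<Longrightarrow> sgen k \<circ> w \<in> WJ J \<longleftrightarrow> w \<in> WJ J"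
  by (metis WJ_comp WJ_sgen sgen_cancel)+

lemma WJ_sblk: "u \<in> WJ J \<Longrightarrow> sblk J a (u a)"
proof -
  have "set is \<subseteq> J \<Longrightarrow> sblk J a (wordprod is a)" for "is"
    by (induction "is") (auto intro: sblk_trans[OF _ sblk_sgen])
  then show "u \<in> WJ J \<Longrightarrow> sblk J a (u a)" by (auto simp: WJ_def)
qed

context
  fixes n :: nat and J :: "nat set"
  assumes J: "J \<subseteq> {1..<n}"
begin

lemma WJ_Sym: "u \<in> WJ J \<Longrightarrow> u \<in> Sym n"
  using J wordprod_Sym unfolding WJ_def by blast

lemma finite_WJ [simp]: "finite (WJ J)"
  by (rule finite_subset[OF _ finite_Sym[of n]]) (use WJ_Sym in auto)

text \<open>Outside J there is no descent either: points cannot cross a block boundary, so for i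
  outside J the values satisfy u i \<le> i < i+1 \<le> u (i+1).\<close>

lemma block_preserving_no_descent:
  assumes u: "u \<in> Sym n" "\<And>a. sblk J a (u a)" and k: "\<And>k. k \<in> J \<Longrightarrow> u k < u (Suc k)"
  shows "u = id"
proof (rule no_descent_imp_id[OF u(1)])
  fix i assume i: "i \<in> {1..<n}"
  show "u i < u (Suc i)"
  proof (cases "i \<in> J")
    case False
    have "u i \<le> i"
    proof (rule ccontr)
      assume "\<not> ?thesis"
      then have "i \<in> {min i (u i)..<max i (u i)}" by auto
      then show False using u(2)[of i] False unfolding sblk_def by blast
    qed
    moreover have "u (Suc i) \<ge> Suc i"
    proof (rule ccontr)
      assume "\<not> ?thesis"
      then have "i \<in> {min (Suc i) (u (Suc i))..<max (Suc i) (u (Suc i))}" by auto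
      then show False using u(2)[of "Suc i"] False unfolding sblk_def by blast
    qed
    ultimately show ?thesis by simp
  qed (rule k)
qed

text \<open>Only preservation of the blocks is assumed; membership in \<open>WJ J\<close> comes out
  of the same descent on length. \<open>WJ_iff\<close> and \<open>WJ_right_induct\<close> extract
  the two halves.\<close>

lemma WJ_induct [consumes 1, case_names id step]:
  assumes "u \<in> Sym n" "\<And>a. sblk J a (u a)" and "P id"
    and step: "\<And>u k. u \<in> WJ J \<Longrightarrow> k \<in> J \<Longrightarrow> u k < u (Suc k) \<Longrightarrow> P u \<Longrightarrow> P (u \<circ> sgen k)"
  shows "u \<in> WJ J \<and> P u"
  using assms(1,2)
proof (induction "len n u" arbitrary: u rule: less_induct)
  case less
  show ?case
  proof (cases "\<forall>k\<in>J. u k < u (Suc k)")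
    case True
    then have "u = id" using block_preserving_no_descent[OF less.prems] by blast
    then show ?thesis using assms(3) WJ_id by simp
  next
    case False
    then obtain k where k: "k \<in> J" "u (Suc k) < u k"
      using Sym_inj[OF less.prems(1)] by (metis linorder_neqE_nat n_not_Suc_n)
    let ?u = "u \<circ> sgen k"
    have kn: "k \<in> {1..<n}" using k J by auto
    have "?u \<in> WJ J \<and> P ?u"
    proof (rule less.hyps)
      show "len n ?u < len n u" using right_descent_iff less.prems kn k by blast
      show "?u \<in> Sym n" using less.prems(1) kn by (simp add: sgen_comp_Sym)
      show "sblk J a (?u a)" for a
        using sblk_trans[OF sblk_sgen[OF k(1)] less.prems(2)] by simp
    qed
    then show ?thesis using step[of ?u k] k WJ_sgen_iff[OF k(1), of u] by simp
  qed
qed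

lemma WJ_iff: "u \<in> WJ J \<longleftrightarrow> u \<in> Sym n \<and> (\<forall>a. sblk J a (u a))"
  using WJ_induct[of u "\<lambda>_. True"] WJ_sblk WJ_Sym by auto

lemma WJ_right_induct [consumes 1, case_names id step]:
  assumes "u \<in> WJ J" "P id"
    and "\<And>u k. u \<in> WJ J \<Longrightarrow> k \<in> J \<Longrightarrow> u k < u (Suc k) \<Longrightarrow> P u \<Longrightarrow> P (u \<circ> sgen k)"
  shows "P u"
  using WJ_induct[OF WJ_Sym[OF assms(1)] WJ_sblk[OF assms(1)], of P] assms by blast

lemma XJ_Sym: "x \<in> XJ n J \<Longrightarrow> x \<in> Sym n"
  by (simp add: XJ_def)

lemma finite_XJ [simp]: "finite (XJ n J)"
  by (simp add: XJ_def)

lemma XJ_id [simp]: "id \<in> XJ n J"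
  by (simp add: XJ_def)

lemma XJ_mono: "x \<in> XJ n J \<Longrightarrow> sblk J a b \<Longrightarrow> a < b \<Longrightarrow> x a < x b"
  using increasing_imp_mono[of a b x] by (auto simp: XJ_def sblk_iff)

lemma XJ_less_iff: "x \<in> XJ n J \<Longrightarrow> sblk J a b \<Longrightarrow> x a < x b \<longleftrightarrow> a < b"
  using XJ_mono[of x a b] XJ_mono[of x b a] sblk_sym by (cases a b rule: linorder_cases) force+

lemma XJ_comp_less_iff:
  assumes "x \<in> XJ n J" "u \<in> WJ J" "k \<in> J"
  shows "(x \<circ> u) k < (x \<circ> u) (Suc k) \<longleftrightarrow> u k < u (Suc k)"
proof -
  have "sblk J (u k) (u (Suc k))"
    using WJ_sblk[OF assms(2)] sblk_Suc[OF assms(3)] sblk_trans sblk_sym by metis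
  then show ?thesis using XJ_less_iff[OF assms(1)] by simp
qed

text \<open>x is increasing on every block and u stays inside the blocks, so an ascent of u at k in
  J is an ascent of the product, and both lengths grow together.\<close>

lemma len_XJ_WJ:
  assumes "x \<in> XJ n J" "u \<in> WJ J"
  shows "len n (x \<circ> u) = len n x + len n u"
  using assms(2)
proof (induction rule: WJ_right_induct)
  case (step u k)
  have kn: "k \<in> {1..<n}" using step J by auto
  have "len n (x \<circ> u \<circ> sgen k) = Suc (len n (x \<circ> u))"
    using XJ_comp_less_iff[OF assms(1) step(1,2)] step kn XJ_Sym[OF assms(1)] WJ_Sym
    by (intro len_right_ascent Sym_comp) auto
  moreover have "len n (u \<circ> sgen k) = Suc (len n u)"
    using step kn WJ_Sym by (intro len_right_ascent) auto
  ultimately show ?case using step by (simp add: comp_def)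
qed (simp flip: id_def)

lemma XJ_WJ_decomp:
  assumes "w \<in> Sym n"
  obtains x u where "x \<in> XJ n J" "u \<in> WJ J" "w = x \<circ> u"
proof -
  define u where "u = arg_min (\<lambda>u. len n (w \<circ> u)) (\<lambda>u. u \<in> WJ J)"
  have u: "u \<in> WJ J" "\<And>u'. u' \<in> WJ J \<Longrightarrow> len n (w \<circ> u) \<le> len n (w \<circ> u')"
    unfolding u_def using arg_min_natI[of "\<lambda>u. u \<in> WJ J" id "\<lambda>u. len n (w \<circ> u)"]
      arg_min_nat_le[of "\<lambda>u. u \<in> WJ J" _ "\<lambda>u. len n (w \<circ> u)"] by auto
  have wu: "w \<circ> u \<in> Sym n" using assms u WJ_Sym Sym_comp by blast
  have "w \<circ> u \<in> XJ n J"
    unfolding XJ_def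
  proof (intro CollectI conjI ballI wu)
    fix k assume k: "k \<in> J"
    then have kn: "k \<in> {1..<n}" using J by auto
    have "len n (w \<circ> u) \<le> len n (w \<circ> u \<circ> sgen k)"
      using u(2)[of "u \<circ> sgen k"] u(1) k by (simp add: WJ_sgen_iff comp_assoc)
    then have "\<not> (w \<circ> u) (Suc k) < (w \<circ> u) k"
      using right_descent_iff[OF wu kn] by simp
    then show "(w \<circ> u) k < (w \<circ> u) (Suc k)"
      using Sym_inj[OF wu, of k "Suc k"] by simp
  qed
  moreover have "w = (w \<circ> u) \<circ> inv u"
    using Sym_inv_comp(1)[OF WJ_Sym[OF u(1)]] by (simp add: comp_assoc)
  ultimately show thesis using that u(1) WJ_inv by blast
qed

text \<open>Each of x and x' is the other one times an element of the subgroup. Additivity of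
  lengths, used in both directions, makes that element trivial.\<close>

lemma XJ_WJ_unique:
  assumes "x \<in> XJ n J" "x' \<in> XJ n J" "u \<in> WJ J" "u' \<in> WJ J" "x \<circ> u = x' \<circ> u'"
  shows "x = x' \<and> u = u'"
proof -
  have "x = x' \<circ> (u' \<circ> inv u)"
    using assms(5) Sym_comp_eq_right[OF WJ_Sym[OF assms(3)]] by (metis comp_assoc)
  moreover have "x' = x \<circ> (u \<circ> inv u')"
    using assms(5) Sym_comp_eq_right[OF WJ_Sym[OF assms(4)]] by (metis comp_assoc)
  moreover have W: "u' \<circ> inv u \<in> WJ J" "u \<circ> inv u' \<in> WJ J"
    using assms WJ_comp WJ_inv by auto
  ultimately have "len n x = len n x' + len n (u' \<circ> inv u)" "len n x' = len n x + len n (u \<circ> inv u')"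
    using len_XJ_WJ assms by metis+
  then have "u' \<circ> inv u = id" using len_eq_0[OF WJ_Sym[OF W(1)]] by simp
  then have "u' = u" using Sym_comp_eq_right[OF WJ_Sym[OF WJ_inv[OF assms(3)]], of u' id]
      WJ_Sym[OF assms(3)] by simp
  then show ?thesis using \<open>x = x' \<circ> (u' \<circ> inv u)\<close> \<open>u' \<circ> inv u = id\<close> by simp
qed

lemma XJ_WJ_bij: "bij_betw (\<lambda>(x, u). x \<circ> u) (XJ n J \<times> WJ J) (Sym n)"
  unfolding bij_betw_def
proof
  show "inj_on (\<lambda>(x, u). x \<circ> u) (XJ n J \<times> WJ J)"
    using XJ_WJ_unique by (auto simp: inj_on_def)
  show "(\<lambda>(x, u). x \<circ> u) ` (XJ n J \<times> WJ J) = Sym n"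
  proof (intro equalityI subsetI)
    fix w assume "w \<in> (\<lambda>(x, u). x \<circ> u) ` (XJ n J \<times> WJ J)"
    then show "w \<in> Sym n" using Sym_comp XJ_Sym WJ_Sym by auto
  next
    fix w assume "w \<in> Sym n"
    then obtain x u where "x \<in> XJ n J" "u \<in> WJ J" "w = x \<circ> u" by (rule XJ_WJ_decomp)
    then show "w \<in> (\<lambda>(x, u). x \<circ> u) ` (XJ n J \<times> WJ J)" by (auto intro!: image_eqI[of _ _ "(x, u)"])
  qed
qed

lemma sum_Sym_XJ_WJ: "(\<Sum>w\<in>Sym n. f w) = (\<Sum>x\<in>XJ n J. \<Sum>u\<in>WJ J. f (x \<circ> u))"
  by (simp add: sum.reindex_bij_betw[OF XJ_WJ_bij, symmetric] sum.cartesian_product case_prod_unfold)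

lemma minimal_rep_iff: "x \<in> XJ n J \<longleftrightarrow> x \<in> Sym n \<and> (\<forall>u\<in>WJ J. len n x \<le> len n (x \<circ> u))"
proof
  assume "x \<in> XJ n J"
  then show "x \<in> Sym n \<and> (\<forall>u\<in>WJ J. len n x \<le> len n (x \<circ> u))"
    using len_XJ_WJ XJ_Sym by auto
next
  assume x: "x \<in> Sym n \<and> (\<forall>u\<in>WJ J. len n x \<le> len n (x \<circ> u))"
  show "x \<in> XJ n J"
    unfolding XJ_def
  proof (intro CollectI conjI ballI)
    fix k assume k: "k \<in> J"
    then have "len n x \<le> len n (x \<circ> sgen k)" using x WJ_sgen by blast
    then show "x k < x (Suc k)"
      using right_descent_iff[of x n k] x k J Sym_inj[of x n k "Suc k"] by fastforce
  qed (use x in auto)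
qed

text \<open>Since w decreases on every block, an ascent of u becomes a descent of the product, and
  lengths subtract instead of adding. Longest elements are thereby characterised by their descents
  (\<open>longest_unique\<close>).\<close>

lemma all_descents_len:
  assumes w: "w \<in> Sym n" "\<And>k. k \<in> J \<Longrightarrow> w (Suc k) < w k" and "u \<in> WJ J"
  shows "len n (w \<circ> u) + len n u = len n w"
  using assms(3)
proof (induction rule: WJ_right_induct)
  case (step u k)
  have kn: "k \<in> {1..<n}" using step J by auto
  have b: "sblk J (u k) (u (Suc k))"
    using WJ_sblk[OF step(1)] sblk_Suc[OF step(2)] sblk_trans sblk_sym by metis
  have "w (u (Suc k)) < w (u k)"
  proof -
    \<comment> \<open>Complementing to n + 1 turns decreasing values in 1..n into increasing ones,
      with no truncation in the subtraction.\<close>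
    have "n + 1 - w (u k) < n + 1 - w (u (Suc k))"
    proof (rule increasing_imp_mono[where f = "\<lambda>a. n + 1 - w a", OF _ step(3)])
      fix a assume "u k \<le> a" "a < u (Suc k)"
      then have a: "a \<in> J" using b step(3) by (auto simp: sblk_iff)
      then have "w a \<in> {1..n}" using J Sym_range[OF w(1), of a] by auto
      then show "n + 1 - w a < n + 1 - w (Suc a)" using w(2)[OF a] by auto
    qed
    then show ?thesis by simp
  qed
  then have "len n (w \<circ> u) = Suc (len n (w \<circ> u \<circ> sgen k))"
    using kn w WJ_Sym step by (intro len_right_descent Sym_comp) auto
  moreover have "len n (u \<circ> sgen k) = Suc (len n u)"
    using step kn WJ_Sym by (intro len_right_ascent) auto
  ultimately show ?case using step by (simp add: comp_def)
qed (simp flip: id_def)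

definition wJ :: perm where
  "wJ = (THE w. w \<in> WJ J \<and> (\<forall>u\<in>WJ J. len n u \<le> len n w))"

lemma longest_unique:
  assumes "w \<in> WJ J" "\<And>k. k \<in> J \<Longrightarrow> w (Suc k) < w k" "u \<in> WJ J" "len n w \<le> len n u"
  shows "u = w"
proof -
  have "inv w \<circ> u \<in> WJ J" using assms WJ_comp WJ_inv by blast
  from all_descents_len[OF WJ_Sym[OF assms(1)] assms(2) this]
  have "len n u + len n (inv w \<circ> u) = len n w"
    using Sym_inv_comp(1)[OF WJ_Sym[OF assms(1)]] by (simp flip: comp_assoc)
  then have "inv w \<circ> u = id" using assms(4) len_eq_0[OF WJ_Sym[OF \<open>inv w \<circ> u \<in> WJ J\<close>]] by simp
  then show ?thesis using Sym_comp_eq_left[OF WJ_Sym[OF WJ_inv[OF assms(1)]], of u id] WJ_Sym[OF assms(1)] by simp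
qed

lemma
  shows wJ_WJ: "wJ \<in> WJ J" and wJ_descent: "\<And>k. k \<in> J \<Longrightarrow> wJ (Suc k) < wJ k"
    and wJ_max: "\<And>u. u \<in> WJ J \<Longrightarrow> len n u \<le> len n wJ"
proof -
  have "WJ J \<noteq> {}" using WJ_id by blast
  then have "Max (len n ` WJ J) \<in> len n ` WJ J" by (intro Max_in) auto
  then obtain w where w: "w \<in> WJ J" "len n w = Max (len n ` WJ J)" by auto
  then have w: "w \<in> WJ J" "\<And>u. u \<in> WJ J \<Longrightarrow> len n u \<le> len n w" by auto
  have d: "w (Suc k) < w k" if "k \<in> J" for k
  proof -
    have "len n (w \<circ> sgen k) \<le> len n w" using w that WJ_sgen_iff(1) by blast
    then show ?thesis
      using len_right_ascent[of w n k] WJ_Sym[OF w(1)] that J Sym_inj[of w n k "Suc k"]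
      by (cases "w k" "w (Suc k)" rule: linorder_cases) auto
  qed
  have "wJ = w"
    unfolding wJ_def
  proof (rule the_equality)
    fix w' assume "w' \<in> WJ J \<and> (\<forall>u\<in>WJ J. len n u \<le> len n w')"
    then show "w' = w" using longest_unique[OF w(1) d, of w'] w(1) by auto
  qed (use w in auto)
  then show "wJ \<in> WJ J" "\<And>k. k \<in> J \<Longrightarrow> wJ (Suc k) < wJ k" "\<And>u. u \<in> WJ J \<Longrightarrow> len n u \<le> len n wJ"
    using w d by auto
qed

lemma wJ_Sym: "wJ \<in> Sym n"
  using wJ_WJ WJ_Sym by blast

lemma wJ_unique: "u \<in> WJ J \<Longrightarrow> len n wJ \<le> len n u \<Longrightarrow> u = wJ"
  using longest_unique wJ_WJ wJ_descent by blast

lemma wJ_len: "u \<in> WJ J \<Longrightarrow> len n (wJ \<circ> u) + len n u = len n wJ"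
  using all_descents_len wJ_Sym wJ_descent by blast

lemma inv_wJ: "inv wJ = wJ"
  using wJ_unique[of "inv wJ"] WJ_inv wJ_WJ len_inv wJ_Sym by simp

lemma all_descents_decomp:
  assumes "w \<in> Sym n" "\<And>k. k \<in> J \<Longrightarrow> w (Suc k) < w k"
  obtains x where "x \<in> XJ n J" "w = x \<circ> wJ"
proof -
  obtain x u where xu: "x \<in> XJ n J" "u \<in> WJ J" "w = x \<circ> u" using XJ_WJ_decomp[OF assms(1)] .
  have "u (Suc k) < u k" if "k \<in> J" for k
    using XJ_comp_less_iff[OF xu(1,2) that] assms(2)[OF that] xu(3)
      Sym_inj[OF WJ_Sym[OF xu(2)], of k "Suc k"] by (cases "u k" "u (Suc k)" rule: linorder_cases) auto
  then have "u = wJ" using longest_unique[of u wJ] wJ_max xu(2) wJ_WJ by blast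
  then show thesis using that xu by blast
qed

text \<open>Nothing crosses a block boundary and each block is reversed, so the inversions are
  exactly the pairs within one block.\<close>

lemma len_wJ: "len n wJ = card {(a, b). 1 \<le> a \<and> a < b \<and> b \<le> n \<and> sblk J a b}"
proof -
  have "invset n wJ = {(a, b). 1 \<le> a \<and> a < b \<and> b \<le> n \<and> sblk J a b}"
  proof (intro equalityI subsetI)
    fix p assume "p \<in> invset n wJ"
    then obtain a b where p: "p = (a, b)" "1 \<le> a" "a < b" "b \<le> n" "wJ b < wJ a" by (auto simp: invset_def)
    have "sblk J a b"
    proof (rule ccontr)
      assume "\<not> sblk J a b"
      then obtain k where k: "a \<le> k" "k < b" "k \<notin> J" using p by (auto simp: sblk_iff)
      have "wJ a \<le> k"
      proof (rule ccontr)
        assume "\<not> ?thesis"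
        then have "k \<in> {min a (wJ a)..<max a (wJ a)}" using k by auto
        then show False using WJ_sblk[OF wJ_WJ, of a] k unfolding sblk_def by blast
      qed
      moreover have "wJ b > k"
      proof (rule ccontr)
        assume "\<not> ?thesis"
        then have "k \<in> {min b (wJ b)..<max b (wJ b)}" using k by auto
        then show False using WJ_sblk[OF wJ_WJ, of b] k unfolding sblk_def by blast
      qed
      ultimately show False using p by simp
    qed
    then show "p \<in> {(a, b). 1 \<le> a \<and> a < b \<and> b \<le> n \<and> sblk J a b}" using p by simp
  next
    fix p assume "p \<in> {(a, b). 1 \<le> a \<and> a < b \<and> b \<le> n \<and> sblk J a b}"
    then obtain a b where p: "p = (a, b)" "1 \<le> a" "a < b" "b \<le> n" "sblk J a b" by auto
    have "n + 1 - wJ a < n + 1 - wJ b"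
    proof (rule increasing_imp_mono[where f = "\<lambda>a. n + 1 - wJ a", OF _ p(3)])
      fix c assume "a \<le> c" "c < b"
      then have c: "c \<in> J" using p by (auto simp: sblk_iff)
      then have "wJ c \<in> {1..n}" using J Sym_range[OF wJ_Sym, of c] by auto
      then show "n + 1 - wJ c < n + 1 - wJ (Suc c)" using wJ_descent[OF c] by auto
    qed
    then show "p \<in> invset n wJ" using p by (auto simp: invset_def)
  qed
  then show ?thesis using len_invset[OF wJ_Sym] by simp
qed

end

lemma Xmin_XJ: "Xmin n la = XJ n (youngJ n la)"
  using minimal_rep_iff[OF youngJ_subset] by (auto simp: Xmin_def young_WJ)

lemma wlong_wJ: "wlong n la = wJ n (youngJ n la)"
  by (simp add: wlong_def young_WJ wJ_def[OF youngJ_subset])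

section \<open>The Iwahori--Hecke algebra\<close>

text \<open>Elements are functions on all maps from nat to nat, so the support has to be controlled
  separately: outside \<open>Sym n\<close> lengths and inverses have no meaning.\<close>

definition HK :: "nat \<Rightarrow> hecke set" where
  "HK n = {h. \<forall>w. w \<notin> Sym n \<longrightarrow> h w = 0}"

definition hlin :: "(hecke \<Rightarrow> hecke) \<Rightarrow> bool" where
  "hlin A \<longleftrightarrow> (\<forall>h g. A (\<lambda>y. h y + g y) = (\<lambda>y. A h y + A g y)) \<and> (\<forall>c h. A (\<lambda>y. c * h y) = (\<lambda>y. c * A h y))"

text \<open>Right multiplication by \<open>T_(s_j)\<close>. Since left and right multiplications by generators commute,
  an operator commuting with all right multiplications is determined by its value at \<open>T_1\<close>;
  associativity and independence of reduced words follow from this.\<close>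

definition rmulTs :: "nat \<Rightarrow> nat \<Rightarrow> hecke \<Rightarrow> hecke" where
  "rmulTs n j h = (\<lambda>y. h (y \<circ> sgen j)
      + (if len n (y \<circ> sgen j) < len n y then (vK - inverse vK) * h y else 0))"

lemma HK_outside: "h \<in> HK n \<Longrightarrow> w \<notin> Sym n \<Longrightarrow> h w = 0"
  by (simp add: HK_def)

lemma HK_eqI: "h \<in> HK n \<Longrightarrow> g \<in> HK n \<Longrightarrow> (\<And>w. w \<in> Sym n \<Longrightarrow> h w = g w) \<Longrightarrow> h = g"
  by (metis HK_outside ext)

lemma hT_HK: "w \<in> Sym n \<Longrightarrow> hT w \<in> HK n"
  by (auto simp: HK_def hT_def)

lemma HK_add: "h \<in> HK n \<Longrightarrow> g \<in> HK n \<Longrightarrow> (\<lambda>y. h y + g y) \<in> HK n"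
  and HK_diff: "h \<in> HK n \<Longrightarrow> g \<in> HK n \<Longrightarrow> (\<lambda>y. h y - g y) \<in> HK n"
  and HK_smult: "h \<in> HK n \<Longrightarrow> (\<lambda>y. c * h y) \<in> HK n"
  by (auto simp: HK_def)

lemma HK_sum: "(\<And>s. s \<in> S \<Longrightarrow> F s \<in> HK n) \<Longrightarrow> (\<lambda>y. \<Sum>s\<in>S. c s * F s y) \<in> HK n"
  by (auto simp: HK_def intro!: sum.neutral)

lemma HK_expand: "h \<in> HK n \<Longrightarrow> h = (\<lambda>y. \<Sum>x\<in>Sym n. h x * hT x y)"
  by (rule ext) (auto simp: hT_def HK_def sum.delta' if_distrib cong: if_cong)

lemma hlinI:
  assumes "\<And>h g y. A (\<lambda>y. h y + g y) y = A h y + A g y" "\<And>c h y. A (\<lambda>y. c * h y) y = c * A h y"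
  shows "hlin A"
  using assms by (simp add: hlin_def fun_eq_iff)

lemma hlin_add: "hlin A \<Longrightarrow> A (\<lambda>y. h y + g y) = (\<lambda>y. A h y + A g y)"
  and hlin_smult: "hlin A \<Longrightarrow> A (\<lambda>y. c * h y) = (\<lambda>y. c * A h y)"
  by (auto simp: hlin_def)

lemma hlin_0: "hlin A \<Longrightarrow> A (\<lambda>y. 0) = (\<lambda>y. 0)"
  using hlin_smult[of A 0 "\<lambda>_. 0"] by simp

lemma hlin_diff: "hlin A \<Longrightarrow> A (\<lambda>y. h y - g y) = (\<lambda>y. A h y - A g y)"
  using hlin_add[of A h "\<lambda>y. (-1) * g y"] hlin_smult[of A "-1" g] by simp

lemma hlin_sum: "hlin A \<Longrightarrow> A (\<lambda>y. \<Sum>s\<in>S. c s * F s y) = (\<lambda>y. \<Sum>s\<in>S. c s * A (F s) y)"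
  by (induction S rule: infinite_finite_induct)
    (simp_all add: hlin_0 hlin_add[of A "\<lambda>y. c _ * F _ y" "\<lambda>y. \<Sum>s\<in>_. c s * F s y"] hlin_smult[of A _ "F _"])

lemma hlin_comp: "hlin A \<Longrightarrow> hlin B \<Longrightarrow> hlin (\<lambda>h. A (B h))"
  by (simp add: hlin_def)

lemma hlin_mulTs: "hlin (mulTs n i)" and hlin_rmulTs: "hlin (rmulTs n i)"
  by (rule hlinI; simp add: mulTs_def rmulTs_def algebra_simps)+

lemma hlin_foldr: "(\<And>i. hlin (f i)) \<Longrightarrow> hlin (foldr f is)"
  by (induction "is") (auto simp: hlin_def)

lemma hlin_mulT: "hlin (mulT n x)"
  unfolding mulT_def[abs_def] by (rule hlin_foldr[OF hlin_mulTs])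

lemma hlin_hmul: "hlin (hmul n h)"
  by (rule hlinI; simp add: hmul_def hlin_add[OF hlin_mulT] hlin_smult[OF hlin_mulT] algebra_simps sum.distrib sum_distrib_left)

lemma hmul_smult_left: "hmul n (\<lambda>y. c * h y) k = (\<lambda>y. c * hmul n h k y)"
  by (simp add: hmul_def mult.assoc sum_distrib_left)

lemma hmul_sum_left: "hmul n (\<lambda>y. \<Sum>s\<in>S. c s * F s y) k = (\<lambda>y. \<Sum>s\<in>S. c s * hmul n (F s) k y)"
  unfolding hmul_def
proof
  fix y
  have "(\<Sum>x\<in>Sym n. (\<Sum>s\<in>S. c s * F s x) * mulT n x k y) = (\<Sum>x\<in>Sym n. \<Sum>s\<in>S. c s * (F s x * mulT n x k y))"
    by (simp add: sum_distrib_right mult.assoc)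
  also have "\<dots> = (\<Sum>s\<in>S. \<Sum>x\<in>Sym n. c s * (F s x * mulT n x k y))" by (rule sum.swap)
  finally show "(\<Sum>x\<in>Sym n. (\<Sum>s\<in>S. c s * F s x) * mulT n x k y) = (\<Sum>s\<in>S. c s * (\<Sum>x\<in>Sym n. F s x * mulT n x k y))"
    by (simp add: sum_distrib_left)
qed

lemmas hmul_smult_right = hlin_smult[OF hlin_hmul]
lemmas hmul_sum_right = hlin_sum[OF hlin_hmul]

lemma mulTs_HK: "i \<in> {1..<n} \<Longrightarrow> h \<in> HK n \<Longrightarrow> mulTs n i h \<in> HK n"
  and rmulTs_HK: "i \<in> {1..<n} \<Longrightarrow> h \<in> HK n \<Longrightarrow> rmulTs n i h \<in> HK n"
  by (auto simp: HK_def mulTs_def rmulTs_def sgen_comp_Sym)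

lemma foldr_HK: "set is \<subseteq> {1..<n} \<Longrightarrow> h \<in> HK n \<Longrightarrow> foldr (mulTs n) is h \<in> HK n"
  by (induction "is") (simp_all add: mulTs_HK)

lemma mulT_HK: "x \<in> Sym n \<Longrightarrow> h \<in> HK n \<Longrightarrow> mulT n x h \<in> HK n"
  unfolding mulT_def using foldr_HK redword(2) by blast

lemma hmul_HK: "g \<in> HK n \<Longrightarrow> hmul n h g \<in> HK n"
  unfolding hmul_def by (rule HK_sum) (rule mulT_HK)

text \<open>If s_i y = y s_j, the length tests on the two sides coincide and both expressions agree.
  Otherwise multiplication on one side does not affect the descents on the other.\<close>

lemma mulTs_rmulTs_commute:
  assumes "i \<in> {1..<n}" "j \<in> {1..<n}" "h \<in> HK n"
  shows "mulTs n i (rmulTs n j h) = rmulTs n j (mulTs n i h)"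
proof (rule HK_eqI[of _ n])
  fix y assume y: "y \<in> Sym n"
  show "mulTs n i (rmulTs n j h) y = rmulTs n j (mulTs n i h) y"
  proof (cases "sgen i \<circ> y = y \<circ> sgen j")
    case True
    have e: "sgen i \<circ> y \<circ> sgen j = y" "sgen i \<circ> (y \<circ> sgen j) = y"
      using True sgen_cancel by metis+
    have "len n (y \<circ> sgen j) \<noteq> len n y" using len_right_cases[OF y assms(2)] by auto
    then show ?thesis by (auto simp: mulTs_def rmulTs_def True e algebra_simps)
  next
    case False
    have a: "len n (sgen i \<circ> y \<circ> sgen j) < len n (sgen i \<circ> y) \<longleftrightarrow> len n (y \<circ> sgen j) < len n y"
      using sgen_commute_or_descents[OF y assms(1,2) False] .
    \<comment> \<open>Passing to inverses turns the statement about right descents into the one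
      about left descents.\<close>
    have F: "sgen j \<circ> inv y \<noteq> inv y \<circ> sgen i"
    proof
      assume "sgen j \<circ> inv y = inv y \<circ> sgen i"
      then have "inv (sgen j \<circ> inv y) = inv (inv y \<circ> sgen i)" by simp
      then show False using False Sym_inv_distrib[OF sgen_Sym[OF assms(2)] Sym_inv[OF y]]
          Sym_inv_distrib[OF Sym_inv[OF y] sgen_Sym[OF assms(1)]] y by simp
    qed
    have ij: "y \<circ> sgen j \<in> Sym n" "sgen i \<circ> y \<in> Sym n" using y assms by (simp_all add: sgen_comp_Sym)
    have "len n (sgen j \<circ> inv y \<circ> sgen i) = len n (sgen i \<circ> (y \<circ> sgen j))"
      using len_left_conv[OF ij(1) assms(1)] Sym_inv_distrib[OF y sgen_Sym[OF assms(2)]] by simp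
    moreover have "len n (sgen j \<circ> inv y) = len n (y \<circ> sgen j)"
      using len_inv[OF ij(1)] Sym_inv_distrib[OF y sgen_Sym[OF assms(2)]] by simp
    moreover have "len n (inv y \<circ> sgen i) = len n (sgen i \<circ> y)" using len_left_conv[OF y assms(1)] by simp
    ultimately have b: "len n (sgen i \<circ> (y \<circ> sgen j)) < len n (y \<circ> sgen j) \<longleftrightarrow> len n (sgen i \<circ> y) < len n y"
      using sgen_commute_or_descents[OF Sym_inv[OF y] assms(2,1) F] len_inv[OF y] by simp
    show ?thesis using a b by (simp add: mulTs_def rmulTs_def comp_assoc algebra_simps)
  qed
qed (use assms mulTs_HK rmulTs_HK in blast)+

lemma rmulTs_hT: "w \<in> Sym n \<Longrightarrow> j \<in> {1..<n} \<Longrightarrow> len n w < len n (w \<circ> sgen j) \<Longrightarrow> rmulTs n j (hT w) = hT (w \<circ> sgen j)"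
  by (auto simp: rmulTs_def hT_def fun_eq_iff[of "\<lambda>y. _ y + _ y"] sgen_right_eq_iff)

lemma mulTs_hT: "w \<in> Sym n \<Longrightarrow> j \<in> {1..<n} \<Longrightarrow> len n w < len n (sgen j \<circ> w) \<Longrightarrow> mulTs n j (hT w) = hT (sgen j \<circ> w)"
  by (auto simp: mulTs_def hT_def fun_eq_iff[of "\<lambda>y. _ y + _ y"] sgen_left_eq_iff)

lemma mulTs_hT_descent: "w \<in> Sym n \<Longrightarrow> j \<in> {1..<n} \<Longrightarrow> len n (sgen j \<circ> w) < len n w \<Longrightarrow>
    mulTs n j (hT w) = (\<lambda>y. hT (sgen j \<circ> w) y + (vK - inverse vK) * hT w y)"
  by (auto simp: mulTs_def hT_def fun_eq_iff[of "\<lambda>y. _ y + _ y"] sgen_left_eq_iff)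

definition rcommutes :: "nat \<Rightarrow> (hecke \<Rightarrow> hecke) \<Rightarrow> bool" where
  "rcommutes n A \<longleftrightarrow> hlin A \<and> (\<forall>j\<in>{1..<n}. \<forall>h\<in>HK n. A (rmulTs n j h) = rmulTs n j (A h))"

lemma rcommutes_determined:
  assumes "rcommutes n A" "rcommutes n B" "A (hT id) = B (hT id)" "h \<in> HK n"
  shows "A h = B h"
proof -
  have "A (hT w) = B (hT w)" if "w \<in> Sym n" for w
    using that
  proof (induction "len n w" arbitrary: w rule: less_induct)
    case less
    show ?case
    proof (cases "w = id")
      case True
      show ?thesis unfolding True by (rule assms(3))
    next
      case False
      then obtain j where j: "j \<in> {1..<n}" "\<not> w j < w (Suc j)"
        using no_descent_imp_id[OF less.prems] by blast
      then have d: "len n (w \<circ> sgen j) < len n w"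
        using right_descent_iff[OF less.prems j(1)] Sym_inj[OF less.prems, of j "Suc j"] by auto
      have w: "w \<circ> sgen j \<in> Sym n" using less.prems j by (simp add: sgen_comp_Sym)
      have e: "hT w = rmulTs n j (hT (w \<circ> sgen j))"
        using rmulTs_hT[OF w j(1)] d by simp
      have h: "hT (w \<circ> sgen j) \<in> HK n" using hT_HK w by blast
      have "A (hT (w \<circ> sgen j)) = B (hT (w \<circ> sgen j))" using less.hyps[OF d w] .
      then show ?thesis using e assms(1,2) j(1) h unfolding rcommutes_def by metis
    qed
  qed
  moreover have "C h = (\<lambda>y. \<Sum>x\<in>Sym n. h x * C (hT x) y)" if "rcommutes n C" for C
  proof -
    have "hlin C" using that by (simp add: rcommutes_def)
    then show ?thesis using hlin_sum[of C h hT "Sym n"] HK_expand[OF assms(4)] by simp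
  qed
  ultimately show ?thesis using assms(1,2) by simp
qed

lemma rcommutes_mulTs: "i \<in> {1..<n} \<Longrightarrow> rcommutes n (mulTs n i)"
  by (simp add: rcommutes_def hlin_mulTs mulTs_rmulTs_commute)

lemma rcommutes_comp: "rcommutes n A \<Longrightarrow> rcommutes n B \<Longrightarrow> (\<And>h. h \<in> HK n \<Longrightarrow> B h \<in> HK n) \<Longrightarrow> rcommutes n (\<lambda>h. A (B h))"
  by (simp add: rcommutes_def hlin_comp)

lemma rcommutes_id: "rcommutes n (\<lambda>h. h)"
  by (simp add: rcommutes_def hlin_def)

lemma rcommutes_foldr: "set is \<subseteq> {1..<n} \<Longrightarrow> rcommutes n (foldr (mulTs n) is)"
proof (induction "is")
  case (Cons i "is")
  then have "rcommutes n (\<lambda>h. mulTs n i (foldr (mulTs n) is h))"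
    using rcommutes_comp[of n "mulTs n i" "foldr (mulTs n) is"] by (simp add: rcommutes_mulTs foldr_HK)
  then show ?case by (simp add: comp_def)
qed (simp add: rcommutes_id id_def)

lemma rcommutes_mulT: "x \<in> Sym n \<Longrightarrow> rcommutes n (mulT n x)"
  unfolding mulT_def[abs_def] using rcommutes_foldr redword(2) by blast

lemma rcommutes_hmul: "rcommutes n (hmul n h)"
  unfolding rcommutes_def
proof (intro conjI hlin_hmul ballI)
  fix j k assume j: "j \<in> {1..<n}" "k \<in> HK n"
  have "hmul n h (rmulTs n j k) = (\<lambda>y. \<Sum>x\<in>Sym n. h x * rmulTs n j (mulT n x k) y)"
    unfolding hmul_def using rcommutes_mulT j by (auto simp: rcommutes_def intro!: sum.cong)
  then show "hmul n h (rmulTs n j k) = rmulTs n j (hmul n h k)"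
    unfolding hmul_def by (simp add: hlin_sum[OF hlin_rmulTs])
qed

lemma foldr_reduced_word:
  assumes "set is \<subseteq> {1..<n}" "len n (wordprod is) = length is"
  shows "foldr (mulTs n) is (hT id) = hT (wordprod is)"
  using assms
proof (induction "is")
  case (Cons i "is")
  have w: "wordprod is \<in> Sym n" "i \<in> {1..<n}" using Cons.prems wordprod_Sym[of "is" n] by auto
  have "len n (sgen i \<circ> wordprod is) \<le> Suc (len n (wordprod is))"
    using len_left_cases[OF w] by auto
  moreover have "len n (wordprod is) \<le> length is" using len_wordprod_le Cons.prems by simp
  ultimately have "len n (wordprod is) = length is" using Cons.prems by (simp add: comp_def)
  then show ?case using Cons w mulTs_hT[OF w] by (simp add: comp_def id_def)
qed (simp add: id_def)

lemma mulT_id: "x \<in> Sym n \<Longrightarrow> mulT n x (hT id) = hT x"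
  unfolding mulT_def using foldr_reduced_word[of "redword n x" n] redword[of x n] by simp

lemma hmul_id_right: "h \<in> HK n \<Longrightarrow> hmul n h (hT id) = h"
proof -
  assume "h \<in> HK n"
  then have "h = (\<lambda>y. \<Sum>x\<in>Sym n. h x * hT x y)" by (rule HK_expand)
  then show ?thesis by (simp add: hmul_def mulT_id cong: sum.cong)
qed

lemma hmul_hT_left: "x \<in> Sym n \<Longrightarrow> hmul n (hT x) g = mulT n x g"
  by (simp add: hmul_def hT_def if_distrib[of "\<lambda>c. c * _"] sum.delta cong: if_cong)

lemma hmul_id_left: "g \<in> HK n \<Longrightarrow> hmul n (hT id) g = g"
  using rcommutes_determined[OF rcommutes_hmul rcommutes_id, of n "hT id" g] hmul_id_right[OF hT_HK[OF Sym_id]] by simp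

lemma hmul_sgen_left: "i \<in> {1..<n} \<Longrightarrow> g \<in> HK n \<Longrightarrow> hmul n (hT (sgen i)) g = mulTs n i g"
proof (rule rcommutes_determined[OF rcommutes_hmul rcommutes_mulTs])
  assume i: "i \<in> {1..<n}"
  have "len n id < len n (sgen i \<circ> id)"
    using len_left_cases[OF Sym_id i] by auto
  then have "mulTs n i (hT id) = hT (sgen i)" using mulTs_hT[OF Sym_id i] by simp
  then show "hmul n (hT (sgen i)) (hT id) = mulTs n i (hT id)"
    using hmul_id_right[OF hT_HK[OF sgen_Sym[OF i]]] by simp
qed

lemma hmul_sgen_right: "j \<in> {1..<n} \<Longrightarrow> h \<in> HK n \<Longrightarrow> hmul n h (hT (sgen j)) = rmulTs n j h"
proof -
  assume j: "j \<in> {1..<n}" "h \<in> HK n"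
  have "len n id < len n (id \<circ> sgen j)"
    using len_right_cases[OF Sym_id j(1)] by auto
  then have "rmulTs n j (hT id) = hT (sgen j)" using rmulTs_hT[OF Sym_id j(1)] by simp
  moreover have "hmul n h (rmulTs n j (hT id)) = rmulTs n j (hmul n h (hT id))"
    using rcommutes_hmul[of n h] j hT_HK[OF Sym_id] unfolding rcommutes_def by blast
  ultimately show ?thesis using hmul_id_right[OF j(2)] by simp
qed

lemma hmul_assoc:
  assumes "h \<in> HK n" "g \<in> HK n" "k \<in> HK n"
  shows "hmul n (hmul n h g) k = hmul n h (hmul n g k)"
proof (rule rcommutes_determined[OF rcommutes_hmul _ _ assms(3)])
  show "rcommutes n (\<lambda>k. hmul n h (hmul n g k))"
    by (rule rcommutes_comp[OF rcommutes_hmul rcommutes_hmul]) (rule hmul_HK)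
  show "hmul n (hmul n h g) (hT id) = hmul n h (hmul n g (hT id))"
    using assms hmul_id_right hmul_HK by simp
qed

lemma hmul_hT_hT:
  assumes "x \<in> Sym n" "y \<in> Sym n" "len n (x \<circ> y) = len n x + len n y"
  shows "hmul n (hT x) (hT y) = hT (x \<circ> y)"
proof -
  let ?is = "redword n x @ redword n y"
  have "hmul n (hT x) (hT y) = foldr (mulTs n) ?is (hT id)"
    using mulT_id[OF assms(2)] assms(1) by (simp add: hmul_hT_left mulT_def)
  also have "\<dots> = hT (wordprod ?is)"
    using assms redword[OF assms(1)] redword[OF assms(2)] by (intro foldr_reduced_word) (auto simp: wordprod_append)
  finally show ?thesis using redword[OF assms(1)] redword[OF assms(2)] by (simp add: wordprod_append)
qed

text \<open>When lengths add, every generator meets an ascent, so the quadratic term of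
  \<open>mulTs\<close> never contributes and the coefficient is merely transported.\<close>

lemma foldr_mulTs_apply:
  assumes "set is \<subseteq> {1..<n}" "y \<in> Sym n" "len n (inv (wordprod is) \<circ> y) = length is + len n y"
  shows "foldr (mulTs n) is g y = g (inv (wordprod is) \<circ> y)"
  using assms
proof (induction "is" arbitrary: y)
  case Nil
  then show ?case by (simp add: inv_id flip: id_def)
next
  case (Cons i "is")
  have w: "wordprod is \<in> Sym n" "i \<in> {1..<n}" using Cons.prems wordprod_Sym[of "is" n] by auto
  have e: "inv (wordprod (i # is)) \<circ> y = inv (wordprod is) \<circ> (sgen i \<circ> y)"
    using Sym_inv_distrib[OF sgen_Sym[OF w(2)] w(1)] by (simp add: comp_assoc)
  have sy: "sgen i \<circ> y \<in> Sym n" using w Cons.prems by (simp add: sgen_comp_Sym)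
  have "len n (inv (wordprod is) \<circ> (sgen i \<circ> y)) \<le> len n (inv (wordprod is)) + len n (sgen i \<circ> y)"
    using len_comp_le[OF Sym_inv[OF w(1)] sy] .
  moreover have "len n (inv (wordprod is)) \<le> length is"
    using len_inv[OF w(1)] len_wordprod_le Cons.prems by simp
  moreover have l: "len n (inv (wordprod is) \<circ> (sgen i \<circ> y)) = Suc (length is) + len n y"
    using Cons.prems(3) e by (simp add: comp_def)
  ultimately have "len n (sgen i \<circ> y) = Suc (len n y)"
    using len_left_cases[OF Cons.prems(2) w(2)] by linarith
  then have "foldr (mulTs n) is g (sgen i \<circ> y) = g (inv (wordprod is) \<circ> (sgen i \<circ> y))"
    using Cons.IH[of "sgen i \<circ> y"] Cons.prems sy l by (simp add: comp_def)
  moreover have "mulTs n i F y = F (sgen i \<circ> y)" for F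
    using \<open>len n (sgen i \<circ> y) = Suc (len n y)\<close> by (simp add: mulTs_def)
  ultimately show ?case using e by (simp add: comp_def)
qed

text \<open>The coefficient at the identity is the symmetrising trace, for which T_w and T_(w^-1)
  are dual bases.\<close>

lemma trace_hmul: "hmul n h g id = (\<Sum>x\<in>Sym n. h x * g (inv x))"
proof -
  have "mulT n x g id = g (inv x)" if "x \<in> Sym n" for x
    unfolding mulT_def using foldr_mulTs_apply[of "redword n x" n id g] redword[OF that] len_inv[OF that] by simp
  then show ?thesis by (simp add: hmul_def)
qed

lemma Sym_inv_bij: "bij_betw inv (Sym n) (Sym n)"
  by (rule bij_betw_byWitness[of _ inv]) (auto simp: Sym_inv)

lemma trace_commute: "hmul n h g id = hmul n g h id"
proof -
  have "(\<Sum>x\<in>Sym n. h x * g (inv x)) = (\<Sum>x\<in>Sym n. h (inv x) * g (inv (inv x)))"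
    by (rule sum.reindex_bij_betw[OF Sym_inv_bij, symmetric])
  then show ?thesis unfolding trace_hmul by (simp add: mult.commute)
qed

text \<open>Writing a coefficient as a trace makes cyclic permutation of factors available
  (\<open>trace_commute\<close>).\<close>

lemma coeff_trace: "y \<in> Sym n \<Longrightarrow> hmul n (hT (inv y)) h id = h y"
  by (simp add: trace_hmul hT_def if_distrib[of "\<lambda>c. c * _"] sum.delta Sym_inv cong: if_cong)

subsection \<open>The anti-automorphism\<close>

text \<open>The linear map sending T_w to T_(w^-1), cut off outside \<open>Sym n\<close>, where
  \<open>inv\<close> is arbitrary. In an orthogonal representation it becomes the weighted transpose
  (\<open>R_hstar\<close>).\<close>

definition hstar :: "nat \<Rightarrow> hecke \<Rightarrow> hecke" where
  "hstar n h = (\<lambda>y. if y \<in> Sym n then h (inv y) else 0)"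

lemma hlin_hstar: "hlin (hstar n)"
  by (rule hlinI) (simp_all add: hstar_def)

lemma hstar_HK [simp]: "hstar n h \<in> HK n"
  by (simp add: hstar_def HK_def)

lemma hstar_hstar: "h \<in> HK n \<Longrightarrow> hstar n (hstar n h) = h"
  by (auto simp: hstar_def HK_def fun_eq_iff Sym_inv)

lemma hstar_hT: "w \<in> Sym n \<Longrightarrow> hstar n (hT w) = hT (inv w)"
  by (auto simp: hstar_def hT_def fun_eq_iff[of "\<lambda>y. if y \<in> Sym n then _ y else 0"] Sym_inv)

lemma hstar_mulTs:
  assumes i: "i \<in> {1..<n}"
  shows "hstar n (mulTs n i h) = rmulTs n i (hstar n h)"
proof (rule HK_eqI[of _ n])
  fix y assume y: "y \<in> Sym n"
  have e: "inv (y \<circ> sgen i) = sgen i \<circ> inv y" using Sym_inv_distrib[OF y sgen_Sym[OF i]] by simp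
  have ys: "y \<circ> sgen i \<in> Sym n" using y i by (simp add: sgen_comp_Sym)
  have "len n (sgen i \<circ> inv y) = len n (y \<circ> sgen i)" using len_inv[OF ys] e by simp
  then show "hstar n (mulTs n i h) y = rmulTs n i (hstar n h) y"
    using y ys len_inv[OF y] by (simp add: hstar_def mulTs_def rmulTs_def e)
qed (use i in \<open>auto intro!: rmulTs_HK\<close>)

lemma hstar_foldr:
  assumes "set is \<subseteq> {1..<n}"
  shows "hstar n (foldr (mulTs n) is g) = hmul n (hstar n g) (hstar n (foldr (mulTs n) is (hT id)))"
  using assms
proof (induction "is")
  case Nil
  then show ?case using hstar_hT[OF Sym_id] hmul_id_right[OF hstar_HK, of n g] by (simp add: inv_id id_def)
next
  case (Cons i "is")
  have "rmulTs n i (hmul n (hstar n g) k) = hmul n (hstar n g) (rmulTs n i k)" if "k \<in> HK n" for k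
    using rcommutes_hmul[of n "hstar n g"] that Cons.prems unfolding rcommutes_def by auto
  then show ?case using Cons by (simp add: hstar_mulTs)
qed

lemma hstar_hmul:
  assumes "h \<in> HK n" "g \<in> HK n"
  shows "hstar n (hmul n h g) = hmul n (hstar n g) (hstar n h)"
proof -
  have m: "hstar n (mulT n x g) = hmul n (hstar n g) (hstar n (hT x))" if "x \<in> Sym n" for x
    using hstar_foldr[of "redword n x" n g] redword[OF that] mulT_id[OF that] unfolding mulT_def by simp
  have "hstar n (hmul n h g) = (\<lambda>y. \<Sum>x\<in>Sym n. h x * hstar n (mulT n x g) y)"
    unfolding hmul_def by (rule hlin_sum[OF hlin_hstar])
  also have "\<dots> = (\<lambda>y. \<Sum>x\<in>Sym n. h x * hmul n (hstar n g) (hstar n (hT x)) y)"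
    by (simp add: m)
  also have "\<dots> = hmul n (hstar n g) (hstar n h)"
    by (subst (2) HK_expand[OF assms(1)]) (simp add: hlin_sum[OF hlin_hstar] hmul_sum_right)
  finally show ?thesis .
qed

lemma hstar_rmulTs:
  assumes i: "i \<in> {1..<n}" and h: "h \<in> HK n"
  shows "hstar n (rmulTs n i h) = mulTs n i (hstar n h)"
  using hstar_hmul[OF h hT_HK[OF sgen_Sym[OF i]]] i h
  by (simp add: hmul_sgen_right hstar_hT[OF sgen_Sym[OF i]] hmul_sgen_left)

subsection \<open>Sign idempotents of parabolic subalgebras\<close>

text \<open>The eigenvalue of T_s in the sign representation T_u |-> eps_u v^(-l(u)); the quadratic
  relation has the roots v and -1/v.\<close>

definition qv :: K where "qv = - inverse vK"

lemma qv_nonzero [simp]: "qv \<noteq> 0"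
  by (simp add: qv_def)

lemma inA_qv [simp]: "inA qv"
  by (simp add: qv_def inA_uminus)

lemma inverse_qv: "inverse qv = - vK"
  by (simp add: qv_def)

definition leig :: "nat \<Rightarrow> nat set \<Rightarrow> hecke \<Rightarrow> bool" where
  "leig n J h \<longleftrightarrow> h \<in> HK n \<and> (\<forall>k\<in>J. mulTs n k h = (\<lambda>y. qv * h y))"

definition reig :: "nat \<Rightarrow> nat set \<Rightarrow> hecke \<Rightarrow> bool" where
  "reig n J h \<longleftrightarrow> h \<in> HK n \<and> (\<forall>k\<in>J. rmulTs n k h = (\<lambda>y. qv * h y))"

text \<open>Quasi-idempotent of the sign representation; up to a power of \<open>qv\<close> it is
  C_(w_J) (\<open>KL_wJ\<close>). Its eigenvalue \<open>pJ\<close> on itself is the Poincare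
  polynomial of the parabolic subgroup, with v replaced by 1/v.\<close>

definition EJ :: "nat \<Rightarrow> nat set \<Rightarrow> hecke" where
  "EJ n J = (\<lambda>y. if y \<in> WJ J then qv ^ len n y else 0)"

definition pJ :: "nat \<Rightarrow> nat set \<Rightarrow> K" where
  "pJ n J = (\<Sum>u\<in>WJ J. qv ^ (2 * len n u))"

text \<open>At a descent y the assumption, read from the other end, gives the value -v h(y) at y
  s_k, and -v + (v - 1/v) = -1/v. So ascents suffice.\<close>

lemma reig_I:
  assumes J: "J \<subseteq> {1..<n}" and h: "h \<in> HK n"
    and a: "\<And>k y. k \<in> J \<Longrightarrow> y \<in> Sym n \<Longrightarrow> y k < y (Suc k) \<Longrightarrow> h (y \<circ> sgen k) = qv * h y"
  shows "reig n J h"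
  unfolding reig_def
proof (intro conjI h ballI)
  fix k assume k: "k \<in> J"
  then have kn: "k \<in> {1..<n}" using J by auto
  show "rmulTs n k h = (\<lambda>y. qv * h y)"
  proof (rule HK_eqI[OF rmulTs_HK[OF kn h] HK_smult[OF h]])
    fix y assume y: "y \<in> Sym n"
    show "rmulTs n k h y = qv * h y"
    proof (cases "y k < y (Suc k)")
      case True
      then show ?thesis using a[OF k y] right_descent_iff[OF y kn] by (simp add: rmulTs_def)
    next
      case False
      then have d: "y (Suc k) < y k" using Sym_inj[OF y, of k "Suc k"] by simp
      have ys: "y \<circ> sgen k \<in> Sym n" using y kn by (simp add: sgen_comp_Sym)
      have "h y = qv * h (y \<circ> sgen k)" using a[OF k ys] d by simp
      then have "h (y \<circ> sgen k) = - vK * h y" by (simp add: qv_def field_simps)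
      then show ?thesis using right_descent_iff[OF y kn] d by (simp add: rmulTs_def qv_def algebra_simps)
    qed
  qed
qed

lemma reig_ascent:
  assumes "J \<subseteq> {1..<n}" "reig n J h" "k \<in> J" "y \<in> Sym n" "y k < y (Suc k)"
  shows "h (y \<circ> sgen k) = qv * h y"
proof -
  have "rmulTs n k h y = qv * h y" using assms by (simp add: reig_def)
  moreover have "\<not> len n (y \<circ> sgen k) < len n y"
    using right_descent_iff[of y n k] assms by auto
  ultimately show ?thesis by (simp add: rmulTs_def)
qed

lemma reig_HK: "reig n J h \<Longrightarrow> h \<in> HK n" and leig_HK: "leig n J h \<Longrightarrow> h \<in> HK n"
  by (simp_all add: reig_def leig_def)

lemma reig_hstar: "J \<subseteq> {1..<n} \<Longrightarrow> leig n J h \<Longrightarrow> reig n J (hstar n h)"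
  by (auto simp: reig_def leig_def hlin_smult[OF hlin_hstar] simp flip: hstar_mulTs)

lemma leig_hstar: "J \<subseteq> {1..<n} \<Longrightarrow> reig n J h \<Longrightarrow> leig n J (hstar n h)"
  by (auto simp: reig_def leig_def hlin_smult[OF hlin_hstar] simp flip: hstar_rmulTs)

lemma reig_hmul: "J \<subseteq> {1..<n} \<Longrightarrow> reig n J g \<Longrightarrow> reig n J (hmul n h g)"
  using rcommutes_hmul[of n h] unfolding reig_def rcommutes_def
  by (auto simp: hmul_HK hmul_smult_right subset_iff) (metis atLeastLessThan_iff One_nat_def hmul_smult_right)

lemma leig_hmul: "J \<subseteq> {1..<n} \<Longrightarrow> leig n J h \<Longrightarrow> g \<in> HK n \<Longrightarrow> leig n J (hmul n h g)"
  unfolding leig_def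
proof (intro conjI ballI)
  fix k assume *: "J \<subseteq> {1..<n}" "h \<in> HK n \<and> (\<forall>k\<in>J. mulTs n k h = (\<lambda>y. qv * h y))" "g \<in> HK n" "k \<in> J"
  have k: "k \<in> {1..<n}" using * by auto
  have "mulTs n k (hmul n h g) = hmul n (hmul n (hT (sgen k)) h) g"
    using k *(2,3) by (simp add: hmul_assoc[OF hT_HK[OF sgen_Sym[OF k]]] hmul_sgen_left hmul_HK del: hmul_sgen_left)
      (simp add: hmul_sgen_left hmul_HK)
  then show "mulTs n k (hmul n h g) = (\<lambda>y. qv * hmul n h g y)"
    using * k by (simp add: hmul_sgen_left hmul_smult_left)
qed (simp add: hmul_HK)

lemma leig_subset: "leig n J h \<Longrightarrow> J' \<subseteq> J \<Longrightarrow> leig n J' h"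
  by (auto simp: leig_def)

context
  fixes n :: nat and J :: "nat set"
  assumes J: "J \<subseteq> {1..<n}"
begin

lemma EJ_HK [simp]: "EJ n J \<in> HK n"
  using WJ_Sym[OF J] by (auto simp: EJ_def HK_def)

lemma EJ_expand: "EJ n J = (\<lambda>y. \<Sum>u\<in>WJ J. qv ^ len n u * hT u y)"
  by (rule ext) (auto simp: EJ_def hT_def if_distrib[of "\<lambda>c. _ * c"] sum.delta' finite_WJ[OF J] cong: if_cong)

lemma EJ_id [simp]: "EJ n J id = 1"
  by (simp add: EJ_def)

lemma reig_EJ: "reig n J (EJ n J)"
proof (rule reig_I[OF J EJ_HK])
  fix k y assume k: "k \<in> J" "y \<in> Sym n" "y k < y (Suc k)"
  then have "len n (y \<circ> sgen k) = Suc (len n y)" using J by (intro len_right_ascent) auto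
  then show "EJ n J (y \<circ> sgen k) = qv * EJ n J y"
    using WJ_sgen_iff(1)[OF k(1)] by (simp add: EJ_def)
qed

lemma hstar_EJ: "hstar n (EJ n J) = EJ n J"
proof (rule HK_eqI[OF hstar_HK EJ_HK])
  fix w assume w: "w \<in> Sym n"
  have "inv w \<in> WJ J \<longleftrightarrow> w \<in> WJ J" using WJ_inv w by (metis Sym_inv_comp(3))
  then show "hstar n (EJ n J) w = EJ n J w" using w len_inv[OF w] by (simp add: hstar_def EJ_def)
qed

lemma leig_EJ: "leig n J (EJ n J)"
  using leig_hstar[OF J reig_EJ] by (simp add: hstar_EJ)

lemma reig_apply:
  assumes "reig n J h" "x \<in> XJ n J" "u \<in> WJ J"
  shows "h (x \<circ> u) = qv ^ len n u * h x"
proof (rule WJ_right_induct[OF J assms(3), where P = "\<lambda>u. h (x \<circ> u) = qv ^ len n u * h x"])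
  fix u k assume 2: "u \<in> WJ J" "k \<in> J" "u k < u (Suc k)" "h (x \<circ> u) = qv ^ len n u * h x"
  have kn: "k \<in> {1..<n}" using 2 J by auto
  have "h (x \<circ> u \<circ> sgen k) = qv * h (x \<circ> u)"
    using 2 reig_ascent[OF J assms(1) 2(2), of "x \<circ> u"] XJ_comp_less_iff[OF J assms(2) 2(1,2)]
      Sym_comp[OF XJ_Sym[OF J assms(2)] WJ_Sym[OF J 2(1)]] by simp
  moreover have "len n (u \<circ> sgen k) = Suc (len n u)"
    using 2 kn WJ_Sym[OF J] by (intro len_right_ascent) auto
  ultimately show "h (x \<circ> (u \<circ> sgen k)) = qv ^ len n (u \<circ> sgen k) * h x" using 2 by (simp add: comp_assoc)
qed simp

lemma hmul_hT_EJ: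
  assumes x: "x \<in> XJ n J"
  shows "hmul n (hT x) (EJ n J) = (\<lambda>y. \<Sum>u\<in>WJ J. qv ^ len n u * hT (x \<circ> u) y)"
proof -
  have "EJ n J = (\<lambda>y. \<Sum>u\<in>WJ J. qv ^ len n u * hT u y)"
    by (rule EJ_expand)
  then have "hmul n (hT x) (EJ n J) = (\<lambda>y. \<Sum>u\<in>WJ J. qv ^ len n u * hmul n (hT x) (hT u) y)"
    by (simp add: hmul_sum_right)
  also have "\<dots> = (\<lambda>y. \<Sum>u\<in>WJ J. qv ^ len n u * hT (x \<circ> u) y)"
    using hmul_hT_hT[OF XJ_Sym[OF J x] WJ_Sym[OF J] len_XJ_WJ[OF J x]] by (auto intro!: sum.cong)
  finally show ?thesis .
qed

lemma hmul_hT_EJ_apply: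
  assumes "x \<in> XJ n J" "x' \<in> XJ n J" "u \<in> WJ J"
  shows "hmul n (hT x) (EJ n J) (x' \<circ> u) = (if x' = x then qv ^ len n u else 0)"
proof -
  have "(x' \<circ> u = x \<circ> u') \<longleftrightarrow> x' = x \<and> u = u'" if "u' \<in> WJ J" for u'
    using XJ_WJ_unique[OF J assms(2,1,3) that] by auto
  then show ?thesis
    unfolding hmul_hT_EJ[OF assms(1)] using assms finite_WJ[OF J]
    by (auto simp: hT_def if_distrib[of "\<lambda>c. _ * c"] sum.delta' cong: if_cong sum.cong)
qed

text \<open>A right eigenvector is determined by its values on the distinguished representatives;
  the left ideal generated by E thus has the basis T_x E.\<close>

lemma reig_expand:
  assumes "reig n J h"
  shows "h = (\<lambda>y. \<Sum>x\<in>XJ n J. h x * hmul n (hT x) (EJ n J) y)"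
proof (rule HK_eqI[OF reig_HK[OF assms]])
  show "(\<lambda>y. \<Sum>x\<in>XJ n J. h x * hmul n (hT x) (EJ n J) y) \<in> HK n"
    by (intro HK_sum hmul_HK EJ_HK)
  fix w assume "w \<in> Sym n"
  then obtain x u where xu: "x \<in> XJ n J" "u \<in> WJ J" "w = x \<circ> u" by (rule XJ_WJ_decomp[OF J])
  have "(\<Sum>x'\<in>XJ n J. h x' * hmul n (hT x') (EJ n J) w) = (\<Sum>x'\<in>XJ n J. if x = x' then h x' * qv ^ len n u else 0)"
    using xu by (auto intro!: sum.cong simp: hmul_hT_EJ_apply)
  then show "h w = (\<Sum>x'\<in>XJ n J. h x' * hmul n (hT x') (EJ n J) w)"
    using reig_apply[OF assms xu(1,2)] xu finite_XJ[OF J] by (simp add: sum.delta)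
qed

lemma leig_WJ:
  assumes "leig n J g" "u \<in> WJ J"
  shows "hmul n (hT u) g = (\<lambda>y. qv ^ len n u * g y)"
proof (rule WJ_right_induct[OF J assms(2), where P = "\<lambda>u. hmul n (hT u) g = (\<lambda>y. qv ^ len n u * g y)"])
  show "hmul n (hT id) g = (\<lambda>y. qv ^ len n id * g y)" using hmul_id_left[OF leig_HK[OF assms(1)]] by simp
next
  fix u k assume 2: "u \<in> WJ J" "k \<in> J" "u k < u (Suc k)" "hmul n (hT u) g = (\<lambda>y. qv ^ len n u * g y)"
  have kn: "k \<in> {1..<n}" using 2 J by auto
  have l: "len n (u \<circ> sgen k) = Suc (len n u)"
    using 2 kn WJ_Sym[OF J] by (intro len_right_ascent) auto
  have "len n (sgen k) = 1"
    using len_right_cases[OF Sym_id kn] by auto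
  then have "hT (u \<circ> sgen k) = hmul n (hT u) (hT (sgen k))"
    using hmul_hT_hT[OF WJ_Sym[OF J 2(1)] sgen_Sym[OF kn]] l by simp
  then have "hmul n (hT (u \<circ> sgen k)) g = hmul n (hT u) (mulTs n k g)"
    using leig_HK[OF assms(1)] kn WJ_Sym[OF J 2(1)] by (simp add: hmul_assoc hT_HK sgen_Sym hmul_sgen_left)
  also have "\<dots> = (\<lambda>y. qv * hmul n (hT u) g y)"
    using assms(1) 2(2) by (simp add: leig_def hmul_smult_right)
  finally show "hmul n (hT (u \<circ> sgen k)) g = (\<lambda>y. qv ^ len n (u \<circ> sgen k) * g y)" using 2 l by (simp add: mult.assoc)
qed

lemma EJ_leig:
  assumes "leig n J g"
  shows "hmul n (EJ n J) g = (\<lambda>y. pJ n J * g y)"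
proof -
  have "EJ n J = (\<lambda>y. \<Sum>u\<in>WJ J. qv ^ len n u * hT u y)"
    by (rule EJ_expand)
  then have "hmul n (EJ n J) g = (\<lambda>y. \<Sum>u\<in>WJ J. qv ^ len n u * hmul n (hT u) g y)"
    by (simp add: hmul_sum_left)
  also have "\<dots> = (\<lambda>y. \<Sum>u\<in>WJ J. qv ^ len n u * (qv ^ len n u * g y))"
    by (simp add: leig_WJ[OF assms] cong: sum.cong)
  finally show ?thesis by (simp add: pJ_def sum_distrib_right mult_2 power_add mult.assoc)
qed

lemma EJ_EJ: "hmul n (EJ n J) (EJ n J) = (\<lambda>y. pJ n J * EJ n J y)"
  by (rule EJ_leig[OF leig_EJ])

text \<open>A sum of squares containing the term 1, hence nonzero in a formally real field.\<close>

lemma pJ_nonzero: "pJ n J \<noteq> 0"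
proof
  assume "pJ n J = 0"
  then have "(\<Sum>u\<in>WJ J. qv ^ len n u * qv ^ len n u * 1) = 0"
    by (simp add: pJ_def mult_2 power_add)
  from sum_squares_zeroD[OF finite_WJ[OF J] _ _ this WJ_id] show False by simp
qed

end

section \<open>The bar involution and the Kazhdan--Lusztig basis\<close>

lemma mulTs_quadratic:
  assumes i: "i \<in> {1..<n}" and h: "h \<in> HK n"
  shows "mulTs n i (mulTs n i h) = (\<lambda>y. h y + (vK - inverse vK) * mulTs n i h y)"
proof (rule HK_eqI[of _ n])
  fix y assume y: "y \<in> Sym n"
  consider "len n (sgen i \<circ> y) < len n y" "\<not> len n y < len n (sgen i \<circ> y)"
    | "len n y < len n (sgen i \<circ> y)" "\<not> len n (sgen i \<circ> y) < len n y"
    using len_left_cases[OF y i] by linarith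
  then show "mulTs n i (mulTs n i h) y = h y + (vK - inverse vK) * mulTs n i h y"
    by cases (simp_all add: mulTs_def)
qed (use mulTs_HK[OF i mulTs_HK[OF i h]] HK_add[OF h HK_smult[OF mulTs_HK[OF i h]]] in auto)

lemma hlin_mulTsinv: "hlin (mulTsinv n i)"
  by (rule hlinI; simp add: mulTsinv_def hlin_add[OF hlin_mulTs] hlin_smult[OF hlin_mulTs] algebra_simps)

lemma mulTsinv_HK: "i \<in> {1..<n} \<Longrightarrow> h \<in> HK n \<Longrightarrow> mulTsinv n i h \<in> HK n"
  unfolding mulTsinv_def using HK_diff[OF mulTs_HK HK_smult] by blast

lemma mulTs_mulTsinv: "i \<in> {1..<n} \<Longrightarrow> h \<in> HK n \<Longrightarrow> mulTs n i (mulTsinv n i h) = h"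
  unfolding mulTsinv_def by (simp add: hlin_diff[OF hlin_mulTs] hlin_smult[OF hlin_mulTs] mulTs_quadratic)

lemma mulTsinv_mulTs: "i \<in> {1..<n} \<Longrightarrow> h \<in> HK n \<Longrightarrow> mulTsinv n i (mulTs n i h) = h"
  unfolding mulTsinv_def by (simp add: mulTs_quadratic)

lemma foldr_mulTsinv_HK: "set is \<subseteq> {1..<n} \<Longrightarrow> h \<in> HK n \<Longrightarrow> foldr (mulTsinv n) is h \<in> HK n"
  by (induction "is") (simp_all add: mulTsinv_HK)

lemma foldr_mulTs_rev_mulTsinv:
  "set is \<subseteq> {1..<n} \<Longrightarrow> h \<in> HK n \<Longrightarrow> foldr (mulTs n) (rev is) (foldr (mulTsinv n) is h) = h"
  by (induction "is") (simp_all add: mulTs_mulTsinv foldr_mulTsinv_HK)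

lemma foldr_mulTsinv_mulTs_rev:
  assumes "set is \<subseteq> {1..<n}" "h \<in> HK n"
  shows "foldr (mulTsinv n) is (foldr (mulTs n) (rev is) h) = h"
  using assms
proof (induction "is" arbitrary: h)
  case (Cons i "is")
  then show ?case by (simp add: mulTs_HK mulTsinv_mulTs)
qed simp

lemma rcommutes_mulTsinv: "i \<in> {1..<n} \<Longrightarrow> rcommutes n (mulTsinv n i)"
  unfolding rcommutes_def
proof (intro conjI hlin_mulTsinv ballI)
  fix j h assume "i \<in> {1..<n}" "j \<in> {1..<n}" "h \<in> HK n"
  then show "mulTsinv n i (rmulTs n j h) = rmulTs n j (mulTsinv n i h)"
    unfolding mulTsinv_def by (simp add: mulTs_rmulTs_commute hlin_diff[OF hlin_rmulTs] hlin_smult[OF hlin_rmulTs])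
qed

lemma rcommutes_foldr_mulTsinv: "set is \<subseteq> {1..<n} \<Longrightarrow> rcommutes n (foldr (mulTsinv n) is)"
proof (induction "is")
  case (Cons i "is")
  then have "rcommutes n (\<lambda>h. mulTsinv n i (foldr (mulTsinv n) is h))"
    using rcommutes_comp[of n "mulTsinv n i" "foldr (mulTsinv n) is"] by (simp add: rcommutes_mulTsinv foldr_mulTsinv_HK)
  then show ?case by (simp add: comp_def)
qed (simp add: rcommutes_id id_def)

definition barT :: "nat \<Rightarrow> perm \<Rightarrow> hecke" where
  "barT n w = foldr (mulTsinv n) (redword n w) (hT id)"

lemma barT_HK: "w \<in> Sym n \<Longrightarrow> barT n w \<in> HK n"
  unfolding barT_def using foldr_mulTsinv_HK redword hT_HK[OF Sym_id] by blast

text \<open>The inverse generators along a reduced word undo the product of the T_s along the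
  reversed word, and that product is T_(w^-1) whichever word is chosen.\<close>

lemma barT_reduced_word:
  assumes "set is \<subseteq> {1..<n}" "len n (wordprod is) = length is"
  shows "foldr (mulTsinv n) is (hT id) = barT n (wordprod is)"
    and "hmul n (hT (inv (wordprod is))) (barT n (wordprod is)) = hT id"
proof -
  let ?w = "wordprod is"
  have w: "?w \<in> Sym n" using assms wordprod_Sym by blast
  have eq: "foldr (mulTs n) (rev js) h = hmul n (hT (inv ?w)) h"
    if "set js \<subseteq> {1..<n}" "wordprod js = ?w" "length js = len n ?w" "h \<in> HK n" for js h
  proof (rule rcommutes_determined[OF rcommutes_foldr rcommutes_hmul _ that(4)])
    show "set (rev js) \<subseteq> {1..<n}" using that by simp
    then have "foldr (mulTs n) (rev js) (hT id) = hT (wordprod (rev js))"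
      using that len_inv[OF w] by (intro foldr_reduced_word) (simp_all add: wordprod_rev)
    then show "foldr (mulTs n) (rev js) (hT id) = hmul n (hT (inv ?w)) (hT id)"
      using that Sym_inv[OF w] by (simp add: wordprod_rev hmul_id_right hT_HK)
  qed
  note rw = redword[OF w]
  have i: "hT id \<in> HK n" by (simp add: hT_HK)
  show b: "hmul n (hT (inv ?w)) (barT n ?w) = hT id"
    using eq[OF rw(2,3,1) barT_HK[OF w]] foldr_mulTs_rev_mulTsinv[OF rw(2) i] by (simp add: barT_def)
  have "hmul n (hT (inv ?w)) (foldr (mulTsinv n) is (hT id)) = hT id"
    using eq[OF assms(1) refl assms(2)[symmetric] foldr_mulTsinv_HK[OF assms(1) i]]
      foldr_mulTs_rev_mulTsinv[OF assms(1) i] by simp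
  then have "foldr (mulTs n) (rev is) (foldr (mulTsinv n) is (hT id)) = foldr (mulTs n) (rev is) (barT n ?w)"
    using b eq[OF assms(1) refl assms(2)[symmetric]] foldr_mulTsinv_HK[OF assms(1) i] barT_HK[OF w] by simp
  then show "foldr (mulTsinv n) is (hT id) = barT n ?w"
    using foldr_mulTsinv_mulTs_rev[OF assms(1)] foldr_mulTsinv_HK[OF assms(1) i] barT_HK[OF w] by metis
qed

lemma barT_inverse: "w \<in> Sym n \<Longrightarrow> hmul n (hT (inv w)) (barT n w) = hT id"
  using barT_reduced_word(2)[of "redword n w" n] redword[of w n] by simp

lemma barT_id: "barT n id = hT id"
  using barT_reduced_word(1)[of "[]" n] by simp

lemma barT_ascent:
  assumes "w \<in> Sym n" "i \<in> {1..<n}" "len n w < len n (sgen i \<circ> w)"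
  shows "barT n (sgen i \<circ> w) = mulTsinv n i (barT n w)"
proof -
  have "len n (sgen i \<circ> w) = Suc (len n w)" using len_left_cases[OF assms(1,2)] assms(3) by auto
  then have "foldr (mulTsinv n) (i # redword n w) (hT id) = barT n (wordprod (i # redword n w))"
    using redword[OF assms(1)] assms(2) by (intro barT_reduced_word) simp_all
  then show ?thesis using redword[OF assms(1)] by (simp add: barT_def)
qed

lemma barT_hstar:
  assumes w: "w \<in> Sym n"
  shows "hstar n (barT n w) = barT n (inv w)"
proof -
  have "hstar n (hmul n (hT (inv w)) (barT n w)) = hT id"
    using barT_inverse[OF w] hstar_hT[OF Sym_id] by (simp add: inv_id)
  then have a: "hmul n (hstar n (barT n w)) (hT w) = hT id"
    using w by (simp add: hstar_hmul hT_HK Sym_inv barT_HK hstar_hT)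
  have b: "hmul n (hT w) (barT n (inv w)) = hT id"
    using barT_inverse[OF Sym_inv[OF w]] w by simp
  have "hstar n (barT n w) = hmul n (hstar n (barT n w)) (hmul n (hT w) (barT n (inv w)))"
    using b by (simp add: hmul_id_right)
  also have "\<dots> = hmul n (hT id) (barT n (inv w))"
    using a w by (simp add: hT_HK barT_HK Sym_inv flip: hmul_assoc)
  also have "\<dots> = barT n (inv w)" using w by (simp add: hmul_id_left barT_HK Sym_inv)
  finally show ?thesis .
qed

text \<open>Comparison by length is coarser than Bruhat order, but it is enough for arguments that
  look at a longest element of the support.\<close>

lemma barT_triangular:
  assumes w: "w \<in> Sym n"
  shows "barT n w y \<noteq> 0 \<Longrightarrow> y = w \<or> len n y < len n w" and "barT n w w = 1" and "inA (barT n w y)"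
proof -
  have "(\<forall>y. barT n w y \<noteq> 0 \<longrightarrow> y = w \<or> len n y < len n w) \<and> barT n w w = 1 \<and> (\<forall>y. inA (barT n w y))"
    using w
  proof (induction "len n w" arbitrary: w rule: less_induct)
    case less
    show ?case
    proof (cases "w = id")
      case True
      then show ?thesis unfolding True barT_id by (simp add: hT_def)
    next
      case False
      then have "inv w \<noteq> id" using less.prems by (metis Sym_inv_comp(3) inv_id)
      then obtain i where i: "i \<in> {1..<n}" "\<not> inv w i < inv w (Suc i)"
        using no_descent_imp_id[OF Sym_inv[OF less.prems]] by blast
      then have d: "len n (sgen i \<circ> w) < len n w"
        using left_descent_iff[OF less.prems i(1)] Sym_inj[OF Sym_inv[OF less.prems], of i "Suc i"] by auto
      define u where "u = sgen i \<circ> w"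
      have u1: "u \<in> Sym n" unfolding u_def using less.prems i(1) sgen_comp_Sym(1) by blast
      have u2: "w = sgen i \<circ> u" by (simp add: u_def)
      have u3: "len n w = Suc (len n u)" unfolding u_def using d len_left_cases[OF less.prems i(1)] by linarith
      note u = u1 u2 u3
      have IH: "\<And>y. barT n u y \<noteq> 0 \<Longrightarrow> y = u \<or> len n y < len n u" "barT n u u = 1" "\<And>y. inA (barT n u y)"
        using less.hyps[OF _ u1] u3 by simp_all
      have bw: "barT n w = mulTsinv n i (barT n u)"
        using barT_ascent[OF u(1) i(1)] u by simp
      have val: "barT n w y = barT n u (sgen i \<circ> y) - (if len n (sgen i \<circ> y) < len n y then 0 else (vK - inverse vK) * barT n u y)" for y
        by (simp add: bw mulTsinv_def mulTs_def)
      have "y = w \<or> len n y < len n w" if "barT n w y \<noteq> 0" for y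
      proof -
        have y: "y \<in> Sym n" using that HK_outside[OF barT_HK[OF less.prems]] by blast
        from that val[of y] have "barT n u (sgen i \<circ> y) \<noteq> 0 \<or> barT n u y \<noteq> 0" by (auto split: if_splits)
        then show ?thesis
        proof
          assume "barT n u (sgen i \<circ> y) \<noteq> 0"
          then consider "sgen i \<circ> y = u" | "len n (sgen i \<circ> y) < len n u" using IH(1) by blast
          then show ?thesis
          proof cases
            case 1 then show ?thesis using u(2) sgen_left_eq_iff by metis
          next
            case 2 then show ?thesis using len_left_cases[OF y i(1)] u(3) by linarith
          qed
        next
          assume "barT n u y \<noteq> 0"
          then have "len n y \<le> len n u" using IH(1) by fastforce
          then show ?thesis using u(3) by simp
        qed
      qed
      moreover have "barT n w w = 1" using val[of w] d IH(2) by (simp add: u_def)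
      moreover have "inA (barT n w y)" for y
        unfolding val using IH(3) by (auto intro!: inA_diff inA_mult)
      ultimately show ?thesis by blast
    qed
  qed
  then show "barT n w y \<noteq> 0 \<Longrightarrow> y = w \<or> len n y < len n w" "barT n w w = 1" "inA (barT n w y)"
    by blast+
qed

lemma hbar_barT: "hbar n h = (\<lambda>y. \<Sum>w\<in>Sym n. barK (h w) * barT n w y)"
  by (simp add: hbar_def barT_def)

lemma hbar_HK: "hbar n h \<in> HK n"
  unfolding hbar_barT by (intro HK_sum barT_HK)

lemma hbar_add: "hbar n (\<lambda>y. h y + g y) = (\<lambda>y. hbar n h y + hbar n g y)"
  and hbar_diff: "hbar n (\<lambda>y. h y - g y) = (\<lambda>y. hbar n h y - hbar n g y)"
  and hbar_smult: "hbar n (\<lambda>y. c * h y) = (\<lambda>y. barK c * hbar n h y)"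
  by (simp_all add: hbar_barT algebra_simps sum.distrib sum_subtractf sum_distrib_left)

lemma hbar_sum: "hbar n (\<lambda>y. \<Sum>s\<in>S. c s * F s y) = (\<lambda>y. \<Sum>s\<in>S. barK (c s) * hbar n (F s) y)"
proof (induction S rule: infinite_finite_induct)
  case (insert x S)
  then show ?case
    using hbar_add[of n "\<lambda>y. c x * F x y" "\<lambda>y. \<Sum>s\<in>S. c s * F s y"] by (simp add: hbar_smult)
qed (simp_all add: hbar_barT)

lemma hbar_hT: "w \<in> Sym n \<Longrightarrow> hbar n (hT w) = barT n w"
  by (simp add: hbar_barT hT_def if_distrib[of barK] if_distrib[of "\<lambda>c. c * _"] sum.delta cong: if_cong)

lemma hbar_mulTs:
  assumes i: "i \<in> {1..<n}" and h: "h \<in> HK n"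
  shows "hbar n (mulTs n i h) = mulTsinv n i (hbar n h)"
proof -
  have *: "hbar n (mulTs n i (hT w)) = mulTsinv n i (barT n w)" if w: "w \<in> Sym n" for w
  proof (cases "len n w < len n (sgen i \<circ> w)")
    case True
    then show ?thesis using w i by (simp add: mulTs_hT hbar_hT sgen_comp_Sym barT_ascent)
  next
    case False
    then have d: "len n (sgen i \<circ> w) < len n w" using len_left_cases[OF w i] by auto
    let ?u = "sgen i \<circ> w"
    have u: "?u \<in> Sym n" using w i by (simp add: sgen_comp_Sym)
    have "barT n w = mulTsinv n i (barT n ?u)" using barT_ascent[OF u i] d by simp
    then have e: "barT n ?u = mulTs n i (barT n w)" using mulTs_mulTsinv[OF i barT_HK[OF u]] by simp
    \<comment> \<open>Bar negates v - 1/v, and this is exactly the difference between T_s and its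
      inverse.\<close>
    have "hbar n (mulTs n i (hT w)) = (\<lambda>y. barT n ?u y + (inverse vK - vK) * barT n w y)"
      using mulTs_hT_descent[OF w i d] u w by (simp add: hbar_add hbar_smult hbar_hT)
    then show ?thesis unfolding e by (simp add: mulTsinv_def algebra_simps)
  qed
  have "mulTs n i h = (\<lambda>y. \<Sum>w\<in>Sym n. h w * mulTs n i (hT w) y)"
    by (subst HK_expand[OF h]) (simp add: hlin_sum[OF hlin_mulTs])
  then have "hbar n (mulTs n i h) = (\<lambda>y. \<Sum>w\<in>Sym n. barK (h w) * mulTsinv n i (barT n w) y)"
    by (simp add: hbar_sum *)
  then show ?thesis unfolding hbar_barT by (simp add: hlin_sum[OF hlin_mulTsinv])
qed

lemma hbar_hmul:
  assumes "h \<in> HK n" "g \<in> HK n"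
  shows "hbar n (hmul n h g) = hmul n (hbar n h) (hbar n g)"
proof -
  have f: "set is \<subseteq> {1..<n} \<Longrightarrow> hbar n (foldr (mulTs n) is g) = foldr (mulTsinv n) is (hbar n g)" for "is"
    by (induction "is") (simp_all add: hbar_mulTs foldr_HK assms)
  have m: "hbar n (mulT n x g) = hmul n (barT n x) (hbar n g)" if x: "x \<in> Sym n" for x
  proof -
    note rw = redword[OF x]
    have "hbar n (mulT n x g) = foldr (mulTsinv n) (redword n x) (hbar n g)"
      unfolding mulT_def using f rw by blast
    also have "\<dots> = hmul n (barT n x) (hbar n g)"
      by (rule rcommutes_determined[OF rcommutes_foldr_mulTsinv[OF rw(2)] rcommutes_hmul _ hbar_HK])
        (simp add: hmul_id_right barT_HK[OF x], simp add: barT_def)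
    finally show ?thesis .
  qed
  have "hbar n (hmul n h g) = (\<lambda>y. \<Sum>x\<in>Sym n. barK (h x) * hmul n (barT n x) (hbar n g) y)"
    unfolding hmul_def[of n h g] by (simp add: hbar_sum m)
  also have "\<dots> = hmul n (hbar n h) (hbar n g)"
    unfolding hbar_barT[of n h] by (simp add: hmul_sum_left)
  finally show ?thesis .
qed

lemma hbar_hstar:
  shows "hbar n (hstar n h) = hstar n (hbar n h)"
proof -
  have "hbar n (hstar n h) = (\<lambda>y. \<Sum>w\<in>Sym n. barK (h (inv w)) * barT n w y)"
    by (simp add: hbar_barT hstar_def)
  also have "\<dots> = (\<lambda>y. \<Sum>w\<in>Sym n. barK (h w) * barT n (inv w) y)"
  proof
    fix y
    show "(\<Sum>w\<in>Sym n. barK (h (inv w)) * barT n w y) = (\<Sum>w\<in>Sym n. barK (h w) * barT n (inv w) y)"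
      by (rule sum.reindex_bij_witness[of _ inv inv]) (auto simp: Sym_inv)
  qed
  also have "\<dots> = (\<lambda>y. \<Sum>w\<in>Sym n. barK (h w) * hstar n (barT n w) y)"
    by (simp add: barT_hstar)
  also have "\<dots> = hstar n (hbar n h)"
    unfolding hbar_barT by (simp add: hlin_sum[OF hlin_hstar])
  finally show ?thesis .
qed

section \<open>Integral elements; existence, uniqueness and triangularity of the Kazhdan-Lusztig
  basis\<close>

lemma inH_HK: "inH n h \<Longrightarrow> h \<in> HK n"
  by (simp add: inH_def HK_def)

lemma inH_iff: "inH n h \<longleftrightarrow> h \<in> HK n \<and> (\<forall>w. inA (h w))"
  by (simp add: inH_def HK_def)

lemma inH_hT: "w \<in> Sym n \<Longrightarrow> inH n (hT w)"
  by (simp add: inH_iff hT_HK) (simp add: hT_def)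

lemma inH_diff: "inH n h \<Longrightarrow> inH n g \<Longrightarrow> inH n (\<lambda>y. h y - g y)"
  and inH_smult: "inA c \<Longrightarrow> inH n h \<Longrightarrow> inH n (\<lambda>y. c * h y)"
  by (auto simp: inH_def intro: inA_diff inA_mult)

lemma inH_sum: "(\<And>s. s \<in> S \<Longrightarrow> inA (c s)) \<Longrightarrow> (\<And>s. s \<in> S \<Longrightarrow> inH n (F s)) \<Longrightarrow> inH n (\<lambda>y. \<Sum>s\<in>S. c s * F s y)"
  by (auto simp: inH_iff intro!: HK_sum inA_sum inA_mult)

lemma inH_mulTs: "i \<in> {1..<n} \<Longrightarrow> inH n h \<Longrightarrow> inH n (mulTs n i h)"
  by (simp add: inH_iff mulTs_HK) (auto simp: mulTs_def intro!: inA_add inA_mult inA_diff)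

lemma inH_mulT: "x \<in> Sym n \<Longrightarrow> inH n h \<Longrightarrow> inH n (mulT n x h)"
proof -
  assume x: "x \<in> Sym n" "inH n h"
  have "set is \<subseteq> {1..<n} \<Longrightarrow> inH n (foldr (mulTs n) is h)" for "is"
    by (induction "is") (simp_all add: inH_mulTs x)
  then show ?thesis unfolding mulT_def using redword(2)[OF x(1)] by blast
qed

lemma inH_hmul: "inH n h \<Longrightarrow> inH n g \<Longrightarrow> inH n (hmul n h g)"
  unfolding hmul_def by (rule inH_sum[OF _ inH_mulT]) (auto simp: inH_def)

lemma inH_hstar: "inH n h \<Longrightarrow> inH n (hstar n h)"
  by (auto simp: inH_def hstar_def)

definition KLspec :: "nat \<Rightarrow> perm \<Rightarrow> hecke \<Rightarrow> bool" where
  "KLspec n w c \<longleftrightarrow> inH n c \<and> hbar n c = c \<and> (\<forall>y. in_vZv (c y - hT w y))"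

lemma in_vZv_add: "in_vZv x \<Longrightarrow> in_vZv y \<Longrightarrow> in_vZv (x + y)"
  and in_vZv_uminus: "in_vZv x \<Longrightarrow> in_vZv (- x)"
  and in_vZv_mult: "inA x \<Longrightarrow> inO x \<Longrightarrow> in_vZv y \<Longrightarrow> in_vZv (x * y)"
  and in_vZv_0 [simp]: "in_vZv 0"
  by (auto simp: in_vZv_iff inA_add inO_add const0_add inA_uminus inO_uminus const0_uminus inA_mult inO_mult const0_mult)

lemma in_vZv_diff: "in_vZv x \<Longrightarrow> in_vZv y \<Longrightarrow> in_vZv (x - y)"
  using in_vZv_add[of x "- y"] in_vZv_uminus by simp

lemma in_vZv_sum: "(\<And>s. s \<in> S \<Longrightarrow> in_vZv (f s)) \<Longrightarrow> in_vZv (\<Sum>s\<in>S. f s)"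
  by (induction S rule: infinite_finite_induct) (auto intro: in_vZv_add)

text \<open>At a longest element y of the support, triangularity of bar leaves only h(y) =
  bar(h(y)), and a bar invariant element of vZ[v] is zero.\<close>

lemma bar_invariant_small_zero:
  assumes h: "h \<in> HK n" "hbar n h = h" "\<And>y. in_vZv (h y)"
  shows "h = (\<lambda>y. 0)"
proof (rule ccontr)
  assume "h \<noteq> (\<lambda>y. 0)"
  let ?S = "{y \<in> Sym n. h y \<noteq> 0}"
  have "?S \<noteq> {}" using \<open>h \<noteq> _\<close> HK_outside[OF h(1)] by fastforce
  then have "Max (len n ` ?S) \<in> len n ` ?S" by (intro Max_in) auto
  then obtain y where y: "y \<in> ?S" "len n y = Max (len n ` ?S)" by auto
  have max: "len n w \<le> len n y" if "w \<in> ?S" for w unfolding y(2) using that by (intro Max_ge) auto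
  have "h y = (\<Sum>w\<in>Sym n. barK (h w) * barT n w y)"
    using fun_cong[OF h(2), of y] by (simp add: hbar_barT)
  also have "\<dots> = (\<Sum>w\<in>Sym n. if w = y then barK (h y) else 0)"
  proof (rule sum.cong)
    fix w assume w: "w \<in> Sym n"
    show "barK (h w) * barT n w y = (if w = y then barK (h y) else 0)"
    proof (cases "w = y")
      case True
      then show ?thesis using barT_triangular(2)[OF w] by simp
    next
      case False
      show ?thesis
      proof (cases "barT n w y = 0")
        case nz: False
        then have "len n y < len n w" using barT_triangular(1)[OF w, of y] False by auto
        then have "h w = 0" using max[of w] w by auto
        then show ?thesis using False by simp
      qed (use False in simp)
    qed
  qed simp
  also have "\<dots> = barK (h y)" using y by (simp add: sum.delta)
  finally have "h y = 0" using bar_invariant_zero[OF h(3)] by simp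
  then show False using y by simp
qed

lemma KLspec_unique:
  assumes "KLspec n w c" "KLspec n w c'"
  shows "c = c'"
proof -
  have "(\<lambda>y. c y - c' y) = (\<lambda>y. 0)"
  proof (rule bar_invariant_small_zero)
    show "(\<lambda>y. c y - c' y) \<in> HK n" using assms by (auto simp: KLspec_def inH_iff intro: HK_diff)
    show "hbar n (\<lambda>y. c y - c' y) = (\<lambda>y. c y - c' y)" using assms by (simp add: KLspec_def hbar_diff)
    fix y
    have "in_vZv ((c y - hT w y) - (c' y - hT w y))"
      using assms by (intro in_vZv_diff[of "_ - _" "_ - _"]) (auto simp: KLspec_def)
    then show "in_vZv (c y - c' y)" by simp
  qed
  then show ?thesis by (auto simp: fun_eq_iff dest: fun_cong)
qed

definition KLtri :: "nat \<Rightarrow> perm \<Rightarrow> hecke \<Rightarrow> bool" where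
  "KLtri n w c \<longleftrightarrow> (\<forall>y. c y \<noteq> 0 \<longrightarrow> y = w \<or> len n y < len n w) \<and> c w = 1"

text \<open>With w = s u and C_s = T_s - v, the product C_s C_u is bar invariant and an eigenvector
  of T_s. Its coefficients are small except for constants at w and at some shorter z with s z < z.
  Subtracting integer multiples of the C_z cancels the latter and keeps the eigenvalue, which is why
  the eigenvector property belongs to the induction hypothesis.\<close>

lemma KL_step:
  assumes w: "w \<in> Sym n" and i: "i \<in> {1..<n}" and d: "len n (sgen i \<circ> w) < len n w"
    and C: "\<And>z. z \<in> Sym n \<Longrightarrow> len n z < len n w \<Longrightarrow> KLspec n z (C z) \<and> KLtri n z (C z)"
      "\<And>z. z \<in> Sym n \<Longrightarrow> len n z < len n w \<Longrightarrow> len n (sgen i \<circ> z) < len n z \<Longrightarrow> mulTs n i (C z) = (\<lambda>y. qv * C z y)"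
  shows "\<exists>c. KLspec n w c \<and> KLtri n w c \<and> mulTs n i c = (\<lambda>y. qv * c y)"
proof -
  define u where "u = sgen i \<circ> w"
  have u1: "u \<in> Sym n" unfolding u_def using w i sgen_comp_Sym(1) by blast
  have u2: "w = sgen i \<circ> u" by (simp add: u_def)
  have u3: "len n w = Suc (len n u)" unfolding u_def using d len_left_cases[OF w i] by linarith
  note u = u1 u2 u3
  define c' where "c' = C u"
  have c': "inH n c'" "hbar n c' = c'" "\<And>y. in_vZv (c' y - hT u y)" "\<And>y. c' y \<noteq> 0 \<Longrightarrow> y = u \<or> len n y < len n u" "c' u = 1"
    using C(1)[of u] u by (auto simp: c'_def KLspec_def KLtri_def)
  have c'K: "c' \<in> HK n" using c' inH_HK by blast
  have small: "in_vZv (c' y)" if "y \<noteq> u" for y using c'(3)[of y] that by (simp add: hT_def)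
  define g where "g = (\<lambda>y. mulTs n i c' y - vK * c' y)"
  have gH: "inH n g" unfolding g_def using c' i by (intro inH_diff inH_smult inH_mulTs) auto
  have gbar: "hbar n g = g"
    unfolding g_def by (simp add: hbar_diff hbar_smult hbar_mulTs[OF i c'K] c'(2)) (simp add: mulTsinv_def algebra_simps)
  have geig: "mulTs n i g = (\<lambda>y. qv * g y)"
    unfolding g_def by (simp add: hlin_diff[OF hlin_mulTs] hlin_smult[OF hlin_mulTs] mulTs_quadratic[OF i c'K])
      (simp add: qv_def algebra_simps fun_eq_iff)
  have gval: "g y = c' (sgen i \<circ> y) - (if len n (sgen i \<circ> y) < len n y then inverse vK else vK) * c' y" for y
    by (simp add: g_def mulTs_def algebra_simps)
  have gsupp: "y = w \<or> len n y < len n w" if "g y \<noteq> 0" for y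
  proof -
    have y: "y \<in> Sym n" using that gH by (auto simp: inH_def)
    from that gval[of y] have "c' (sgen i \<circ> y) \<noteq> 0 \<or> c' y \<noteq> 0" by auto
    then show ?thesis
    proof
      assume "c' (sgen i \<circ> y) \<noteq> 0"
      then consider "sgen i \<circ> y = u" | "len n (sgen i \<circ> y) < len n u" using c'(4) by blast
      then show ?thesis
      proof cases
        case 1 then show ?thesis using u(2) sgen_left_eq_iff by metis
      next
        case 2 then show ?thesis using len_left_cases[OF y i(1)] u(3) by linarith
      qed
    next
      assume "c' y \<noteq> 0"
      then have "len n y \<le> len n u" using c'(4) by fastforce
      then show ?thesis using u(3) by simp
    qed
  qed
  have gw: "g w = 1"
  proof -
    have "c' w = 0" using c'(4)[of w] u(3) by (cases "c' w = 0") auto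
    then show ?thesis using gval[of w] d c'(5) by (simp add: u_def)
  qed
  define Z where "Z = {z \<in> Sym n. len n z < len n w \<and> len n (sgen i \<circ> z) < len n z}"
  have finZ: "finite Z" by (simp add: Z_def)
  \<comment> \<open>Up to sign these integers are the classical coefficients mu(z, u).\<close>
  define a where "a = (\<lambda>z. Kpoly [:const0 (g z):])"
  have abar: "barK (a z) = a z" for z by (simp add: a_def)
  have gZ: "inO (g z)" if "z \<in> Z" for z
  proof -
    have z: "z \<in> Sym n" "len n z < len n w" "len n (sgen i \<circ> z) < len n z" using that by (auto simp: Z_def)
    have "z \<noteq> u" using z u by auto
    then obtain p where p: "int_poly p" "coeff p 0 = 0" "c' z = Kpoly p" using small by (auto simp: in_vZv_def)
    then obtain q where q: "p = pCons 0 q" by (metis coeff_pCons_0 pCons_cases)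
    \<comment> \<open>At a descent z the coefficient of g involves c'(z) / v, which has no pole
      because c'(z) lies in vZ[v].\<close>
    have "c' z = vK * Kpoly q"
      using Kpoly_simps(6)[of "[:0, 1:]" q] by (simp add: p q vK_Kpoly del: Kpoly_simps)
    then have "inverse vK * c' z = Kpoly q" by simp
    moreover have "sgen i \<circ> z \<noteq> u" using z u sgen_left_eq_iff by auto
    then have "inO (c' (sgen i \<circ> z))" using small by (simp add: in_vZv_iff)
    ultimately show ?thesis using gval[of z] z inO_add[of "c' (sgen i \<circ> z)" "- Kpoly q"] by (simp add: inO_uminus)
  qed
  have aA: "inA (a z)" "inO (a z)" "in_vZv (g z - a z)" if zZ: "z \<in> Z" for z
  proof -
    have "inA (g z)" using gH by (simp add: inH_def)
    then obtain p where p: "int_poly p" "g z = Kpoly p" using inA_inO_Kpoly gZ[OF zZ] by blast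
    then show A: "inA (a z)" "inO (a z)" by (auto simp: a_def int_poly_def intro!: inA_Kpoly split: nat.splits simp: coeff_pCons)
    show "in_vZv (g z - a z)"
      using A p inA_diff[OF \<open>inA (g z)\<close> A(1)] inO_add[of "g z" "- a z"] const0_add[of "g z" "- a z"]
      by (simp add: in_vZv_iff inO_uminus const0_uminus) (simp add: a_def)
  qed
  define c where "c = (\<lambda>y. g y - (\<Sum>z\<in>Z. a z * C z y))"
  have CZ: "KLspec n z (C z)" "KLtri n z (C z)" "mulTs n i (C z) = (\<lambda>y. qv * C z y)" if "z \<in> Z" for z
    using C[of z] that by (auto simp: Z_def)
  have cH: "inH n c" unfolding c_def
    using CZ aA by (intro inH_diff gH inH_sum) (auto simp: KLspec_def)
  have cbar: "hbar n c = c"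
    unfolding c_def using CZ(1) by (simp add: hbar_diff gbar hbar_sum abar KLspec_def cong: sum.cong)
  have ceig: "mulTs n i c = (\<lambda>y. qv * c y)"
    unfolding c_def by (simp add: hlin_diff[OF hlin_mulTs] hlin_sum[OF hlin_mulTs] geig CZ(3) algebra_simps sum_distrib_left cong: sum.cong)
  have Csupp: "C z y = 0" if "z \<in> Z" "\<not> len n y < len n w" for z y
  proof (rule ccontr)
    assume "C z y \<noteq> 0"
    then have "len n y \<le> len n z" using CZ(2)[OF that(1)] by (auto simp: KLtri_def)
    then show False using that by (auto simp: Z_def)
  qed
  have ctri: "KLtri n w c"
    unfolding KLtri_def
  proof (intro conjI allI impI)
    fix y assume "c y \<noteq> 0"
    then show "y = w \<or> len n y < len n w"
      using gsupp[of y] Csupp[of _ y] by (cases "len n y < len n w") (auto simp: c_def)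
  next
    show "c w = 1" using gw Csupp[of _ w] by (simp add: c_def)
  qed
  have small_c: "in_vZv (c y - hT w y)" for y
  proof -
    have "(\<Sum>z\<in>Z. a z * C z y) = (\<Sum>z\<in>Z. a z * (C z y - hT z y)) + (\<Sum>z\<in>Z. a z * hT z y)"
      by (simp add: algebra_simps flip: sum.distrib)
    also have "(\<Sum>z\<in>Z. a z * hT z y) = (if y \<in> Z then a y else 0)"
      using finZ by (simp add: hT_def if_distrib[of "\<lambda>c. _ * c"] sum.delta' cong: if_cong)
    finally have cy: "c y - hT w y = (g y - (if y \<in> Z then a y else 0) - hT w y) - (\<Sum>z\<in>Z. a z * (C z y - hT z y))"
      by (simp add: c_def)
    have "in_vZv (\<Sum>z\<in>Z. a z * (C z y - hT z y))"
      using CZ aA by (intro in_vZv_sum in_vZv_mult) (auto simp: KLspec_def)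
    moreover have "in_vZv (g y - (if y \<in> Z then a y else 0) - hT w y)"
    proof (cases "y = w")
      case True
      then show ?thesis using gw by (auto simp: hT_def Z_def)
    next
      case yw: False
      have h0: "hT w y = 0" using yw by (simp add: hT_def)
      show ?thesis
      proof (cases "y \<in> Z")
        case True
        then show ?thesis using aA(3)[OF True] h0 by simp
      next
        case False
        have "in_vZv (g y)"
        proof (cases "y \<in> Sym n")
          case y: True
          have su: "sgen i \<circ> y \<noteq> u"
            using yw u(2) sgen_left_eq_iff by metis
          show ?thesis
          proof (cases "len n (sgen i \<circ> y) < len n y")
            case True
            then have "\<not> len n y < len n w" using False y by (simp add: Z_def)
            then have "c' y = 0" using c'(4)[of y] u(3) by (cases "c' y = 0") auto
            then show ?thesis using gval[of y] small[OF su] by simp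
          next
            case False
            have "inA (c' y)" "inO (c' y)"
              using c'(1) small[of y] c'(5) by (auto simp: inH_def in_vZv_iff) (metis inO_simps(2))
            then have "in_vZv (c' y * vK)" by (intro in_vZv_mult) (simp_all add: in_vZv_iff)
            then show ?thesis using gval[of y] False small[OF su] by (simp add: in_vZv_diff mult.commute)
          qed
        next
          case False
          then show ?thesis using gH by (simp add: inH_def)
        qed
        then show ?thesis using False h0 by simp
      qed
    qed
    ultimately show ?thesis unfolding cy by (rule in_vZv_diff[rotated])
  qed
  then show ?thesis using cH cbar ctri ceig by (auto simp: KLspec_def)
qed

text \<open>The construction depends on a choice of left descent. By uniqueness every choice yields
  the same element, so the eigenvalue equations for all left descents hold at once.\<close>

lemma KL_exists:
  assumes "w \<in> Sym n"
  shows "\<exists>c. KLspec n w c \<and> KLtri n w c \<and> (\<forall>i\<in>{1..<n}. len n (sgen i \<circ> w) < len n w \<longrightarrow> mulTs n i c = (\<lambda>y. qv * c y))"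
  using assms
proof (induction "len n w" arbitrary: w rule: less_induct)
  case less
  show ?case
  proof (cases "w = id")
    case True
    have "KLspec n id (hT id) \<and> KLtri n id (hT id)"
      by (simp add: KLspec_def KLtri_def inH_hT hbar_hT barT_id) (simp add: hT_def)
    then show ?thesis unfolding True by auto
  next
    case False
    then have "inv w \<noteq> id" using less.prems by (metis Sym_inv_comp(3) inv_id)
    then obtain i where i: "i \<in> {1..<n}" "\<not> inv w i < inv w (Suc i)"
      using no_descent_imp_id[OF Sym_inv[OF less.prems]] by blast
    then have d: "len n (sgen i \<circ> w) < len n w"
      using left_descent_iff[OF less.prems i(1)] Sym_inj[OF Sym_inv[OF less.prems], of i "Suc i"] by auto
    have "\<forall>z. \<exists>c. z \<in> Sym n \<longrightarrow> len n z < len n w \<longrightarrow> KLspec n z c \<and> KLtri n z c \<and>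
        (\<forall>i\<in>{1..<n}. len n (sgen i \<circ> z) < len n z \<longrightarrow> mulTs n i c = (\<lambda>y. qv * c y))"
      using less.hyps by blast
    then obtain C where C: "\<And>z. z \<in> Sym n \<Longrightarrow> len n z < len n w \<Longrightarrow> KLspec n z (C z) \<and> KLtri n z (C z) \<and>
        (\<forall>i\<in>{1..<n}. len n (sgen i \<circ> z) < len n z \<longrightarrow> mulTs n i (C z) = (\<lambda>y. qv * C z y))"
      by metis
    have step: "\<exists>c. KLspec n w c \<and> KLtri n w c \<and> mulTs n i c = (\<lambda>y. qv * c y)"
      if "i \<in> {1..<n}" "len n (sgen i \<circ> w) < len n w" for i
      by (rule KL_step[OF less.prems that, of C]) (use C that in auto)
    obtain c where c: "KLspec n w c" "KLtri n w c" using step[OF i(1) d] by blast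
    have "mulTs n i c = (\<lambda>y. qv * c y)" if "i \<in> {1..<n}" "len n (sgen i \<circ> w) < len n w" for i
      using step[OF that] KLspec_unique[OF c(1)] by blast
    then show ?thesis using c by blast
  qed
qed

lemma
  assumes w: "w \<in> Sym n"
  shows KL_KLspec: "KLspec n w (KL n w)" and KL_KLtri: "KLtri n w (KL n w)"
    and KL_left_descent: "\<And>i. i \<in> {1..<n} \<Longrightarrow> len n (sgen i \<circ> w) < len n w \<Longrightarrow> mulTs n i (KL n w) = (\<lambda>y. qv * KL n w y)"
proof -
  obtain c where c: "KLspec n w c" "KLtri n w c" "\<forall>i\<in>{1..<n}. len n (sgen i \<circ> w) < len n w \<longrightarrow> mulTs n i c = (\<lambda>y. qv * c y)"
    using KL_exists[OF w] by blast
  have "KL n w = c"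
    unfolding KL_def
  proof (rule the_equality)
    show "inH n c \<and> hbar n c = c \<and> (\<forall>y. in_vZv (c y - hT w y))" using c by (simp add: KLspec_def)
    fix c' assume "inH n c' \<and> hbar n c' = c' \<and> (\<forall>y. in_vZv (c' y - hT w y))"
    then show "c' = c" using KLspec_unique[OF _ c(1)] by (simp add: KLspec_def)
  qed
  then show "KLspec n w (KL n w)" "KLtri n w (KL n w)"
    "\<And>i. i \<in> {1..<n} \<Longrightarrow> len n (sgen i \<circ> w) < len n w \<Longrightarrow> mulTs n i (KL n w) = (\<lambda>y. qv * KL n w y)"
    using c by auto
qed

lemma KL_inH: "w \<in> Sym n \<Longrightarrow> inH n (KL n w)" and KL_bar: "w \<in> Sym n \<Longrightarrow> hbar n (KL n w) = KL n w"
  and KL_small: "w \<in> Sym n \<Longrightarrow> in_vZv (KL n w y - hT w y)"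
  using KL_KLspec[of w n] by (auto simp: KLspec_def)

lemma KL_HK: "w \<in> Sym n \<Longrightarrow> KL n w \<in> HK n"
  using KL_inH inH_HK by blast

lemma KL_supp: "w \<in> Sym n \<Longrightarrow> KL n w y \<noteq> 0 \<Longrightarrow> y = w \<or> len n y < len n w" and KL_self: "w \<in> Sym n \<Longrightarrow> KL n w w = 1"
  using KL_KLtri[of w n] by (auto simp: KLtri_def)

lemma KL_hstar:
  assumes w: "w \<in> Sym n"
  shows "hstar n (KL n w) = KL n (inv w)"
proof (rule KLspec_unique[OF _ KL_KLspec[OF Sym_inv[OF w]]])
  have "in_vZv (hstar n (KL n w) y - hT (inv w) y)" for y
  proof (cases "y \<in> Sym n")
    case True
    then have "hT (inv w) y = hT w (inv y)" using w by (auto simp: hT_def)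
    then show ?thesis using True KL_small[OF w, of "inv y"] by (simp add: hstar_def)
  next
    case False
    then have "hT (inv w) y = 0" using Sym_inv[OF w] by (auto simp: hT_def)
    then show ?thesis using False by (simp add: hstar_def)
  qed
  then show "KLspec n (inv w) (hstar n (KL n w))"
    using w by (simp add: KLspec_def inH_hstar KL_inH hbar_hstar KL_bar)
qed

lemma KL_reig:
  assumes J: "J \<subseteq> {1..<n}" and w: "w \<in> Sym n" "\<And>k. k \<in> J \<Longrightarrow> w (Suc k) < w k"
  shows "reig n J (KL n w)"
proof -
  have "leig n J (KL n (inv w))"
    unfolding leig_def
  proof (intro conjI ballI KL_HK Sym_inv w(1))
    fix k assume k: "k \<in> J"
    then have "len n (sgen k \<circ> inv w) < len n (inv w)"
      using left_descent_iff[OF Sym_inv[OF w(1)], of k] w J by auto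
    then show "mulTs n k (KL n (inv w)) = (\<lambda>y. qv * KL n (inv w) y)"
      using KL_left_descent[OF Sym_inv[OF w(1)]] k J by auto
  qed
  from reig_hstar[OF J this] show ?thesis using w by (simp add: KL_hstar Sym_inv)
qed

text \<open>For x other than the identity, x w_J is longer than w_J and so outside the support of
  C_(w_J); in the expansion by the T_x E_J only x = 1 survives.\<close>

lemma KL_wJ:
  assumes J: "J \<subseteq> {1..<n}"
  shows "KL n (wJ n J) = (\<lambda>y. inverse (qv ^ len n (wJ n J)) * EJ n J y)"
proof -
  let ?w = "wJ n J" and ?h = "KL n (wJ n J)"
  have w: "?w \<in> Sym n" "?w \<in> WJ J" using wJ_Sym[OF J] wJ_WJ[OF J] by auto
  have r: "reig n J ?h" using KL_reig[OF J w(1)] wJ_descent[OF J] by blast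
  have val: "?h x = (if x = id then inverse (qv ^ len n ?w) else 0)" if x: "x \<in> XJ n J" for x
  proof (cases "x = id")
    case True
    then have "1 = qv ^ len n ?w * ?h id"
      using reig_apply[OF J r XJ_id[OF J] w(2)] KL_self[OF w(1)] by simp
    then show ?thesis using True by (simp add: field_simps)
  next
    case False
    then have "len n x \<noteq> 0" using len_eq_0[OF XJ_Sym[OF J x]] by auto
    then have "?h (x \<circ> ?w) = 0"
      using KL_supp[OF w(1), of "x \<circ> ?w"] len_XJ_WJ[OF J x w(2)] by (metis add_eq_self_zero add.commute not_add_less2)
    then show ?thesis using reig_apply[OF J r x w(2)] False by simp
  qed
  have "?h = (\<lambda>y. \<Sum>x\<in>XJ n J. ?h x * hmul n (hT x) (EJ n J) y)" by (rule reig_expand[OF J r])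
  also have "\<dots> = (\<lambda>y. \<Sum>x\<in>XJ n J. if x = id then inverse (qv ^ len n ?w) * hmul n (hT id) (EJ n J) y else 0)"
    by (intro ext sum.cong) (auto simp: val)
  also have "\<dots> = (\<lambda>y. inverse (qv ^ len n ?w) * EJ n J y)"
    using XJ_id[OF J] finite_XJ[OF J] by (simp add: sum.delta hmul_id_left EJ_HK[OF J])
  finally show ?thesis .
qed

lemma KL_independent:
  assumes "(\<lambda>y. \<Sum>w\<in>Sym n. a w * KL n w y) = (\<lambda>y. 0)" "w \<in> Sym n"
  shows "a w = 0"
proof (rule ccontr)
  assume "a w \<noteq> 0"
  let ?S = "{y \<in> Sym n. a y \<noteq> 0}"
  have "?S \<noteq> {}" using \<open>a w \<noteq> 0\<close> assms by auto
  then have "Max (len n ` ?S) \<in> len n ` ?S" by (intro Max_in) auto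
  then obtain y where y: "y \<in> ?S" "len n y = Max (len n ` ?S)" by auto
  have max: "len n w \<le> len n y" if "w \<in> ?S" for w unfolding y(2) using that by (intro Max_ge) auto
  have "0 = (\<Sum>w\<in>Sym n. a w * KL n w y)" using fun_cong[OF assms(1), of y] by simp
  also have "\<dots> = (\<Sum>w\<in>Sym n. if w = y then a y else 0)"
  proof (rule sum.cong)
    fix w assume w: "w \<in> Sym n"
    show "a w * KL n w y = (if w = y then a y else 0)"
    proof (cases "w = y \<or> a w = 0")
      case True
      then show ?thesis using KL_self[OF w] by auto
    next
      case False
      then have "\<not> len n y < len n w" using max[of w] w by auto
      then show ?thesis using KL_supp[OF w, of y] False by auto
    qed
  qed simp
  also have "\<dots> = a y" using y by (simp add: sum.delta)
  finally show False using y by simp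
qed

text \<open>By unitriangularity the layer of greatest length is subtracted repeatedly. No division
  occurs, so the coefficients stay in A.\<close>

lemma KL_expand_A:
  assumes "inH n h"
  obtains a where "\<And>w. inA (a w)" "h = (\<lambda>y. \<Sum>w\<in>Sym n. a w * KL n w y)"
proof -
  have "\<exists>a. (\<forall>w. inA (a w)) \<and> h = (\<lambda>y. \<Sum>w\<in>Sym n. a w * KL n w y)"
    if "inH n h" "\<And>y. h y \<noteq> 0 \<Longrightarrow> len n y < k" for h k
    using that
  proof (induction k arbitrary: h)
    case 0
    then have "h = (\<lambda>y. 0)" by auto
    then show ?case by (intro exI[of _ "\<lambda>_. 0"]) simp
  next
    case (Suc k)
    define S where "S = {w \<in> Sym n. len n w = k}"
    define g where "g = (\<lambda>y. h y - (\<Sum>w\<in>S. h w * KL n w y))"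
    have S: "S \<subseteq> Sym n" "finite S" by (auto simp: S_def)
    have hA: "inA (h w)" for w using Suc.prems by (simp add: inH_def)
    have "inH n g" unfolding g_def
      using Suc.prems hA S by (intro inH_diff inH_sum) (auto intro: KL_inH)
    moreover have "len n y < k" if "g y \<noteq> 0" for y
    proof (rule ccontr)
      assume nk: "\<not> len n y < k"
      have y: "y \<in> Sym n" using that \<open>inH n g\<close> by (auto simp: inH_def)
      have "(\<Sum>w\<in>S. h w * KL n w y) = (\<Sum>w\<in>S. if w = y then h y else 0)"
      proof (rule sum.cong)
        fix w assume w: "w \<in> S"
        then show "h w * KL n w y = (if w = y then h y else 0)"
          using KL_supp[of w n y] KL_self[of w n] nk by (auto simp: S_def)
      qed simp
      also have "\<dots> = (if y \<in> S then h y else 0)" using S by (simp add: sum.delta)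
      also have "\<dots> = h y" using Suc.prems(2)[of y] nk y by (cases "h y = 0") (auto simp: S_def)
      finally show False using that by (simp add: g_def)
    qed
    ultimately obtain a where a: "\<forall>w. inA (a w)" "g = (\<lambda>y. \<Sum>w\<in>Sym n. a w * KL n w y)" using Suc.IH by blast
    have "h y = (\<Sum>w\<in>Sym n. (a w + (if w \<in> S then h w else 0)) * KL n w y)" for y
    proof -
      have "h y = g y + (\<Sum>w\<in>S. h w * KL n w y)" by (simp add: g_def)
      also have "(\<Sum>w\<in>S. h w * KL n w y) = (\<Sum>w\<in>Sym n. (if w \<in> S then h w else 0) * KL n w y)"
        using S by (intro sum.mono_neutral_cong_left) auto
      finally show ?thesis by (simp add: a(2) algebra_simps sum.distrib)
    qed
    then show ?case using a(1) hA by (intro exI[of _ "\<lambda>w. a w + (if w \<in> S then h w else 0)"]) (auto intro: inA_add)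
  qed
  from this[OF assms, of "Suc (Max (len n ` Sym n))"] show thesis
  proof -
    have "len n y < Suc (Max (len n ` Sym n))" if "h y \<noteq> 0" for y
    proof -
      have "y \<in> Sym n" using that assms by (auto simp: inH_def)
      then show ?thesis by (simp add: less_Suc_eq_le)
    qed
    then show thesis using that \<open>(\<And>y. h y \<noteq> 0 \<Longrightarrow> _) \<Longrightarrow> _\<close> by blast
  qed
qed

lemma KL_coeff_bar:
  assumes "h = (\<lambda>y. \<Sum>w\<in>Sym n. a w * KL n w y)" "hbar n h = h" "w \<in> Sym n"
  shows "barK (a w) = a w"
proof -
  have "hbar n h = (\<lambda>y. \<Sum>w\<in>Sym n. barK (a w) * KL n w y)"
    unfolding assms(1) by (simp add: hbar_sum KL_bar cong: sum.cong)
  then have "(\<lambda>y. \<Sum>w\<in>Sym n. barK (a w) * KL n w y) = (\<lambda>y. \<Sum>w\<in>Sym n. a w * KL n w y)"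
    using assms(1,2) by simp
  then have "(\<lambda>y. \<Sum>w\<in>Sym n. (barK (a w) - a w) * KL n w y) = (\<lambda>y. 0)"
    by (intro ext) (simp add: left_diff_distrib sum_subtractf, metis)
  from KL_independent[OF this assms(3)] show ?thesis by simp
qed

text \<open>Reading h at the longest coset elements x w_J instead of at x absorbs the power of
  \<open>qv\<close> between C_(w_J) and E_J. The coefficients are values of h itself, so they are in
  A for integral h.\<close>

lemma reig_expand_KL:
  assumes J: "J \<subseteq> {1..<n}" and h: "reig n J h"
  shows "h = (\<lambda>y. \<Sum>x\<in>XJ n J. h (x \<circ> wJ n J) * hmul n (hT x) (KL n (wJ n J)) y)"
proof -
  have "h (x \<circ> wJ n J) * hmul n (hT x) (KL n (wJ n J)) y = h x * hmul n (hT x) (EJ n J) y" if "x \<in> XJ n J" for x y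
    using reig_apply[OF J h that wJ_WJ[OF J]] by (simp add: KL_wJ[OF J] hmul_smult_right)
  then show ?thesis using reig_expand[OF J h] by (simp cong: sum.cong)
qed

section \<open>Matrix representations\<close>

definition MM :: "nat \<Rightarrow> (nat \<Rightarrow> nat \<Rightarrow> K) \<Rightarrow> (nat \<Rightarrow> nat \<Rightarrow> K) \<Rightarrow> nat \<Rightarrow> nat \<Rightarrow> K" where
  "MM d A B = (\<lambda>i j. \<Sum>k=1..d. A i k * B k j)"

definition mtr :: "nat \<Rightarrow> (nat \<Rightarrow> nat \<Rightarrow> K) \<Rightarrow> K" where
  "mtr d A = (\<Sum>i=1..d. A i i)"

lemma MM_assoc: "MM e (MM d A B) C = MM d A (MM e B C)"
proof (intro ext)
  fix i j
  have "MM e (MM d A B) C i j = (\<Sum>k=1..e. \<Sum>l=1..d. A i l * B l k * C k j)"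
    by (simp add: MM_def sum_distrib_right)
  also have "\<dots> = (\<Sum>l=1..d. \<Sum>k=1..e. A i l * B l k * C k j)" by (rule sum.swap)
  also have "\<dots> = MM d A (MM e B C) i j" by (simp add: MM_def sum_distrib_left mult.assoc)
  finally show "MM e (MM d A B) C i j = MM d A (MM e B C) i j" .
qed

lemma mtr_MM: "mtr d (MM e A B) = mtr e (MM d B A)"
proof -
  have "mtr d (MM e A B) = (\<Sum>i=1..d. \<Sum>k=1..e. A i k * B k i)" by (simp add: mtr_def MM_def)
  also have "\<dots> = (\<Sum>k=1..e. \<Sum>i=1..d. A i k * B k i)" by (rule sum.swap)
  finally show ?thesis by (simp add: mtr_def MM_def mult.commute)
qed

lemma MM_cong: "(\<And>k. k \<in> {1..d} \<Longrightarrow> A i k = A' i k) \<Longrightarrow> (\<And>k. k \<in> {1..d} \<Longrightarrow> B k j = B' k j) \<Longrightarrow> MM d A B i j = MM d A' B' i j"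
  by (simp add: MM_def)

text \<open>Extended by zero outside the index range, so that equality of matrices, and in
  particular vanishing, is equality of functions.\<close>

definition hrep :: "nat \<Rightarrow> nat \<Rightarrow> matrep \<Rightarrow> hecke \<Rightarrow> nat \<Rightarrow> nat \<Rightarrow> K" where
  "hrep n d Y h = (\<lambda>i j. if i \<in> {1..d} \<and> j \<in> {1..d} then \<Sum>w\<in>Sym n. h w * Y w i j else 0)"

lemma hrep_hT: "w \<in> Sym n \<Longrightarrow> i \<in> {1..d} \<Longrightarrow> j \<in> {1..d} \<Longrightarrow> hrep n d Y (hT w) i j = Y w i j"
  by (simp add: hrep_def hT_def if_distrib[of "\<lambda>c. c * _"] sum.delta cong: if_cong)

lemma hrep_outside: "i \<notin> {1..d} \<or> j \<notin> {1..d} \<Longrightarrow> hrep n d Y h i j = 0"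
  by (auto simp: hrep_def)

lemma hrep_add: "hrep n d Y (\<lambda>y. h y + g y) i j = hrep n d Y h i j + hrep n d Y g i j"
  and hrep_diff: "hrep n d Y (\<lambda>y. h y - g y) i j = hrep n d Y h i j - hrep n d Y g i j"
  and hrep_smult: "hrep n d Y (\<lambda>y. c * h y) i j = c * hrep n d Y h i j"
  by (simp_all add: hrep_def algebra_simps sum.distrib sum_subtractf sum_distrib_left)

lemma hrep_sum: "hrep n d Y (\<lambda>y. \<Sum>s\<in>S. c s * F s y) i j = (\<Sum>s\<in>S. c s * hrep n d Y (F s) i j)"
proof (induction S rule: infinite_finite_induct)
  case (insert x S)
  then show ?case
    using hrep_add[of n d Y "\<lambda>y. c x * F x y" "\<lambda>y. \<Sum>s\<in>S. c s * F s y"] by (simp add: hrep_smult)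
qed (simp_all add: hrep_def)

lemma hrep_expand: "h \<in> HK n \<Longrightarrow> hrep n d Y h i j = (\<Sum>w\<in>Sym n. h w * hrep n d Y (hT w) i j)"
  using hrep_sum[of n d Y h hT "Sym n" i j] HK_expand[of h n] by simp

lemma hrep_hmul_hT:
  assumes "is_matrep n d Y" "x \<in> Sym n" "y \<in> Sym n"
  shows "hrep n d Y (hmul n (hT x) (hT y)) = MM d (hrep n d Y (hT x)) (hrep n d Y (hT y))"
proof (intro ext)
  fix i j
  show "hrep n d Y (hmul n (hT x) (hT y)) i j = MM d (hrep n d Y (hT x)) (hrep n d Y (hT y)) i j"
  proof (cases "i \<in> {1..d} \<and> j \<in> {1..d}")
    case True
    then have "hrep n d Y (hmul n (hT x) (hT y)) i j = (\<Sum>k=1..d. Y x i k * Y y k j)"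
      using assms by (simp add: hrep_def is_matrep_def)
    also have "\<dots> = MM d (hrep n d Y (hT x)) (hrep n d Y (hT y)) i j"
      unfolding MM_def using True assms by (intro sum.cong) (simp_all add: hrep_hT)
    finally show ?thesis .
  next
    case False
    then show ?thesis by (auto simp: hrep_outside MM_def)
  qed
qed

lemma hrep_hmul:
  assumes Y: "is_matrep n d Y" and h: "h \<in> HK n" "g \<in> HK n"
  shows "hrep n d Y (hmul n h g) = MM d (hrep n d Y h) (hrep n d Y g)"
proof (intro ext)
  fix i j
  let ?r = "hrep n d Y"
  have "hmul n h g = (\<lambda>z. \<Sum>x\<in>Sym n. h x * hmul n (hT x) g z)"
    by (subst HK_expand[OF h(1)]) (rule hmul_sum_left)
  also have "\<dots> = (\<lambda>z. \<Sum>x\<in>Sym n. h x * (\<Sum>y\<in>Sym n. g y * hmul n (hT x) (hT y) z))"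
    by (subst HK_expand[OF h(2)]) (simp only: hmul_sum_right)
  finally have "?r (hmul n h g) i j = (\<Sum>x\<in>Sym n. h x * (\<Sum>y\<in>Sym n. g y * ?r (hmul n (hT x) (hT y)) i j))"
    by (simp only: hrep_sum)
  also have "\<dots> = (\<Sum>x\<in>Sym n. h x * (\<Sum>y\<in>Sym n. g y * (\<Sum>k=1..d. ?r (hT x) i k * ?r (hT y) k j)))"
    using hrep_hmul_hT[OF Y] by (simp add: MM_def cong: sum.cong)
  also have "\<dots> = (\<Sum>x\<in>Sym n. \<Sum>y\<in>Sym n. \<Sum>k=1..d. (h x * ?r (hT x) i k) * (g y * ?r (hT y) k j))"
    by (simp add: sum_distrib_left mult_ac)
  also have "\<dots> = (\<Sum>x\<in>Sym n. \<Sum>k=1..d. \<Sum>y\<in>Sym n. (h x * ?r (hT x) i k) * (g y * ?r (hT y) k j))"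
    by (intro sum.cong refl sum.swap)
  also have "\<dots> = (\<Sum>k=1..d. \<Sum>x\<in>Sym n. \<Sum>y\<in>Sym n. (h x * ?r (hT x) i k) * (g y * ?r (hT y) k j))"
    by (rule sum.swap)
  also have "\<dots> = (\<Sum>k=1..d. (\<Sum>x\<in>Sym n. h x * ?r (hT x) i k) * (\<Sum>y\<in>Sym n. g y * ?r (hT y) k j))"
    by (simp add: sum_product)
  also have "\<dots> = MM d (?r h) (?r g) i j"
    by (simp add: MM_def hrep_expand[OF h(1)] hrep_expand[OF h(2)])
  finally show "?r (hmul n h g) i j = MM d (?r h) (?r g) i j" .
qed

lemma hrep_id:
  assumes "is_matrep n d Y" "i \<in> {1..d}" "j \<in> {1..d}"
  shows "hrep n d Y (hT id) i j = (if i = j then 1 else 0)"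
  using assms by (simp add: hrep_hT is_matrep_def)

subsection \<open>Schur's lemma\<close>

definition invariant_subspace :: "nat \<Rightarrow> nat \<Rightarrow> matrep \<Rightarrow> (nat \<Rightarrow> K) set \<Rightarrow> bool" where
  "invariant_subspace n d Y U \<longleftrightarrow> U \<subseteq> vecs d \<and> (\<lambda>_. 0) \<in> U \<and> (\<forall>u\<in>U. \<forall>u'\<in>U. (\<lambda>k. u k + u' k) \<in> U)
        \<and> (\<forall>a. \<forall>u\<in>U. (\<lambda>k. a * u k) \<in> U) \<and> (\<forall>w\<in>Sym n. \<forall>u\<in>U. matvec d (Y w) u \<in> U)"

lemma irreducible_repD:
  assumes "irreducible_rep n d Y" "invariant_subspace n d Y U"
  shows "U = {\<lambda>_. 0} \<or> U = vecs d"
  by (rule mp[OF assms(1)[unfolded irreducible_rep_def, THEN conjunct2, THEN conjunct2, THEN spec, of U]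
        assms(2)[unfolded invariant_subspace_def]])

lemma matvec_vecs: "matvec d M u \<in> vecs d"
  by (simp add: matvec_def vecs_def)

definition unitvec :: "nat \<Rightarrow> nat \<Rightarrow> K" where "unitvec j = (\<lambda>k. if k = j then 1 else 0)"

lemma unitvec_vecs: "j \<in> {1..d} \<Longrightarrow> unitvec j \<in> vecs d"
  by (auto simp: unitvec_def vecs_def)

lemma sum_unitvec: "j \<in> {1..d} \<Longrightarrow> (\<Sum>k=1..d. f k * unitvec j k) = f j"
  by (simp add: unitvec_def if_distrib[of "\<lambda>c. _ * c"] sum.delta cong: if_cong)

text \<open>Schur's lemma without dimension theory: kernel and image are invariant, so one is zero
  and the other is everything. Preimages of the unit vectors form an inverse matrix N, and cyclicity
  of the trace compares the characters, by which the setup tells the representations apart.\<close>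

lemma intertwiner_imp_equal_characters:
  assumes irr: "irreducible_rep n d Y" "irreducible_rep n e Z"
    and M: "\<And>w i j. w \<in> Sym n \<Longrightarrow> i \<in> {1..d} \<Longrightarrow> j \<in> {1..e} \<Longrightarrow> MM d (Y w) M i j = MM e M (Z w) i j"
    and nz: "i0 \<in> {1..d}" "j0 \<in> {1..e}" "M i0 j0 \<noteq> 0" and w: "w \<in> Sym n"
  shows "character d Y w = character e Z w"
proof -
  define app where "app = (\<lambda>u i. if i \<in> {1..d} then \<Sum>k=1..e. M i k * u k else 0)"
  have app_add: "app (\<lambda>k. u k + u' k) = (\<lambda>k. app u k + app u' k)"
    and app_smult: "app (\<lambda>k. a * u k) = (\<lambda>k. a * app u k)" for u u' a
    by (auto simp: app_def algebra_simps sum.distrib sum_distrib_left)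
  have app_inter: "app (matvec e (Z w) u) = matvec d (Y w) (app u)" if "w \<in> Sym n" for w u
  proof
    fix i
    show "app (matvec e (Z w) u) i = matvec d (Y w) (app u) i"
    proof (cases "i \<in> {1..d}")
      case i: True
      have "app (matvec e (Z w) u) i = (\<Sum>k=1..e. \<Sum>l=1..e. M i k * Z w k l * u l)"
        using i by (simp add: app_def matvec_def sum_distrib_left mult.assoc)
      also have "\<dots> = (\<Sum>l=1..e. MM e M (Z w) i l * u l)"
        by (subst sum.swap) (simp add: MM_def sum_distrib_right)
      also have "\<dots> = (\<Sum>l=1..e. MM d (Y w) M i l * u l)"
        using M[OF that i] by simp
      also have "\<dots> = (\<Sum>l=1..e. \<Sum>k=1..d. Y w i k * M k l * u l)"
        by (simp add: MM_def sum_distrib_right)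
      also have "\<dots> = (\<Sum>k=1..d. \<Sum>l=1..e. Y w i k * M k l * u l)" by (rule sum.swap)
      also have "\<dots> = matvec d (Y w) (app u) i"
        using i by (simp add: app_def matvec_def sum_distrib_left mult.assoc)
      finally show ?thesis .
    qed (auto simp: app_def matvec_def)
  qed
  define U where "U = {u \<in> vecs e. app u = (\<lambda>_. 0)}"
  have "invariant_subspace n e Z U"
    unfolding invariant_subspace_def
  proof (intro conjI ballI allI)
    show "(\<lambda>_. 0) \<in> U" by (auto simp: U_def vecs_def app_def)
    show "(\<lambda>k. u k + u' k) \<in> U" if "u \<in> U" "u' \<in> U" for u u'
      using that by (auto simp: U_def vecs_def app_add)
    show "(\<lambda>k. a * u k) \<in> U" if "u \<in> U" for a u
      using that by (auto simp: U_def vecs_def app_smult)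
    show "matvec e (Z w) u \<in> U" if "w \<in> Sym n" "u \<in> U" for w u
      using that by (auto simp: U_def matvec_vecs app_inter) (auto simp: matvec_def)
  qed (auto simp: U_def)
  moreover have "app (unitvec j0) i0 \<noteq> 0"
    using nz sum_unitvec[OF nz(2), of "M i0"] by (simp add: app_def)
  then have "unitvec j0 \<notin> U" by (auto simp: U_def)
  ultimately have U: "U = {\<lambda>_. 0}" using irreducible_repD[OF irr(2)] unitvec_vecs[OF nz(2)] by blast
  define V where "V = app ` vecs e"
  have "invariant_subspace n d Y V"
    unfolding invariant_subspace_def
  proof (intro conjI ballI allI)
    show "V \<subseteq> vecs d" by (auto simp: V_def app_def vecs_def)
    show "(\<lambda>_. 0) \<in> V" unfolding V_def by (rule image_eqI[of _ _ "\<lambda>_. 0"]) (auto simp: app_def vecs_def)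
    show "(\<lambda>k. u k + u' k) \<in> V" if uV: "u \<in> V" "u' \<in> V" for u u'
    proof -
      obtain z z' where "z \<in> vecs e" "u = app z" "z' \<in> vecs e" "u' = app z'" using uV unfolding V_def by blast
      then show ?thesis unfolding V_def by (intro image_eqI[of _ _ "\<lambda>k. z k + z' k"]) (auto simp: app_add vecs_def)
    qed
    show "(\<lambda>k. a * u k) \<in> V" if uV: "u \<in> V" for a u
    proof -
      obtain z where "z \<in> vecs e" "u = app z" using uV unfolding V_def by blast
      then show ?thesis unfolding V_def by (intro image_eqI[of _ _ "\<lambda>k. a * z k"]) (auto simp: app_smult vecs_def)
    qed
    show "matvec d (Y w) u \<in> V" if uV: "w \<in> Sym n" "u \<in> V" for w u
    proof -
      obtain z where "z \<in> vecs e" "u = app z" using uV unfolding V_def by blast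
      then show ?thesis unfolding V_def using uV
        by (intro image_eqI[of _ _ "matvec e (Z w) z"]) (auto simp: app_inter matvec_vecs)
    qed
  qed
  moreover have "app (unitvec j0) \<in> V" "app (unitvec j0) i0 \<noteq> 0"
    using nz unitvec_vecs[OF nz(2)] sum_unitvec[OF nz(2), of "M i0"] by (auto simp: V_def app_def)
  then have "V \<noteq> {\<lambda>_. 0}" by auto
  ultimately have V: "V = vecs d" using irreducible_repD[OF irr(1)] by blast
  have "\<forall>j\<in>{1..d}. \<exists>z\<in>vecs e. app z = unitvec j"
  proof
    fix j assume "j \<in> {1..d}"
    then have "unitvec j \<in> app ` vecs e" using V unitvec_vecs by (simp add: V_def)
    then show "\<exists>z\<in>vecs e. app z = unitvec j" by (metis imageE)
  qed
  then obtain z where z: "\<And>j. j \<in> {1..d} \<Longrightarrow> z j \<in> vecs e \<and> app (z j) = unitvec j" by metis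
  define N where "N = (\<lambda>k j. z j k)"
  have MN: "MM e M N i j = (if i = j then 1 else 0)" if "i \<in> {1..d}" "j \<in> {1..d}" for i j
  proof -
    have "MM e M N i j = app (z j) i" using that by (simp add: app_def MM_def N_def)
    then show ?thesis using z[OF that(2)] by (simp add: unitvec_def)
  qed
  \<comment> \<open>N is a right inverse by construction. It is a left inverse too, because M
    annihilates the columns of N M - 1 and has no kernel.\<close>
  have NM: "MM d N M k j = (if k = j then 1 else 0)" if k: "k \<in> {1..e}" and j: "j \<in> {1..e}" for k j
  proof -
    define u where "u = (\<lambda>k. if k \<in> {1..e} then MM d N M k j - (if k = j then 1 else 0) else 0)"
    have "app u = (\<lambda>_. 0)"
    proof
      fix i
      show "app u i = 0"
      proof (cases "i \<in> {1..d}")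
        case i: True
        have "app u i = (\<Sum>k=1..e. M i k * (MM d N M k j - (if k = j then 1 else 0)))"
          using i by (simp add: app_def u_def)
        also have "\<dots> = MM e M (MM d N M) i j - (\<Sum>k=1..e. if k = j then M i k else 0)"
          by (simp add: MM_def algebra_simps sum_subtractf if_distrib[of "\<lambda>c. _ * c"] cong: if_cong)
        also have "MM e M (MM d N M) i j = MM d (MM e M N) M i j" by (simp add: MM_assoc)
        also have "\<dots> = (\<Sum>k=1..d. if k = i then M k j else 0)"
          unfolding MM_def[of d] using i by (intro sum.cong) (auto simp: MN)
        also have "\<dots> = M i j" using i by (simp add: sum.delta)
        also have "(\<Sum>k=1..e. if k = j then M i k else 0) = M i j" using j by (simp add: sum.delta)
        finally show ?thesis by simp
      qed (auto simp: app_def)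
    qed
    then have "u \<in> U" by (auto simp: U_def u_def vecs_def)
    then have "u k = 0" using U by auto
    then show ?thesis using k by (simp add: u_def)
  qed
  have "character d Y w = mtr d (MM d (Y w) (MM e M N))"
  proof -
    have "MM d (Y w) (MM e M N) i i = Y w i i" if i: "i \<in> {1..d}" for i
    proof -
      have "MM d (Y w) (MM e M N) i i = (\<Sum>k=1..d. if k = i then Y w i k else 0)"
        unfolding MM_def[of d] using i by (intro sum.cong) (auto simp: MN)
      then show ?thesis using i by (simp add: sum.delta)
    qed
    then show ?thesis by (simp add: character_def mtr_def)
  qed
  also have "\<dots> = mtr d (MM e (MM d (Y w) M) N)" by (simp add: MM_assoc)
  also have "\<dots> = mtr d (MM e (MM e M (Z w)) N)"
    unfolding mtr_def using M[OF w] by (intro sum.cong MM_cong) auto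
  also have "\<dots> = mtr d (MM e M (MM e (Z w) N))" by (simp add: MM_assoc)
  also have "\<dots> = mtr e (MM d (MM e (Z w) N) M)" by (rule mtr_MM)
  also have "\<dots> = mtr e (MM e (Z w) (MM d N M))" by (simp add: MM_assoc)
  also have "\<dots> = character e Z w"
  proof -
    have "MM e (Z w) (MM d N M) i i = Z w i i" if i: "i \<in> {1..e}" for i
    proof -
      have "MM e (Z w) (MM d N M) i i = (\<Sum>k=1..e. if k = i then Z w i k else 0)"
        unfolding MM_def[of e] using i by (intro sum.cong) (auto simp: NM)
      then show ?thesis using i by (simp add: sum.delta)
    qed
    then show ?thesis by (simp add: character_def mtr_def)
  qed
  finally show ?thesis .
qed

text \<open>The Casimir tensor \<open>\<Sum>\<^sub>w T_w \<otimes> T_(w^-1)\<close> of the symmetrising trace is invariant.\<close>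

lemma casimir_intertwiner:
  assumes Y: "is_matrep n d Y" and Z: "is_matrep n e Z" and x: "x \<in> Sym n"
    and ij: "i \<in> {1..d}" "j \<in> {1..d}" "k \<in> {1..e}" "l \<in> {1..e}"
  shows "(\<Sum>m=1..d. Y x i m * (\<Sum>w\<in>Sym n. Y w m j * Z (inv w) k l)) =
         (\<Sum>m=1..e. (\<Sum>w\<in>Sym n. Y w i j * Z (inv w) k m) * Z x m l)"
proof -
  let ?r = "hrep n d Y" and ?s = "hrep n e Z"
  \<comment> \<open>The coefficient of T_y in T_x T_w is the trace of T_(y^-1) T_x T_w; by cyclicity
    it is also the coefficient of T_(w^-1) in T_(y^-1) T_x.\<close>
  have tr: "hmul n (hT x) (hT w) y = hmul n (hT (inv y)) (hT x) (inv w)" if "w \<in> Sym n" "y \<in> Sym n" for w y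
  proof -
    have "hmul n (hT x) (hT w) y = hmul n (hT (inv y)) (hmul n (hT x) (hT w)) id"
      using that by (simp add: coeff_trace)
    also have "\<dots> = hmul n (hmul n (hT (inv y)) (hT x)) (hT w) id"
      using that x by (simp add: hmul_assoc hT_HK Sym_inv)
    also have "\<dots> = hmul n (hT (inv (inv w))) (hmul n (hT (inv y)) (hT x)) id"
      using that by (simp add: trace_commute)
    also have "\<dots> = hmul n (hT (inv y)) (hT x) (inv w)"
      by (rule coeff_trace[OF Sym_inv[OF that(1)]])
    finally show ?thesis .
  qed
  have "(\<Sum>m=1..d. Y x i m * (\<Sum>w\<in>Sym n. Y w m j * Z (inv w) k l)) = (\<Sum>m=1..d. \<Sum>w\<in>Sym n. Y x i m * Y w m j * Z (inv w) k l)"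
    by (simp add: sum_distrib_left mult.assoc)
  also have "\<dots> = (\<Sum>w\<in>Sym n. \<Sum>m=1..d. Y x i m * Y w m j * Z (inv w) k l)" by (rule sum.swap)
  also have "\<dots> = (\<Sum>w\<in>Sym n. (\<Sum>y\<in>Sym n. hmul n (hT x) (hT w) y * Y y i j) * Z (inv w) k l)"
    using Y x ij by (intro sum.cong) (simp_all add: is_matrep_def sum_distrib_right)
  also have "\<dots> = (\<Sum>w\<in>Sym n. \<Sum>y\<in>Sym n. Y y i j * (hmul n (hT (inv y)) (hT x) (inv w) * Z (inv w) k l))"
  proof (rule sum.cong[OF refl])
    fix w assume w: "w \<in> Sym n"
    have "(\<Sum>y\<in>Sym n. hmul n (hT x) (hT w) y * Y y i j) * Z (inv w) k l
        = (\<Sum>y\<in>Sym n. hmul n (hT x) (hT w) y * Y y i j * Z (inv w) k l)" by (rule sum_distrib_right)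
    also have "\<dots> = (\<Sum>y\<in>Sym n. Y y i j * (hmul n (hT (inv y)) (hT x) (inv w) * Z (inv w) k l))"
      using tr[OF w] by (intro sum.cong refl) (simp add: mult_ac)
    finally show "(\<Sum>y\<in>Sym n. hmul n (hT x) (hT w) y * Y y i j) * Z (inv w) k l
        = (\<Sum>y\<in>Sym n. Y y i j * (hmul n (hT (inv y)) (hT x) (inv w) * Z (inv w) k l))" .
  qed
  also have "\<dots> = (\<Sum>y\<in>Sym n. \<Sum>w\<in>Sym n. Y y i j * (hmul n (hT (inv y)) (hT x) (inv w) * Z (inv w) k l))" by (rule sum.swap)
  also have "\<dots> = (\<Sum>y\<in>Sym n. Y y i j * (\<Sum>w\<in>Sym n. hmul n (hT (inv y)) (hT x) (inv w) * Z (inv w) k l))"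
    by (simp add: sum_distrib_left)
  also have "\<dots> = (\<Sum>y\<in>Sym n. Y y i j * (\<Sum>w\<in>Sym n. hmul n (hT (inv y)) (hT x) w * Z w k l))"
    by (subst (2) sum.reindex_bij_betw[OF Sym_inv_bij, symmetric]) simp
  also have "\<dots> = (\<Sum>y\<in>Sym n. Y y i j * (\<Sum>m=1..e. Z (inv y) k m * Z x m l))"
    using Z x ij by (intro sum.cong) (simp_all add: is_matrep_def Sym_inv)
  also have "\<dots> = (\<Sum>y\<in>Sym n. \<Sum>m=1..e. Y y i j * Z (inv y) k m * Z x m l)"
    by (simp add: sum_distrib_left mult.assoc)
  also have "\<dots> = (\<Sum>m=1..e. \<Sum>y\<in>Sym n. Y y i j * Z (inv y) k m * Z x m l)" by (rule sum.swap)
  finally show ?thesis by (simp add: sum_distrib_right)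
qed

section \<open>The representations of the Hecke algebra\<close>

lemma finite_partitions: "finite (partitions n)"
proof (rule finite_subset)
  show "partitions n \<subseteq> {xs. set xs \<subseteq> {..n} \<and> length xs \<le> n}"
  proof
    fix la assume la: "la \<in> partitions n"
    have "x \<le> sum_list la" if "x \<in> set la" for x :: nat using that by (simp add: member_le_sum_list)
    moreover have "0 \<notin> set xs \<Longrightarrow> length xs \<le> sum_list xs" for xs :: "nat list"
      by (induction xs) auto
    ultimately show "la \<in> {xs. set xs \<subseteq> {..n} \<and> length xs \<le> n}" using la by (auto simp: partitions_def)
  qed
  show "finite {xs. set xs \<subseteq> {..n} \<and> length xs \<le> n}" by (rule finite_lists_length_le) simp
qed

text \<open>The right side is the trace of h |-> T_w h E on the whole algebra. The image lies in the
  left ideal generated by E, which affords the induced sign character, and right multiplication by E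
  acts on it as the scalar \<open>pJ\<close>.\<close>

lemma induced_sign_trace:
  fixes la :: "nat list"
  assumes w: "w \<in> Sym n"
  defines "J \<equiv> youngJ n la"
  shows "pJ n J * ind_sign n la w = (\<Sum>y\<in>Sym n. hmul n (hT w) (hmul n (hT y) (EJ n J)) y)"
proof -
  have J: "J \<subseteq> {1..<n}" unfolding J_def by (rule youngJ_subset)
  let ?E = "EJ n J"
  have q: "sgnK n u * inverse (vK ^ len n u) = qv ^ len n u" for u
    using power_mult_distrib[of "-1" "inverse vK" "len n u"] by (simp add: sgnK_def qv_def power_inverse)
  have TE: "hmul n (hT (x \<circ> u)) ?E = (\<lambda>y. qv ^ len n u * hmul n (hT x) ?E y)" if "x \<in> XJ n J" "u \<in> WJ J" for x u
  proof -
    have "hT (x \<circ> u) = hmul n (hT x) (hT u)"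
      using hmul_hT_hT[OF XJ_Sym[OF J that(1)] WJ_Sym[OF J that(2)] len_XJ_WJ[OF J that]] by simp
    then have "hmul n (hT (x \<circ> u)) ?E = hmul n (hT x) (hmul n (hT u) ?E)"
      using XJ_Sym[OF J that(1)] WJ_Sym[OF J that(2)] by (simp add: hmul_assoc hT_HK EJ_HK[OF J])
    then show ?thesis using leig_WJ[OF J leig_EJ[OF J] that(2)] by (simp add: hmul_smult_right)
  qed
  have gE: "hmul n g ?E x = (\<Sum>u\<in>WJ J. g (x \<circ> u) * qv ^ len n u)" if g: "g \<in> HK n" and x: "x \<in> XJ n J" for g x
  proof -
    have "hmul n g ?E x = (\<Sum>y\<in>Sym n. g y * hmul n (hT y) ?E x)"
      by (subst HK_expand[OF g]) (simp only: hmul_sum_left)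
    also have "\<dots> = (\<Sum>x'\<in>XJ n J. \<Sum>u\<in>WJ J. g (x' \<circ> u) * hmul n (hT (x' \<circ> u)) ?E x)"
      by (rule sum_Sym_XJ_WJ[OF J])
    also have "\<dots> = (\<Sum>x'\<in>XJ n J. if x' = x then \<Sum>u\<in>WJ J. g (x' \<circ> u) * qv ^ len n u else 0)"
      using hmul_hT_EJ_apply[OF J _ x WJ_id] by (intro sum.cong refl) (auto simp: TE)
    also have "\<dots> = (\<Sum>u\<in>WJ J. g (x \<circ> u) * qv ^ len n u)"
      using x finite_XJ[OF J] by (simp add: sum.delta)
    finally show ?thesis .
  qed
  have "(\<Sum>y\<in>Sym n. hmul n (hT w) (hmul n (hT y) ?E) y) =
      (\<Sum>x\<in>XJ n J. \<Sum>u\<in>WJ J. hmul n (hT w) (hmul n (hT (x \<circ> u)) ?E) (x \<circ> u))"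
    by (rule sum_Sym_XJ_WJ[OF J])
  also have "\<dots> = (\<Sum>x\<in>XJ n J. \<Sum>u\<in>WJ J. qv ^ (2 * len n u) * hmul n (hT w) (hmul n (hT x) ?E) x)"
  proof (intro sum.cong refl)
    fix x u assume xu: "x \<in> XJ n J" "u \<in> WJ J"
    have "reig n J (hmul n (hT w) (hmul n (hT x) ?E))" by (intro reig_hmul J reig_EJ)
    then show "hmul n (hT w) (hmul n (hT (x \<circ> u)) ?E) (x \<circ> u) = qv ^ (2 * len n u) * hmul n (hT w) (hmul n (hT x) ?E) x"
      using reig_apply[OF J _ xu] by (simp add: TE[OF xu] hmul_smult_right mult_2 power_add)
  qed
  also have "\<dots> = (\<Sum>x\<in>XJ n J. pJ n J * hmul n (hT w) (hmul n (hT x) ?E) x)"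
    by (simp add: pJ_def sum_distrib_right)
  also have "\<dots> = (\<Sum>x\<in>XJ n J. pJ n J * (\<Sum>u\<in>WJ J. mulT n w (hT x) (x \<circ> u) * qv ^ len n u))"
  proof (intro sum.cong refl)
    fix x assume x: "x \<in> XJ n J"
    have "hmul n (hT w) (hmul n (hT x) ?E) = hmul n (hmul n (hT w) (hT x)) ?E"
      using w XJ_Sym[OF J x] by (simp add: hmul_assoc hT_HK EJ_HK[OF J])
    then show "pJ n J * hmul n (hT w) (hmul n (hT x) ?E) x = pJ n J * (\<Sum>u\<in>WJ J. mulT n w (hT x) (x \<circ> u) * qv ^ len n u)"
      using gE[OF hmul_HK[OF hT_HK[OF XJ_Sym[OF J x]]] x, of "hT w"] w by (simp add: hmul_hT_left)
  qed
  also have "\<dots> = pJ n J * ind_sign n la w"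
    by (simp add: ind_sign_def Xmin_XJ young_WJ flip: J_def) (simp add: mult.assoc q sum_distrib_left)
  finally show ?thesis by simp
qed

locale hecke_reps =
  fixes n :: nat and d :: "nat list \<Rightarrow> nat" and X :: "nat list \<Rightarrow> matrep"
  assumes standing: "standing_setup n d X"
begin

abbreviation Pt where "Pt \<equiv> partitions n"

definition R :: "nat list \<Rightarrow> hecke \<Rightarrow> nat \<Rightarrow> nat \<Rightarrow> K" where
  "R la = hrep n (d la) (X la)"

definition chi :: "nat list \<Rightarrow> hecke \<Rightarrow> K" where
  "chi la h = mtr (d la) (R la h)"

abbreviation "Jl la \<equiv> youngJ n la"
abbreviation "El la \<equiv> EJ n (youngJ n la)"
abbreviation "pl la \<equiv> pJ n (youngJ n la)"

lemma irr: "la \<in> Pt \<Longrightarrow> irreducible_rep n (d la) (X la)"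
  using standing by (simp add: standing_setup_def)

lemma mrep: "la \<in> Pt \<Longrightarrow> is_matrep n (d la) (X la)"
  using irr by (simp add: irreducible_rep_def)

lemma d_pos: "la \<in> Pt \<Longrightarrow> 1 \<le> d la"
  using irr by (simp add: irreducible_rep_def)

lemma R_outside: "i \<notin> {1..d la} \<or> j \<notin> {1..d la} \<Longrightarrow> R la h i j = 0"
  unfolding R_def by (rule hrep_outside)

lemmas R_add = hrep_add[where Y = "X la" and d = "d la" and n = n for la, folded R_def]
lemmas R_diff = hrep_diff[where Y = "X la" and d = "d la" and n = n for la, folded R_def]
lemmas R_smult = hrep_smult[where Y = "X la" and d = "d la" and n = n for la, folded R_def]
lemmas R_sum = hrep_sum[where Y = "X la" and d = "d la" and n = n for la, folded R_def]
lemmas R_expand = hrep_expand[where Y = "X la" and d = "d la" and n = n for la, folded R_def]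
lemmas R_hT = hrep_hT[where Y = "X la" and d = "d la" and n = n for la, folded R_def]

lemma R_hmul: "la \<in> Pt \<Longrightarrow> h \<in> HK n \<Longrightarrow> g \<in> HK n \<Longrightarrow> R la (hmul n h g) = MM (d la) (R la h) (R la g)"
  unfolding R_def by (rule hrep_hmul[OF mrep])

lemma R_id: "la \<in> Pt \<Longrightarrow> i \<in> {1..d la} \<Longrightarrow> j \<in> {1..d la} \<Longrightarrow> R la (hT id) i j = (if i = j then 1 else 0)"
  unfolding R_def by (rule hrep_id[OF mrep])

lemma chi_character: "w \<in> Sym n \<Longrightarrow> chi la (hT w) = character (d la) (X la) w"
  by (simp add: chi_def mtr_def character_def R_hT)

lemma chi_expand: "h \<in> HK n \<Longrightarrow> chi la h = (\<Sum>w\<in>Sym n. h w * chi la (hT w))"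
proof -
  assume h: "h \<in> HK n"
  have "chi la h = (\<Sum>i=1..d la. \<Sum>w\<in>Sym n. h w * R la (hT w) i i)"
    unfolding chi_def mtr_def using R_expand[OF h] by simp
  also have "\<dots> = (\<Sum>w\<in>Sym n. \<Sum>i=1..d la. h w * R la (hT w) i i)" by (rule sum.swap)
  finally show ?thesis by (simp add: chi_def mtr_def sum_distrib_left)
qed

lemma chi_smult: "chi la (\<lambda>y. c * h y) = c * chi la h"
  by (simp add: chi_def mtr_def R_smult sum_distrib_left)

text \<open>For fixed inner indices j and k the sum is, by the Casimir identity, an intertwiner in
  the indices (i, l); a nonzero entry would force equal characters.\<close>

lemma schur_distinct:
  assumes "la \<in> Pt" "mu \<in> Pt" "la \<noteq> mu"
  shows "(\<Sum>w\<in>Sym n. R la (hT w) i j * R mu (hT (inv w)) k l) = 0"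
proof (cases "i \<in> {1..d la} \<and> j \<in> {1..d la} \<and> k \<in> {1..d mu} \<and> l \<in> {1..d mu}")
  case True
  define M where "M = (\<lambda>i l. \<Sum>w\<in>Sym n. X la w i j * X mu (inv w) k l)"
  have inter: "MM (d la) (X la x) M i l = MM (d mu) M (X mu x) i l"
    if "x \<in> Sym n" "i \<in> {1..d la}" "l \<in> {1..d mu}" for x i l
    using casimir_intertwiner[OF mrep[OF assms(1)] mrep[OF assms(2)] that(1,2), of j k l] that True
    by (simp add: MM_def M_def)
  have "(\<lambda>w\<in>Sym n. character (d la) (X la) w) \<noteq> (\<lambda>w\<in>Sym n. character (d mu) (X mu) w)"
    using standing assms by (simp add: standing_setup_def)
  then obtain w where w: "w \<in> Sym n" "character (d la) (X la) w \<noteq> character (d mu) (X mu) w"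
    by (metis (no_types, lifting) restrict_ext)
  have "M i l = 0"
  proof (rule ccontr)
    assume "M i l \<noteq> 0"
    from intertwiner_imp_equal_characters[OF irr[OF assms(1)] irr[OF assms(2)] inter _ _ this w(1)]
    show False using w True by blast
  qed
  then show ?thesis using True by (simp add: M_def R_hT Sym_inv)
next
  case False
  then have "R la (hT w) i j * R mu (hT (inv w)) k l = 0" for w using R_outside by (metis mult_eq_0_iff)
  then show ?thesis by (intro sum.neutral) blast
qed

definition P :: "nat list \<Rightarrow> nat \<Rightarrow> K" where
  "P la = (SOME P. (\<forall>i\<in>{1..d la}. \<exists>p. P i = Kpoly p \<and> coeff p 0 = 1) \<and>
     (\<forall>w\<in>Sym n. \<forall>i\<in>{1..d la}. \<forall>j\<in>{1..d la}. X la (inv w) i j = X la w j i * P j / P i))"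

lemma
  assumes "la \<in> Pt" "i \<in> {1..d la}"
  shows P_inO: "inO (P la i)" and P_const0: "const0 (P la i) = 1"
    and P_transpose: "w \<in> Sym n \<Longrightarrow> j \<in> {1..d la} \<Longrightarrow> X la (inv w) i j = X la w j i * P la j / P la i"
proof -
  have "\<exists>P. (\<forall>i\<in>{1..d la}. \<exists>p. P i = Kpoly p \<and> coeff p 0 = 1) \<and>
     (\<forall>w\<in>Sym n. \<forall>i\<in>{1..d la}. \<forall>j\<in>{1..d la}. X la (inv w) i j = X la w j i * P j / P i)"
    using standing assms(1) by (auto simp: standing_setup_def orthogonal_rep_def)
  from someI_ex[OF this] have *: "\<exists>p. P la i = Kpoly p \<and> coeff p 0 = 1"
    "w \<in> Sym n \<Longrightarrow> j \<in> {1..d la} \<Longrightarrow> X la (inv w) i j = X la w j i * P la j / P la i"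
    unfolding P_def[symmetric] using assms(2) by blast+
  then show "inO (P la i)" "const0 (P la i) = 1"
    "w \<in> Sym n \<Longrightarrow> j \<in> {1..d la} \<Longrightarrow> X la (inv w) i j = X la w j i * P la j / P la i" by auto
qed

lemma P_nonzero: "la \<in> Pt \<Longrightarrow> i \<in> {1..d la} \<Longrightarrow> P la i \<noteq> 0"
  using P_const0 by force

lemma P_ratio: "la \<in> Pt \<Longrightarrow> i \<in> {1..d la} \<Longrightarrow> j \<in> {1..d la} \<Longrightarrow> inO (P la i / P la j) \<and> const0 (P la i / P la j) = 1"
  unfolding divide_inverse by (simp add: inO_mult const0_mult inO_inverse const0_inverse P_inO P_const0)

lemma R_hstar:
  assumes "la \<in> Pt" "h \<in> HK n" "i \<in> {1..d la}" "j \<in> {1..d la}"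
  shows "R la (hstar n h) i j = R la h j i * (P la j / P la i)"
proof -
  have "R la (hstar n h) i j = (\<Sum>w\<in>Sym n. h (inv w) * X la w i j)"
    using assms by (simp add: R_def hrep_def hstar_def)
  also have "\<dots> = (\<Sum>w\<in>Sym n. h w * X la (inv w) i j)"
    by (rule sum.reindex_bij_witness[of _ inv inv]) (auto simp: Sym_inv)
  also have "\<dots> = (\<Sum>w\<in>Sym n. h w * X la w j i) * (P la j / P la i)"
    unfolding sum_distrib_right using assms by (intro sum.cong refl) (simp add: P_transpose)
  finally show ?thesis using assms by (simp add: R_def hrep_def)
qed

lemma R_hT_inv: "la \<in> Pt \<Longrightarrow> w \<in> Sym n \<Longrightarrow> i \<in> {1..d la} \<Longrightarrow> j \<in> {1..d la} \<Longrightarrow>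
    R la (hT (inv w)) i j = R la (hT w) j i * (P la j / P la i)"
  using R_hstar[of la "hT w" i j] by (simp add: hT_HK hstar_hT)

text \<open>The weights are units with constant term 1, so a vanishing trace of h times
  \<open>hstar n h\<close> forces h to act as zero.\<close>

lemma chi_star_positive:
  assumes "la \<in> Pt" "h \<in> HK n"
  shows "chi la (hmul n h (hstar n h)) = (\<Sum>(i, j)\<in>{1..d la} \<times> {1..d la}. R la h i j * R la h i j * (P la i / P la j))"
proof -
  have "chi la (hmul n h (hstar n h)) = (\<Sum>i=1..d la. \<Sum>j=1..d la. R la h i j * R la (hstar n h) j i)"
    using assms by (simp add: chi_def R_hmul mtr_def MM_def)
  also have "\<dots> = (\<Sum>i=1..d la. \<Sum>j=1..d la. R la h i j * R la h i j * (P la i / P la j))"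
    using assms by (intro sum.cong refl) (simp add: R_hstar)
  finally show ?thesis by (simp add: sum.cartesian_product)
qed

section \<open>Multiplicities in the induced sign characters and vanishing of sign
  idempotents\<close>

definition mult :: "nat list \<Rightarrow> nat list \<Rightarrow> nat" where
  "mult la mu = (if mu = la then 1 else if la \<lhd> mu then
     (SOME m. \<forall>w\<in>Sym n. ind_sign n la w = character (d la) (X la) w
          + (\<Sum>mu\<in>{mu\<in>partitions n. la \<lhd> mu}. of_nat (m mu) * character (d mu) (X mu) w)) mu else 0)"

lemma mult_self [simp]: "mult la la = 1"
  by (simp add: mult_def)

lemma mult_dominates: "mult la mu \<noteq> 0 \<Longrightarrow> la \<unlhd> mu"
  by (auto simp: mult_def sdominates_def dominates_def split: if_splits)

lemma ind_sign_mult: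
  assumes la: "la \<in> Pt" and w: "w \<in> Sym n"
  shows "ind_sign n la w = (\<Sum>mu\<in>Pt. of_nat (mult la mu) * chi mu (hT w))"
proof -
  define m where "m = (SOME m. \<forall>w\<in>Sym n. ind_sign n la w = character (d la) (X la) w
          + (\<Sum>mu\<in>{mu\<in>partitions n. la \<lhd> mu}. of_nat (m mu) * character (d mu) (X mu) w))"
  have "\<exists>m :: nat list \<Rightarrow> nat. \<forall>w\<in>Sym n. ind_sign n la w = character (d la) (X la) w
          + (\<Sum>mu\<in>{mu\<in>partitions n. la \<lhd> mu}. of_nat (m mu) * character (d mu) (X mu) w)"
    using standing la by (simp add: standing_setup_def)
  from someI_ex[OF this] have "ind_sign n la w = character (d la) (X la) w
          + (\<Sum>mu\<in>{mu\<in>partitions n. la \<lhd> mu}. of_nat (m mu) * character (d mu) (X mu) w)"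
    unfolding m_def using w by blast
  also have "\<dots> = (\<Sum>mu\<in>insert la {mu\<in>Pt. la \<lhd> mu}. of_nat (mult la mu) * chi mu (hT w))"
  proof -
    have "la \<notin> {mu\<in>Pt. la \<lhd> mu}" by (simp add: sdominates_def)
    then have "(\<Sum>mu\<in>insert la {mu\<in>Pt. la \<lhd> mu}. of_nat (mult la mu) * chi mu (hT w)) =
        chi la (hT w) + (\<Sum>mu\<in>{mu\<in>Pt. la \<lhd> mu}. of_nat (mult la mu) * chi mu (hT w))"
      using finite_partitions[of n] by (subst sum.insert) auto
    also have "(\<Sum>mu\<in>{mu\<in>Pt. la \<lhd> mu}. of_nat (mult la mu) * chi mu (hT w)) =
        (\<Sum>mu\<in>{mu\<in>Pt. la \<lhd> mu}. of_nat (m mu) * character (d mu) (X mu) w)"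
      by (intro sum.cong) (auto simp: mult_def m_def sdominates_def chi_character[OF w])
    finally show ?thesis by (simp add: chi_character[OF w])
  qed
  also have "\<dots> = (\<Sum>mu\<in>Pt. of_nat (mult la mu) * chi mu (hT w))"
    using finite_partitions[of n] la by (intro sum.mono_neutral_left) (auto simp: mult_def)
  finally show ?thesis .
qed

text \<open>The norm of the character for the trace form. It is usable before absolute
  irreducibility is known; later it equals the degree times the Schur element
  (\<open>Gram_cS\<close>).\<close>

definition Gram :: "nat list \<Rightarrow> K" where
  "Gram nu = (\<Sum>w\<in>Sym n. chi nu (hT w) * chi nu (hT (inv w)))"

lemma chi_orthogonal:
  assumes "nu \<in> Pt" "mu \<in> Pt" "nu \<noteq> mu"
  shows "(\<Sum>w\<in>Sym n. chi nu (hT w) * chi mu (hT (inv w))) = 0"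
proof -
  have "(\<Sum>w\<in>Sym n. chi nu (hT w) * chi mu (hT (inv w))) =
      (\<Sum>w\<in>Sym n. \<Sum>i=1..d nu. \<Sum>k=1..d mu. R nu (hT w) i i * R mu (hT (inv w)) k k)"
    by (simp add: chi_def mtr_def sum_product)
  also have "\<dots> = (\<Sum>i=1..d nu. \<Sum>w\<in>Sym n. \<Sum>k=1..d mu. R nu (hT w) i i * R mu (hT (inv w)) k k)"
    by (rule sum.swap)
  also have "\<dots> = (\<Sum>i=1..d nu. \<Sum>k=1..d mu. \<Sum>w\<in>Sym n. R nu (hT w) i i * R mu (hT (inv w)) k k)"
    by (intro sum.cong refl sum.swap)
  finally show ?thesis using schur_distinct[OF assms] by simp
qed

text \<open>The trace of \<open>\<Sum>\<^sub>w \<chi>\<^sub>\<nu>(T_w) T_(w^-1)\<close> on the left ideal generated by the sign idempotent.\<close>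

lemma chi_conj_sum:
  assumes la: "la \<in> Pt" and nu: "nu \<in> Pt"
  shows "(\<Sum>y\<in>Sym n. chi nu (hmul n (hmul n (hT y) (El la)) (hT (inv y)))) = pl la * of_nat (mult la nu) * Gram nu"
proof -
  have E: "El la \<in> HK n" by (rule EJ_HK[OF youngJ_subset])
  have "(\<Sum>y\<in>Sym n. chi nu (hmul n (hmul n (hT y) (El la)) (hT (inv y)))) =
      (\<Sum>y\<in>Sym n. \<Sum>w\<in>Sym n. hmul n (hmul n (hT y) (El la)) (hT (inv y)) w * chi nu (hT w))"
    by (intro sum.cong refl chi_expand hmul_HK hT_HK Sym_inv)
  also have "\<dots> = (\<Sum>y\<in>Sym n. \<Sum>w\<in>Sym n. chi nu (hT w) * hmul n (hT (inv w)) (hmul n (hT y) (El la)) y)"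
  proof (intro sum.cong refl)
    fix y w assume yw: "y \<in> Sym n" "w \<in> Sym n"
    have "hmul n (hmul n (hT y) (El la)) (hT (inv y)) w = hmul n (hT (inv w)) (hmul n (hmul n (hT y) (El la)) (hT (inv y))) id"
      using yw by (simp add: coeff_trace)
    also have "\<dots> = hmul n (hmul n (hT (inv w)) (hmul n (hT y) (El la))) (hT (inv y)) id"
      using yw E by (simp add: hmul_assoc hT_HK Sym_inv hmul_HK)
    also have "\<dots> = hmul n (hT (inv y)) (hmul n (hT (inv w)) (hmul n (hT y) (El la))) id"
      by (rule trace_commute)
    also have "\<dots> = hmul n (hT (inv w)) (hmul n (hT y) (El la)) y" using yw by (simp add: coeff_trace)
    finally show "hmul n (hmul n (hT y) (El la)) (hT (inv y)) w * chi nu (hT w) = chi nu (hT w) * hmul n (hT (inv w)) (hmul n (hT y) (El la)) y"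
      by (simp add: mult.commute)
  qed
  also have "\<dots> = (\<Sum>w\<in>Sym n. \<Sum>y\<in>Sym n. chi nu (hT w) * hmul n (hT (inv w)) (hmul n (hT y) (El la)) y)" by (rule sum.swap)
  also have "\<dots> = (\<Sum>w\<in>Sym n. chi nu (hT w) * (pl la * ind_sign n la (inv w)))"
    by (intro sum.cong refl) (simp add: induced_sign_trace Sym_inv sum_distrib_left)
  also have "\<dots> = (\<Sum>w\<in>Sym n. \<Sum>mu\<in>Pt. pl la * of_nat (mult la mu) * (chi nu (hT w) * chi mu (hT (inv w))))"
    by (intro sum.cong refl) (simp add: ind_sign_mult[OF la] Sym_inv sum_distrib_left mult_ac)
  also have "\<dots> = (\<Sum>mu\<in>Pt. \<Sum>w\<in>Sym n. pl la * of_nat (mult la mu) * (chi nu (hT w) * chi mu (hT (inv w))))" by (rule sum.swap)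
  also have "\<dots> = (\<Sum>mu\<in>Pt. if mu = nu then pl la * of_nat (mult la nu) * Gram nu else 0)"
    using chi_orthogonal[OF nu] by (intro sum.cong refl) (auto simp: Gram_def simp flip: sum_distrib_left)
  also have "\<dots> = pl la * of_nat (mult la nu) * Gram nu"
    using nu finite_partitions[of n] by (simp add: sum.delta)
  finally show ?thesis .
qed

text \<open>Since E is fixed by \<open>hstar\<close> and E E = \<open>pJ\<close> E, the element T_y
  E times its own \<open>hstar\<close> is \<open>pJ\<close> times the conjugate T_y E T_(y^-1). So
  the characters summed in \<open>chi_conj_sum\<close> are sums of squares up to the common factor
  \<open>pJ\<close>.\<close>

lemma chi_conj_positive:
  assumes la: "la \<in> Pt" and nu: "nu \<in> Pt" and y: "y \<in> Sym n"
  shows "pl la * chi nu (hmul n (hmul n (hT y) (El la)) (hT (inv y))) =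
    (\<Sum>(i, j)\<in>{1..d nu} \<times> {1..d nu}. R nu (hmul n (hT y) (El la)) i j * R nu (hmul n (hT y) (El la)) i j * (P nu i / P nu j))"
proof -
  have E: "El la \<in> HK n" by (rule EJ_HK[OF youngJ_subset])
  let ?h = "hmul n (hT y) (El la)"
  have "hstar n ?h = hmul n (El la) (hT (inv y))"
    using y E by (simp add: hstar_hmul hT_HK hstar_hT hstar_EJ[OF youngJ_subset])
  then have "hmul n ?h (hstar n ?h) = hmul n (hT y) (hmul n (hmul n (El la) (El la)) (hT (inv y)))"
    using y E by (simp add: hmul_assoc hT_HK Sym_inv hmul_HK)
  also have "\<dots> = (\<lambda>z. pl la * hmul n ?h (hT (inv y)) z)"
    using y E by (simp add: EJ_EJ[OF youngJ_subset] hmul_smult_left hmul_smult_right hmul_assoc hT_HK Sym_inv)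
  finally have "chi nu (hmul n ?h (hstar n ?h)) = pl la * chi nu (hmul n ?h (hT (inv y)))"
    by (simp add: chi_smult)
  then show ?thesis using chi_star_positive[OF nu, of ?h] E by (simp add: hmul_HK)
qed

text \<open>Multiplicity zero makes the sum over all conjugates vanish. It is a sum of weighted
  squares, so every term is zero, and y = 1 gives the matrix entries of E itself.\<close>

lemma R_El_zero:
  assumes la: "la \<in> Pt" and nu: "nu \<in> Pt" and m: "mult la nu = 0"
  shows "R nu (El la) = (\<lambda>i j. 0)"
proof (intro ext)
  fix i j
  have E: "El la \<in> HK n" by (rule EJ_HK[OF youngJ_subset])
  let ?A = "\<lambda>y. R nu (hmul n (hT y) (El la))"
  have "0 = pl la * (\<Sum>y\<in>Sym n. chi nu (hmul n (hmul n (hT y) (El la)) (hT (inv y))))"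
    using chi_conj_sum[OF la nu] m by simp
  also have "\<dots> = (\<Sum>y\<in>Sym n. \<Sum>(i, j)\<in>{1..d nu} \<times> {1..d nu}. ?A y i j * ?A y i j * (P nu i / P nu j))"
    using chi_conj_positive[OF la nu] by (simp add: sum_distrib_left)
  also have "\<dots> = (\<Sum>(y, i, j)\<in>Sym n \<times> {1..d nu} \<times> {1..d nu}. ?A y i j * ?A y i j * (P nu i / P nu j))"
    by (simp add: sum.cartesian_product)
  finally have z: "(\<Sum>s\<in>Sym n \<times> {1..d nu} \<times> {1..d nu}. ?A (fst s) (fst (snd s)) (snd (snd s)) * ?A (fst s) (fst (snd s)) (snd (snd s))
      * (P nu (fst (snd s)) / P nu (snd (snd s)))) = 0" by (simp add: case_prod_unfold)
  show "R nu (El la) i j = 0"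
  proof (cases "i \<in> {1..d nu} \<and> j \<in> {1..d nu}")
    case True
    from sum_squares_zeroD[OF _ _ _ z, of "(id, i, j)"]
    have "?A id i j = 0" using P_ratio[OF nu] True by auto
    then show ?thesis using E by (simp add: hmul_id_left)
  qed (use R_outside in auto)
qed

lemma R_El_zero': "la \<in> Pt \<Longrightarrow> nu \<in> Pt \<Longrightarrow> \<not> la \<unlhd> nu \<Longrightarrow> R nu (El la) = (\<lambda>i j. 0)"
  using R_El_zero mult_dominates by blast

text \<open>Orthogonality gives T_w and T_(w^-1) the same character value, so this is a sum of
  squares, and the term at w = 1 is the square of the degree.\<close>

lemma Gram_nonzero:
  assumes nu: "nu \<in> Pt"
  shows "Gram nu \<noteq> 0"
proof
  assume "Gram nu = 0"
  moreover have "chi nu (hT (inv w)) = chi nu (hT w)" if "w \<in> Sym n" for w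
    unfolding chi_def mtr_def using nu that P_nonzero[OF nu] by (intro sum.cong refl) (simp add: R_hT_inv)
  ultimately have "(\<Sum>w\<in>Sym n. chi nu (hT w) * chi nu (hT w) * 1) = 0" by (simp add: Gram_def)
  from sum_squares_zeroD[OF finite_Sym _ _ this Sym_id] have "chi nu (hT id) = 0" by simp
  moreover have "chi nu (hT id) = of_nat (d nu)"
    using nu by (simp add: chi_def mtr_def R_id)
  moreover have "const0 (of_nat (d nu)) \<noteq> 0" using d_pos[OF nu] by simp
  ultimately show False by (metis const0_simps(1))
qed

text \<open>If E acted as zero, so would all its conjugates, but their characters sum to
  \<open>pl la\<close> times \<open>Gram la\<close> because the multiplicity of chi_la is
  one.\<close>

lemma R_El_nonzero:
  assumes la: "la \<in> Pt"
  shows "R la (El la) \<noteq> (\<lambda>i j. 0)"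
proof
  assume z: "R la (El la) = (\<lambda>i j. 0)"
  have E: "El la \<in> HK n" by (rule EJ_HK[OF youngJ_subset])
  have "chi la (hmul n (hmul n (hT y) (El la)) (hT (inv y))) = 0" if "y \<in> Sym n" for y
    using la E that z by (simp add: chi_def mtr_def R_hmul hT_HK Sym_inv hmul_HK) (simp add: MM_def)
  then have "pl la * Gram la = 0" using chi_conj_sum[OF la la] by simp
  then show False using Gram_nonzero[OF la] pJ_nonzero[OF youngJ_subset] by simp
qed

end

section \<open>Rows, tableaux and the dominance order\<close>

abbreviation stl :: "nat list \<Rightarrow> nat \<Rightarrow> nat" where
  "stl la i \<equiv> sum_list (take i la)"

lemma stl_Suc: "i < length la \<Longrightarrow> stl la (Suc i) = stl la i + la ! i"
  by (simp add: take_Suc_conv_app_nth)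

lemma stl_mono: "i \<le> j \<Longrightarrow> stl la i \<le> stl la j"
proof -
  assume "i \<le> j"
  then have "take j la = take i la @ take (j - i) (drop i la)"
    by (metis le_add_diff_inverse take_add)
  then show ?thesis by simp
qed

lemma partitions_sum: "la \<in> partitions n \<Longrightarrow> sum_list la = n"
  by (simp add: partitions_def)

lemma partitions_pos: "la \<in> partitions n \<Longrightarrow> i < length la \<Longrightarrow> 1 \<le> la ! i"
  unfolding partitions_def by (metis (mono_tags, lifting) mem_Collect_eq not_less_eq_eq nth_mem One_nat_def le_zero_eq)

lemma partitions_antimono: "la \<in> partitions n \<Longrightarrow> i \<le> j \<Longrightarrow> j < length la \<Longrightarrow> la ! j \<le> la ! i"
  unfolding partitions_def by (cases "i = j") (auto simp: sorted_wrt_iff_nth_less)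

lemma stl_le: "sum_list la = n \<Longrightarrow> stl la i \<le> n"
  using stl_mono[of i "max i (length la)" la] by simp

lemma row_exists:
  assumes "sum_list la = n" "b \<in> {1..n}"
  obtains i where "i < length la" "stl la i < b" "b \<le> stl la (Suc i)"
proof -
  define k where "k = (LEAST k. b \<le> stl la k)"
  have ex: "b \<le> stl la (length la)" using assms by simp
  have k: "b \<le> stl la k" unfolding k_def by (rule LeastI[of "\<lambda>k. b \<le> stl la k", OF ex])
  have min: "\<not> b \<le> stl la i" if "i < k" for i using not_less_Least that unfolding k_def by blast
  have "k \<noteq> 0" using k assms by (cases k) auto
  then obtain i where i: "k = Suc i" by (cases k) auto
  have "stl la i < b" using min[of i] i by simp
  moreover have "i < length la"
  proof (rule ccontr)
    assume "\<not> ?thesis"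
    then have "stl la i = n" using assms by simp
    then show False using \<open>stl la i < b\<close> assms by simp
  qed
  ultimately show thesis using that k i by blast
qed

lemma row_sblk:
  assumes "sum_list la = n" "stl la i < a" "a \<le> stl la (Suc i)" "stl la i < b" "b \<le> stl la (Suc i)"
  shows "sblk (youngJ n la) a b"
proof -
  have "sblk (youngJ n la) a b" if "a \<le> b" "stl la i < a" "b \<le> stl la (Suc i)" for a b
    unfolding sblk_iff[OF that(1)]
  proof (intro allI impI)
    fix k assume k: "a \<le> k" "k < b"
    have "k \<noteq> stl la j" for j
      using stl_mono[of j i la] stl_mono[of "Suc i" j la] that k by (cases "j \<le> i") auto
    moreover have "k \<in> {1..<n}" using k that stl_le[OF assms(1), of "Suc i"] by auto
    ultimately show "k \<in> youngJ n la" by (auto simp: youngJ_def)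
  qed
  then show ?thesis using assms sblk_sym by (cases a b rule: le_cases) blast+
qed

lemma sblk_row:
  assumes "sblk (youngJ n la) a b" "i \<ge> 1"
  shows "a \<le> stl la i \<longleftrightarrow> b \<le> stl la i"
proof -
  have "b \<le> stl la i" if "sblk (youngJ n la) a b" "a \<le> stl la i" for a b
  proof (rule ccontr)
    assume n: "\<not> ?thesis"
    then have "stl la i \<in> youngJ n la" using that sblk_iff[of a b] by auto
    then show False using assms(2) by (auto simp: youngJ_def)
  qed
  then show ?thesis using assms(1) sblk_sym by blast
qed

text \<open>Up to the Young subgroup on both sides, an element outside it has a distinguished
  representative x violating column-strictness in the first column, between two adjacent rows. This
  makes a Garnir relation applicable to every nontrivial double coset.\<close>

lemma nonstandard_rep:
  assumes la: "la \<in> partitions n" and w: "w \<in> Sym n" "w \<notin> WJ (youngJ n la)"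
  obtains u x u' r where "u \<in> WJ (youngJ n la)" "x \<in> XJ n (youngJ n la)" "u' \<in> WJ (youngJ n la)" "u \<circ> w = x \<circ> u'"
    "Suc r < length la" "x (stl la (Suc r) + 1) < x (stl la r + 1)"
proof -
  let ?J = "youngJ n la"
  note J = youngJ_subset[of n la]
  have sum: "sum_list la = n" using la by (rule partitions_sum)
  let ?bad = "\<lambda>b. \<not> sblk ?J (inv w b) b"
  have "\<exists>a. \<not> sblk ?J a (w a)" using w WJ_iff[OF J, of w] by blast
  then have ex: "\<exists>b. ?bad b" using w(1) by (metis Sym_inv_app(2))
  \<comment> \<open>The least value not staying in its own row i. Smaller values are well placed, so
    b can only come from a row k below row i.\<close>
  define b where "b = (LEAST b. ?bad b)"
  have b: "?bad b" unfolding b_def using LeastI_ex[OF ex] .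
  have good: "sblk ?J (inv w b') b'" if "b' < b" for b' using not_less_Least that unfolding b_def by blast
  have "b \<in> {1..n}"
  proof (rule ccontr)
    assume "b \<notin> {1..n}"
    then have "inv w b = b" using Sym_outside[OF Sym_inv[OF w(1)]] by blast
    then show False using b by simp
  qed
  then obtain i where i: "i < length la" "stl la i < b" "b \<le> stl la (Suc i)" using row_exists[OF sum] by blast
  define c where "c = inv w b"
  have wc: "w c = b" using w(1) by (simp add: c_def)
  \<comment> \<open>The values in the rows before i fill the positions of those rows, so the initial
    segment is preserved by w and its inverse.\<close>
  have low: "inv w ` {1..stl la i} = {1..stl la i}"
  proof (rule card_subset_eq)
    show "inv w ` {1..stl la i} \<subseteq> {1..stl la i}"
    proof
      fix a assume "a \<in> inv w ` {1..stl la i}"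
      then obtain b' where b': "b' \<in> {1..stl la i}" "a = inv w b'" by auto
      then have "i \<ge> 1" by (cases i) auto
      have "sblk ?J a b'" using good[of b'] b' i by simp
      then have "a \<le> stl la i" using sblk_row[OF _ \<open>i \<ge> 1\<close>] b' by simp
      moreover have "b' \<in> {1..n}" using b' stl_le[OF sum, of i] by auto
      then have "a \<in> {1..n}" using Sym_range[OF Sym_inv[OF w(1)]] b' by blast
      ultimately show "a \<in> {1..stl la i}" by simp
    qed
    have "inj_on (inv w) {1..stl la i}" using Sym_inj[OF Sym_inv[OF w(1)]] by (simp add: inj_on_def)
    then show "card (inv w ` {1..stl la i}) = card {1..stl la i}" by (rule card_image)
  qed simp
  have high: "stl la i < w a" if "stl la i < a" "a \<in> {1..n}" for a
  proof (rule ccontr)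
    assume "\<not> ?thesis"
    moreover have "w a \<in> {1..n}" using Sym_range[OF w(1)] that by blast
    ultimately have "w a \<in> {1..stl la i}" by auto
    then have "inv w (w a) \<in> {1..stl la i}" using low by blast
    then show False using that w(1) by simp
  qed
  have cn: "c \<in> {1..n}" using \<open>b \<in> {1..n}\<close> Sym_range[OF Sym_inv[OF w(1)]] unfolding c_def by blast
  have "stl la i < c"
  proof (rule ccontr)
    assume "\<not> ?thesis"
    then have "c \<in> inv w ` {1..stl la i}" using low cn by auto
    then obtain b' where "b' \<in> {1..stl la i}" "inv w b' = inv w b" by (auto simp: c_def)
    then show False using Sym_inj[OF Sym_inv[OF w(1)]] i by auto
  qed
  then have "stl la (Suc i) < c"
    using row_sblk[OF sum, of i c b] i b by (metis c_def not_le_imp_less)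
  obtain k where k: "k < length la" "stl la k < c" "c \<le> stl la (Suc k)" using row_exists[OF sum cn] by blast
  have "i < k"
    using k \<open>stl la (Suc i) < c\<close> stl_mono[of "Suc k" "Suc i" la] by (cases "i < k") auto
  \<comment> \<open>The first value of row i. Exchanging b with it by an element of the Young
    subgroup makes the entry coming from row k smaller than everything in row i.\<close>
  define \<beta> where "\<beta> = Suc (stl la i)"
  define u where "u = transpose b \<beta>"
  have \<beta>: "stl la i < \<beta>" "\<beta> \<le> stl la (Suc i)" "\<beta> \<in> {1..n}" using i \<open>b \<in> {1..n}\<close> by (auto simp: \<beta>_def)
  have bb: "sblk ?J b \<beta>" using row_sblk[OF sum i(2,3) \<beta>(1,2)] .
  have u: "u \<in> WJ ?J"
    unfolding WJ_iff[OF J]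
  proof (intro conjI allI)
    show "u \<in> Sym n" unfolding u_def Sym_def using \<open>b \<in> {1..n}\<close> \<beta>(3) by (simp only: mem_Collect_eq permutes_swap_id)
    show "sblk ?J a (u a)" for a using bb sblk_sym[OF bb] by (auto simp: u_def transpose_def)
  qed
  have w': "u \<circ> w \<in> Sym n" using u w(1) WJ_Sym[OF J] Sym_comp by blast
  obtain x u' where x: "x \<in> XJ n ?J" "u' \<in> WJ ?J" "u \<circ> w = x \<circ> u'" using XJ_WJ_decomp[OF J w'] by blast
  have ev: "x (u' a) = u (w a)" for a using fun_cong[OF x(3), of a] by simp
  have "x (u' c) = \<beta>" using ev[of c] wc by (simp add: u_def)
  have "x (stl la k + 1) \<le> \<beta>"
  proof -
    have *: "sblk ?J c (u' c)" using WJ_sblk[OF x(2)] .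
    have "stl la k < u' c"
    proof (cases "k \<ge> 1")
      case True then show ?thesis using sblk_row[OF * True] k by auto
    next
      case False then show ?thesis using \<open>i < k\<close> by simp
    qed
    moreover have "u' c \<le> stl la (Suc k)" using sblk_row[OF *, of "Suc k"] k by auto
    ultimately have "sblk ?J (stl la k + 1) (u' c)" using row_sblk[OF sum, of k "stl la k + 1" "u' c"] by auto
    then have "x (stl la k + 1) \<le> x (u' c)"
      using XJ_mono[OF J x(1)] \<open>stl la k < u' c\<close> by (cases "stl la k + 1 = u' c") (auto simp: less_imp_le)
    then show ?thesis using \<open>x (u' c) = \<beta>\<close> by simp
  qed
  moreover have "\<beta> < x (stl la i + 1)"
  proof -
    define e where "e = inv u' \<beta>"
    have u'e: "u' e = \<beta>" using WJ_Sym[OF J x(2)] by (simp add: e_def)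
    have se: "sblk ?J e \<beta>" using WJ_sblk[OF x(2), of e] u'e by simp
    have e1: "e \<in> {1..n}" using \<beta>(3) Sym_range[OF Sym_inv[OF WJ_Sym[OF J x(2)]]] unfolding e_def by blast
    have e2: "stl la i < e"
    proof (cases "i \<ge> 1")
      case True then show ?thesis using sblk_row[OF se True] \<beta> by auto
    next
      case False then have "i = 0" by simp
      then show ?thesis using e1 by simp
    qed
    have e3: "e \<le> stl la (Suc i)" using sblk_row[OF se, of "Suc i"] \<beta> by auto
    have "stl la i < w e" by (rule high[OF e2 e1])
    moreover have "sblk ?J (w e) (u (w e))" by (rule WJ_sblk[OF u])
    ultimately have "stl la i < u (w e)"
    proof (cases "i \<ge> 1")
      case True
      then show ?thesis using sblk_row[OF \<open>sblk ?J (w e) (u (w e))\<close> True] \<open>stl la i < w e\<close> by auto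
    next
      case False
      have "u (w e) \<in> {1..n}" using Sym_range[OF w', of e] e1 by simp
      moreover have "i = 0" using False by simp
      ultimately show ?thesis by simp
    qed
    moreover have "u (w e) \<noteq> \<beta>"
    proof
      assume "u (w e) = \<beta>"
      then have "(u \<circ> w) e = (u \<circ> w) c" using wc by (simp add: u_def)
      then have "e = c" using Sym_inj[OF w'] by blast
      then show False using e3 \<open>stl la (Suc i) < c\<close> by simp
    qed
    ultimately have "\<beta> < x (u' e)" using ev[of e] by (simp add: \<beta>_def)
    then show ?thesis using u'e by (simp add: \<beta>_def)
  qed
  ultimately have viol: "x (stl la k + 1) < x (stl la i + 1)" by simp
  \<comment> \<open>The first entries of rows i and k are in the wrong order, so they cannot
    increase all the way from i to k; some adjacent pair is already out of order.\<close>
  have "\<exists>r. i \<le> r \<and> r < k \<and> x (stl la (Suc r) + 1) < x (stl la r + 1)"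
  proof (rule ccontr)
    assume no: "\<not> ?thesis"
    have "x (stl la i + 1) \<le> x (stl la j + 1)" if "i \<le> j" "j \<le> k" for j
      using that
    proof (induction j rule: dec_induct)
      case (step j)
      then have "x (stl la j + 1) \<le> x (stl la (Suc j) + 1)" using no by (meson Suc_le_lessD linorder_not_le)
      then show ?case using step by linarith
    qed simp
    from this[of k] show False using viol \<open>i < k\<close> by simp
  qed
  then obtain r where r: "i \<le> r" "r < k" "x (stl la (Suc r) + 1) < x (stl la r + 1)" by blast
  then have "Suc r < length la" using k(1) by linarith
  then show thesis using that u x r by blast
qed

subsection \<open>Standard tableaux\<close>

text \<open>Column-strictness of the tableau obtained by applying x to the initial one.
  Row-strictness is membership in \<open>XJ\<close>, so both together describe the permutations d(t)
  for standard t.\<close>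

definition std_perm :: "nat list \<Rightarrow> perm \<Rightarrow> bool" where
  "std_perm la x \<longleftrightarrow> (\<forall>r c. Suc r < length la \<longrightarrow> 1 \<le> c \<longrightarrow> c \<le> la ! Suc r \<longrightarrow> x (stl la r + c) < x (stl la (Suc r) + c))"

lemma diagram_iff: "(i, j) \<in> diagram la \<longleftrightarrow> (\<exists>r. i = Suc r \<and> r < length la \<and> 1 \<le> j \<and> j \<le> la ! r)"
  by (cases i) (auto simp: diagram_def)

lemma tab0_eq: "r < length la \<Longrightarrow> 1 \<le> j \<Longrightarrow> j \<le> la ! r \<Longrightarrow> tab0 la (Suc r, j) = stl la r + j"
  by (simp add: tab0_def diagram_iff)

lemma tab0_bij:
  assumes sum: "sum_list la = n"
  shows "bij_betw (tab0 la) (diagram la) {1..n}"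
  unfolding bij_betw_def
proof
  show "inj_on (tab0 la) (diagram la)"
  proof (rule inj_onI)
    fix p q assume pq: "p \<in> diagram la" "q \<in> diagram la" "tab0 la p = tab0 la q"
    obtain r j where p: "p = (Suc r, j)" "r < length la" "1 \<le> j" "j \<le> la ! r"
      using pq(1) diagram_iff by (metis surj_pair)
    obtain s l where q: "q = (Suc s, l)" "s < length la" "1 \<le> l" "l \<le> la ! s"
      using pq(2) diagram_iff by (metis surj_pair)
    have eq: "stl la r + j = stl la s + l" using pq p q tab0_eq by simp
    have "\<not> r < s" using stl_mono[of "Suc r" s la] stl_Suc[OF p(2)] eq p q by auto
    moreover have "\<not> s < r" using stl_mono[of "Suc s" r la] stl_Suc[OF q(2)] eq p q by auto
    ultimately show "p = q" using p q eq by simp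
  qed
  show "tab0 la ` diagram la = {1..n}"
  proof (intro equalityI subsetI)
    fix a assume "a \<in> tab0 la ` diagram la"
    then obtain r j where "r < length la" "1 \<le> j" "j \<le> la ! r" "a = tab0 la (Suc r, j)"
      using diagram_iff by (metis imageE surj_pair)
    then show "a \<in> {1..n}" using stl_Suc[of r la] stl_le[OF sum, of "Suc r"] tab0_eq[of r la j] by simp
  next
    fix a assume "a \<in> {1..n}"
    then obtain i where i: "i < length la" "stl la i < a" "a \<le> stl la (Suc i)" using row_exists[OF sum] by blast
    then have "(Suc i, a - stl la i) \<in> diagram la" "tab0 la (Suc i, a - stl la i) = a"
      using stl_Suc[OF i(1)] tab0_eq[OF i(1), of "a - stl la i"] by (auto simp: diagram_iff)
    then show "a \<in> tab0 la ` diagram la" by (metis imageI)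
  qed
qed

lemma dtab_unique:
  assumes sum: "sum_list la = n" and x: "x \<in> XJ n (youngJ n la)" "\<And>c. c \<in> diagram la \<Longrightarrow> t c = x (tab0 la c)"
  shows "dtab n la t = x"
  unfolding dtab_def Xmin_XJ
proof (rule the_equality)
  fix x' assume x': "x' \<in> XJ n (youngJ n la) \<and> (\<forall>c\<in>diagram la. t c = x' (tab0 la c))"
  show "x' = x"
  proof
    fix a show "x' a = x a"
    proof (cases "a \<in> {1..n}")
      case True
      then obtain c where "c \<in> diagram la" "a = tab0 la c" using tab0_bij[OF sum] by (metis bij_betw_iff_bijections)
      then show ?thesis using x' x by metis
    next
      case False
      then show ?thesis using x x' XJ_Sym[OF youngJ_subset] Sym_outside by metis
    qed
  qed
qed (use x in auto)

lemma dtab_std: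
  assumes la: "la \<in> partitions n" and t: "t \<in> std_tableaux n la"
  shows "dtab n la t \<in> XJ n (youngJ n la)"
proof -
  have sum: "sum_list la = n" using la by (rule partitions_sum)
  note b = tab0_bij[OF sum]
  define x where "x = (\<lambda>a. if a \<in> {1..n} then t (inv_into (diagram la) (tab0 la) a) else a)"
  have tb: "bij_betw t (diagram la) {1..n}" using t by (simp add: std_tableaux_def)
  have "bij_betw (t \<circ> inv_into (diagram la) (tab0 la)) {1..n} {1..n}"
    using bij_betw_trans[OF bij_betw_inv_into[OF b] tb] .
  then have "bij_betw x {1..n} {1..n}" by (rule bij_betw_cong[THEN iffD1, rotated]) (simp add: x_def)
  then have xS: "x \<in> Sym n" unfolding Sym_def by (auto intro!: bij_imp_permutes simp: x_def)
  have xt: "t c = x (tab0 la c)" if "c \<in> diagram la" for c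
  proof -
    have "tab0 la c \<in> {1..n}" using b that by (auto simp: bij_betw_def)
    moreover have "inv_into (diagram la) (tab0 la) (tab0 la c) = c" using b that by (simp add: bij_betw_def)
    ultimately show ?thesis by (simp only: x_def if_True)
  qed
  have "x \<in> XJ n (youngJ n la)"
    unfolding XJ_def
  proof (intro CollectI conjI xS ballI)
    fix k assume k: "k \<in> youngJ n la"
    then have "k \<in> {1..n}" by (auto simp: youngJ_def)
    then obtain i where i: "i < length la" "stl la i < k" "k \<le> stl la (Suc i)" using row_exists[OF sum] by blast
    have "k \<noteq> stl la (Suc i)" using k by (auto simp: youngJ_def)
    then have j: "1 \<le> k - stl la i" "k - stl la i + 1 \<le> la ! i" "stl la i + (k - stl la i) = k" using i stl_Suc[OF i(1)] by auto
    then have d: "(Suc i, k - stl la i) \<in> diagram la" "(Suc i, k - stl la i + 1) \<in> diagram la"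
      using i by (auto simp: diagram_iff)
    then have "t (Suc i, k - stl la i) < t (Suc i, k - stl la i + 1)" using t by (simp add: std_tableaux_def)
    then show "x k < x (Suc k)"
      using xt[OF d(1)] xt[OF d(2)] tab0_eq[OF i(1), of "k - stl la i"] tab0_eq[OF i(1), of "k - stl la i + 1"] j by simp
  qed
  then show ?thesis using dtab_unique[OF sum, of x t] xt by simp
qed

lemma std_perm_tableau:
  assumes la: "la \<in> partitions n" and x: "x \<in> XJ n (youngJ n la)" "std_perm la x"
  obtains t where "t \<in> std_tableaux n la" "dtab n la t = x"
proof -
  have sum: "sum_list la = n" using la by (rule partitions_sum)
  have xS: "x \<in> Sym n" using x XJ_Sym[OF youngJ_subset] by blast
  define t where "t = (\<lambda>c. if c \<in> diagram la then x (tab0 la c) else 0)"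
  have "bij_betw (x \<circ> tab0 la) (diagram la) {1..n}"
    using bij_betw_trans[OF tab0_bij[OF sum]] xS permutes_imp_bij unfolding Sym_def by blast
  then have "bij_betw t (diagram la) {1..n}" by (rule bij_betw_cong[THEN iffD1, rotated]) (simp add: t_def)
  moreover have "t (i, j) < t (i, j + 1)" if ij: "(i, j) \<in> diagram la" "(i, j + 1) \<in> diagram la" for i j
  proof -
    obtain r where r: "i = Suc r" "r < length la" "1 \<le> j" "j + 1 \<le> la ! r" using ij by (auto simp: diagram_iff)
    have "sblk (youngJ n la) (stl la r + j) (stl la r + (j + 1))"
      using r stl_Suc[of r la] by (intro row_sblk[OF sum, of r]) auto
    then have "x (stl la r + j) < x (stl la r + (j + 1))" using XJ_mono[OF youngJ_subset x(1)] by simp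
    then show ?thesis using ij r tab0_eq[of r la j] tab0_eq[of r la "j + 1"] by (simp add: t_def)
  qed
  moreover have "t (i, j) < t (i + 1, j)" if ij: "(i, j) \<in> diagram la" "(i + 1, j) \<in> diagram la" for i j
  proof -
    obtain r where r: "i = Suc r" "Suc r < length la" "1 \<le> j" "j \<le> la ! r" "j \<le> la ! Suc r" using ij by (auto simp: diagram_iff)
    have "x (stl la r + j) < x (stl la (Suc r) + j)" using x(2) r by (simp add: std_perm_def)
    then show ?thesis using ij r tab0_eq[of r la j] tab0_eq[of "Suc r" la j] by (simp add: t_def)
  qed
  ultimately have "t \<in> std_tableaux n la" by (auto simp: std_tableaux_def t_def)
  moreover have "dtab n la t = x" using dtab_unique[OF sum x(1), of t] by (simp add: t_def)
  ultimately show thesis by (rule that)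
qed

subsection \<open>Lengths of longest elements\<close>

lemma card_pairs: "card {(a, b). q < a \<and> a < b \<and> b \<le> q + m} = (\<Sum>j<m. j)" for q m :: nat
proof (induction m)
  case 0
  have e: "{(a, b). q < a \<and> a < b \<and> b \<le> q + 0} = {}" by auto
  show ?case unfolding e by simp
next
  case (Suc m)
  have "{(a, b). q < a \<and> a < b \<and> b \<le> q + Suc m} = {(a, b). q < a \<and> a < b \<and> b \<le> q + m} \<union> (\<lambda>a. (a, q + Suc m)) ` {q<..q + m}"
    by auto
  moreover have "finite {(a, b). q < a \<and> a < b \<and> b \<le> q + m}"
    by (rule finite_subset[of _ "{..q + m} \<times> {..q + m}"]) auto
  moreover have "card ((\<lambda>a. (a, q + Suc m)) ` {q<..q + m}) = m" by (subst card_image) (auto simp: inj_on_def)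
  moreover have "{(a, b). q < a \<and> a < b \<and> b \<le> q + m} \<inter> (\<lambda>a. (a, q + Suc m)) ` {q<..q + m} = {}" by auto
  ultimately show ?case using Suc.IH by (simp add: card_Un_disjoint)
qed

lemma len_wlong:
  assumes la: "la \<in> partitions n"
  shows "len n (wlong n la) = (\<Sum>i<length la. \<Sum>j<la ! i. j)"
proof -
  have sum: "sum_list la = n" using la by (rule partitions_sum)
  let ?B = "\<lambda>i. {(a, b). stl la i < a \<and> a < b \<and> b \<le> stl la i + la ! i}"
  have "{(a, b). 1 \<le> a \<and> a < b \<and> b \<le> n \<and> sblk (youngJ n la) a b} = (\<Union>i<length la. ?B i)"
  proof (intro equalityI subsetI)
    fix p assume "p \<in> {(a, b). 1 \<le> a \<and> a < b \<and> b \<le> n \<and> sblk (youngJ n la) a b}"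
    then obtain a b where p: "p = (a, b)" "1 \<le> a" "a < b" "b \<le> n" "sblk (youngJ n la) a b" by auto
    then obtain i where i: "i < length la" "stl la i < a" "a \<le> stl la (Suc i)" using row_exists[OF sum, of a] by auto
    have "b \<le> stl la (Suc i)" using sblk_row[OF p(5), of "Suc i"] i by simp
    then have "p \<in> ?B i" using p i stl_Suc[OF i(1)] by simp
    then show "p \<in> (\<Union>i<length la. ?B i)" using i by blast
  next
    fix p assume "p \<in> (\<Union>i<length la. ?B i)"
    then obtain i a b where p: "p = (a, b)" "i < length la" "stl la i < a" "a < b" "b \<le> stl la i + la ! i" by auto
    then have "b \<le> stl la (Suc i)" using stl_Suc[of i la] by simp
    then have "sblk (youngJ n la) a b" "b \<le> n"
      using row_sblk[OF sum, of i a b] p stl_le[OF sum, of "Suc i"] by auto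
    then show "p \<in> {(a, b). 1 \<le> a \<and> a < b \<and> b \<le> n \<and> sblk (youngJ n la) a b}" using p by simp
  qed
  moreover have "card (\<Union>i<length la. ?B i) = (\<Sum>i<length la. card (?B i))"
  proof (rule card_UN_disjoint)
    show "\<forall>i\<in>{..<length la}. finite (?B i)"
    proof
      fix i show "finite (?B i)" by (rule finite_subset[of _ "{..stl la i + la ! i} \<times> {..stl la i + la ! i}"]) auto
    qed
    have disj: "?B i \<inter> ?B j = {}" if "i < j" "j < length la" for i j
    proof -
      have "stl la i + la ! i \<le> stl la j" using stl_mono[of "Suc i" j la] stl_Suc[of i la] that by simp
      then show ?thesis by auto
    qed
    show "\<forall>i\<in>{..<length la}. \<forall>j\<in>{..<length la}. i \<noteq> j \<longrightarrow> ?B i \<inter> ?B j = {}"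
    proof (intro ballI impI)
      fix i j assume "i \<in> {..<length la}" "j \<in> {..<length la}" "i \<noteq> j"
      then show "?B i \<inter> ?B j = {}"
        using disj[of i j] disj[of j i] by (cases i j rule: linorder_cases) (auto simp only: Int_commute lessThan_iff)
    qed
  qed simp
  ultimately show ?thesis using len_wJ[OF youngJ_subset, of n la] by (simp add: wlong_wJ card_pairs)
qed

lemma triangle_square: "2 * (\<Sum>j<m. j) + m = m * m" for m :: nat
  by (induction m) auto

lemma stl_padded: "stl la k = (\<Sum>i<k. if i < length la then la ! i else 0)"
proof (induction k)
  case (Suc k)
  then show ?case by (cases "k < length la") (simp_all add: stl_Suc del: take_Suc)
qed simp

text \<open>Twice the length plus n is the sum of the squares of the parts. With f and g the padded
  parts, the sum of g^2 exceeds that of f^2 by the sum of (g - f)^2 plus twice the sum of f (g - f);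
  the latter is nonnegative by summation by parts.\<close>

lemma len_wlong_strict_mono:
  assumes la: "la \<in> partitions n" and nu: "nu \<in> partitions n" and dom: "la \<lhd> nu"
  shows "len n (wlong n la) < len n (wlong n nu)"
proof -
  define f where "f = (\<lambda>i. int (if i < length la then la ! i else 0))"
  define g where "g = (\<lambda>i. int (if i < length nu then nu ! i else 0))"
  define D where "D = (\<lambda>k. \<Sum>i<k. g i - f i)"
  have F: "(\<Sum>i<k. f i) = int (stl la k)" "(\<Sum>i<k. g i) = int (stl nu k)" for k
    by (simp_all add: stl_padded f_def g_def del: of_nat_add)
  have D: "D k \<ge> 0" for k using dom F[of k] by (simp add: D_def sum_subtractf sdominates_def dominates_def)
  define N where "N = max (length la) (length nu)"
  have DN: "D N = 0" using F[of N] partitions_sum[OF la] partitions_sum[OF nu] by (simp add: D_def sum_subtractf N_def)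
  have fd: "f (Suc i) \<le> f i" for i using partitions_antimono[OF la, of i "Suc i"] by (auto simp: f_def)
  \<comment> \<open>Summation by parts in inductive form: f is decreasing and the partial sums D are
    nonnegative by dominance. At k = N the bound is 0.\<close>
  have "(\<Sum>i<k. f i * (g i - f i)) \<ge> f k * D k" for k
  proof (induction k)
    case (Suc k)
    have "D (Suc k) = D k + (g k - f k)" by (simp add: D_def)
    then have "f k * D (Suc k) = f k * D k + f k * (g k - f k)" by (simp only: distrib_left)
    then have "f k * D (Suc k) \<le> (\<Sum>i<Suc k. f i * (g i - f i))" using Suc by simp
    moreover have "f (Suc k) * D (Suc k) \<le> f k * D (Suc k)" using fd D by (intro mult_right_mono) auto
    ultimately show ?case by linarith
  qed (simp add: D_def)
  from this[of N] have A: "(\<Sum>i<N. f i * (g i - f i)) \<ge> 0" using DN by simp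
  have "\<exists>i<N. f i \<noteq> g i"
  proof (rule ccontr)
    assume "\<not> ?thesis"
    then have eq: "f i = g i" if "i < N" for i using that by blast
    have "length la = length nu"
    proof (rule ccontr)
      assume "length la \<noteq> length nu"
      then consider "length la < length nu" | "length nu < length la" by linarith
      then show False
      proof cases
        case 1
        then show False using eq[of "length la"] partitions_pos[OF nu 1] by (simp add: f_def g_def N_def)
      next
        case 2
        then show False using eq[of "length nu"] partitions_pos[OF la 2] by (simp add: f_def g_def N_def)
      qed
    qed
    moreover have "la ! i = nu ! i" if "i < length la" for i
      using eq[of i] that \<open>length la = length nu\<close> by (simp add: f_def g_def N_def)
    ultimately have "la = nu" by (simp add: nth_equalityI)
    then show False using dom by (simp add: sdominates_def)
  qed
  then obtain i0 where "i0 < N" "f i0 \<noteq> g i0" by blast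
  then have B: "(\<Sum>i<N. (g i - f i) * (g i - f i)) > 0"
    by (intro sum_pos2[of _ i0]) (auto simp: zero_less_mult_iff)
  have "(\<Sum>i<N. g i * g i) = (\<Sum>i<N. f i * f i) + (\<Sum>i<N. (g i - f i) * (g i - f i)) + 2 * (\<Sum>i<N. f i * (g i - f i))"
    by (simp add: sum_distrib_left algebra_simps flip: sum.distrib)
  then have C: "(\<Sum>i<N. f i * f i) < (\<Sum>i<N. g i * g i)" using A B by linarith
  have sq: "2 * len n (wlong n mu) + n = (\<Sum>i<N. (if i < length mu then mu ! i else 0) * (if i < length mu then mu ! i else 0))"
    if mu: "mu \<in> partitions n" "length mu \<le> N" for mu
  proof -
    have "2 * len n (wlong n mu) + n = (\<Sum>i<length mu. 2 * (\<Sum>j<mu ! i. j) + mu ! i)"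
      using len_wlong[OF mu(1)] partitions_sum[OF mu(1)]
      by (simp add: sum.distrib sum_distrib_left sum_list_sum_nth atLeast0LessThan)
    also have "\<dots> = (\<Sum>i<length mu. mu ! i * mu ! i)" by (simp only: triangle_square)
    also have "\<dots> = (\<Sum>i<N. (if i < length mu then mu ! i else 0) * (if i < length mu then mu ! i else 0))"
      using mu(2) by (intro sum.mono_neutral_cong_left) auto
    finally show ?thesis .
  qed
  have "int (2 * len n (wlong n la) + n) < int (2 * len n (wlong n nu) + n)"
    using C sq[OF la] sq[OF nu] by (simp only: f_def g_def N_def) (simp only: flip: of_nat_mult of_nat_sum)
  then show ?thesis by simp
qed

lemma dominates_trans: "la \<unlhd> mu \<Longrightarrow> mu \<unlhd> nu \<Longrightarrow> la \<unlhd> nu"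
  unfolding dominates_def using le_trans by blast

lemma dominates_refl [simp]: "la \<unlhd> la"
  by (simp add: dominates_def)

text \<open>Two distinct partitions dominating each other would each have the strictly longer
  longest element.\<close>

lemma dominates_antisym:
  assumes "la \<in> partitions n" "mu \<in> partitions n" "la \<unlhd> mu" "mu \<unlhd> la"
  shows "la = mu"
  using len_wlong_strict_mono[OF assms(1,2)] len_wlong_strict_mono[OF assms(2,1)] assms(3,4)
  by (metis sdominates_def less_asym)

section \<open>Garnir relations\<close>

text \<open>The block boundaries of a composition, including 0. Compositions are needed because the
  Garnir argument rearranges the parts of a partition.\<close>

definition psums :: "nat list \<Rightarrow> nat set" where
  "psums xs = range (stl xs)"

lemma youngJ_psums: "youngJ n c = {k \<in> {1..<n}. k \<notin> psums c}"
proof -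
  have "k \<in> psums c \<longleftrightarrow> (\<exists>i\<ge>1. k = stl c i)" if "k \<ge> 1" for k
  proof -
    have "i \<ge> 1" if "k = stl c i" for i using that \<open>k \<ge> 1\<close> by (cases i) auto
    then show ?thesis by (auto simp: psums_def)
  qed
  then show ?thesis by (auto simp: youngJ_def)
qed

lemma psums_append: "psums (xs @ ys) = psums xs \<union> (\<lambda>j. sum_list xs + j) ` psums ys"
proof (intro equalityI subsetI)
  fix k assume "k \<in> psums (xs @ ys)"
  then obtain i where "k = stl (xs @ ys) i" by (auto simp: psums_def)
  then show "k \<in> psums xs \<union> (\<lambda>j. sum_list xs + j) ` psums ys"
    by (cases "i \<le> length xs") (auto simp: psums_def)
next
  fix k assume "k \<in> psums xs \<union> (\<lambda>j. sum_list xs + j) ` psums ys"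
  then consider i where "k = stl xs i" | i where "k = sum_list xs + stl ys i" by (auto simp: psums_def)
  then show "k \<in> psums (xs @ ys)"
  proof cases
    case 1
    then have "k = stl (xs @ ys) (min i (length xs))" by (cases "i \<le> length xs") (auto simp: min_def)
    then show ?thesis unfolding psums_def by blast
  next
    case 2
    then have "k = stl (xs @ ys) (length xs + i)" by simp
    then show ?thesis unfolding psums_def by blast
  qed
qed

lemma psums_le: "j \<in> psums xs \<Longrightarrow> j \<le> sum_list xs"
  by (auto simp: psums_def intro: stl_le)

lemma psums_single: "psums [a] = {0, a}"
proof -
  have "stl [a] i \<in> {0, a}" for i by (cases i) auto
  then have "psums [a] \<subseteq> {0, a}" unfolding psums_def by (intro image_subsetI)
  moreover have "0 \<in> psums [a]" unfolding psums_def by (rule range_eqI[of _ _ 0]) simp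
  moreover have "a \<in> psums [a]" unfolding psums_def by (rule range_eqI[of _ _ 1]) simp
  ultimately show ?thesis by blast
qed

lemma psums_ones: "psums (replicate m 1) = {0..m}"
proof -
  have "stl (replicate m 1) i = min i m" for i by (simp add: sum_list_replicate take_replicate)
  then have "psums (replicate m 1) = range (\<lambda>i. min i m)" by (simp only: psums_def)
  also have "\<dots> = {0..m}"
  proof (intro equalityI subsetI)
    fix k assume "k \<in> {0..m}"
    then have "k = min k m" by simp
    then show "k \<in> range (\<lambda>i. min i m)" by blast
  qed auto
  finally show ?thesis .
qed

text \<open>The permutation slides the block of length a past the adjacent block of length b. It
  preserves order inside the blocks, so it carries the generators of one Young subgroup to those of
  the rearranged one.\<close>

lemma youngJ_swap:
  assumes n: "sum_list (pre @ [a, b] @ post) = n"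
  shows "\<exists>w\<in>Sym n. \<forall>k'\<in>youngJ n (pre @ [b, a] @ post). \<exists>k\<in>youngJ n (pre @ [a, b] @ post). w k = k' \<and> w (Suc k) = Suc k'"
proof -
  define q where "q = sum_list pre"
  have qn: "q + a + b \<le> n" using n by (simp add: q_def)
  have mem: "k \<in> youngJ n (pre @ [a, b] @ post) \<longleftrightarrow> k \<in> {1..<n} \<and> k \<notin> psums pre \<and> k \<noteq> q \<and> k \<noteq> q + a \<and> k \<noteq> q + a + b
      \<and> k \<notin> (\<lambda>j. q + a + b + j) ` psums post" for k a b
  proof -
    have "psums (pre @ [a, b] @ post) = psums (pre @ [a] @ [b] @ post)" by simp
    also have "\<dots> = psums pre \<union> {q, q + a, q + a + b} \<union> (\<lambda>j. q + a + b + j) ` psums post"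
      unfolding psums_append psums_single by (auto simp: q_def image_Un image_image add.assoc)
    finally show ?thesis by (auto simp: youngJ_psums)
  qed
  define f where "f = (\<lambda>a b k. if q < k \<and> k \<le> q + a then k + b else if q + a < k \<and> k \<le> q + a + b then k - a else k)"
  have inv: "f b a (f a b k) = k" for a b k by (auto simp: f_def)
  have "f a b \<in> Sym n"
    unfolding Sym_def
  proof (intro CollectI bij_imp_permutes)
    show "bij_betw (f a b) {1..n} {1..n}"
      by (rule bij_betw_byWitness[where f' = "f b a"]) (use inv qn in \<open>auto simp: f_def\<close>)
    show "\<And>x. x \<notin> {1..n} \<Longrightarrow> f a b x = x" using qn by (auto simp: f_def)
  qed
  moreover have "\<exists>k\<in>youngJ n (pre @ [a, b] @ post). f a b k = k' \<and> f a b (Suc k) = Suc k'"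
    if "k' \<in> youngJ n (pre @ [b, a] @ post)" for k'
  proof (rule bexI[of _ "f b a k'"])
    have k': "k' \<in> {1..<n}" "k' \<notin> psums pre" "k' \<noteq> q" "k' \<noteq> q + b" "k' \<noteq> q + b + a" "k' \<notin> (\<lambda>j. q + b + a + j) ` psums post"
      using that mem[of k' b a] by auto
    have pre: "j \<in> psums pre \<Longrightarrow> j \<le> q" for j using psums_le by (simp add: q_def)
    consider "k' < q" | "q < k'" "k' < q + b" | "q + b < k'" "k' < q + b + a" | "q + b + a < k'" using k' by linarith
    then show "f b a k' \<in> youngJ n (pre @ [a, b] @ post)"
    proof cases
      case 1
      then show ?thesis unfolding mem using k' by (auto simp: f_def)
    next
      case 2
      then have "f b a k' = k' + a" by (simp add: f_def)
      then show ?thesis unfolding mem using 2 qn pre[of "k' + a"] by auto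
    next
      case 3
      then have "f b a k' = k' - b" by (simp add: f_def)
      then show ?thesis unfolding mem using 3 qn pre[of "k' - b"] by auto
    next
      case 4
      then have "f b a k' = k'" by (simp add: f_def)
      then show ?thesis unfolding mem using 4 k' by (auto simp: add_ac)
    qed
    show "f a b (f b a k') = k' \<and> f a b (Suc (f b a k')) = Suc k'" using inv k' by (auto simp: f_def)
  qed
  ultimately show ?thesis by blast
qed

lemma hmul_commute_far:
  assumes K: "{p..<q} \<subseteq> {1..<n}" and k: "k \<in> {1..<n}" "Suc k < p"
  shows "hmul n (hT (sgen k)) (EJ n {p..<q}) = hmul n (EJ n {p..<q}) (hT (sgen k))"
proof -
  have lk: "len n (sgen k) = 1" using len_right_cases[OF Sym_id k(1)] by auto
  have c: "hmul n (hT (sgen k)) (hT u) = hmul n (hT u) (hT (sgen k))" if u: "u \<in> WJ {p..<q}" for u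
  proof -
    have uS: "u \<in> Sym n" using u WJ_Sym[OF K] by blast
    have fix': "u a = a" if "a < p" for a
    proof (rule ccontr)
      assume "u a \<noteq> a"
      then have "min a (u a) \<in> {min a (u a)..<max a (u a)}" by auto
      then have "min a (u a) \<in> {p..<q}" using WJ_sblk[OF u, of a] unfolding sblk_def by blast
      then show False using that by auto
    qed
    have comm: "sgen k \<circ> u = u \<circ> sgen k"
    proof
      fix a
      show "(sgen k \<circ> u) a = (u \<circ> sgen k) a"
      proof (cases "a < p")
        case True
        then show ?thesis using fix'[of a] fix'[of k] fix'[of "Suc k"] k by (auto simp: sgen_def)
      next
        case False
        have "\<not> u a < p"
        proof
          assume "u a < p"
          then have "u (u a) = u a" by (rule fix')
          then show False using Sym_inj[OF uS] False \<open>u a < p\<close> by auto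
        qed
        then show ?thesis using False k by (auto simp: sgen_def)
      qed
    qed
    have "len n (u \<circ> sgen k) = Suc (len n u)"
      using k fix'[of k] fix'[of "Suc k"] by (intro len_right_ascent[OF uS k(1)]) auto
    then show ?thesis
      using hmul_hT_hT[OF sgen_Sym[OF k(1)] uS] hmul_hT_hT[OF uS sgen_Sym[OF k(1)]] comm lk by simp
  qed
  have "hmul n (hT (sgen k)) (EJ n {p..<q}) = (\<lambda>y. \<Sum>u\<in>WJ {p..<q}. qv ^ len n u * hmul n (hT (sgen k)) (hT u) y)"
    by (subst EJ_expand[OF K]) (rule hmul_sum_right)
  also have "\<dots> = (\<lambda>y. \<Sum>u\<in>WJ {p..<q}. qv ^ len n u * hmul n (hT u) (hT (sgen k)) y)"
    by (simp add: c cong: sum.cong)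
  also have "\<dots> = hmul n (EJ n {p..<q}) (hT (sgen k))"
    by (subst EJ_expand[OF K]) (rule hmul_sum_left[symmetric])
  finally show ?thesis .
qed

lemma hmul_hT_leig:
  assumes J: "J \<subseteq> {1..<n}" and E: "leig n J E" and xu: "x \<in> XJ n J" "u \<in> WJ J"
  shows "hmul n (hT (x \<circ> u)) E = (\<lambda>y. qv ^ len n u * hmul n (hT x) E y)"
proof -
  have "hT (x \<circ> u) = hmul n (hT x) (hT u)"
    using hmul_hT_hT[OF XJ_Sym[OF J xu(1)] WJ_Sym[OF J xu(2)] len_XJ_WJ[OF J xu]] by simp
  then have "hmul n (hT (x \<circ> u)) E = hmul n (hT x) (hmul n (hT u) E)"
    using XJ_Sym[OF J xu(1)] WJ_Sym[OF J xu(2)] leig_HK[OF E] by (simp add: hmul_assoc hT_HK)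
  then show ?thesis using leig_WJ[OF J E xu(2)] by (simp add: hmul_smult_right)
qed

section \<open>Garnir elements in the representations, and rank one of the sign idempotent\<close>

context hecke_reps
begin

lemma El_HK [simp]: "El la \<in> HK n"
  by (rule EJ_HK[OF youngJ_subset])

lemma R_zero_left: "nu \<in> Pt \<Longrightarrow> h \<in> HK n \<Longrightarrow> g \<in> HK n \<Longrightarrow> R nu h = (\<lambda>i j. 0) \<Longrightarrow> R nu (hmul n h g) = (\<lambda>i j. 0)"
  and R_zero_right: "nu \<in> Pt \<Longrightarrow> h \<in> HK n \<Longrightarrow> g \<in> HK n \<Longrightarrow> R nu g = (\<lambda>i j. 0) \<Longrightarrow> R nu (hmul n h g) = (\<lambda>i j. 0)"
  by (simp_all add: R_hmul) (simp_all add: MM_def)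

text \<open>On a left eigenvector E acts as the nonzero scalar \<open>pJ\<close>, so it dies
  together with E.\<close>

lemma R_leig_zero:
  assumes nu: "nu \<in> Pt" and J: "J \<subseteq> {1..<n}" and g: "leig n J g" and z: "R nu (EJ n J) = (\<lambda>i j. 0)"
  shows "R nu g = (\<lambda>i j. 0)"
proof (intro ext)
  fix i j
  have "R nu (\<lambda>y. pJ n J * g y) i j = 0"
    using R_zero_left[OF nu EJ_HK[OF J] leig_HK[OF g] z] EJ_leig[OF J g] by simp
  then show "R nu g i j = 0" using pJ_nonzero[OF J] by (simp add: R_smult)
qed

text \<open>T_w E_J is a left eigenvector for J', because s_k' w = w s_k with lengths adding on both
  sides; hence it is killed. As T_w is invertible, with inverse built from \<open>barT\<close>, so
  is E_J.\<close>

lemma R_EJ_conj_zero: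
  assumes nu: "nu \<in> Pt" and J: "J \<subseteq> {1..<n}" and J': "J' \<subseteq> {1..<n}" and w: "w \<in> Sym n"
    and c: "\<forall>k'\<in>J'. \<exists>k\<in>J. w k = k' \<and> w (Suc k) = Suc k'" and z: "R nu (EJ n J') = (\<lambda>i j. 0)"
  shows "R nu (EJ n J) = (\<lambda>i j. 0)"
proof -
  let ?E = "EJ n J"
  have E: "?E \<in> HK n" by (rule EJ_HK[OF J])
  have "leig n J' (hmul n (hT w) ?E)"
    unfolding leig_def
  proof (intro conjI hmul_HK E ballI)
    fix k' assume k'J: "k' \<in> J'"
    then obtain k where k: "k \<in> J" "w k = k'" "w (Suc k) = Suc k'" using c by blast
    have kn: "k \<in> {1..<n}" "k' \<in> {1..<n}" using k k'J J J' by auto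
    have comm: "sgen k' \<circ> w = w \<circ> sgen k"
    proof
      fix a
      show "(sgen k' \<circ> w) a = (w \<circ> sgen k) a"
        using k Sym_inj[OF w, of a k] Sym_inj[OF w, of a "Suc k"]
        by (cases "a = k"; cases "a = Suc k") (auto simp: sgen_def)
    qed
    have "len n (w \<circ> sgen k) = Suc (len n w)" using k by (intro len_right_ascent[OF w kn(1)]) simp
    moreover have "len n (sgen k) = 1" "len n (sgen k') = 1"
      using len_right_cases[OF Sym_id kn(1)] len_right_cases[OF Sym_id kn(2)] by auto
    ultimately have TT: "hmul n (hT (sgen k')) (hT w) = hmul n (hT w) (hT (sgen k))"
      using hmul_hT_hT[OF sgen_Sym[OF kn(2)] w] hmul_hT_hT[OF w sgen_Sym[OF kn(1)]] comm by simp
    have "mulTs n k' (hmul n (hT w) ?E) = hmul n (hmul n (hT (sgen k')) (hT w)) ?E"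
      using E w kn by (simp add: hmul_sgen_left[symmetric] hmul_HK hmul_assoc hT_HK sgen_Sym)
    also have "\<dots> = hmul n (hT w) (mulTs n k ?E)"
      unfolding TT using E w kn by (simp add: hmul_assoc hT_HK sgen_Sym hmul_sgen_left)
    also have "\<dots> = (\<lambda>y. qv * hmul n (hT w) ?E y)"
      using leig_EJ[OF J] k(1) by (simp add: leig_def hmul_smult_right)
    finally show "mulTs n k' (hmul n (hT w) ?E) = (\<lambda>y. qv * hmul n (hT w) ?E y)" .
  qed
  then have g: "R nu (hmul n (hT w) ?E) = (\<lambda>i j. 0)" using R_leig_zero[OF nu J' _ z] by blast
  have wi: "inv w \<in> Sym n" using w Sym_inv by blast
  have "hstar n (hmul n (hT (inv w)) (barT n w)) = hT id"
    using barT_inverse[OF w] hstar_hT[OF Sym_id] by (simp add: inv_id)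
  then have a: "hmul n (hstar n (barT n w)) (hT w) = hT id"
    using w wi by (simp add: hstar_hmul hT_HK barT_HK hstar_hT)
  have "?E = hmul n (hmul n (hstar n (barT n w)) (hT w)) ?E" using a E by (simp add: hmul_id_left)
  also have "\<dots> = hmul n (hstar n (barT n w)) (hmul n (hT w) ?E)" using E w by (simp add: hmul_assoc hT_HK)
  finally have eq: "?E = hmul n (hstar n (barT n w)) (hmul n (hT w) ?E)" .
  have "R nu (hmul n (hstar n (barT n w)) (hmul n (hT w) ?E)) = (\<lambda>i j. 0)"
    by (rule R_zero_right[OF nu hstar_HK hmul_HK[OF E] g])
  then show ?thesis by (simp only: eq[symmetric])
qed

lemma R_EJ_move_zero:
  assumes nu: "nu \<in> Pt" and "sum_list (pre @ [x] @ zs @ post) = n"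
    "R nu (EJ n (youngJ n (pre @ [x] @ zs @ post))) = (\<lambda>i j. 0)"
  shows "R nu (EJ n (youngJ n (pre @ zs @ [x] @ post))) = (\<lambda>i j. 0)"
  using assms(2,3)
proof (induction zs arbitrary: pre)
  case (Cons z zs)
  have "sum_list (pre @ [z, x] @ zs @ post) = n" using Cons.prems by simp
  from youngJ_swap[OF this] obtain w where w: "w \<in> Sym n"
    "\<forall>k'\<in>youngJ n (pre @ [x, z] @ zs @ post). \<exists>k\<in>youngJ n (pre @ [z, x] @ zs @ post). w k = k' \<and> w (Suc k) = Suc k'"
    by (elim bexE)
  have "R nu (EJ n (youngJ n (pre @ [x, z] @ zs @ post))) = (\<lambda>i j. 0)" using Cons.prems by simp
  then have "R nu (EJ n (youngJ n (pre @ [z, x] @ zs @ post))) = (\<lambda>i j. 0)"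
    by (rule R_EJ_conj_zero[OF nu youngJ_subset youngJ_subset w])
  then have "R nu (EJ n (youngJ n ((pre @ [z]) @ zs @ [x] @ post))) = (\<lambda>i j. 0)"
    using \<open>sum_list (pre @ [z, x] @ zs @ post) = n\<close> by (intro Cons.IH) simp_all
  then show ?case by simp
qed simp

text \<open>The composition below merges the part of row \<open>r\<close> from column \<open>c\<close> on with the first \<open>c\<close> entries of
  row \<open>r + 1\<close>; sorting it gives a partition whose first \<open>r + 1\<close> parts sum to one more than those of \<open>la\<close>.\<close>

lemma garnir_vanish:
  assumes la: "la \<in> Pt" and r: "Suc r < length la" and c: "1 \<le> c" "c \<le> la ! Suc r"
  defines "K \<equiv> {stl la r + c..<stl la (Suc r) + c}"
  shows "K \<subseteq> {1..<n}" "R la (hmul n (EJ n K) (El la)) = (\<lambda>i j. 0)"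
proof -
  have sum: "sum_list la = n" using la by (rule partitions_sum)
  define a where "a = la ! r"
  have st1: "stl la (Suc r) = stl la r + a" using stl_Suc[of r la] r by (simp add: a_def)
  have st2: "stl la (Suc (Suc r)) = stl la (Suc r) + la ! Suc r" using stl_Suc[of "Suc r" la] r by simp
  have le: "stl la (Suc r) + la ! Suc r \<le> n" using stl_le[OF sum, of "Suc (Suc r)"] st2 by simp
  have a1: "1 \<le> a" using partitions_pos[OF la, of r] r by (simp add: a_def)
  show K: "K \<subseteq> {1..<n}" unfolding K_def using c le by auto
  define pre where "pre = take r la"
  \<comment> \<open>The parts before row r are at least a. Those greater than a precede the new part
    a + 1 and those equal to a follow it, so that \<open>nu\<close> is a partition.\<close>
  define A where "A = takeWhile (\<lambda>x. a < x) pre"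
  define B where "B = dropWhile (\<lambda>x. a < x) pre"
  have pre: "pre = A @ B" by (simp add: A_def B_def)
  have lpre: "length pre = r" using r by (simp add: pre_def)
  have spre: "sum_list pre = stl la r" by (simp add: pre_def)
  have sorted_pre: "sorted_wrt (\<ge>) pre" using la by (simp add: pre_def partitions_def sorted_wrt_take)
  have pre_ge: "a \<le> x" if "x \<in> set pre" for x
  proof -
    obtain i where "i < r" "x = la ! i" using \<open>x \<in> set pre\<close> r by (auto simp: pre_def in_set_conv_nth)
    then show ?thesis using partitions_antimono[OF la, of i r] r by (simp add: a_def)
  qed
  have A_gt: "a < x" if "x \<in> set A" for x using that set_takeWhileD unfolding A_def by metis
  have B_eq: "x = a" if "x \<in> set B" for x
  proof -
    have "B \<noteq> []" using that by auto
    then have hd: "\<not> a < hd B" unfolding B_def by (rule hd_dropWhile)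
    have "sorted_wrt (\<ge>) B" using sorted_pre pre by (simp add: sorted_wrt_append)
    then have "x \<le> hd B" using that by (cases B) auto
    moreover have "a \<le> x" using pre_ge that pre by simp
    ultimately show ?thesis using hd by simp
  qed
  define m where "m = n - Suc (stl la (Suc r))"
  have m: "stl la (Suc r) + 1 + m = n" "c - 1 \<le> m" using le c by (auto simp: m_def)
  \<comment> \<open>The boxes left over become parts 1. Of these, c - 1 are listed separately: moved
    in front of a + 1, they stand for the first c - 1 boxes of row r.\<close>
  define nu where "nu = A @ [a + 1] @ (B @ replicate (c - 1) 1) @ replicate (m - (c - 1)) 1"
  have nu_sum: "sum_list nu = n"
    using m spre st1 unfolding nu_def pre by (simp add: sum_list_replicate)
  have sA: "sorted_wrt (\<ge>) A" "sorted_wrt (\<ge>) B" using sorted_pre pre by (simp_all add: sorted_wrt_append)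
  have "sorted_wrt (\<ge>) (replicate k (1::nat))" for k by (induction k) auto
  then have "sorted_wrt (\<ge>) nu"
    unfolding nu_def using sA A_gt B_eq a1 by (fastforce simp: sorted_wrt_append)
  moreover have "0 \<notin> set nu" unfolding nu_def using A_gt B_eq a1 by fastforce
  ultimately have nuP: "nu \<in> Pt" using nu_sum by (simp add: partitions_def)
  have "stl nu (Suc r) = stl la (Suc r) + 1"
  proof -
    have "length A + length B = r" using lpre pre by simp
    then have "Suc r = length (A @ [a + 1] @ B)" by simp
    moreover have "nu = (A @ [a + 1] @ B) @ replicate (c - 1) 1 @ replicate (m - (c - 1)) 1" by (simp add: nu_def)
    ultimately have "take (Suc r) nu = A @ [a + 1] @ B"
      using append_eq_conv_conj[of "A @ [a + 1] @ B" _ nu] by metis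
    then show ?thesis using spre st1 pre by simp
  qed
  then have "\<not> nu \<unlhd> la" unfolding dominates_def by (metis Suc_eq_plus1 Suc_n_not_le_n)
  then have z0: "R la (EJ n (youngJ n nu)) = (\<lambda>i j. 0)" using R_El_zero'[OF nuP la] by blast
  define cc where "cc = A @ (B @ replicate (c - 1) 1) @ [a + 1] @ replicate (m - (c - 1)) 1"
  have z: "R la (EJ n (youngJ n cc)) = (\<lambda>i j. 0)"
    using R_EJ_move_zero[OF la nu_sum[unfolded nu_def] z0[unfolded nu_def]] by (simp only: cc_def)
  have cc_psums: "psums pre \<subseteq> psums cc" "\<And>j. j \<le> c - 1 \<Longrightarrow> stl la r + j \<in> psums cc"
    "\<And>j. j \<le> m - (c - 1) \<Longrightarrow> stl la (Suc r) + c + j \<in> psums cc"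
  proof -
    have cc: "cc = pre @ replicate (c - 1) 1 @ [a + 1] @ replicate (m - (c - 1)) 1" by (simp add: cc_def pre)
    have ps: "psums cc = psums pre \<union> (\<lambda>j. stl la r + j) ` ({0..c - 1} \<union> (\<lambda>j. (c - 1) + j) ` ({0, a + 1} \<union> (\<lambda>j. (a + 1) + j) ` {0..m - (c - 1)}))"
      unfolding cc psums_append psums_ones psums_single spre by (simp add: sum_list_replicate)
    show "psums pre \<subseteq> psums cc" "\<And>j. j \<le> c - 1 \<Longrightarrow> stl la r + j \<in> psums cc" unfolding ps by auto
    show "stl la (Suc r) + c + j \<in> psums cc" if "j \<le> m - (c - 1)" for j
    proof -
      have "stl la (Suc r) + c + j = stl la r + ((c - 1) + ((a + 1) + j))" using st1 c by simp
      then show ?thesis unfolding ps using that by (intro UnI2) (auto intro!: imageI)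
    qed
  qed
  have J2: "k \<in> K \<or> (k \<in> youngJ n la \<and> k < stl la r)" if "k \<in> youngJ n cc" for k
  proof -
    have k: "k \<in> {1..<n}" "k \<notin> psums cc" using that by (auto simp: youngJ_psums)
    show ?thesis
    proof (cases "k < stl la r")
      case True
      have "k \<noteq> stl la i" for i
      proof (cases "i \<le> r")
        case True
        then have "stl la i = stl pre i" by (simp add: pre_def min_def)
        then have "stl la i \<in> psums pre" unfolding psums_def by (metis rangeI)
        then show ?thesis using k cc_psums(1) by auto
      next
        case False
        then show ?thesis using stl_mono[of r i la] \<open>k < stl la r\<close> by auto
      qed
      then show ?thesis using True k by (auto simp: youngJ_def)
    next
      case False
      then obtain j where j: "k = stl la r + j" using le_Suc_ex linorder_not_less by blast
      have "\<not> j \<le> c - 1" using cc_psums(2) k j by blast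
      moreover have "k < stl la (Suc r) + c"
      proof (rule ccontr)
        assume "\<not> ?thesis"
        then obtain i where i: "k = stl la (Suc r) + c + i" using le_Suc_ex linorder_not_less by blast
        then have "i \<le> m - (c - 1)" using k(1) m c by auto
        then show False using cc_psums(3) k i by blast
      qed
      ultimately show ?thesis using j c by (simp add: K_def)
    qed
  qed
  let ?g = "hmul n (EJ n K) (El la)"
  have lK: "leig n K ?g" using leig_hmul[OF K leig_EJ[OF K]] by simp
  \<comment> \<open>A generator of the rearranged Young subgroup lies in K, where E_K supplies the
    eigenvalue, or in a row before r. In the second case its index is far enough from K to commute
    with E_K, and then E_la supplies the eigenvalue.\<close>
  have "leig n (youngJ n cc) ?g"
    unfolding leig_def
  proof (intro conjI hmul_HK El_HK ballI)
    fix k assume "k \<in> youngJ n cc"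
    then consider "k \<in> K" | "k \<in> youngJ n la" "k < stl la r" using J2 by blast
    then show "mulTs n k ?g = (\<lambda>y. qv * ?g y)"
    proof cases
      case 1
      then show ?thesis using lK by (simp add: leig_def)
    next
      case 2
      then have kn: "k \<in> {1..<n}" using youngJ_subset by blast
      have KE: "EJ n K \<in> HK n" by (rule EJ_HK[OF K])
      have "mulTs n k ?g = hmul n (hmul n (hT (sgen k)) (EJ n K)) (El la)"
        using kn KE by (simp add: hmul_sgen_left[symmetric] hmul_HK hmul_assoc hT_HK sgen_Sym)
      also have "\<dots> = hmul n (hmul n (EJ n K) (hT (sgen k))) (El la)"
        using hmul_commute_far[OF K[unfolded K_def] kn] 2 c by (simp add: K_def)
      also have "\<dots> = hmul n (EJ n K) (mulTs n k (El la))"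
        using kn KE by (simp add: hmul_assoc hT_HK sgen_Sym hmul_sgen_left)
      also have "\<dots> = (\<lambda>y. qv * ?g y)"
        using leig_EJ[OF youngJ_subset, of n la] 2 by (simp add: leig_def hmul_smult_right)
      finally show ?thesis .
    qed
  qed
  then show "R la ?g = (\<lambda>i j. 0)" using R_leig_zero[OF la youngJ_subset _ z] by blast
qed

text \<open>Expanding E_K E_la along cosets and multiplying by T_y gives a relation among T_(y g)
  E_la with g in G. The column violation forces g0 to be the longest element of G, so T_x E_la is
  expressed by terms of smaller length.\<close>

lemma garnir_relation:
  assumes la: "la \<in> Pt" and x: "x \<in> XJ n (Jl la)" and r: "Suc r < length la" and c: "1 \<le> c" "c \<le> la ! Suc r"
    and viol: "x (stl la (Suc r) + c) < x (stl la r + c)"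
  obtains y g0 G where "y \<in> Sym n" "finite G" "g0 \<in> G" "x = y \<circ> g0"
    "\<And>g. g \<in> G \<Longrightarrow> y \<circ> g \<in> Sym n \<and> len n (y \<circ> g) = len n y + len n g"
    "\<And>g. g \<in> G \<Longrightarrow> g \<noteq> g0 \<Longrightarrow> len n g < len n g0"
    "\<And>nu. nu \<in> Pt \<Longrightarrow> \<not> la \<lhd> nu \<Longrightarrow> R nu (\<lambda>z. \<Sum>g\<in>G. qv ^ len n g * hmul n (hT (y \<circ> g)) (El la) z) = (\<lambda>i j. 0)"
proof -
  let ?p = "stl la r + c" and ?q = "stl la (Suc r) + c" and ?m = "stl la (Suc r)"
  define K where "K = {?p..<?q}"
  \<comment> \<open>K without the boundary between the two rows. The remaining generators lie in the
    Young subgroup of \<open>la\<close>, so their part of E_K is absorbed by E_la.\<close>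
  define K' where "K' = K - {?m}"
  note gv = garnir_vanish[OF la r c, folded K_def]
  note K = gv(1)
  have K': "K' \<subseteq> {1..<n}" "K' \<subseteq> K" using K by (auto simp: K'_def)
  have st1: "?m = stl la r + la ! r" using stl_Suc[of r la] r by simp
  have st2: "stl la (Suc (Suc r)) = ?m + la ! Suc r" using stl_Suc[of "Suc r" la] r by simp
  have cr: "c \<le> la ! r" using partitions_antimono[OF la, of r "Suc r"] r c by simp
  have mK: "?m \<in> K" unfolding K_def using c cr st1 by simp
  have K'J: "K' \<subseteq> Jl la"
  proof
    fix k assume k: "k \<in> K'"
    then have k': "?p \<le> k" "k < ?q" "k \<noteq> ?m" by (auto simp: K'_def K_def)
    have "k \<noteq> stl la i" for i
    proof -
      consider "i \<le> r" | "i = Suc r" | "i \<ge> Suc (Suc r)" by linarith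
      then show ?thesis
      proof cases
        case 1 then show ?thesis using stl_mono[OF 1, of la] k' c by simp
      next
        case 2 then show ?thesis using k' by simp
      next
        case 3 then show ?thesis using stl_mono[OF 3, of la] k' c st2 by simp
      qed
    qed
    then show "k \<in> Jl la" using k K'(1) by (auto simp: youngJ_def)
  qed
  have E': "leig n K' (El la)" using leig_subset[OF leig_EJ[OF youngJ_subset] K'J] .
  define G where "G = {g \<in> XJ n K'. g \<in> WJ K}"
  have fG: "finite G" using finite_XJ[OF K'(1)] by (simp add: G_def)
  \<comment> \<open>Write w = g u with u in the subgroup of K'. The factor u contributes qv^(l(u))
    from E_K and again from E_la, and these add up to \<open>pJ n K'\<close>.\<close>
  have GE: "hmul n (EJ n K) (El la) = (\<lambda>z. pJ n K' * (\<Sum>g\<in>G. qv ^ len n g * hmul n (hT g) (El la) z))"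
  proof
    fix z
    have "hmul n (EJ n K) (El la) z = (\<Sum>w\<in>Sym n. EJ n K w * hmul n (hT w) (El la) z)"
      by (subst HK_expand[OF EJ_HK[OF K]]) (simp only: hmul_sum_left)
    also have "\<dots> = (\<Sum>g\<in>XJ n K'. \<Sum>u\<in>WJ K'. EJ n K (g \<circ> u) * hmul n (hT (g \<circ> u)) (El la) z)"
      by (rule sum_Sym_XJ_WJ[OF K'(1)])
    also have "\<dots> = (\<Sum>g\<in>XJ n K'. if g \<in> WJ K then pJ n K' * (qv ^ len n g * hmul n (hT g) (El la) z) else 0)"
    proof (rule sum.cong[OF refl])
      fix g assume g: "g \<in> XJ n K'"
      have iff: "g \<circ> u \<in> WJ K \<longleftrightarrow> g \<in> WJ K" if "u \<in> WJ K'" for u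
      proof -
        have u: "u \<in> WJ K" using that WJ_mono[OF K'(2)] by blast
        have "g = (g \<circ> u) \<circ> inv u" using Sym_inv_comp(1)[OF WJ_Sym[OF K u]] by (simp add: comp_assoc)
        then show ?thesis using WJ_comp[of g K u] WJ_comp[of "g \<circ> u" K "inv u"] WJ_inv[OF u] u by metis
      qed
      have "EJ n K (g \<circ> u) * hmul n (hT (g \<circ> u)) (El la) z =
          (if g \<in> WJ K then qv ^ (2 * len n u) * (qv ^ len n g * hmul n (hT g) (El la) z) else 0)" if u: "u \<in> WJ K'" for u
        using iff[OF u] len_XJ_WJ[OF K'(1) g u] hmul_hT_leig[OF K'(1) E' g u]
        by (simp add: EJ_def power_add mult_2)
      then show "(\<Sum>u\<in>WJ K'. EJ n K (g \<circ> u) * hmul n (hT (g \<circ> u)) (El la) z) =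
          (if g \<in> WJ K then pJ n K' * (qv ^ len n g * hmul n (hT g) (El la) z) else 0)"
        by (simp add: pJ_def sum_distrib_right)
    qed
    also have "\<dots> = (\<Sum>g\<in>G. pJ n K' * (qv ^ len n g * hmul n (hT g) (El la) z))"
      unfolding G_def using finite_XJ[OF K'(1)] by (intro sum.inter_filter[symmetric])
    finally show "hmul n (EJ n K) (El la) z = pJ n K' * (\<Sum>g\<in>G. qv ^ len n g * hmul n (hT g) (El la) z)"
      by (simp add: sum_distrib_left)
  qed
  obtain y g0 where yg: "y \<in> XJ n K" "g0 \<in> WJ K" "x = y \<circ> g0"
    using XJ_WJ_decomp[OF K XJ_Sym[OF youngJ_subset x]] by blast
  have yS: "y \<in> Sym n" using yg XJ_Sym[OF K] by blast
  have g0S: "g0 \<in> Sym n" using yg WJ_Sym[OF K] by blast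
  have "g0 \<in> XJ n K'"
    unfolding XJ_def
  proof (intro CollectI conjI g0S ballI)
    fix k assume k: "k \<in> K'"
    then have "x k < x (Suc k)" using x K'J by (auto simp: XJ_def)
    then show "g0 k < g0 (Suc k)" using XJ_comp_less_iff[OF K yg(1,2), of k] k K'(2) yg(3) by auto
  qed
  then have g0G: "g0 \<in> G" using yg by (simp add: G_def)
  have bpq: "sblk K a b" if "?p \<le> a" "a \<le> ?q" "?p \<le> b" "b \<le> ?q" for a b
    using that by (auto simp: sblk_def K_def)
  have g0pq: "g0 ?q < g0 ?p"
  proof -
    have pq: "?p \<le> ?q" using st1 by simp
    have "sblk K (g0 ?q) (g0 ?p)"
      using WJ_sblk[OF yg(2)] bpq[of ?q ?p] pq sblk_trans sblk_sym by (meson order_refl)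
    then show ?thesis using XJ_less_iff[OF K yg(1)] viol yg(3) by simp
  qed
  let ?w' = "wJ n K'"
  have w': "?w' \<in> WJ K'" by (rule wJ_WJ[OF K'(1)])
  have w'K: "?w' \<in> WJ K" using w' WJ_mono[OF K'(2)] by blast
  have w'S: "?w' \<in> Sym n" using w'K WJ_Sym[OF K] by blast
  \<comment> \<open>So g0 times the longest element of the K'-subgroup is the longest element for K.
    Inside the two rows this is the choice of w'; at the boundary it is the violation: all of the
    right part lies below all of the left part.\<close>
  have desc: "(g0 \<circ> ?w') (Suc k) < (g0 \<circ> ?w') k" if k: "k \<in> K" for k
  proof (cases "k = ?m")
    case False
    then have kK': "k \<in> K'" using k by (simp add: K'_def)
    have "\<not> ?w' k < ?w' (Suc k)" using wJ_descent[OF K'(1) kK'] by simp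
    then have "\<not> (g0 \<circ> ?w') k < (g0 \<circ> ?w') (Suc k)"
      using XJ_comp_less_iff[OF K'(1) \<open>g0 \<in> XJ n K'\<close> w' kK'] by simp
    then show ?thesis using Sym_inj[OF Sym_comp[OF g0S w'S], of k "Suc k"] by simp
  next
    case True
    have bl: "sblk K' a b" if "?p \<le> a" "a \<le> b" "b \<le> ?m" for a b
      using that c by (auto simp: sblk_def K'_def K_def)
    have br: "sblk K' a b" if "?m < a" "a \<le> b" "b \<le> ?q" for a b
      using that st1 cr by (auto simp: sblk_def K'_def K_def)
    have pm: "?p \<le> ?m" "?m < ?q" using st1 cr c by auto
    have nm: "?m \<notin> K'" "\<And>a. a < ?p \<Longrightarrow> a \<notin> K'" "\<And>a. ?q \<le> a \<Longrightarrow> a \<notin> K'" by (auto simp: K'_def K_def)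
    have s1: "sblk K' ?m (?w' ?m)" and s2: "sblk K' (Suc ?m) (?w' (Suc ?m))" using WJ_sblk[OF w'] by blast+
    have l: "?p \<le> ?w' ?m" "?w' ?m \<le> ?m"
    proof -
      show "?w' ?m \<le> ?m"
      proof (rule ccontr)
        assume "\<not> ?thesis"
        then have "?m \<in> {min ?m (?w' ?m)..<max ?m (?w' ?m)}" by auto
        then show False using s1 nm(1) unfolding sblk_def by blast
      qed
      show "?p \<le> ?w' ?m"
      proof (rule ccontr)
        assume "\<not> ?thesis"
        then have "?w' ?m \<in> {min ?m (?w' ?m)..<max ?m (?w' ?m)}" "?w' ?m < ?p" using pm by auto
        then show False using s1 nm(2) unfolding sblk_def by blast
      qed
    qed
    have rr: "?m < ?w' (Suc ?m)" "?w' (Suc ?m) \<le> ?q"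
    proof -
      show "?m < ?w' (Suc ?m)"
      proof (rule ccontr)
        assume "\<not> ?thesis"
        then have "?m \<in> {min (Suc ?m) (?w' (Suc ?m))..<max (Suc ?m) (?w' (Suc ?m))}" by auto
        then show False using s2 nm(1) unfolding sblk_def by blast
      qed
      show "?w' (Suc ?m) \<le> ?q"
      proof (rule ccontr)
        assume "\<not> ?thesis"
        then have "?q \<in> {min (Suc ?m) (?w' (Suc ?m))..<max (Suc ?m) (?w' (Suc ?m))}" using pm by auto
        then show False using s2 nm(3)[of ?q] unfolding sblk_def by blast
      qed
    qed
    have "g0 ?p \<le> g0 (?w' ?m)"
      using XJ_mono[OF K'(1) \<open>g0 \<in> XJ n K'\<close> bl[of ?p "?w' ?m"]] l by (cases "?p = ?w' ?m") auto
    moreover have "g0 (?w' (Suc ?m)) \<le> g0 ?q"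
      using XJ_mono[OF K'(1) \<open>g0 \<in> XJ n K'\<close> br[of "?w' (Suc ?m)" ?q]] rr by (cases "?w' (Suc ?m) = ?q") auto
    ultimately show ?thesis using g0pq True by simp
  qed
  have longest: "len n g < len n g0" if g: "g \<in> G" "g \<noteq> g0" for g
  proof (rule ccontr)
    assume "\<not> ?thesis"
    moreover have gX: "g \<in> XJ n K'" "g \<in> WJ K" using g by (auto simp: G_def)
    ultimately have "len n (g0 \<circ> ?w') \<le> len n (g \<circ> ?w')"
      using len_XJ_WJ[OF K'(1) _ w'] \<open>g0 \<in> XJ n K'\<close> by simp
    then have "g \<circ> ?w' = g0 \<circ> ?w'"
      using longest_unique[OF K WJ_comp[OF yg(2) w'K] desc WJ_comp[OF gX(2) w'K]] by blast
    then show False using XJ_WJ_unique[OF K'(1) gX(1) \<open>g0 \<in> XJ n K'\<close> w' w'] g by blast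
  qed
  have len_add: "y \<circ> g \<in> Sym n \<and> len n (y \<circ> g) = len n y + len n g" if "g \<in> G" for g
    using that yS WJ_Sym[OF K] len_XJ_WJ[OF K yg(1)] by (auto simp: G_def intro: Sym_comp)
  have van: "R nu (\<lambda>z. \<Sum>g\<in>G. qv ^ len n g * hmul n (hT (y \<circ> g)) (El la) z) = (\<lambda>i j. 0)"
    if nu: "nu \<in> Pt" "\<not> la \<lhd> nu" for nu
  proof -
    have z: "R nu (hmul n (EJ n K) (El la)) = (\<lambda>i j. 0)"
    proof (cases "nu = la")
      case True
      then show ?thesis using gv(2) by simp
    next
      case False
      then have "\<not> la \<unlhd> nu" using nu by (auto simp: sdominates_def)
      then show ?thesis using R_zero_right[OF nu(1) EJ_HK[OF K] El_HK R_El_zero'[OF la nu(1)]] by blast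
    qed
    let ?S = "\<lambda>z. \<Sum>g\<in>G. qv ^ len n g * hmul n (hT g) (El la) z"
    have S: "?S \<in> HK n" by (intro HK_sum hmul_HK El_HK)
    have "R nu ?S = (\<lambda>i j. 0)"
    proof (intro ext)
      fix i j
      have "R nu (\<lambda>z. pJ n K' * ?S z) i j = 0" using z unfolding GE by simp
      then have "pJ n K' * R nu ?S i j = 0" by (simp only: R_smult)
      then show "R nu ?S i j = 0" using pJ_nonzero[OF K'(1)] by simp
    qed
    then have "R nu (hmul n (hT y) ?S) = (\<lambda>i j. 0)" using R_zero_right[OF nu(1) hT_HK[OF yS] S] by blast
    moreover have "hmul n (hT y) ?S = (\<lambda>z. \<Sum>g\<in>G. qv ^ len n g * hmul n (hT (y \<circ> g)) (El la) z)"
    proof -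
      have "hmul n (hT y) (hmul n (hT g) (El la)) = hmul n (hT (y \<circ> g)) (El la)" if g: "g \<in> G" for g
      proof -
        have gS: "g \<in> Sym n" using g WJ_Sym[OF K] by (auto simp: G_def)
        show ?thesis using hmul_hT_hT[OF yS gS] len_add[OF g] yS gS by (simp add: hT_HK flip: hmul_assoc)
      qed
      then show ?thesis by (simp add: hmul_sum_right cong: sum.cong)
    qed
    ultimately show ?thesis by simp
  qed
  show thesis by (rule that[OF yS fG g0G yg(3) len_add longest van])
qed

text \<open>A Nakayama argument: normalised by \<open>(-v)^l(w)\<close>, the elements \<open>E T_w E\<close> depend only on the double coset of \<open>w\<close>,
  and for each nontrivial double coset a Garnir relation expresses its element as a combination
  of such elements with coefficients divisible by \<open>v\<close>, modulo the kernel of the representation.\<close>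

lemma R_EhE_proportional_hT:
  assumes la: "la \<in> Pt" and w: "w \<in> Sym n"
  shows "R la (hmul n (El la) (hmul n (hT w) (El la))) i j * R la (El la) k l =
         R la (hmul n (El la) (hmul n (hT w) (El la))) k l * R la (El la) i j"
proof -
  let ?E = "El la" and ?J = "Jl la"
  note J = youngJ_subset[of n la]
  \<comment> \<open>The cross difference that vanishes exactly when the entries are in the same
    ratio as those of E; it is linear in h.\<close>
  define F where "F = (\<lambda>h. R la h i j * R la ?E k l - R la h k l * R la ?E i j)"
  \<comment> \<open>The normalisation removes the powers of \<open>qv\<close> arising when elements
    of the Young subgroup are absorbed into E on either side, so G is constant on double
    cosets.\<close>
  define G where "G = (\<lambda>w. inverse qv ^ len n w * F (hmul n ?E (hmul n (hT w) ?E)))"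
  have F_smult: "F (\<lambda>y. c * h y) = c * F h" for c h by (simp add: F_def R_smult algebra_simps)
  have F_sum: "F (\<lambda>y. \<Sum>s\<in>S. c s * H s y) = (\<Sum>s\<in>S. c s * F (H s))" for S and c :: "'a \<Rightarrow> K" and H
    by (simp add: F_def R_sum sum_distrib_right right_diff_distrib sum_subtractf mult.assoc)
  have FG: "F (hmul n ?E (hmul n (hT w) ?E)) = qv ^ len n w * G w" for w
    by (simp add: G_def mult.assoc[symmetric] flip: power_mult_distrib)
  have G_right: "G (x \<circ> u) = G x" if "x \<in> XJ n ?J" "u \<in> WJ ?J" for x u
  proof -
    have "hmul n (hT (x \<circ> u)) ?E = (\<lambda>y. qv ^ len n u * hmul n (hT x) ?E y)"
      by (rule hmul_hT_leig[OF J leig_EJ[OF J] that])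
    then have "F (hmul n ?E (hmul n (hT (x \<circ> u)) ?E)) = qv ^ len n u * F (hmul n ?E (hmul n (hT x) ?E))"
      by (simp add: hmul_smult_right F_smult)
    then show ?thesis using len_XJ_WJ[OF J that] by (simp add: G_def power_add field_simps)
  qed
  have G_left: "G (u \<circ> w) = G w" if uw: "u \<in> WJ ?J" "w \<in> Sym n" for u w
  proof -
    have key: "G (u \<circ> inv x) = G (inv x)" if x: "x \<in> XJ n ?J" and u: "u \<in> WJ ?J" for x u
    proof -
      have S: "x \<in> Sym n" "u \<in> Sym n" "inv x \<in> Sym n" "inv u \<in> Sym n" "inv u \<in> WJ ?J"
        using XJ_Sym[OF J x] WJ_Sym[OF J u] Sym_inv WJ_inv[OF u] by auto
      have e: "inv (x \<circ> inv u) = u \<circ> inv x" using Sym_inv_distrib[OF S(1,4)] S by simp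
      have "hstar n (hmul n (hT (x \<circ> inv u)) ?E) = hstar n (\<lambda>y. qv ^ len n (inv u) * hmul n (hT x) ?E y)"
        using hmul_hT_leig[OF J leig_EJ[OF J] x S(5)] by simp
      then have "hmul n ?E (hT (u \<circ> inv x)) = (\<lambda>y. qv ^ len n u * hmul n ?E (hT (inv x)) y)"
        using S by (simp add: hstar_hmul hT_HK Sym_comp hstar_hT e hstar_EJ[OF J] hlin_smult[OF hlin_hstar] len_inv)
      then have "hmul n (hmul n ?E (hT (u \<circ> inv x))) ?E = (\<lambda>y. qv ^ len n u * hmul n (hmul n ?E (hT (inv x))) ?E y)"
        by (simp add: hmul_smult_left)
      then have "F (hmul n ?E (hmul n (hT (u \<circ> inv x)) ?E)) = qv ^ len n u * F (hmul n ?E (hmul n (hT (inv x)) ?E))"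
        using S by (simp add: hmul_assoc hT_HK Sym_comp F_smult)
      moreover have "len n (u \<circ> inv x) = len n u + len n (inv x)"
        using len_XJ_WJ[OF J x S(5)] len_inv[of "x \<circ> inv u" n] S by (simp add: e len_inv Sym_comp)
      ultimately show ?thesis by (simp add: G_def power_add field_simps)
    qed
    obtain x u1 where x: "x \<in> XJ n ?J" "u1 \<in> WJ ?J" "inv w = x \<circ> u1"
      using XJ_WJ_decomp[OF J Sym_inv[OF uw(2)]] by blast
    have "w = inv (x \<circ> u1)" using x(3) uw(2) by (metis Sym_inv_comp(3))
    then have w: "w = inv u1 \<circ> inv x" using Sym_inv_distrib[OF XJ_Sym[OF J x(1)] WJ_Sym[OF J x(2)]] by simp
    have "G (u \<circ> w) = G ((u \<circ> inv u1) \<circ> inv x)" by (simp add: w comp_assoc)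
    also have "\<dots> = G (inv x)" using key x(1) WJ_comp[OF uw(1) WJ_inv[OF x(2)]] by blast
    also have "\<dots> = G w" using key[OF x(1) WJ_inv[OF x(2)]] by (simp add: w)
    finally show ?thesis .
  qed
  have G_id: "G id = 0"
    by (simp add: G_def hmul_id_left EJ_EJ[OF J] F_smult) (simp add: F_def)
  have "\<not> (\<exists>w\<in>Sym n. G w \<noteq> 0)"
  proof
    assume "\<exists>w\<in>Sym n. G w \<noteq> 0"
    then obtain k where k: "\<And>w. w \<in> Sym n \<Longrightarrow> inO (vK powi k * G w)" "\<exists>w\<in>Sym n. const0 (vK powi k * G w) \<noteq> 0"
      using finite_family_normal_form[OF finite_Sym, of n G] by blast
    then obtain w where w: "w \<in> Sym n" "const0 (vK powi k * G w) \<noteq> 0" by blast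
    have "w \<notin> WJ ?J" using G_right[OF XJ_id[OF J], of w] G_id w by auto
    then obtain u x u' r where x: "u \<in> WJ ?J" "x \<in> XJ n ?J" "u' \<in> WJ ?J" "u \<circ> w = x \<circ> u'"
      "Suc r < length la" "x (stl la (Suc r) + 1) < x (stl la r + 1)"
      using nonstandard_rep[OF la w(1)] by blast
    have Gx: "G w = G x" using G_left[OF x(1) w(1)] G_right[OF x(2,3)] x(4) by simp
    have "1 \<le> la ! Suc r" using partitions_pos[OF la x(5)] .
    then obtain y g0 H where H: "y \<in> Sym n" "finite H" "g0 \<in> H" "x = y \<circ> g0"
      "\<And>g. g \<in> H \<Longrightarrow> y \<circ> g \<in> Sym n \<and> len n (y \<circ> g) = len n y + len n g"
      "\<And>g. g \<in> H \<Longrightarrow> g \<noteq> g0 \<Longrightarrow> len n g < len n g0"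
      "\<And>nu. nu \<in> Pt \<Longrightarrow> \<not> la \<lhd> nu \<Longrightarrow> R nu (\<lambda>z. \<Sum>g\<in>H. qv ^ len n g * hmul n (hT (y \<circ> g)) ?E z) = (\<lambda>i j. 0)"
      using garnir_relation[OF la x(2,5) _ _ x(6)] by blast
    let ?S = "\<lambda>z. \<Sum>g\<in>H. qv ^ len n g * hmul n (hT (y \<circ> g)) ?E z"
    have SK: "?S \<in> HK n" by (intro HK_sum hmul_HK El_HK)
    have "R la ?S = (\<lambda>i j. 0)" using H(7)[OF la] by (simp add: sdominates_def)
    then have "R la (hmul n ?E ?S) = (\<lambda>i j. 0)" using R_zero_right[OF la El_HK SK] by blast
    then have "0 = F (hmul n ?E ?S)" by (simp add: F_def)
    also have "\<dots> = (\<Sum>g\<in>H. qv ^ len n g * (qv ^ len n (y \<circ> g) * G (y \<circ> g)))"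
      by (simp add: hmul_sum_right F_sum FG)
    also have "\<dots> = (\<Sum>g\<in>H. qv ^ len n y * (qv ^ (2 * len n g) * G (y \<circ> g)))"
      using H(5) by (intro sum.cong refl) (simp add: power_add mult_2 mult.assoc mult.left_commute)
    finally have "qv ^ len n y * (\<Sum>g\<in>H. qv ^ (2 * len n g) * G (y \<circ> g)) = 0" by (simp add: sum_distrib_left)
    then have s0: "(\<Sum>g\<in>H. qv ^ (2 * len n g) * G (y \<circ> g)) = 0" by simp
    have v2: "vK ^ (2 * a) * qv ^ (2 * a) = 1" for a
    proof -
      have "vK ^ 2 * qv ^ 2 = 1" by (simp add: qv_def power2_eq_square field_simps)
      then have "(vK ^ 2 * qv ^ 2) ^ a = 1" by simp
      then show ?thesis by (simp only: power_mult_distrib power_mult)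
    qed
    \<comment> \<open>This factor makes the term of g0 integral with coefficient 1 and leaves a
      positive power of v in front of all others, since g0 is strictly longest. The constant term
      therefore isolates G x, which was chosen nonzero.\<close>
    have "0 = vK ^ (2 * len n g0) * vK powi k * (\<Sum>g\<in>H. qv ^ (2 * len n g) * G (y \<circ> g))" using s0 by simp
    also have "\<dots> = (\<Sum>g\<in>H. vK ^ (2 * (len n g0 - len n g)) * (vK powi k * G (y \<circ> g)))"
      unfolding sum_distrib_left
    proof (rule sum.cong[OF refl])
      fix g assume g: "g \<in> H"
      then have "len n g \<le> len n g0" using H(6)[OF g] by (cases "g = g0") auto
      then have "vK ^ (2 * len n g0) = vK ^ (2 * (len n g0 - len n g)) * vK ^ (2 * len n g)"
        by (simp flip: power_add add: algebra_simps)
      then have "vK ^ (2 * len n g0) * qv ^ (2 * len n g) = vK ^ (2 * (len n g0 - len n g))"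
        using v2[of "len n g"] by (simp add: mult.assoc)
      then show "vK ^ (2 * len n g0) * vK powi k * (qv ^ (2 * len n g) * G (y \<circ> g)) = vK ^ (2 * (len n g0 - len n g)) * (vK powi k * G (y \<circ> g))"
        by (simp add: mult_ac)
    qed
    finally have "0 = const0 (\<Sum>g\<in>H. vK ^ (2 * (len n g0 - len n g)) * (vK powi k * G (y \<circ> g)))" by simp
    also have "\<dots> = (\<Sum>g\<in>H. 0 ^ (2 * (len n g0 - len n g)) * const0 (vK powi k * G (y \<circ> g)))"
      using k(1) H(5) by (subst const0_sum) (auto simp: inO_mult inO_power const0_mult const0_power intro!: sum.cong)
    also have "\<dots> = (\<Sum>g\<in>H. if g = g0 then const0 (vK powi k * G x) else 0)"
    proof (rule sum.cong[OF refl])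
      fix g assume g: "g \<in> H"
      show "0 ^ (2 * (len n g0 - len n g)) * const0 (vK powi k * G (y \<circ> g)) = (if g = g0 then const0 (vK powi k * G x) else 0)"
        using H(6)[OF g] H(4) by (cases "g = g0") (simp_all add: power_0_left)
    qed
    also have "\<dots> = const0 (vK powi k * G x)" using H(2,3) by (simp add: sum.delta)
    finally show False using w(2) Gx by simp
  qed
  then have "G w = 0" using w by blast
  then have "F (hmul n ?E (hmul n (hT w) ?E)) = 0" using FG[of w] by simp
  then show ?thesis by (simp add: F_def)
qed

text \<open>In the representation of \<open>la\<close> the algebra E H E acts on the image of E by
  scalars. This replaces algebraic closedness in the determination of the commutant.\<close>

lemma R_EhE_proportional:
  assumes la: "la \<in> Pt" and h: "h \<in> HK n"
  obtains c where "\<And>i j. R la (hmul n (El la) (hmul n h (El la))) i j = c * R la (El la) i j"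
proof -
  let ?E = "El la"
  obtain k l where kl: "R la ?E k l \<noteq> 0" using R_El_nonzero[OF la] by (auto simp: fun_eq_iff)
  define c where "c = R la (hmul n ?E (hmul n h ?E)) k l / R la ?E k l"
  have ex: "R la (hmul n ?E (hmul n h ?E)) i j = (\<Sum>w\<in>Sym n. h w * R la (hmul n ?E (hmul n (hT w) ?E)) i j)" for i j
  proof -
    have "hmul n h ?E = (\<lambda>z. \<Sum>w\<in>Sym n. h w * hmul n (hT w) ?E z)"
      by (subst HK_expand[OF h]) (simp only: hmul_sum_left)
    then show ?thesis by (simp add: hmul_sum_right R_sum)
  qed
  have "R la (hmul n ?E (hmul n h ?E)) i j * R la ?E k l = R la (hmul n ?E (hmul n h ?E)) k l * R la ?E i j" for i j
    unfolding ex sum_distrib_right using R_EhE_proportional_hT[OF la] by (intro sum.cong refl) (simp add: mult.assoc)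
  then have "R la (hmul n ?E (hmul n h ?E)) i j = c * R la ?E i j" for i j
    using kl by (simp add: c_def field_simps)
  then show thesis by (rule that)
qed

end

section \<open>Schur relations and leading coefficients\<close>

lemma matvec_MM: "matvec d (MM d A B) u = matvec d A (matvec d B u)"
proof
  fix i
  have "(\<Sum>k=1..d. (\<Sum>l=1..d. A i l * B l k) * u k) = (\<Sum>k=1..d. \<Sum>l=1..d. A i l * (B l k * u k))"
    by (simp add: sum_distrib_right mult.assoc)
  also have "\<dots> = (\<Sum>l=1..d. \<Sum>k=1..d. A i l * (B l k * u k))" by (rule sum.swap)
  finally show "matvec d (MM d A B) u i = matvec d A (matvec d B u) i"
    by (simp add: matvec_def MM_def sum_distrib_left)
qed

lemma matvec_smult: "matvec d A (\<lambda>k. c * u k) = (\<lambda>k. c * matvec d A u k)"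
  by (auto simp: matvec_def sum_distrib_left mult_ac)

lemma matvec_add: "matvec d A (\<lambda>k. u k + u' k) = (\<lambda>k. matvec d A u k + matvec d A u' k)"
  by (auto simp: matvec_def algebra_simps sum.distrib)

lemma matvec_cong: "(\<And>i j. i \<in> {1..d} \<Longrightarrow> j \<in> {1..d} \<Longrightarrow> A i j = B i j) \<Longrightarrow> matvec d A u = matvec d B u"
  by (auto simp: matvec_def)

lemma matvec_unitvec: "j \<in> {1..d} \<Longrightarrow> i \<in> {1..d} \<Longrightarrow> matvec d M (unitvec j) i = M i j"
  using sum_unitvec[of j d "M i"] by (simp add: matvec_def)

context hecke_reps
begin

lemma matvec_X: "w \<in> Sym n \<Longrightarrow> matvec (d la) (X la w) u = matvec (d la) (R la (hT w)) u"
  by (rule matvec_cong) (simp add: R_hT)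

text \<open>Since the sign idempotent has rank one on the representation, the commutant consists of scalars,
  although the base field is not algebraically closed.\<close>

lemma commutant_scalar:
  assumes la: "la \<in> Pt"
    and M: "\<And>w i j. w \<in> Sym n \<Longrightarrow> i \<in> {1..d la} \<Longrightarrow> j \<in> {1..d la} \<Longrightarrow> MM (d la) (X la w) M i j = MM (d la) M (X la w) i j"
  obtains c where "\<And>i j. i \<in> {1..d la} \<Longrightarrow> j \<in> {1..d la} \<Longrightarrow> M i j = (if i = j then c else 0)"
proof -
  let ?d = "d la" and ?E = "El la"
  obtain k l where kl: "R la ?E k l \<noteq> 0" using R_El_nonzero[OF la] by (auto simp: fun_eq_iff)
  \<comment> \<open>A nonzero column of E, hence an eigenvector of E with eigenvalue
    \<open>pl la\<close>.\<close>
  define u where "u = (\<lambda>i. R la ?E i l)"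
  have lr: "l \<in> {1..?d}" using kl R_outside by blast
  have uv: "u \<in> vecs ?d" using R_outside by (auto simp: u_def vecs_def)
  have u0: "u \<noteq> (\<lambda>_. 0)" using kl by (auto simp: u_def fun_eq_iff)
  have ul: "u = matvec ?d (R la ?E) (unitvec l)"
    using matvec_unitvec[OF lr, of _ "R la ?E"] R_outside[of _ la l ?E] by (auto simp: u_def matvec_def fun_eq_iff)
  have Eu: "matvec ?d (R la ?E) u = (\<lambda>i. pl la * u i)"
  proof -
    have "matvec ?d (R la ?E) u = matvec ?d (R la (hmul n ?E ?E)) (unitvec l)"
      by (simp add: ul R_hmul[OF la] matvec_MM)
    also have "\<dots> = (\<lambda>i. pl la * u i)"
      unfolding EJ_EJ[OF youngJ_subset] ul by (auto simp: matvec_def R_smult sum_distrib_left mult.assoc)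
    finally show ?thesis .
  qed
  have Mw: "matvec ?d (X la w) (matvec ?d M x) = matvec ?d M (matvec ?d (X la w) x)" if "w \<in> Sym n" for w x
    unfolding matvec_MM[symmetric] using M[OF that] by (intro matvec_cong)
  have Mh: "matvec ?d (R la h) (matvec ?d M x) = matvec ?d M (matvec ?d (R la h) x)" if h: "h \<in> HK n" for h x
  proof
    fix i
    have R: "matvec ?d (R la h) y i = (\<Sum>w\<in>Sym n. h w * matvec ?d (X la w) y i)" for y i
    proof (cases "i \<in> {1..?d}")
      case True
      have "matvec ?d (R la h) y i = (\<Sum>k=1..?d. \<Sum>w\<in>Sym n. h w * (R la (hT w) i k * y k))"
        using True by (simp add: matvec_def R_expand[OF h] sum_distrib_right mult.assoc)
      also have "\<dots> = (\<Sum>w\<in>Sym n. \<Sum>k=1..?d. h w * (R la (hT w) i k * y k))" by (rule sum.swap)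
      also have "\<dots> = (\<Sum>w\<in>Sym n. h w * matvec ?d (X la w) y i)"
        using True by (intro sum.cong refl) (simp add: matvec_X, simp add: matvec_def sum_distrib_left)
      finally show ?thesis .
    qed (auto simp: matvec_def)
    show "matvec ?d (R la h) (matvec ?d M x) i = matvec ?d M (matvec ?d (R la h) x) i"
    proof (cases "i \<in> {1..?d}")
      case True
      have "matvec ?d M (matvec ?d (R la h) x) i = (\<Sum>k=1..?d. \<Sum>w\<in>Sym n. h w * (M i k * matvec ?d (X la w) x k))"
        using True by (simp add: matvec_def[of ?d M] R sum_distrib_left mult_ac)
      also have "\<dots> = (\<Sum>w\<in>Sym n. \<Sum>k=1..?d. h w * (M i k * matvec ?d (X la w) x k))" by (rule sum.swap)
      also have "\<dots> = (\<Sum>w\<in>Sym n. h w * matvec ?d M (matvec ?d (X la w) x) i)"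
        using True by (simp add: matvec_def[of ?d M] sum_distrib_left)
      also have "\<dots> = matvec ?d (R la h) (matvec ?d M x) i" by (simp add: R Mw cong: sum.cong)
      finally show ?thesis by simp
    qed (auto simp: matvec_def)
  qed
  \<comment> \<open>The submodule generated by u; by irreducibility it is everything, so M u is h u
    for some element h of the algebra.\<close>
  define U where "U = {matvec ?d (R la h) u | h. h \<in> HK n}"
  have "invariant_subspace n ?d (X la) U"
    unfolding invariant_subspace_def
  proof (intro conjI ballI allI)
    show "U \<subseteq> vecs ?d" by (auto simp: U_def matvec_vecs)
    have "(\<lambda>_. 0) = matvec ?d (R la (\<lambda>y. 0 * hT id y)) u" unfolding matvec_def R_smult by auto
    then show "(\<lambda>_. 0) \<in> U" unfolding U_def using HK_smult[OF hT_HK[OF Sym_id]] by blast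
    show "(\<lambda>k. y k + y' k) \<in> U" if "y \<in> U" "y' \<in> U" for y y'
    proof -
      from \<open>y \<in> U\<close> obtain h where h: "h \<in> HK n" "y = matvec ?d (R la h) u" by (auto simp: U_def)
      from \<open>y' \<in> U\<close> obtain h' where h': "h' \<in> HK n" "y' = matvec ?d (R la h') u" by (auto simp: U_def)
      have "(\<lambda>k. y k + y' k) = matvec ?d (R la (\<lambda>z. h z + h' z)) u"
        unfolding h h' by (auto simp: matvec_def R_add algebra_simps sum.distrib)
      then show ?thesis unfolding U_def using HK_add[OF h(1) h'(1)] by blast
    qed
    show "(\<lambda>k. a * y k) \<in> U" if "y \<in> U" for a y
    proof -
      from \<open>y \<in> U\<close> obtain h where h: "h \<in> HK n" "y = matvec ?d (R la h) u" by (auto simp: U_def)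
      have "(\<lambda>k. a * y k) = matvec ?d (R la (\<lambda>z. a * h z)) u"
        unfolding h by (auto simp: matvec_def R_smult sum_distrib_left mult.assoc)
      then show ?thesis unfolding U_def using HK_smult[OF h(1)] by blast
    qed
    show "matvec ?d (X la w) y \<in> U" if "w \<in> Sym n" "y \<in> U" for w y
    proof -
      from \<open>y \<in> U\<close> obtain h where h: "h \<in> HK n" "y = matvec ?d (R la h) u" by (auto simp: U_def)
      have "matvec ?d (X la w) y = matvec ?d (R la (hmul n (hT w) h)) u"
        using that h by (simp add: matvec_X R_hmul[OF la] hT_HK matvec_MM)
      then show ?thesis unfolding U_def using hmul_HK[OF h(1)] by blast
    qed
  qed
  moreover have "u \<in> U"
  proof -
    have "matvec ?d (R la (hT id)) u = u"
    proof
      fix i show "matvec ?d (R la (hT id)) u i = u i"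
      proof (cases "i \<in> {1..?d}")
        case True
        then have "matvec ?d (R la (hT id)) u i = (\<Sum>k=1..?d. if k = i then u k else 0)"
          unfolding matvec_def by (simp only: if_True) (intro sum.cong refl, simp add: R_id[OF la] True)
        then show ?thesis using True by (simp add: sum.delta)
      qed (use uv in \<open>auto simp: matvec_def vecs_def\<close>)
    qed
    then show ?thesis unfolding U_def using hT_HK[OF Sym_id] by force
  qed
  ultimately have "U = vecs ?d" using irreducible_repD[OF irr[OF la]] u0 by blast
  then obtain h where h: "h \<in> HK n" "matvec ?d M u = matvec ?d (R la h) u" using matvec_vecs[of ?d M u] by (auto simp: U_def)
  obtain c where c: "\<And>i j. R la (hmul n ?E (hmul n h ?E)) i j = c * R la ?E i j" using R_EhE_proportional[OF la h(1)] by blast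
  have p0: "pl la \<noteq> 0" using pJ_nonzero[OF youngJ_subset] .
  \<comment> \<open>M commutes with E, so p^2 M u = E M E u = p E h u = E h E u, which is a multiple
    of u.\<close>
  have "(\<lambda>i. pl la * (pl la * matvec ?d M u i)) = matvec ?d (R la ?E) (matvec ?d M (matvec ?d (R la ?E) u))"
    using Mh[OF El_HK] by (simp add: Eu matvec_smult)
  also have "\<dots> = matvec ?d (R la ?E) (\<lambda>i. pl la * matvec ?d (R la h) u i)" by (simp add: Eu matvec_smult h(2))
  also have "\<dots> = matvec ?d (R la ?E) (matvec ?d (R la h) (matvec ?d (R la ?E) u))" by (simp add: Eu matvec_smult)
  also have "\<dots> = matvec ?d (R la (hmul n ?E (hmul n h ?E))) u"
    using h(1) by (simp add: R_hmul[OF la] hmul_HK matvec_MM)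
  also have "\<dots> = (\<lambda>i. c * matvec ?d (R la ?E) u i)" by (auto simp: matvec_def c sum_distrib_left mult.assoc)
  finally have eq: "(\<lambda>i. pl la * (pl la * matvec ?d M u i)) = (\<lambda>i. c * matvec ?d (R la ?E) u i)" .
  have "pl la * (pl la * matvec ?d M u i) = c * (pl la * u i)" for i using fun_cong[OF eq, of i] by (simp only: Eu)
  then have Mu: "matvec ?d M u i = (c / pl la) * u i" for i using p0 by (simp add: field_simps)
  \<comment> \<open>The eigenspace of M for the scalar found on u is invariant and nonzero, hence
    everything.\<close>
  define V where "V = {x \<in> vecs ?d. matvec ?d M x = (\<lambda>i. (c / pl la) * x i)}"
  have "invariant_subspace n ?d (X la) V"
    unfolding invariant_subspace_def
  proof (intro conjI ballI allI)
    show "V \<subseteq> vecs ?d" by (auto simp: V_def)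
    show "(\<lambda>_. 0) \<in> V" by (auto simp: V_def vecs_def matvec_def)
    show "(\<lambda>k. y k + y' k) \<in> V" if "y \<in> V" "y' \<in> V" for y y'
      using that by (auto simp: V_def vecs_def matvec_add algebra_simps add_divide_distrib)
    show "(\<lambda>k. a * y k) \<in> V" if "y \<in> V" for a y
      using that by (auto simp: V_def vecs_def matvec_smult algebra_simps)
    show "matvec ?d (X la w) y \<in> V" if "w \<in> Sym n" "y \<in> V" for w y
      using that Mw[OF that(1), of y] matvec_smult[of ?d "X la w" "c / pl la" y] by (simp add: V_def matvec_vecs)
  qed
  moreover have "u \<in> V" using uv Mu by (auto simp: V_def)
  ultimately have V: "V = vecs ?d" using irreducible_repD[OF irr[OF la]] u0 by blast
  have "M i j = (if i = j then c / pl la else 0)" if "i \<in> {1..?d}" "j \<in> {1..?d}" for i j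
  proof -
    have "unitvec j \<in> V" using V unitvec_vecs that by blast
    then have "matvec ?d M (unitvec j) i = (c / pl la) * unitvec j i" by (simp add: V_def)
    then have "M i j = (c / pl la) * unitvec j i" using matvec_unitvec[OF that(2,1), of M] by simp
    then show ?thesis by (cases "i = j") (simp_all add: unitvec_def)
  qed
  then show thesis by (rule that)
qed

text \<open>The Schur element of chi_la; by \<open>schur_same\<close> the same value arises from any
  matrix position.\<close>

definition cS :: "nat list \<Rightarrow> K" where
  "cS la = (\<Sum>w\<in>Sym n. R la (hT w) 1 1 * R la (hT (inv w)) 1 1)"

text \<open>By the commutant result the sum is delta(i, l) B(j, k). Replacing w by its inverse
  exchanges (i, j) with (k, l), so B is a scalar matrix too.\<close>

lemma schur_same:
  assumes la: "la \<in> Pt" and ij: "i \<in> {1..d la}" "j \<in> {1..d la}" "k \<in> {1..d la}" "l \<in> {1..d la}"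
  shows "(\<Sum>w\<in>Sym n. R la (hT w) i j * R la (hT (inv w)) k l) = (if i = l \<and> j = k then cS la else 0)"
proof -
  let ?d = "d la"
  define S where "S = (\<lambda>i j k l. \<Sum>w\<in>Sym n. X la w i j * X la (inv w) k l)"
  have SR: "S i j k l = (\<Sum>w\<in>Sym n. R la (hT w) i j * R la (hT (inv w)) k l)"
    if "i \<in> {1..?d}" "j \<in> {1..?d}" "k \<in> {1..?d}" "l \<in> {1..?d}" for i j k l
    unfolding S_def using that by (intro sum.cong refl) (simp add: R_hT Sym_inv)
  have "\<exists>c. \<forall>i\<in>{1..?d}. \<forall>l\<in>{1..?d}. S i j k l = (if i = l then c else 0)" if jk: "j \<in> {1..?d}" "k \<in> {1..?d}" for j k
  proof -
    have "MM ?d (X la x) (\<lambda>i l. S i j k l) i l = MM ?d (\<lambda>i l. S i j k l) (X la x) i l"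
      if "x \<in> Sym n" "i \<in> {1..?d}" "l \<in> {1..?d}" for x i l
      using casimir_intertwiner[OF mrep[OF la] mrep[OF la] that(1,2) jk that(3)] by (simp add: MM_def S_def)
    from commutant_scalar[OF la this] show ?thesis by metis
  qed
  then obtain B where B: "\<And>i j k l. i \<in> {1..?d} \<Longrightarrow> j \<in> {1..?d} \<Longrightarrow> k \<in> {1..?d} \<Longrightarrow> l \<in> {1..?d} \<Longrightarrow>
      S i j k l = (if i = l then B j k else 0)" by metis
  have sym: "S i j k l = S k l i j" for i j k l
    unfolding S_def by (rule sum.reindex_bij_witness[of _ inv inv]) (auto simp: Sym_inv mult.commute)
  have one: "1 \<in> {1..?d}" using d_pos[OF la] by simp
  have "B j j = cS la" if "j \<in> {1..?d}" for j
  proof -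
    have "B j j = S 1 j j 1" using B[OF one that that one] by simp
    also have "\<dots> = S j 1 1 j" by (rule sym)
    also have "\<dots> = B 1 1" using B[OF that one one that] by simp
    also have "\<dots> = cS la" using B[OF one one one one] SR[OF one one one one] by (simp add: cS_def)
    finally show ?thesis .
  qed
  moreover have "B j k = 0" if "j \<in> {1..?d}" "k \<in> {1..?d}" "j \<noteq> k" for j k
  proof -
    have "B j k = S 1 j k 1" using B[OF one that(1,2) one] by simp
    also have "\<dots> = S k 1 1 j" by (rule sym)
    also have "\<dots> = 0" using B[OF that(2) one one that(1)] that by simp
    finally show ?thesis .
  qed
  ultimately have "S i j k l = (if i = l \<and> j = k then cS la else 0)" using B[OF ij] ij by (cases "j = k") auto
  then show ?thesis using SR[OF ij] by simp
qed

lemma Gram_cS: "nu \<in> Pt \<Longrightarrow> Gram nu = of_nat (d nu) * cS nu"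
proof -
  assume nu: "nu \<in> Pt"
  have "Gram nu = (\<Sum>w\<in>Sym n. \<Sum>i=1..d nu. \<Sum>k=1..d nu. R nu (hT w) i i * R nu (hT (inv w)) k k)"
    by (simp add: Gram_def chi_def mtr_def sum_product)
  also have "\<dots> = (\<Sum>i=1..d nu. \<Sum>w\<in>Sym n. \<Sum>k=1..d nu. R nu (hT w) i i * R nu (hT (inv w)) k k)"
    by (rule sum.swap)
  also have "\<dots> = (\<Sum>i=1..d nu. \<Sum>k=1..d nu. \<Sum>w\<in>Sym n. R nu (hT w) i i * R nu (hT (inv w)) k k)"
    by (intro sum.cong refl sum.swap)
  also have "\<dots> = (\<Sum>i=1..d nu. \<Sum>k=1..d nu. if i = k then cS nu else 0)"
    by (intro sum.cong refl) (auto simp: schur_same[OF nu])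
  also have "\<dots> = of_nat (d nu) * cS nu" by simp
  finally show ?thesis .
qed

lemma cS_nonzero: "nu \<in> Pt \<Longrightarrow> cS nu \<noteq> 0"
  using Gram_cS Gram_nonzero by force

lemma of_nat_d_nonzero: "nu \<in> Pt \<Longrightarrow> (of_nat (d nu) :: K) \<noteq> 0"
  using Gram_cS Gram_nonzero by force

lemma chi_conj_sum_cS:
  assumes nu: "nu \<in> Pt" and h: "h \<in> HK n"
  shows "(\<Sum>y\<in>Sym n. chi nu (hmul n (hmul n (hT y) h) (hT (inv y)))) = of_nat (d nu) * cS nu * chi nu h"
proof -
  let ?d = "d nu"
  have "chi nu (hmul n (hmul n (hT y) h) (hT (inv y))) =
      (\<Sum>i=1..?d. \<Sum>k=1..?d. \<Sum>j=1..?d. R nu h j k * (R nu (hT y) i j * R nu (hT (inv y)) k i))" if "y \<in> Sym n" for y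
    using that nu h by (simp add: chi_def mtr_def R_hmul hT_HK Sym_inv hmul_HK MM_def sum_distrib_right mult.assoc mult.left_commute)
  then have "(\<Sum>y\<in>Sym n. chi nu (hmul n (hmul n (hT y) h) (hT (inv y)))) =
      (\<Sum>y\<in>Sym n. \<Sum>i=1..?d. \<Sum>k=1..?d. \<Sum>j=1..?d. R nu h j k * (R nu (hT y) i j * R nu (hT (inv y)) k i))"
    by simp
  also have "\<dots> = (\<Sum>i=1..?d. \<Sum>k=1..?d. \<Sum>j=1..?d. \<Sum>y\<in>Sym n. R nu h j k * (R nu (hT y) i j * R nu (hT (inv y)) k i))"
    by (subst sum.swap, intro sum.cong refl, subst sum.swap, intro sum.cong refl, rule sum.swap)
  also have "\<dots> = (\<Sum>i=1..?d. \<Sum>k=1..?d. \<Sum>j=1..?d. if j = k then R nu h j k * cS nu else 0)"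
    by (intro sum.cong refl) (auto simp: schur_same[OF nu] simp flip: sum_distrib_left)
  also have "\<dots> = of_nat ?d * cS nu * chi nu h"
    by (simp add: chi_def mtr_def sum_distrib_left sum_distrib_right mult_ac)
  finally show ?thesis .
qed

text \<open>The sum over the conjugates of E is evaluated twice, by multiplicities and by the Schur
  element, and the common factor is cancelled.\<close>

lemma chi_El:
  assumes la: "la \<in> Pt" and nu: "nu \<in> Pt"
  shows "chi nu (El la) = pl la * of_nat (mult la nu)"
proof -
  have "of_nat (d nu) * cS nu * chi nu (El la) = pl la * of_nat (mult la nu) * (of_nat (d nu) * cS nu)"
    unfolding chi_conj_sum_cS[OF nu El_HK, of la, symmetric] chi_conj_sum[OF la nu] Gram_cS[OF nu] ..
  then have "(of_nat (d nu) * cS nu) * chi nu (El la) = (of_nat (d nu) * cS nu) * (pl la * of_nat (mult la nu))"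
    by (simp only: mult.commute)
  then show ?thesis using cS_nonzero[OF nu] of_nat_d_nonzero[OF nu] by (simp only: mult_cancel_left mult_eq_0_iff) simp
qed

subsection \<open>Completeness\<close>

text \<open>The partition with all parts 1. Its Young subgroup is trivial and its sign idempotent is
  T_1, so the induced sign character is the regular character and multiplicities are
  degrees.\<close>

definition one_part :: "nat list" where "one_part = replicate n 1"

lemma one_part_Pt: "one_part \<in> Pt"
proof -
  have "sorted_wrt (\<ge>) (replicate k (1::nat))" for k by (induction k) auto
  then show ?thesis by (simp add: one_part_def partitions_def sum_list_replicate)
qed

lemma youngJ_one_part: "youngJ n one_part = {}"
  using psums_ones[of n] by (auto simp: youngJ_psums one_part_def)

lemma WJ_empty: "WJ {} = {id}"
  by (auto simp: WJ_def)

lemma El_one_part: "El one_part = hT id" and pl_one_part: "pl one_part = 1"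
  by (auto simp: youngJ_one_part EJ_def pJ_def WJ_empty hT_def)

lemma mult_one_part: "nu \<in> Pt \<Longrightarrow> (of_nat (mult one_part nu) :: K) = of_nat (d nu)"
  using chi_El[OF one_part_Pt, of nu] by (simp add: El_one_part pl_one_part chi_def mtr_def R_id)

lemma regular_trace:
  assumes h: "h \<in> HK n"
  shows "(\<Sum>y\<in>Sym n. hmul n h (hT y) y) = (\<Sum>nu\<in>Pt. of_nat (d nu) * chi nu h)"
proof -
  have T: "(\<Sum>y\<in>Sym n. hmul n (hT w) (hT y) y) = (\<Sum>nu\<in>Pt. of_nat (d nu) * chi nu (hT w))" if w: "w \<in> Sym n" for w
  proof -
    have "(\<Sum>y\<in>Sym n. hmul n (hT w) (hT y) y) = ind_sign n one_part w"
      using induced_sign_trace[OF w, of one_part] El_one_part pl_one_part by (simp add: hmul_id_right hT_HK)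
    also have "\<dots> = (\<Sum>nu\<in>Pt. of_nat (d nu) * chi nu (hT w))"
      using ind_sign_mult[OF one_part_Pt w] mult_one_part by (simp cong: sum.cong)
    finally show ?thesis .
  qed
  have "(\<Sum>y\<in>Sym n. hmul n h (hT y) y) = (\<Sum>y\<in>Sym n. \<Sum>w\<in>Sym n. h w * hmul n (hT w) (hT y) y)"
    by (subst HK_expand[OF h]) (simp only: hmul_sum_left)
  also have "\<dots> = (\<Sum>w\<in>Sym n. \<Sum>y\<in>Sym n. h w * hmul n (hT w) (hT y) y)" by (rule sum.swap)
  also have "\<dots> = (\<Sum>w\<in>Sym n. \<Sum>nu\<in>Pt. of_nat (d nu) * (h w * chi nu (hT w)))"
    by (intro sum.cong refl) (simp add: T mult_ac sum_distrib_left flip: sum_distrib_left)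
  also have "\<dots> = (\<Sum>nu\<in>Pt. \<Sum>w\<in>Sym n. of_nat (d nu) * (h w * chi nu (hT w)))" by (rule sum.swap)
  also have "\<dots> = (\<Sum>nu\<in>Pt. of_nat (d nu) * chi nu h)"
    by (simp add: chi_expand[OF h] sum_distrib_left)
  finally show ?thesis .
qed

text \<open>The regular trace of the identity, an equation in K brought back to natural numbers by
  \<open>const0\<close>. It provides the count needed for surjectivity in
  \<open>wb_surj\<close>.\<close>

lemma sum_d_squares: "(\<Sum>nu\<in>Pt. d nu * d nu) = card (Sym n)"
proof -
  have "(\<Sum>y\<in>Sym n. hmul n (hT id) (hT y) y) = (\<Sum>y\<in>Sym n. 1)"
    by (intro sum.cong refl) (simp add: hmul_id_left hT_HK, simp add: hT_def)
  then have "(of_nat (card (Sym n)) :: K) = (\<Sum>nu\<in>Pt. of_nat (d nu) * chi nu (hT id))"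
    using regular_trace[OF hT_HK[OF Sym_id]] by simp
  also have "\<dots> = (\<Sum>nu\<in>Pt. of_nat (d nu) * of_nat (d nu))"
    by (intro sum.cong refl) (simp add: chi_def mtr_def R_id)
  finally have "(of_nat (card (Sym n)) :: K) = of_nat (\<Sum>nu\<in>Pt. d nu * d nu)" by simp
  then have "const0 (of_nat (card (Sym n))) = const0 (of_nat (\<Sum>nu\<in>Pt. d nu * d nu))" by (rule arg_cong)
  then have "real (card (Sym n)) = real (\<Sum>nu\<in>Pt. d nu * d nu)" by (simp only: const0_of_nat)
  then show ?thesis by (simp only: of_nat_eq_iff)
qed

text \<open>The regular trace of x times \<open>hstar n x\<close> vanishes. It is the sum over y of
  the squared coefficients of \<open>hstar n x\<close> times T_y, and y = 1 already gives x =
  0.\<close>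

lemma R_faithful:
  assumes x: "x \<in> HK n" and z: "\<And>nu. nu \<in> Pt \<Longrightarrow> R nu x = (\<lambda>i j. 0)"
  shows "x = (\<lambda>y. 0)"
proof -
  let ?xs = "hstar n x"
  have h: "hmul n x ?xs \<in> HK n" by (simp add: hmul_HK)
  have "R nu (hmul n x ?xs) = (\<lambda>i j. 0)" if "nu \<in> Pt" for nu using R_zero_left[OF that x hstar_HK z[OF that]] .
  then have "(\<Sum>y\<in>Sym n. hmul n (hmul n x ?xs) (hT y) y) = 0"
    using regular_trace[OF h] by (simp add: chi_def mtr_def)
  moreover have "hmul n (hmul n x ?xs) (hT y) y = (\<Sum>w\<in>Sym n. hmul n ?xs (hT y) w * hmul n ?xs (hT y) w * 1)" if y: "y \<in> Sym n" for y
  proof -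
    let ?g = "hmul n ?xs (hT y)"
    have g: "?g \<in> HK n" using y by (simp add: hmul_HK hT_HK)
    have "hmul n (hmul n x ?xs) (hT y) y = hmul n (hT (inv y)) (hmul n x ?g) id"
      using y x by (simp add: coeff_trace hmul_assoc hT_HK)
    also have "\<dots> = hmul n (hmul n (hT (inv y)) x) ?g id" using y x g by (simp add: hmul_assoc hT_HK Sym_inv)
    also have "hmul n (hT (inv y)) x = hstar n ?g" using y x by (simp add: hstar_hmul hT_HK hstar_hT hstar_hstar)
    also have "hmul n (hstar n ?g) ?g id = (\<Sum>w\<in>Sym n. ?g (inv w) * ?g (inv w) * 1)"
      by (simp add: trace_hmul hstar_def)
    also have "\<dots> = (\<Sum>w\<in>Sym n. ?g w * ?g w * 1)" by (rule sum.reindex_bij_betw[OF Sym_inv_bij])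
    finally show ?thesis .
  qed
  ultimately have "(\<Sum>y\<in>Sym n. \<Sum>w\<in>Sym n. hmul n ?xs (hT y) w * hmul n ?xs (hT y) w * 1) = 0" by simp
  then have s: "(\<Sum>p\<in>Sym n \<times> Sym n. hmul n ?xs (hT (fst p)) (snd p) * hmul n ?xs (hT (fst p)) (snd p) * 1) = 0"
    by (simp add: sum.cartesian_product case_prod_unfold)
  have "hmul n ?xs (hT id) w = 0" if "w \<in> Sym n" for w
    using sum_squares_zeroD[OF _ _ _ s, of "(id, w)"] that by simp
  then have "?xs w = 0" if "w \<in> Sym n" for w using that by (simp add: hmul_id_right)
  then have "x (inv w) = 0" if "w \<in> Sym n" for w using that by (simp add: hstar_def)
  then have "x w = 0" if "w \<in> Sym n" for w using that Sym_inv by (metis Sym_inv_comp(3))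
  then show ?thesis using HK_outside[OF x] by blast
qed

text \<open>The element t acts as the identity in every representation by Schur's relations, hence t
  = T_1 by faithfulness. The formula is the trace of t h.\<close>

lemma trace_characters:
  assumes h: "h \<in> HK n"
  shows "h id = (\<Sum>nu\<in>Pt. inverse (cS nu) * chi nu h)"
proof -
  define t where "t = (\<lambda>y. if y \<in> Sym n then \<Sum>nu\<in>Pt. inverse (cS nu) * chi nu (hT (inv y)) else 0)"
  have t: "t \<in> HK n" by (simp add: t_def HK_def)
  have Rt: "R mu t k l = R mu (hT id) k l" if mu: "mu \<in> Pt" for mu k l
  proof (cases "k \<in> {1..d mu} \<and> l \<in> {1..d mu}")
    case True
    have S: "(\<Sum>y\<in>Sym n. chi nu (hT (inv y)) * R mu (hT y) k l) = (if nu = mu \<and> k = l then cS mu else 0)" if nu: "nu \<in> Pt" for nu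
    proof -
      have "(\<Sum>y\<in>Sym n. chi nu (hT (inv y)) * R mu (hT y) k l) = (\<Sum>y\<in>Sym n. \<Sum>i=1..d nu. R mu (hT y) k l * R nu (hT (inv y)) i i)"
        by (simp add: chi_def mtr_def sum_distrib_left mult.commute)
      also have "\<dots> = (\<Sum>i=1..d nu. \<Sum>y\<in>Sym n. R mu (hT y) k l * R nu (hT (inv y)) i i)" by (rule sum.swap)
      also have "\<dots> = (if nu = mu \<and> k = l then cS mu else 0)"
      proof (cases "nu = mu")
        case nm: True
        have "(\<Sum>i=1..d nu. \<Sum>y\<in>Sym n. R mu (hT y) k l * R nu (hT (inv y)) i i) = (\<Sum>i=1..d mu. if i = k then (if k = l then cS mu else 0) else 0)"
          using True nm by (intro sum.cong) (auto simp: schur_same[OF mu])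
        then show ?thesis using True nm by (simp add: sum.delta)
      next
        case False
        then show ?thesis using schur_distinct[OF mu nu] by auto
      qed
      finally show ?thesis .
    qed
    have "R mu t k l = (\<Sum>y\<in>Sym n. \<Sum>nu\<in>Pt. inverse (cS nu) * (chi nu (hT (inv y)) * R mu (hT y) k l))"
      unfolding R_expand[OF t] by (intro sum.cong refl) (simp add: t_def sum_distrib_right mult.assoc)
    also have "\<dots> = (\<Sum>nu\<in>Pt. \<Sum>y\<in>Sym n. inverse (cS nu) * (chi nu (hT (inv y)) * R mu (hT y) k l))" by (rule sum.swap)
    also have "\<dots> = (\<Sum>nu\<in>Pt. if nu = mu then (if k = l then 1 else 0) else 0)"
      using cS_nonzero[OF mu] by (intro sum.cong refl) (auto simp: S simp flip: sum_distrib_left)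
    also have "\<dots> = R mu (hT id) k l" using mu True finite_partitions[of n] by (simp add: sum.delta R_id)
    finally show ?thesis .
  qed (use R_outside in metis)
  have "(\<lambda>y. t y - hT id y) = (\<lambda>y. 0)"
    by (rule R_faithful) (simp_all add: HK_diff t hT_HK R_diff Rt fun_eq_iff)
  then have "t = hT id" by (simp add: fun_eq_iff)
  then have "h id = hmul n t h id" using h by (simp add: hmul_id_left)
  also have "\<dots> = (\<Sum>x\<in>Sym n. \<Sum>nu\<in>Pt. inverse (cS nu) * (h (inv x) * chi nu (hT (inv x))))"
    unfolding trace_hmul by (intro sum.cong refl) (simp add: t_def sum_distrib_left mult_ac)
  also have "\<dots> = (\<Sum>nu\<in>Pt. \<Sum>x\<in>Sym n. inverse (cS nu) * (h (inv x) * chi nu (hT (inv x))))" by (rule sum.swap)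
  also have "\<dots> = (\<Sum>nu\<in>Pt. inverse (cS nu) * (\<Sum>x\<in>Sym n. h (inv x) * chi nu (hT (inv x))))" by (simp add: sum_distrib_left)
  also have "\<dots> = (\<Sum>nu\<in>Pt. inverse (cS nu) * chi nu h)"
    using sum.reindex_bij_betw[OF Sym_inv_bij, of "\<lambda>x. h x * chi _ (hT x)"] by (simp add: chi_expand[OF h])
  finally show ?thesis .
qed

text \<open>The trace formula applied to E_la, whose coefficient at 1 is 1. This equation links
  Schur elements to Poincare polynomials.\<close>

lemma sum_inverse_cS:
  assumes la: "la \<in> Pt"
  shows "(\<Sum>nu\<in>Pt. of_nat (mult la nu) * inverse (cS nu)) = inverse (pl la)"
proof -
  have "1 = (\<Sum>nu\<in>Pt. inverse (cS nu) * chi nu (El la))"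
    using trace_characters[OF El_HK, of la] EJ_id[OF youngJ_subset] by simp
  also have "\<dots> = pl la * (\<Sum>nu\<in>Pt. of_nat (mult la nu) * inverse (cS nu))"
    unfolding sum_distrib_left by (intro sum.cong refl) (simp add: chi_El[OF la] mult_ac)
  finally show ?thesis by (metis inverse_unique)
qed

subsection \<open>The a-function\<close>

lemma unit_valuation_unique:
  assumes "inO (vK powi k * x)" "const0 (vK powi k * x) \<noteq> 0" "inO (vK powi l * x)" "const0 (vK powi l * x) \<noteq> 0"
  shows "k = l"
proof -
  have "\<not> k < l" if "inO (vK powi k * x)" "const0 (vK powi l * x) \<noteq> 0" for k l
  proof
    assume "k < l"
    have e: "vK powi l * x = vK powi (l - k) * (vK powi k * x)" by (simp add: power_int_diff)
    have "const0 (vK powi l * x) = 0"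
      unfolding e using const0_mult[of "vK powi (l - k)" "vK powi k * x"] \<open>k < l\<close> that(1) vK_powi_inO[of "l - k"] vK_powi_const0[of "l - k"] by simp
    then show False using that by simp
  qed
  from this[of k l] this[of l k] show ?thesis using assms by linarith
qed

text \<open>For any position (i, j) the Schur element is a sum of squares of that matrix entry over
  all w, with weights of constant term 1. Lowest terms cannot cancel, so its pole order is twice the
  largest pole order of the entry.\<close>

lemma a_value_entry:
  assumes nu: "nu \<in> Pt" and i: "i \<in> {1..d nu}" and j: "j \<in> {1..d nu}"
  obtains a :: int where "\<And>w. w \<in> Sym n \<Longrightarrow> inO (vK powi a * R nu (hT w) i j)"
    "inO (vK powi (2 * a) * cS nu)" "const0 (vK powi (2 * a) * cS nu) > 0"
    "const0 (vK powi (2 * a) * cS nu) = (\<Sum>w\<in>Sym n. (const0 (vK powi a * R nu (hT w) i j))\<^sup>2)"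
proof -
  let ?f = "\<lambda>w. R nu (hT w) i j" and ?r = "P nu i / P nu j"
  have c: "cS nu = (\<Sum>w\<in>Sym n. ?f w * ?f w * ?r)"
  proof -
    have "cS nu = (\<Sum>w\<in>Sym n. ?f w * R nu (hT (inv w)) j i)" using schur_same[OF nu i j j i] by simp
    also have "\<dots> = (\<Sum>w\<in>Sym n. ?f w * ?f w * ?r)" using nu i j by (intro sum.cong refl) (simp add: R_hT_inv)
    finally show ?thesis .
  qed
  have r: "inO ?r" "const0 ?r = 1" using P_ratio[OF nu i j] by auto
  have "\<exists>w\<in>Sym n. ?f w \<noteq> 0"
  proof (rule ccontr)
    assume "\<not> ?thesis"
    then have "cS nu = 0" unfolding c by (intro sum.neutral) auto
    then show False using cS_nonzero[OF nu] by simp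
  qed
  then obtain a where a: "\<And>w. w \<in> Sym n \<Longrightarrow> inO (vK powi a * ?f w)" "\<exists>w\<in>Sym n. const0 (vK powi a * ?f w) \<noteq> 0"
    using finite_family_normal_form[OF finite_Sym, of n ?f] by blast
  let ?g = "\<lambda>w. vK powi a * ?f w"
  have e: "vK powi (2 * a) * cS nu = (\<Sum>w\<in>Sym n. ?g w * ?g w * ?r)"
  proof -
    have "vK powi (2 * a) = vK powi a * vK powi a" by (metis mult_2 power_int_add vK_nonzero)
    then show ?thesis unfolding c sum_distrib_left by (intro sum.cong refl) (simp add: mult_ac)
  qed
  have t: "inO (?g w * ?g w * ?r)" "const0 (?g w * ?g w * ?r) = (const0 (?g w))\<^sup>2" if "w \<in> Sym n" for w
  proof -
    note g = inO_mult[OF a(1)[OF that] a(1)[OF that]] const0_mult[OF a(1)[OF that] a(1)[OF that]]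
    show "inO (?g w * ?g w * ?r)" using inO_mult[OF g(1) r(1)] .
    show "const0 (?g w * ?g w * ?r) = (const0 (?g w))\<^sup>2"
      using const0_mult[OF g(1) r(1)] g(2) r(2) by (simp add: power2_eq_square)
  qed
  have O: "inO (vK powi (2 * a) * cS nu)" unfolding e using t by (intro inO_sum)
  have s: "const0 (vK powi (2 * a) * cS nu) = (\<Sum>w\<in>Sym n. (const0 (?g w))\<^sup>2)"
    unfolding e using t by (subst const0_sum) auto
  obtain w0 where "w0 \<in> Sym n" "const0 (?g w0) \<noteq> 0" using a(2) by blast
  then have pos: "const0 (vK powi (2 * a) * cS nu) > 0" unfolding s by (intro sum_pos2[of _ w0]) auto
  show thesis by (rule that[OF a(1) O pos s])
qed

text \<open>Half the pole order of the Schur element at v = 0. As \<open>cS\<close> does not depend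
  on the matrix position, neither does this exponent.\<close>

definition aval :: "nat list \<Rightarrow> int" where
  "aval nu = (THE a. inO (vK powi (2 * a) * cS nu) \<and> const0 (vK powi (2 * a) * cS nu) \<noteq> 0)"

lemma
  assumes nu: "nu \<in> Pt"
  shows aval_cS: "inO (vK powi (2 * aval nu) * cS nu)" "const0 (vK powi (2 * aval nu) * cS nu) > 0"
    and aval_entry: "\<And>i j w. i \<in> {1..d nu} \<Longrightarrow> j \<in> {1..d nu} \<Longrightarrow> w \<in> Sym n \<Longrightarrow> inO (vK powi aval nu * R nu (hT w) i j)"
    and aval_sum: "\<And>i j. i \<in> {1..d nu} \<Longrightarrow> j \<in> {1..d nu} \<Longrightarrow>
      const0 (vK powi (2 * aval nu) * cS nu) = (\<Sum>w\<in>Sym n. (const0 (vK powi aval nu * R nu (hT w) i j))\<^sup>2)"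
proof -
  have eq: "aval nu = a" if "inO (vK powi (2 * a) * cS nu)" "const0 (vK powi (2 * a) * cS nu) > 0" for a
    unfolding aval_def
  proof (rule the_equality)
    show "inO (vK powi (2 * a) * cS nu) \<and> const0 (vK powi (2 * a) * cS nu) \<noteq> 0" using that by simp
    fix b assume b: "inO (vK powi (2 * b) * cS nu) \<and> const0 (vK powi (2 * b) * cS nu) \<noteq> 0"
    then have "2 * b = 2 * a" using that by (intro unit_valuation_unique[of "2 * b" "cS nu" "2 * a"]) auto
    then show "b = a" by simp
  qed
  have all: "inO (vK powi (2 * aval nu) * cS nu) \<and> const0 (vK powi (2 * aval nu) * cS nu) > 0 \<and>
      (\<forall>w\<in>Sym n. inO (vK powi aval nu * R nu (hT w) i j)) \<and>
      const0 (vK powi (2 * aval nu) * cS nu) = (\<Sum>w\<in>Sym n. (const0 (vK powi aval nu * R nu (hT w) i j))\<^sup>2)"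
    if "i \<in> {1..d nu}" "j \<in> {1..d nu}" for i j
    using a_value_entry[OF nu that] eq by metis
  have one: "1 \<in> {1..d nu}" using d_pos[OF nu] by simp
  show "inO (vK powi (2 * aval nu) * cS nu)" "const0 (vK powi (2 * aval nu) * cS nu) > 0" using all[OF one one] by auto
  show "\<And>i j w. i \<in> {1..d nu} \<Longrightarrow> j \<in> {1..d nu} \<Longrightarrow> w \<in> Sym n \<Longrightarrow> inO (vK powi aval nu * R nu (hT w) i j)"
    "\<And>i j. i \<in> {1..d nu} \<Longrightarrow> j \<in> {1..d nu} \<Longrightarrow>
      const0 (vK powi (2 * aval nu) * cS nu) = (\<Sum>w\<in>Sym n. (const0 (vK powi aval nu * R nu (hT w) i j))\<^sup>2)"
    using all by blast+
qed

abbreviation Lw :: "nat list \<Rightarrow> nat" where "Lw la \<equiv> len n (wlong n la)"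

lemma vqv: "vK * qv = -1"
  by (simp add: qv_def)

text \<open>Only the longest element of the Young subgroup contributes to the lowest power of v,
  with coefficient 1.\<close>

lemma pl_unit:
  obtains q where "inO q" "const0 q = 1" "pl la = vK powi (- 2 * int (Lw la)) * q"
proof -
  let ?J = "Jl la"
  note J = youngJ_subset[of n la]
  let ?L = "Lw la"
  have wl: "wlong n la = wJ n ?J" by (rule wlong_wJ)
  define q where "q = (\<Sum>u\<in>WJ ?J. vK ^ (2 * (?L - len n u)))"
  have "inO q" unfolding q_def by (intro inO_sum inO_power) simp
  moreover have "const0 q = 1"
  proof -
    have "const0 q = (\<Sum>u\<in>WJ ?J. if u = wJ n ?J then 1 else 0)"
      unfolding q_def
    proof (subst const0_sum)
      show "(\<Sum>u\<in>WJ ?J. const0 (vK ^ (2 * (?L - len n u)))) = (\<Sum>u\<in>WJ ?J. if u = wJ n ?J then 1 else 0)"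
      proof (rule sum.cong[OF refl])
        fix u assume u: "u \<in> WJ ?J"
        show "const0 (vK ^ (2 * (?L - len n u))) = (if u = wJ n ?J then 1 else 0)"
        proof (cases "u = wJ n ?J")
          case False
          then have "len n u < ?L" using wJ_unique[OF J u] wl by (metis not_le_imp_less)
          then show ?thesis using False by (simp add: const0_power)
        qed (simp add: wl)
      qed
    qed (simp add: inO_power)
    then show ?thesis using wJ_WJ[OF J] finite_WJ[OF J] by (simp add: sum.delta)
  qed
  moreover have "pl la = vK powi (- 2 * int ?L) * q"
  proof -
    have "qv ^ (2 * len n u) = vK powi (- 2 * int ?L) * vK ^ (2 * (?L - len n u))" if u: "u \<in> WJ ?J" for u
    proof -
      have le: "len n u \<le> ?L" using wJ_max[OF J u] wl by simp
      have "qv ^ (2 * len n u) * vK ^ (2 * len n u) = 1"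
        using vqv by (simp add: mult.commute flip: power_mult_distrib)
      moreover have "vK ^ (2 * ?L) = vK ^ (2 * (?L - len n u)) * vK ^ (2 * len n u)"
        using le by (simp flip: power_add add: algebra_simps)
      ultimately have AB: "qv ^ (2 * len n u) * vK ^ (2 * ?L) = vK ^ (2 * (?L - len n u))"
        by (simp add: mult_ac)
      have DB: "vK powi (- 2 * int ?L) * vK ^ (2 * ?L) = 1"
      proof -
        have "vK powi (- 2 * int ?L) * vK powi (int (2 * ?L)) = vK powi (- 2 * int ?L + int (2 * ?L))"
          by (subst power_int_add) simp_all
        then show ?thesis by (simp only: power_int_of_nat) simp
      qed
      have "qv ^ (2 * len n u) = (vK powi (- 2 * int ?L) * vK ^ (2 * ?L)) * qv ^ (2 * len n u)" unfolding DB by simp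
      also have "\<dots> = vK powi (- 2 * int ?L) * (qv ^ (2 * len n u) * vK ^ (2 * ?L))" by (simp only: mult_ac)
      finally show ?thesis unfolding AB .
    qed
    then show ?thesis by (simp add: pJ_def q_def sum_distrib_left cong: sum.cong)
  qed
  ultimately show thesis by (rule that)
qed

lemma inverse_cS_term:
  assumes nu: "nu \<in> Pt"
  obtains s where "inO s" "const0 s > 0" "const0 s = inverse (const0 (vK powi (2 * aval nu) * cS nu))"
    "inverse (cS nu) = vK powi (2 * aval nu) * s"
proof -
  let ?u = "vK powi (2 * aval nu) * cS nu"
  have u: "inO ?u" "const0 ?u > 0" using aval_cS[OF nu] by auto
  show thesis
  proof (rule that[of "inverse ?u"])
    show "inO (inverse ?u)" using u by (intro inO_inverse) auto
    show i: "const0 (inverse ?u) = inverse (const0 ?u)" by (rule const0_inverse) (use u in auto)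
    show "const0 (inverse ?u) > 0" unfolding i using u(2) by simp
    show "inverse (cS nu) = vK powi (2 * aval nu) * inverse ?u" by (simp add: field_simps)
  qed
qed

text \<open>Each inverse Schur element is v^(2 a) times a unit with positive constant term. Scaling
  by a common lower bound b of the exponents singles out the constituents attaining it.\<close>

lemma leading_sum:
  fixes b :: int
  assumes la: "la \<in> Pt" and b: "\<And>nu. nu \<in> Pt \<Longrightarrow> mult la nu \<noteq> 0 \<Longrightarrow> b \<le> aval nu"
  shows "const0 (vK powi (- 2 * b) * inverse (pl la)) = (\<Sum>nu\<in>Pt. if aval nu = b then of_nat (mult la nu) * inverse (const0 (vK powi (2 * aval nu) * cS nu)) else 0)"
    and "inO (vK powi (- 2 * b) * inverse (pl la))"
proof -
  have *: "inO (of_nat (mult la nu) * (vK powi (- 2 * b) * inverse (cS nu))) \<and>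
      const0 (of_nat (mult la nu) * (vK powi (- 2 * b) * inverse (cS nu))) =
      (if aval nu = b then of_nat (mult la nu) * inverse (const0 (vK powi (2 * aval nu) * cS nu)) else 0)" if nu: "nu \<in> Pt" for nu
  proof (cases "mult la nu = 0")
    case False
    then have ab: "b \<le> aval nu" using b nu by blast
    obtain s where s: "inO s" "const0 s = inverse (const0 (vK powi (2 * aval nu) * cS nu))" "inverse (cS nu) = vK powi (2 * aval nu) * s"
      using inverse_cS_term[OF nu] by metis
    have "vK powi (- 2 * b) * vK powi (2 * aval nu) = vK powi (2 * (aval nu - b))"
      by (subst power_int_add[symmetric]) (simp_all add: algebra_simps)
    then have e: "vK powi (- 2 * b) * inverse (cS nu) = vK powi (2 * (aval nu - b)) * s" unfolding s(3) by (simp add: mult.assoc[symmetric])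
    have O: "inO (vK powi (2 * (aval nu - b)))" using ab by (intro vK_powi_inO) simp
    have c: "const0 (vK powi (2 * (aval nu - b))) = (if aval nu = b then 1 else 0)"
      using ab vK_powi_const0[of "2 * (aval nu - b)"] by auto
    show ?thesis unfolding e using O s(1) by (simp only: inO_mult const0_mult c s(2) inO_of_nat const0_of_nat) simp
  qed simp
  have "vK powi (- 2 * b) * inverse (pl la) = (\<Sum>nu\<in>Pt. of_nat (mult la nu) * (vK powi (- 2 * b) * inverse (cS nu)))"
    unfolding sum_inverse_cS[OF la, symmetric] sum_distrib_left by (intro sum.cong refl) (simp add: mult_ac)
  then show "inO (vK powi (- 2 * b) * inverse (pl la))"
    "const0 (vK powi (- 2 * b) * inverse (pl la)) = (\<Sum>nu\<in>Pt. if aval nu = b then of_nat (mult la nu) * inverse (const0 (vK powi (2 * aval nu) * cS nu)) else 0)"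
    using * by (simp_all add: inO_sum const0_sum)
qed

lemma inverse_pl_const:
  assumes "b \<le> int (Lw la)"
  shows "const0 (vK powi (- 2 * b) * inverse (pl la)) = (if b = int (Lw la) then 1 else 0)"
proof -
  obtain q where q: "inO q" "const0 q = 1" "pl la = vK powi (- 2 * int (Lw la)) * q" by (rule pl_unit)
  have "vK powi (- 2 * b) * inverse (vK powi (- 2 * int (Lw la))) = vK powi (2 * (int (Lw la) - b))"
    by (simp add: power_int_minus[symmetric] power_int_diff algebra_simps) (simp add: power_int_minus field_simps)
  then have e: "vK powi (- 2 * b) * inverse (pl la) = vK powi (2 * (int (Lw la) - b)) * inverse q"
    unfolding q(3) by (simp add: mult.assoc[symmetric] del: power_int_mult_distrib_numeral1)
  have "inO (vK powi (2 * (int (Lw la) - b)))" using assms by (intro vK_powi_inO) simp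
  moreover have "const0 (vK powi (2 * (int (Lw la) - b))) = (if b = int (Lw la) then 1 else 0)"
    using assms vK_powi_const0[of "2 * (int (Lw la) - b)"] by auto
  ultimately show ?thesis unfolding e using q by (simp add: const0_mult inO_inverse const0_inverse)
qed

text \<open>Let b be the least exponent among the constituents. If b were below l(w_la), the left
  side of \<open>leading_sum\<close> would have constant term 0, whereas the right side is a sum of
  nonnegative terms with a positive one among them.\<close>

lemma aval_ge: assumes la: "la \<in> Pt" shows "int (Lw la) \<le> aval la"
proof (rule ccontr)
  assume lt: "\<not> ?thesis"
  let ?N = "{nu \<in> Pt. mult la nu \<noteq> 0}"
  define b where "b = Min (aval ` ?N)"
  have fin: "finite (aval ` ?N)" "la \<in> ?N" using finite_partitions la by auto
  then have "b \<in> aval ` ?N" unfolding b_def by (intro Min_in) auto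
  then obtain nu where nu: "nu \<in> Pt" "mult la nu \<noteq> 0" "aval nu = b" by auto
  have min: "b \<le> aval nu" if "nu \<in> Pt" "mult la nu \<noteq> 0" for nu unfolding b_def using that fin by (intro Min_le) auto
  have "b < int (Lw la)" using min[OF la] lt by simp
  then have "const0 (vK powi (- 2 * b) * inverse (pl la)) = 0" using inverse_pl_const[of b la] by simp
  moreover have "0 < (\<Sum>nu\<in>Pt. if aval nu = b then of_nat (mult la nu) * inverse (const0 (vK powi (2 * aval nu) * cS nu)) else 0)"
  proof (rule sum_pos2[OF finite_partitions nu(1)])
    show "0 < (if aval nu = b then of_nat (mult la nu) * inverse (const0 (vK powi (2 * aval nu) * cS nu)) else 0)"
      using nu aval_cS(2)[OF nu(1)] by simp
    show "0 \<le> (if aval mu = b then of_nat (mult la mu) * inverse (const0 (vK powi (2 * aval mu) * cS mu)) else 0)" if "mu \<in> Pt" for mu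
    proof (cases "aval mu = b")
      case True
      have "0 \<le> inverse (const0 (vK powi (2 * aval mu) * cS mu))" using aval_cS(2)[OF that] by simp
      then have "0 \<le> real (mult la mu) * inverse (const0 (vK powi (2 * aval mu) * cS mu))" by (intro mult_nonneg_nonneg) auto
      then show ?thesis using True by simp
    qed simp
  qed
  ultimately show False using leading_sum(1)[OF la min] by simp
qed

text \<open>Every other constituent belongs to a strictly dominating partition and so has a strictly
  larger exponent. At b = l(w_la) the equation reduces to the term of \<open>la\<close>, whose value
  must be 1.\<close>

lemma aval_eq:
  assumes la: "la \<in> Pt"
  shows "aval la = int (Lw la)" "const0 (vK powi (2 * aval la) * cS la) = 1"
proof -
  have gt: "int (Lw la) < aval nu" if "nu \<in> Pt" "mult la nu \<noteq> 0" "nu \<noteq> la" for nu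
  proof -
    have "la \<lhd> nu" using mult_dominates[OF that(2)] that(3) by (auto simp: sdominates_def)
    then show ?thesis using len_wlong_strict_mono[OF la that(1)] aval_ge[OF that(1)] by linarith
  qed
  have ge: "int (Lw la) \<le> aval nu" if "nu \<in> Pt" "mult la nu \<noteq> 0" for nu
    using gt[OF that] aval_ge[OF la] by (cases "nu = la") auto
  have "1 = const0 (vK powi (- 2 * int (Lw la)) * inverse (pl la))" using inverse_pl_const[of "int (Lw la)" la] by simp
  also have "\<dots> = (\<Sum>nu\<in>Pt. if aval nu = int (Lw la) then of_nat (mult la nu) * inverse (const0 (vK powi (2 * aval nu) * cS nu)) else 0)"
    by (rule leading_sum(1)[OF la ge])
  also have "\<dots> = (\<Sum>nu\<in>Pt. if nu = la then (if aval la = int (Lw la) then inverse (const0 (vK powi (2 * aval la) * cS la)) else 0) else 0)"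
  proof (rule sum.cong[OF refl])
    fix nu assume "nu \<in> Pt"
    then show "(if aval nu = int (Lw la) then of_nat (mult la nu) * inverse (const0 (vK powi (2 * aval nu) * cS nu)) else 0) =
      (if nu = la then (if aval la = int (Lw la) then inverse (const0 (vK powi (2 * aval la) * cS la)) else 0) else 0)"
      using gt[of nu] by (cases "mult la nu = 0") auto
  qed
  also have "\<dots> = (if aval la = int (Lw la) then inverse (const0 (vK powi (2 * aval la) * cS la)) else 0)"
    using la finite_partitions[of n] by (simp add: sum.delta)
  finally show "aval la = int (Lw la)" "const0 (vK powi (2 * aval la) * cS la) = 1"
    by (auto split: if_splits)
qed

end

subsection \<open>Leading matrix coefficients\<close>

context hecke_reps
begin

text \<open>The leading coefficient without the sign eps_w of \<open>lcoeff\<close>; zero patterns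
  and squares are not affected by the sign.\<close>

definition lead :: "nat list \<Rightarrow> perm \<Rightarrow> nat \<Rightarrow> nat \<Rightarrow> real" where
  "lead la w i j = const0 (vK ^ Lw la * R la (hT w) i j)"

abbreviation wb :: "nat list \<Rightarrow> nat \<Rightarrow> nat \<Rightarrow> perm" where
  "wb la i j \<equiv> wbold n la (X la) i j"

lemma lead_inO: "la \<in> Pt \<Longrightarrow> i \<in> {1..d la} \<Longrightarrow> j \<in> {1..d la} \<Longrightarrow> w \<in> Sym n \<Longrightarrow> inO (vK ^ Lw la * R la (hT w) i j)"
  using aval_entry[of la i j w] by (simp add: aval_eq(1))

lemma lead_sum: "la \<in> Pt \<Longrightarrow> i \<in> {1..d la} \<Longrightarrow> j \<in> {1..d la} \<Longrightarrow> (\<Sum>w\<in>Sym n. (lead la w i j)\<^sup>2) = 1"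
  using aval_sum[of la i j] aval_eq(2)[of la] by (simp add: aval_eq(1) lead_def)

lemma lcoeff_lead: "w \<in> Sym n \<Longrightarrow> i \<in> {1..d la} \<Longrightarrow> j \<in> {1..d la} \<Longrightarrow> lcoeff n la (X la) w i j = (-1) ^ len n w * lead la w i j"
  by (simp add: lcoeff_def lead_def R_hT)

lemma lead_unique:
  assumes la: "la \<in> Pt" and i: "i \<in> {1..d la}" and j: "j \<in> {1..d la}"
  obtains w where "w \<in> Sym n" "(lead la w i j)\<^sup>2 = 1" "\<And>w'. w' \<in> Sym n \<Longrightarrow> w' \<noteq> w \<Longrightarrow> lead la w' i j = 0"
proof -
  have int: "lead la w i j \<in> \<int>" if "w \<in> Sym n" for w
  proof -
    have "lcoeff n la (X la) w i j \<in> \<int>" using standing la i j that by (simp add: standing_setup_def)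
    then have "(-1) ^ len n w * lcoeff n la (X la) w i j \<in> \<int>" by (intro Ints_mult Ints_power) auto
    then show ?thesis using lcoeff_lead[OF that i j] by (simp add: mult.assoc[symmetric] flip: power_mult_distrib)
  qed
  have "\<exists>w\<in>Sym n. lead la w i j \<noteq> 0"
  proof (rule ccontr)
    assume "\<not> ?thesis"
    then have "(\<Sum>w\<in>Sym n. (lead la w i j)\<^sup>2) = 0" by (intro sum.neutral) auto
    then show False using lead_sum[OF la i j] by simp
  qed
  then obtain w where w: "w \<in> Sym n" "lead la w i j \<noteq> 0" by blast
  have ge: "(lead la w i j)\<^sup>2 \<ge> 1"
  proof -
    have "\<bar>lead la w i j\<bar> \<ge> 1" using Ints_nonzero_abs_ge1[OF int[OF w(1)] w(2)] .
    then show ?thesis by (metis abs_le_square_iff abs_one one_power2)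
  qed
  have s: "(lead la w i j)\<^sup>2 + (\<Sum>w'\<in>Sym n - {w}. (lead la w' i j)\<^sup>2) = 1"
    using lead_sum[OF la i j] w(1) by (simp add: sum.remove[OF finite_Sym])
  have nn: "(\<Sum>w'\<in>Sym n - {w}. (lead la w' i j)\<^sup>2) \<ge> 0" by (rule sum_nonneg) simp
  have "(\<Sum>w'\<in>Sym n - {w}. (lead la w' i j)\<^sup>2) = 0" using s nn ge by linarith
  then have "\<forall>w'\<in>Sym n - {w}. (lead la w' i j)\<^sup>2 = 0" by (subst (asm) sum_nonneg_eq_0_iff) auto
  then have "\<And>w'. w' \<in> Sym n \<Longrightarrow> w' \<noteq> w \<Longrightarrow> lead la w' i j = 0" by simp
  moreover have "(lead la w i j)\<^sup>2 = 1" using s ge nn by linarith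
  ultimately show thesis using that w(1) by blast
qed

lemma
  assumes la: "la \<in> Pt" and i: "i \<in> {1..d la}" and j: "j \<in> {1..d la}"
  shows wb_Sym: "wb la i j \<in> Sym n" and wb_lead: "(lead la (wb la i j) i j)\<^sup>2 = 1"
    and lead_zero: "\<And>w. w \<in> Sym n \<Longrightarrow> w \<noteq> wb la i j \<Longrightarrow> lead la w i j = 0"
proof -
  obtain w where w: "w \<in> Sym n" "(lead la w i j)\<^sup>2 = 1" "\<And>w'. w' \<in> Sym n \<Longrightarrow> w' \<noteq> w \<Longrightarrow> lead la w' i j = 0"
    using lead_unique[OF la i j] by blast
  have "wb la i j = w"
    unfolding wbold_def
  proof (rule the_equality)
    show "w \<in> Sym n \<and> lcoeff n la (X la) w i j \<noteq> 0" using w(1,2) lcoeff_lead[OF w(1) i j] by auto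
    fix w' assume "w' \<in> Sym n \<and> lcoeff n la (X la) w' i j \<noteq> 0"
    then show "w' = w" using w(3)[of w'] lcoeff_lead[of w' i la j] i j by auto
  qed
  then show "wb la i j \<in> Sym n" "(lead la (wb la i j) i j)\<^sup>2 = 1" "\<And>w. w \<in> Sym n \<Longrightarrow> w \<noteq> wb la i j \<Longrightarrow> lead la w i j = 0"
    using w by auto
qed

lemma wb_lead_nonzero: "la \<in> Pt \<Longrightarrow> i \<in> {1..d la} \<Longrightarrow> j \<in> {1..d la} \<Longrightarrow> lead la (wb la i j) i j \<noteq> 0"
  using wb_lead[of la i j] by auto

lemma lead_hT_inv:
  assumes mu: "mu \<in> Pt" and k: "k \<in> {1..d mu}" and l: "l \<in> {1..d mu}" and w: "w \<in> Sym n"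
  shows "inO (vK ^ Lw mu * R mu (hT (inv w)) l k) \<and> lead mu (inv w) l k = lead mu w k l"
proof -
  have e: "vK ^ Lw mu * R mu (hT (inv w)) l k = (vK ^ Lw mu * R mu (hT w) k l) * (P mu k / P mu l)"
    using R_hT_inv[OF mu w l k] by (simp only: mult.assoc)
  have r: "inO (P mu k / P mu l)" "const0 (P mu k / P mu l) = 1" using P_ratio[OF mu k l] by auto
  show ?thesis unfolding lead_def e using inO_mult[OF lead_inO[OF mu k l w] r(1)] const0_mult[OF lead_inO[OF mu k l w] r(1)] r(2) by simp
qed

text \<open>The constant terms of Schur's relations, with orthogonality of the representation
  turning w^-1 back into w.\<close>

lemma lead_orthogonal:
  assumes la: "la \<in> Pt" and ij: "i \<in> {1..d la}" "j \<in> {1..d la}" and mu: "mu \<in> Pt" and kl: "k \<in> {1..d mu}" "l \<in> {1..d mu}"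
    and ne: "(la, i, j) \<noteq> (mu, k, l)"
  shows "(\<Sum>w\<in>Sym n. lead la w i j * lead mu w k l) = 0"
proof -
  have z: "(\<Sum>w\<in>Sym n. R la (hT w) i j * R mu (hT (inv w)) l k) = 0"
  proof (cases "la = mu")
    case True
    then have "\<not> (i = k \<and> j = l)" using ne by auto
    then show ?thesis using schur_same[OF la ij, of l k] kl True by (simp only: if_False)
  qed (rule schur_distinct[OF la mu])
  have t: "inO ((vK ^ Lw la * R la (hT w) i j) * (vK ^ Lw mu * R mu (hT (inv w)) l k)) \<and>
      const0 ((vK ^ Lw la * R la (hT w) i j) * (vK ^ Lw mu * R mu (hT (inv w)) l k)) = lead la w i j * lead mu w k l"
    if w: "w \<in> Sym n" for w
    using lead_hT_inv[OF mu kl w] lead_inO[OF la ij w] by (simp add: inO_mult const0_mult) (simp add: lead_def)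
  have "0 = vK ^ Lw la * vK ^ Lw mu * (\<Sum>w\<in>Sym n. R la (hT w) i j * R mu (hT (inv w)) l k)" using z by simp
  also have "\<dots> = (\<Sum>w\<in>Sym n. (vK ^ Lw la * R la (hT w) i j) * (vK ^ Lw mu * R mu (hT (inv w)) l k))"
    unfolding sum_distrib_left by (intro sum.cong refl) (simp only: mult_ac)
  finally have "0 = const0 (\<Sum>w\<in>Sym n. (vK ^ Lw la * R la (hT w) i j) * (vK ^ Lw mu * R mu (hT (inv w)) l k))" by simp
  also have "\<dots> = (\<Sum>w\<in>Sym n. const0 ((vK ^ Lw la * R la (hT w) i j) * (vK ^ Lw mu * R mu (hT (inv w)) l k)))"
    using t by (intro const0_sum) blast
  also have "\<dots> = (\<Sum>w\<in>Sym n. lead la w i j * lead mu w k l)" using t by (intro sum.cong refl) blast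
  finally show ?thesis by simp
qed

text \<open>Each family of leading coefficients is supported on a single w, so two orthogonal
  families cannot share it.\<close>

lemma wb_inj:
  assumes la: "la \<in> Pt" and ij: "i \<in> {1..d la}" "j \<in> {1..d la}" and mu: "mu \<in> Pt" and kl: "k \<in> {1..d mu}" "l \<in> {1..d mu}"
    and eq: "wb la i j = wb mu k l"
  shows "la = mu \<and> i = k \<and> j = l"
proof (rule ccontr)
  assume "\<not> ?thesis"
  then have "(\<Sum>w\<in>Sym n. lead la w i j * lead mu w k l) = 0" by (intro lead_orthogonal[OF la ij mu kl]) auto
  moreover have "(\<Sum>w\<in>Sym n. lead la w i j * lead mu w k l) = (\<Sum>w\<in>Sym n. if w = wb la i j then lead la (wb la i j) i j * lead mu (wb mu k l) k l else 0)"
    using lead_zero[OF la ij] eq by (intro sum.cong refl) auto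
  ultimately have "lead la (wb la i j) i j * lead mu (wb mu k l) k l = 0"
    using wb_Sym[OF la ij] by (simp add: sum.delta)
  then show False using wb_lead_nonzero[OF la ij] wb_lead_nonzero[OF mu kl] by simp
qed

text \<open>Injectivity together with the count of sum of squared degrees.\<close>

lemma wb_surj:
  assumes "y \<in> Sym n"
  obtains la i j where "la \<in> Pt" "i \<in> {1..d la}" "j \<in> {1..d la}" "y = wb la i j"
proof -
  define T where "T = (SIGMA la:Pt. {1..d la} \<times> {1..d la})"
  let ?f = "\<lambda>(la, i, j). wb la i j"
  have "inj_on ?f T" using wb_inj by (fastforce simp: T_def inj_on_def)
  moreover have "card T = card (Sym n)"
    unfolding T_def using finite_partitions[of n] sum_d_squares by (subst card_SigmaI) auto
  ultimately have "card (?f ` T) = card (Sym n)" by (simp add: card_image)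
  moreover have "?f ` T \<subseteq> Sym n" using wb_Sym by (auto simp: T_def)
  ultimately have "?f ` T = Sym n" by (intro card_subset_eq) auto
  then have "y \<in> ?f ` T" using assms by simp
  then show thesis using that by (auto simp: T_def)
qed

lemma wb_inv:
  assumes la: "la \<in> Pt" and i: "i \<in> {1..d la}" and j: "j \<in> {1..d la}"
  shows "inv (wb la i j) = wb la j i"
proof (rule ccontr)
  assume ne: "\<not> ?thesis"
  have w: "wb la i j \<in> Sym n" by (rule wb_Sym[OF la i j])
  have "lead la (inv (wb la i j)) j i = 0" using lead_zero[OF la j i Sym_inv[OF w]] ne by simp
  then show False using lead_hT_inv[OF la i j w] wb_lead_nonzero[OF la i j] by simp
qed

lemma R_lead:
  assumes la: "la \<in> Pt" and ij: "i \<in> {1..d la}" "j \<in> {1..d la}" and h: "h \<in> HK n" "\<And>w. w \<in> Sym n \<Longrightarrow> inO (h w)"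
  shows "inO (vK ^ Lw la * R la h i j) \<and> const0 (vK ^ Lw la * R la h i j) = (\<Sum>w\<in>Sym n. const0 (h w) * lead la w i j)"
proof -
  have e: "vK ^ Lw la * R la h i j = (\<Sum>w\<in>Sym n. h w * (vK ^ Lw la * R la (hT w) i j))"
    unfolding R_expand[OF h(1)] sum_distrib_left by (intro sum.cong refl) (simp only: mult_ac)
  have t: "inO (h w * (vK ^ Lw la * R la (hT w) i j))"
    "const0 (h w * (vK ^ Lw la * R la (hT w) i j)) = const0 (h w) * lead la w i j" if "w \<in> Sym n" for w
    using lead_inO[OF la ij that] h(2)[OF that] by (simp_all add: inO_mult const0_mult lead_def)
  show ?thesis unfolding e using t by (simp add: inO_sum const0_sum)
qed

lemma R_KL_lead:
  assumes la: "la \<in> Pt" and ij: "i \<in> {1..d la}" "j \<in> {1..d la}" and w: "w \<in> Sym n"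
  shows "inO (vK ^ Lw la * R la (KL n w) i j)" "const0 (vK ^ Lw la * R la (KL n w) i j) = lead la w i j"
proof -
  have k: "inO (KL n w y) \<and> const0 (KL n w y) = (if y = w then 1 else 0)" for y
  proof -
    have s: "inO (KL n w y - hT w y)" "const0 (KL n w y - hT w y) = 0" using KL_small[OF w, of y] by (auto simp: in_vZv_iff)
    have h: "inO (hT w y)" "const0 (hT w y) = (if y = w then 1 else 0)" by (auto simp: hT_def)
    show ?thesis using inO_add[OF s(1) h(1)] const0_add[OF s(1) h(1)] s(2) h(2) by simp
  qed
  have "(\<Sum>y\<in>Sym n. const0 (KL n w y) * lead la y i j) = (\<Sum>y\<in>Sym n. if y = w then lead la w i j else 0)"
    using k by (intro sum.cong refl) auto
  also have "\<dots> = lead la w i j" using w by (simp add: sum.delta)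
  finally show "inO (vK ^ Lw la * R la (KL n w) i j)" "const0 (vK ^ Lw la * R la (KL n w) i j) = lead la w i j"
    using R_lead[OF la ij KL_HK[OF w]] k by auto
qed

lemma wb_11: "la \<in> Pt \<Longrightarrow> wb la 1 1 = wlong n la"
  using standing by (simp add: standing_setup_def)

lemma wlong_Sym: "wlong n la \<in> Sym n"
  unfolding wlong_wJ by (rule wJ_Sym[OF youngJ_subset])

text \<open>At an ascent k of w, absorbing s_k into C gives T_w C = -v T_(w s_k) C for C = C_(w_la).
  Scaled by v^(2 l(w_la)), the right side has constant term 0, while the (i, 1) entry of the left
  side has a nonzero one.\<close>

lemma wb_column_descent:
  assumes la: "la \<in> Pt" and i: "i \<in> {1..d la}" and k: "k \<in> Jl la"
  shows "wb la i 1 (Suc k) < wb la i 1 k"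
proof (rule ccontr)
  assume nd: "\<not> ?thesis"
  let ?w = "wb la i 1" and ?C = "KL n (wlong n la)" and ?L = "Lw la" and ?d = "d la"
  have one: "1 \<in> {1..?d}" using d_pos[OF la] by simp
  have w: "?w \<in> Sym n" by (rule wb_Sym[OF la i one])
  have kn: "k \<in> {1..<n}" using k youngJ_subset by blast
  have asc: "?w k < ?w (Suc k)" using nd Sym_inj[OF w, of k "Suc k"] by simp
  have ws: "?w \<circ> sgen k \<in> Sym n" using w kn by (simp add: sgen_comp_Sym)
  have C: "?C \<in> HK n" by (rule KL_HK[OF wlong_Sym])
  have lC: "mulTs n k ?C = (\<lambda>y. qv * ?C y)"
    unfolding wlong_wJ KL_wJ[OF youngJ_subset] hlin_smult[OF hlin_mulTs]
    using leig_EJ[OF youngJ_subset, of n la] k by (simp add: leig_def mult_ac)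
  have "len n (sgen k) = 1" using len_right_cases[OF Sym_id kn] by auto
  then have TT: "hT (?w \<circ> sgen k) = hmul n (hT ?w) (hT (sgen k))"
    using hmul_hT_hT[OF w sgen_Sym[OF kn]] len_right_ascent[OF w kn asc] by simp
  have "hmul n (hT (?w \<circ> sgen k)) ?C = (\<lambda>y. qv * hmul n (hT ?w) ?C y)"
    unfolding TT using w kn C lC by (simp add: hmul_assoc hT_HK sgen_Sym hmul_sgen_left hmul_smult_right)
  then have e: "R la (hmul n (hT (?w \<circ> sgen k)) ?C) i 1 = qv * R la (hmul n (hT ?w) ?C) i 1" by (simp add: R_smult)
  define e' where "e' = (\<lambda>m. vK ^ ?L * R la ?C m 1)"
  have e'O: "inO (e' m)" "const0 (e' m) = lead la (wlong n la) m 1" if "m \<in> {1..?d}" for m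
    unfolding e'_def using R_KL_lead[OF la that one wlong_Sym] by auto
  have prod: "inO (vK ^ ?L * (vK ^ ?L * R la (hmul n (hT y) ?C) i 1)) \<and>
      const0 (vK ^ ?L * (vK ^ ?L * R la (hmul n (hT y) ?C) i 1)) = (\<Sum>m=1..?d. lead la y i m * lead la (wlong n la) m 1)"
    if y: "y \<in> Sym n" for y
  proof -
    have eq: "vK ^ ?L * (vK ^ ?L * R la (hmul n (hT y) ?C) i 1) = (\<Sum>m=1..?d. (vK ^ ?L * R la (hT y) i m) * e' m)"
      unfolding R_hmul[OF la hT_HK[OF y] C] MM_def sum_distrib_left e'_def by (intro sum.cong refl) (simp only: mult_ac)
    have t: "inO ((vK ^ ?L * R la (hT y) i m) * e' m)"
      "const0 ((vK ^ ?L * R la (hT y) i m) * e' m) = lead la y i m * lead la (wlong n la) m 1" if "m \<in> {1..?d}" for m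
      using lead_inO[OF la i that y] e'O[OF that] by (simp_all add: inO_mult const0_mult lead_def)
    show ?thesis unfolding eq
    proof
      show "inO (\<Sum>m=1..?d. (vK ^ ?L * R la (hT y) i m) * e' m)" by (rule inO_sum[OF t(1)])
      show "const0 (\<Sum>m=1..?d. (vK ^ ?L * R la (hT y) i m) * e' m) = (\<Sum>m=1..?d. lead la y i m * lead la (wlong n la) m 1)"
        by (subst const0_sum[OF t(1)]) (simp_all only: t(2) cong: sum.cong)
    qed
  qed
  \<comment> \<open>Since w_la sits at position (1, 1), its leading coefficients in the first column
    vanish for m other than 1.\<close>
  have "(\<Sum>m=1..?d. lead la ?w i m * lead la (wlong n la) m 1) = (\<Sum>m=1..?d. if m = 1 then lead la ?w i 1 * lead la (wlong n la) 1 1 else 0)"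
  proof (rule sum.cong[OF refl])
    fix m assume m: "m \<in> {1..?d}"
    have "lead la (wlong n la) m 1 = 0" if "m \<noteq> 1"
    proof (rule lead_zero[OF la m one wlong_Sym])
      show "wlong n la \<noteq> wb la m 1" using wb_inj[OF la one one la m one] that wb_11[OF la] by auto
    qed
    then show "lead la ?w i m * lead la (wlong n la) m 1 = (if m = 1 then lead la ?w i 1 * lead la (wlong n la) 1 1 else 0)" by simp
  qed
  also have "\<dots> = lead la ?w i 1 * lead la (wlong n la) 1 1" using one by (simp add: sum.delta)
  finally have nz: "const0 (vK ^ ?L * (vK ^ ?L * R la (hmul n (hT ?w) ?C) i 1)) \<noteq> 0"
    using prod[OF w] wb_lead_nonzero[OF la i one] wb_lead_nonzero[OF la one one] wb_11[OF la] by simp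
  have "vK ^ ?L * (vK ^ ?L * R la (hmul n (hT ?w) ?C) i 1) = - vK * (vK ^ ?L * (vK ^ ?L * R la (hmul n (hT (?w \<circ> sgen k)) ?C) i 1))"
    unfolding e by (simp add: qv_def)
  then have "const0 (vK ^ ?L * (vK ^ ?L * R la (hmul n (hT ?w) ?C) i 1)) = const0 (- vK) * const0 (vK ^ ?L * (vK ^ ?L * R la (hmul n (hT (?w \<circ> sgen k)) ?C) i 1))"
    using const0_mult[of "- vK"] prod[OF ws] by (simp add: inO_uminus)
  then show False using nz by (simp add: const0_uminus)
qed

lemma
  assumes la: "la \<in> Pt" and i: "i \<in> {1..d la}"
  shows xcos_wb: "xcos n la (X la) i \<circ> wlong n la = wb la i 1"
    and xcos_wb': "wlong n la \<circ> inv (xcos n la (X la) i) = wb la 1 i"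
proof -
  have one: "1 \<in> {1..d la}" using d_pos[OF la] by simp
  have w: "wb la i 1 \<in> Sym n" by (rule wb_Sym[OF la i one])
  obtain x where x: "x \<in> XJ n (Jl la)" "wb la i 1 = x \<circ> wlong n la"
    using all_descents_decomp[OF youngJ_subset w wb_column_descent[OF la i]] unfolding wlong_wJ by blast
  have eq: "xcos n la (X la) i = x"
    unfolding xcos_def Xmin_XJ
  proof (rule the_equality)
    fix x' assume x': "x' \<in> XJ n (Jl la) \<and> wb la i 1 = x' \<circ> wlong n la"
    then have "x' \<circ> wlong n la = x \<circ> wlong n la" using x by simp
    then show "x' = x" using x' x(1) XJ_WJ_unique[OF youngJ_subset] wJ_WJ[OF youngJ_subset] unfolding wlong_wJ by blast
  qed (use x in auto)
  then show "xcos n la (X la) i \<circ> wlong n la = wb la i 1" using x by auto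
  have "inv (x \<circ> wlong n la) = inv (wlong n la) \<circ> inv x"
    using Sym_inv_distrib[OF XJ_Sym[OF youngJ_subset x(1)] wlong_Sym] .
  moreover have "inv (wlong n la) = wlong n la" unfolding wlong_wJ by (rule inv_wJ[OF youngJ_subset])
  ultimately show "wlong n la \<circ> inv (xcos n la (X la) i) = wb la 1 i"
    using wb_inv[OF la i one] x(2) eq by simp
qed

section \<open>Cells and the Murphy basis\<close>

definition Cell :: "nat list \<Rightarrow> perm set" where
  "Cell mu = Rcell n mu (d mu) (X mu)"

definition vanishes_below :: "nat list \<Rightarrow> hecke \<Rightarrow> bool" where
  "vanishes_below mu h \<longleftrightarrow> (\<forall>nu\<in>Pt. \<not> mu \<unlhd> nu \<longrightarrow> R nu h = (\<lambda>i j. 0))"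

lemma Cell_iff: "y \<in> Cell mu \<longleftrightarrow> (\<exists>i\<in>{1..d mu}. \<exists>j\<in>{1..d mu}. y = wb mu i j)"
  unfolding Cell_def Rcell_def by blast

text \<open>The last clause carries the induction hypothesis of the final argument: basis elements
  of the cells in U are invisible to representations outside U.\<close>

definition upset :: "nat list set \<Rightarrow> bool" where
  "upset U \<longleftrightarrow> U \<subseteq> Pt \<and> (\<forall>mu\<in>U. \<forall>nu\<in>Pt. mu \<unlhd> nu \<longrightarrow> nu \<in> U) \<and> (\<forall>mu\<in>U. \<forall>y\<in>Cell mu. vanishes_below mu (KL n y))"

definition outer :: "nat list set \<Rightarrow> perm set" where
  "outer U = Sym n - (\<Union>mu\<in>U. Cell mu)"

lemma wb_outer: "U \<subseteq> Pt \<Longrightarrow> nu \<in> Pt \<Longrightarrow> i \<in> {1..d nu} \<Longrightarrow> j \<in> {1..d nu} \<Longrightarrow> wb nu i j \<in> outer U \<longleftrightarrow> nu \<notin> U"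
proof -
  assume *: "U \<subseteq> Pt" "nu \<in> Pt" "i \<in> {1..d nu}" "j \<in> {1..d nu}"
  have "wb nu i j \<in> Cell mu \<longleftrightarrow> mu = nu" if "mu \<in> Pt" for mu
    unfolding Cell_iff using wb_inj[OF *(2-4) that] *(3,4) by metis
  then show ?thesis using * wb_Sym by (auto simp: outer_def)
qed

text \<open>The coefficients of an element on the cells outside an up-set can be read off from the
  leading terms of the representations outside the up-set.\<close>

lemma outer_coefficients:
  assumes U: "upset U" and h: "h = (\<lambda>y. \<Sum>w\<in>Sym n. a w * KL n w y)"
    and O: "\<And>nu i j. nu \<in> Pt - U \<Longrightarrow> i \<in> {1..d nu} \<Longrightarrow> j \<in> {1..d nu} \<Longrightarrow> inO (vK ^ Lw nu * R nu h i j)"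
  shows "\<And>y. y \<in> outer U \<Longrightarrow> inO (a y)"
    and "\<And>nu i j. nu \<in> Pt - U \<Longrightarrow> i \<in> {1..d nu} \<Longrightarrow> j \<in> {1..d nu} \<Longrightarrow>
      const0 (a (wb nu i j)) * lead nu (wb nu i j) i j = const0 (vK ^ Lw nu * R nu h i j)"
proof -
  have fin: "finite (outer U)" by (simp add: outer_def)
  have sub: "outer U \<subseteq> Sym n" by (auto simp: outer_def)
  have UP: "U \<subseteq> Pt" using U by (simp add: upset_def)
  have Rh: "R nu h i j = (\<Sum>y\<in>outer U. a y * R nu (KL n y) i j)" if nu: "nu \<in> Pt - U" for nu i j
  proof -
    have "R nu h i j = (\<Sum>y\<in>Sym n. a y * R nu (KL n y) i j)" unfolding h by (rule R_sum)
    also have "\<dots> = (\<Sum>y\<in>outer U. a y * R nu (KL n y) i j)"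
    proof (rule sum.mono_neutral_right[OF finite_Sym sub], intro ballI)
      fix y assume "y \<in> Sym n - outer U"
      then obtain mu where mu: "mu \<in> U" "y \<in> Cell mu" by (auto simp: outer_def)
      then have "vanishes_below mu (KL n y)" "\<not> mu \<unlhd> nu" using U nu by (auto simp: upset_def)
      then show "a y * R nu (KL n y) i j = 0" using nu by (auto simp: vanishes_below_def)
    qed
    finally show ?thesis .
  qed
  have lead_outer: "const0 (vK powi k * (vK ^ Lw nu * R nu h i j)) = const0 (vK powi k * a (wb nu i j)) * lead nu (wb nu i j) i j"
    if k: "\<And>y. y \<in> outer U \<Longrightarrow> inO (vK powi k * a y)" and nu: "nu \<in> Pt - U" and ij: "i \<in> {1..d nu}" "j \<in> {1..d nu}" for k nu i j
  proof -
    have nuP: "nu \<in> Pt" using nu by simp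
    have "vK powi k * (vK ^ Lw nu * R nu h i j) = (\<Sum>y\<in>outer U. (vK powi k * a y) * (vK ^ Lw nu * R nu (KL n y) i j))"
      unfolding Rh[OF nu] sum_distrib_left by (intro sum.cong refl) (simp only: mult_ac)
    then have "const0 (vK powi k * (vK ^ Lw nu * R nu h i j)) = const0 (\<Sum>y\<in>outer U. (vK powi k * a y) * (vK ^ Lw nu * R nu (KL n y) i j))" by simp
    also have "\<dots> = (\<Sum>y\<in>outer U. const0 ((vK powi k * a y) * (vK ^ Lw nu * R nu (KL n y) i j)))"
      by (rule const0_sum) (use k R_KL_lead(1)[OF nuP ij] sub in \<open>blast intro: inO_mult[of "vK powi k * _" "vK ^ _ * _"]\<close>)
    also have "\<dots> = (\<Sum>y\<in>outer U. if y = wb nu i j then const0 (vK powi k * a (wb nu i j)) * lead nu (wb nu i j) i j else 0)"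
    proof (rule sum.cong[OF refl])
      fix y assume y: "y \<in> outer U"
      then have "const0 ((vK powi k * a y) * (vK ^ Lw nu * R nu (KL n y) i j)) = const0 (vK powi k * a y) * lead nu y i j"
        using k[OF y] R_KL_lead[OF nuP ij, of y] sub const0_mult[of "vK powi k * a y" "vK ^ Lw nu * R nu (KL n y) i j"] by auto
      then show "const0 ((vK powi k * a y) * (vK ^ Lw nu * R nu (KL n y) i j)) = (if y = wb nu i j then const0 (vK powi k * a (wb nu i j)) * lead nu (wb nu i j) i j else 0)"
        using lead_zero[OF nuP ij, of y] y sub by auto
    qed
    also have "\<dots> = const0 (vK powi k * a (wb nu i j)) * lead nu (wb nu i j) i j"
      using wb_outer[OF UP nuP ij] nu fin by (simp add: sum.delta)
    finally show ?thesis .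
  qed
  show aO: "inO (a y)" if y: "y \<in> outer U" for y
  proof (cases "a y = 0")
    case False
    then obtain k where k: "\<And>y. y \<in> outer U \<Longrightarrow> inO (vK powi k * a y)" "\<exists>y\<in>outer U. const0 (vK powi k * a y) \<noteq> 0"
      using finite_family_normal_form[OF fin, of a] y by blast
    then obtain y0 where y0: "y0 \<in> outer U" "const0 (vK powi k * a y0) \<noteq> 0" by blast
    obtain nu i j where nu: "nu \<in> Pt" "i \<in> {1..d nu}" "j \<in> {1..d nu}" "y0 = wb nu i j" using wb_surj[of y0] y0(1) sub by blast
    have nuU: "nu \<in> Pt - U" using wb_outer[OF UP nu(1-3)] y0(1) nu by simp
    \<comment> \<open>A positive k means that some outer coefficient has a pole. The scaled leading
      term would then be nonzero at y0, although integrality of the entries of h makes it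
      vanish.\<close>
    have "\<not> 0 < k"
    proof
      assume "0 < k"
      then have "const0 (vK powi k * (vK ^ Lw nu * R nu h i j)) = 0"
        using const0_mult[of "vK powi k" "vK ^ Lw nu * R nu h i j"] O[OF nuU nu(2,3)] vK_powi_inO[of k] vK_powi_const0[of k] by simp
      then show False using lead_outer[OF k(1) nuU nu(2,3)] y0(2) nu(4) wb_lead_nonzero[OF nu(1-3)] by simp
    qed
    then have "inO (vK powi (- k))" by (intro vK_powi_inO) simp
    from inO_mult[OF this k(1)[OF y]] show ?thesis by (simp add: power_int_minus field_simps)
  qed simp
  show "const0 (a (wb nu i j)) * lead nu (wb nu i j) i j = const0 (vK ^ Lw nu * R nu h i j)"
    if "nu \<in> Pt - U" "i \<in> {1..d nu}" "j \<in> {1..d nu}" for nu i j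
    using lead_outer[of 0 nu i j] that aO by simp
qed

text \<open>Some outer coefficient could be scaled to have nonzero constant term. For the scaled
  element all leading terms outside U are still zero, and they determine that constant term.\<close>

lemma outer_coefficients_zero:
  assumes U: "upset U" and h: "h = (\<lambda>y. \<Sum>w\<in>Sym n. a w * KL n w y)"
    and z: "\<And>nu. nu \<in> Pt - U \<Longrightarrow> R nu h = (\<lambda>i j. 0)" and y: "y \<in> outer U"
  shows "a y = 0"
proof (rule ccontr)
  assume "a y \<noteq> 0"
  have fin: "finite (outer U)" by (simp add: outer_def)
  obtain k where k: "\<exists>y\<in>outer U. const0 (vK powi k * a y) \<noteq> 0"
    using finite_family_normal_form[OF fin, of a] y \<open>a y \<noteq> 0\<close> by blast
  then obtain y0 where y0: "y0 \<in> outer U" "const0 (vK powi k * a y0) \<noteq> 0" by blast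
  have UP: "U \<subseteq> Pt" using U by (simp add: upset_def)
  obtain nu i j where nu: "nu \<in> Pt" "i \<in> {1..d nu}" "j \<in> {1..d nu}" "y0 = wb nu i j" using wb_surj[of y0] y0(1) by (auto simp: outer_def)
  have nuU: "nu \<in> Pt - U" using wb_outer[OF UP nu(1-3)] y0(1) nu by simp
  let ?h = "\<lambda>y. vK powi k * h y"
  have h': "?h = (\<lambda>y. \<Sum>w\<in>Sym n. (vK powi k * a w) * KL n w y)" unfolding h by (simp add: sum_distrib_left mult.assoc)
  have z': "R mu ?h i j = 0" if "mu \<in> Pt - U" for mu i j using z[OF that] by (simp add: R_smult)
  have "const0 (vK powi k * a (wb nu i j)) * lead nu (wb nu i j) i j = const0 (vK ^ Lw nu * R nu ?h i j)"
    by (rule outer_coefficients(2)[OF U h' _ nuU nu(2,3)]) (simp add: z')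
  then have "const0 (vK powi k * a y0) * lead nu (wb nu i j) i j = 0" using z'[OF nuU] nu(4) by simp
  then show False using y0(2) wb_lead_nonzero[OF nu(1-3)] by simp
qed

end

subsection \<open>Spans over the Laurent polynomials\<close>

lemma spanA_superset: "b \<in> S \<Longrightarrow> b \<in> spanA S"
  unfolding spanA_def by (intro CollectI exI[of _ "{b}"] exI[of _ "\<lambda>_. 1"]) auto

lemma spanA_zero: "(\<lambda>y. 0) \<in> spanA S"
  unfolding spanA_def by (intro CollectI exI[of _ "{}"] exI[of _ "\<lambda>_. 0"]) auto

lemma spanA_add: "h \<in> spanA S \<Longrightarrow> g \<in> spanA S \<Longrightarrow> (\<lambda>y. h y + g y) \<in> spanA S"
proof -
  assume "h \<in> spanA S" "g \<in> spanA S"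
  then obtain F f G g' where *: "finite F" "F \<subseteq> S" "\<forall>b. inA (f b)" "h = (\<lambda>y. \<Sum>b\<in>F. f b * b y)"
    "finite G" "G \<subseteq> S" "\<forall>b. inA (g' b)" "g = (\<lambda>y. \<Sum>b\<in>G. g' b * b y)" unfolding spanA_def by blast
  define k where "k = (\<lambda>b. (if b \<in> F then f b else 0) + (if b \<in> G then g' b else 0))"
  have "(\<Sum>b\<in>F. f b * b y) = (\<Sum>b\<in>F \<union> G. (if b \<in> F then f b else 0) * b y)" for y
    using *(1,5) by (intro sum.mono_neutral_cong_left) auto
  moreover have "(\<Sum>b\<in>G. g' b * b y) = (\<Sum>b\<in>F \<union> G. (if b \<in> G then g' b else 0) * b y)" for y
    using *(1,5) by (intro sum.mono_neutral_cong_left) auto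
  ultimately have "(\<lambda>y. h y + g y) = (\<lambda>y. \<Sum>b\<in>F \<union> G. k b * b y)"
    unfolding *(4,8) k_def by (simp add: distrib_right sum.distrib)
  moreover have "\<forall>b. inA (k b)" using *(3,7) by (auto simp: k_def intro: inA_add)
  ultimately show ?thesis unfolding spanA_def using *(1,2,5,6) by blast
qed

lemma spanA_smult: "inA c \<Longrightarrow> h \<in> spanA S \<Longrightarrow> (\<lambda>y. c * h y) \<in> spanA S"
proof -
  assume c: "inA c" "h \<in> spanA S"
  then obtain F f where *: "finite F" "F \<subseteq> S" "\<forall>b. inA (f b)" "h = (\<lambda>y. \<Sum>b\<in>F. f b * b y)" unfolding spanA_def by blast
  have "(\<lambda>y. c * h y) = (\<lambda>y. \<Sum>b\<in>F. (c * f b) * b y)" unfolding *(4) by (simp add: sum_distrib_left mult.assoc)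
  moreover have "\<forall>b. inA (c * f b)" using *(3) c by (auto intro: inA_mult)
  ultimately show ?thesis unfolding spanA_def using *(1,2) by (intro CollectI exI[of _ F] exI[of _ "\<lambda>b. c * f b"]) auto
qed

lemma spanA_sum: "(\<And>s. s \<in> I \<Longrightarrow> inA (c s)) \<Longrightarrow> (\<And>s. s \<in> I \<Longrightarrow> F s \<in> spanA S) \<Longrightarrow> (\<lambda>y. \<Sum>s\<in>I. c s * F s y) \<in> spanA S"
proof (induction I rule: infinite_finite_induct)
  case (insert x I)
  then have "(\<lambda>y. c x * F x y + (\<Sum>s\<in>I. c s * F s y)) \<in> spanA S" by (intro spanA_add spanA_smult) auto
  then show ?case using insert by simp
qed (auto intro: spanA_zero)

lemma spanA_least:
  assumes "\<And>b. b \<in> S \<Longrightarrow> b \<in> spanA T"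
  shows "spanA S \<subseteq> spanA T"
proof
  fix h assume "h \<in> spanA S"
  then obtain F f where *: "finite F" "F \<subseteq> S" "\<forall>b. inA (f b)" "h = (\<lambda>y. \<Sum>b\<in>F. f b * b y)" unfolding spanA_def by blast
  show "h \<in> spanA T" unfolding *(4) using * assms by (intro spanA_sum) auto
qed

lemma spanA_mono: "S \<subseteq> T \<Longrightarrow> spanA S \<subseteq> spanA T"
  by (rule spanA_least) (auto intro: spanA_superset)

context hecke_reps
begin

lemma Nhat_Nideal: "Nhat n la \<subseteq> Nideal n la"
  unfolding Nhat_def Nideal_def by (rule spanA_mono) (auto simp: sdominates_def)

lemma Nideal_mono: "la \<unlhd> mu \<Longrightarrow> Nideal n mu \<subseteq> Nideal n la"
  unfolding Nideal_def by (rule spanA_mono) (auto intro: dominates_trans)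

lemma Nideal_Nhat:
  assumes "la \<in> Pt" "mu \<in> Pt" "la \<lhd> mu"
  shows "Nideal n mu \<subseteq> Nhat n la"
proof -
  have "la \<lhd> nu" if "nu \<in> Pt" "mu \<unlhd> nu" for nu
    using assms that dominates_trans[of la mu nu] dominates_antisym[OF assms(1,2)] by (auto simp: sdominates_def)
  then show ?thesis unfolding Nideal_def Nhat_def by (intro spanA_mono) auto
qed

section \<open>The elements C_(w_la) and Z_w: integrality, bar invariance and leading terms\<close>

abbreviation Cl :: "nat list \<Rightarrow> hecke" where "Cl la \<equiv> KL n (wlong n la)"

lemma Cl_EJ: "Cl la = (\<lambda>y. inverse (qv ^ Lw la) * El la y)"
  using KL_wJ[OF youngJ_subset, of n la] by (simp add: wlong_wJ)

lemma Cl_HK [simp]: "Cl la \<in> HK n" and Cl_inH [simp]: "inH n (Cl la)"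
  by (rule KL_HK[OF wlong_Sym], rule KL_inH[OF wlong_Sym])

lemma Cl_star: "hstar n (Cl la) = Cl la"
  using KL_hstar[OF wlong_Sym, of la] inv_wJ[OF youngJ_subset, of n la] by (simp add: wlong_wJ)

lemma R_Cl_zero: "la \<in> Pt \<Longrightarrow> nu \<in> Pt \<Longrightarrow> \<not> la \<unlhd> nu \<Longrightarrow> R nu (Cl la) = (\<lambda>i j. 0)"
  using R_El_zero'[of la nu] by (simp add: Cl_EJ R_smult fun_eq_iff)

text \<open>The factor in front of Z_w. It is the inverse of the eigenvalue of C_(w_la) on itself
  (\<open>scal_Cl_Cl\<close>).\<close>

definition scal :: "nat list \<Rightarrow> K" where
  "scal la = inverse (Ppoly n la) * sgnK n (wlong n la) * vK ^ Lw la"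

text \<open>Multiplication by w_la permutes the Young subgroup and turns a length into its
  complement in l(w_la).\<close>

lemma Ppoly_pl: "Ppoly n la = vK ^ (2 * Lw la) * pl la"
proof -
  let ?J = "Jl la"
  note J = youngJ_subset[of n la]
  have inv: "wJ n ?J \<circ> (wJ n ?J \<circ> u) = u" for u
  proof -
    have "wJ n ?J \<circ> wJ n ?J = id" using Sym_inv_comp(1)[OF wJ_Sym[OF J]] inv_wJ[OF J] by simp
    then show ?thesis by (simp flip: comp_assoc)
  qed
  have "Ppoly n la = (\<Sum>u\<in>WJ ?J. vK ^ (2 * len n u))" by (simp add: Ppoly_def young_WJ)
  also have "\<dots> = (\<Sum>u\<in>WJ ?J. vK ^ (2 * len n (wJ n ?J \<circ> u)))"
    by (rule sum.reindex_bij_witness[of _ "\<lambda>u. wJ n ?J \<circ> u" "\<lambda>u. wJ n ?J \<circ> u"])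
      (auto simp: inv WJ_comp[OF wJ_WJ[OF J]])
  also have "\<dots> = (\<Sum>u\<in>WJ ?J. vK ^ (2 * Lw la) * qv ^ (2 * len n u))"
  proof (rule sum.cong[OF refl])
    fix u assume u: "u \<in> WJ ?J"
    have l: "Lw la = len n (wJ n ?J \<circ> u) + len n u" using wJ_len[OF J u] by (simp add: wlong_wJ)
    have "vK ^ (2 * len n u) * qv ^ (2 * len n u) = 1" using vqv by (simp flip: power_mult_distrib)
    then show "vK ^ (2 * len n (wJ n ?J \<circ> u)) = vK ^ (2 * Lw la) * qv ^ (2 * len n u)"
      unfolding l by (simp add: power_add distrib_left mult.assoc)
  qed
  finally show ?thesis by (simp add: pJ_def sum_distrib_left)
qed

text \<open>C_(w_la) is bar invariant, so the scalar by which it acts on itself is bar invariant as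
  well, and \<open>scal\<close> is the inverse of that scalar.\<close>

lemma scal_Cl_Cl: "(\<lambda>y. scal la * hmul n (Cl la) (Cl la) y) = Cl la" and scal_bar: "barK (scal la) = scal la"
proof -
  note J = youngJ_subset[of n la]
  define \<kappa> where "\<kappa> = inverse (qv ^ Lw la) * pl la"
  have CC: "hmul n (Cl la) (Cl la) = (\<lambda>y. \<kappa> * Cl la y)"
    unfolding Cl_EJ by (simp add: hmul_smult_left hmul_smult_right EJ_EJ[OF J] \<kappa>_def mult.assoc mult.left_commute)
  have p: "pl la \<noteq> 0" using pJ_nonzero[OF J] .
  have "scal la * \<kappa> = 1"
  proof -
    have "inverse (qv ^ Lw la) = (-1) ^ Lw la * vK ^ Lw la"
      by (simp add: inverse_qv power_inverse[symmetric] power_minus[of vK])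
    then have "scal la * \<kappa> = inverse (vK ^ (2 * Lw la) * pl la) * ((-1) ^ Lw la * (-1) ^ Lw la) * (vK ^ Lw la * vK ^ Lw la) * pl la"
      unfolding scal_def \<kappa>_def Ppoly_pl sgnK_def by (simp only: mult_ac)
    also have "(-1) ^ Lw la * (-1) ^ Lw la = (1 :: K)" by (simp flip: power_mult_distrib)
    also have "vK ^ Lw la * vK ^ Lw la = vK ^ (2 * Lw la)" by (simp add: mult_2 power_add)
    finally show ?thesis using p by (simp add: field_simps)
  qed
  then show "(\<lambda>y. scal la * hmul n (Cl la) (Cl la) y) = Cl la" unfolding CC by (simp add: mult.assoc[symmetric])
  have "hbar n (hmul n (Cl la) (Cl la)) = hmul n (Cl la) (Cl la)"
    by (simp add: hbar_hmul KL_bar[OF wlong_Sym])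
  then have "(\<lambda>y. barK \<kappa> * Cl la y) = (\<lambda>y. \<kappa> * Cl la y)" unfolding CC by (simp add: hbar_smult KL_bar[OF wlong_Sym])
  from fun_cong[OF this, of "wlong n la"] have b: "barK \<kappa> = \<kappa>" using KL_self[OF wlong_Sym] by simp
  have "barK (scal la) * barK \<kappa> = 1" using \<open>scal la * \<kappa> = 1\<close> by (simp flip: barK_mult)
  then show "barK (scal la) = scal la" using \<open>scal la * \<kappa> = 1\<close> unfolding b by (metis mult_cancel_right mult_zero_right zero_neq_one)
qed

text \<open>The second factor is the \<open>hstar\<close> of a first-column element, so that only
  elements C_(x w_la) need to be studied.\<close>

lemma Zelt_eq:
  assumes la: "la \<in> Pt" and i: "i \<in> {1..d la}" and j: "j \<in> {1..d la}"
  shows "Zelt n la (X la) i j = (\<lambda>y. scal la * hmul n (KL n (wb la i 1)) (hstar n (KL n (wb la j 1))) y)"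
proof -
  have one: "1 \<in> {1..d la}" using d_pos[OF la] by simp
  have "hstar n (KL n (wb la j 1)) = KL n (wb la 1 j)"
    using KL_hstar[OF wb_Sym[OF la j one]] wb_inv[OF la j one] by simp
  then show ?thesis unfolding Zelt_def xcos_wb[OF la i] xcos_wb'[OF la j] hsmul_def scal_def by simp
qed

lemma KL_column_factor:
  assumes la: "la \<in> Pt" and i: "i \<in> {1..d la}"
  shows "KL n (wb la i 1) = (\<lambda>y. \<Sum>x\<in>XJ n (Jl la). KL n (wb la i 1) (x \<circ> wlong n la) * hmul n (hT x) (Cl la) y)"
proof -
  have one: "1 \<in> {1..d la}" using d_pos[OF la] by simp
  show ?thesis unfolding wlong_wJ
    by (rule reig_expand_KL[OF youngJ_subset KL_reig[OF youngJ_subset wb_Sym[OF la i one] wb_column_descent[OF la i]]])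
qed

text \<open>The factor \<open>scal\<close> cancels one of the two middle copies of C_(w_la). The
  denominator of Z_w disappears in this way.\<close>

lemma scal_product:
  assumes "g \<in> HK n" "h \<in> HK n"
  shows "(\<lambda>y. scal la * hmul n (hmul n g (Cl la)) (hstar n (hmul n h (Cl la))) y) = hmul n (hmul n g (Cl la)) (hstar n h)"
proof -
  have "hmul n (hmul n g (Cl la)) (hstar n (hmul n h (Cl la))) = hmul n g (hmul n (hmul n (Cl la) (Cl la)) (hstar n h))"
    using assms by (simp add: hstar_hmul Cl_star hmul_assoc hmul_HK)
  then have "(\<lambda>y. scal la * hmul n (hmul n g (Cl la)) (hstar n (hmul n h (Cl la))) y)
      = hmul n g (hmul n (\<lambda>y. scal la * hmul n (Cl la) (Cl la) y) (hstar n h))"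
    by (simp add: hmul_smult_left hmul_smult_right)
  then show ?thesis unfolding scal_Cl_Cl using assms by (simp add: hmul_assoc)
qed

lemma KL_column_inH:
  assumes la: "la \<in> Pt" and i: "i \<in> {1..d la}"
  obtains a where "inH n a" "KL n (wb la i 1) = hmul n a (Cl la)"
proof -
  have one: "1 \<in> {1..d la}" using d_pos[OF la] by simp
  define a where "a = (\<lambda>y. \<Sum>x\<in>XJ n (Jl la). KL n (wb la i 1) (x \<circ> wlong n la) * hT x y)"
  have "inH n a" unfolding a_def
    using KL_inH[OF wb_Sym[OF la i one]] XJ_Sym[OF youngJ_subset] by (intro inH_sum inH_hT) (auto simp: inH_def)
  moreover have "KL n (wb la i 1) = hmul n a (Cl la)"
    unfolding a_def hmul_sum_left by (rule KL_column_factor[OF la i])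
  ultimately show thesis by (rule that)
qed

lemma
  assumes la: "la \<in> Pt" and i: "i \<in> {1..d la}" and j: "j \<in> {1..d la}"
  shows Zelt_inH: "inH n (Zelt n la (X la) i j)" and Zelt_bar: "hbar n (Zelt n la (X la) i j) = Zelt n la (X la) i j"
    and Zelt_vanishes: "vanishes_below la (Zelt n la (X la) i j)"
proof -
  obtain a where a: "inH n a" "KL n (wb la i 1) = hmul n a (Cl la)" using KL_column_inH[OF la i] by blast
  obtain b where b: "inH n b" "KL n (wb la j 1) = hmul n b (Cl la)" using KL_column_inH[OF la j] by blast
  have ab: "a \<in> HK n" "b \<in> HK n" using a b inH_HK by auto
  have Z: "Zelt n la (X la) i j = hmul n (hmul n a (Cl la)) (hstar n b)"
    unfolding Zelt_eq[OF la i j] a(2) b(2) by (rule scal_product[OF ab])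
  show "inH n (Zelt n la (X la) i j)" unfolding Z using a b by (intro inH_hmul inH_hstar) auto
  have one: "1 \<in> {1..d la}" using d_pos[OF la] by simp
  show "hbar n (Zelt n la (X la) i j) = Zelt n la (X la) i j"
    unfolding Zelt_eq[OF la i j]
    using wb_Sym[OF la i one] wb_Sym[OF la j one]
    by (simp add: hbar_smult scal_bar hbar_hmul KL_HK hbar_hstar KL_bar del: One_nat_def)
  show "vanishes_below la (Zelt n la (X la) i j)"
    unfolding vanishes_below_def Z
  proof (intro ballI impI)
    fix nu assume nu: "nu \<in> Pt" "\<not> la \<unlhd> nu"
    have "R nu (hmul n a (Cl la)) = (\<lambda>i j. 0)" using R_zero_right[OF nu(1) ab(1) Cl_HK R_Cl_zero[OF la nu]] .
    then show "R nu (hmul n (hmul n a (Cl la)) (hstar n b)) = (\<lambda>i j. 0)"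
      by (rule R_zero_left[OF nu(1) hmul_HK[OF Cl_HK] hstar_HK])
  qed
qed

text \<open>\<open>scal\<close> is v^(l(w_la)) times a unit with constant term 1 or -1. The extra
  power of v normalises the second factor, and in the matrix product only the inner index 1 carries
  leading terms, at position (i, j).\<close>

lemma Zelt_lead:
  assumes la: "la \<in> Pt" and i: "i \<in> {1..d la}" and j: "j \<in> {1..d la}" and k: "k \<in> {1..d la}" and l: "l \<in> {1..d la}"
  shows "inO (vK ^ Lw la * R la (Zelt n la (X la) i j) k l)"
    "(const0 (vK ^ Lw la * R la (Zelt n la (X la) i j) k l))\<^sup>2 = (if k = i \<and> l = j then 1 else 0)"
proof -
  let ?d = "d la" and ?L = "Lw la"
  have one: "1 \<in> {1..?d}" using d_pos[OF la] by simp
  have w: "wb la i 1 \<in> Sym n" "wb la 1 j \<in> Sym n" using wb_Sym[OF la] i j one by auto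
  have st: "hstar n (KL n (wb la j 1)) = KL n (wb la 1 j)"
    using KL_hstar[OF wb_Sym[OF la j one]] wb_inv[OF la j one] by simp
  let ?A = "KL n (wb la i 1)" and ?B = "KL n (wb la 1 j)"
  have AB: "?A \<in> HK n" "?B \<in> HK n" using KL_HK w by auto
  have P: "inO (Ppoly n la)" "const0 (Ppoly n la) = 1"
  proof -
    have "const0 (Ppoly n la) = (\<Sum>u\<in>WJ (Jl la). const0 (vK ^ (2 * len n u)))"
      unfolding Ppoly_def young_WJ by (rule const0_sum) (simp add: inO_power)
    also have "\<dots> = (\<Sum>u\<in>WJ (Jl la). if u = id then 1 else 0)"
    proof (rule sum.cong[OF refl])
      fix u assume "u \<in> WJ (Jl la)"
      then have "u \<in> Sym n" using WJ_Sym[OF youngJ_subset] by blast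
      then show "const0 (vK ^ (2 * len n u)) = (if u = id then 1 else 0)"
        using len_eq_0[of u n] by (auto simp: const0_power power_0_left)
    qed
    finally show "const0 (Ppoly n la) = 1" using finite_WJ[OF youngJ_subset, of n la] by (simp add: sum.delta)
    show "inO (Ppoly n la)" unfolding Ppoly_def by (intro inO_sum inO_power) simp
  qed
  define s where "s = inverse (Ppoly n la) * sgnK n (wlong n la)"
  have sg: "inO (sgnK n (wlong n la))" "(const0 (sgnK n (wlong n la)))\<^sup>2 = 1"
    unfolding sgnK_def by (simp_all add: inO_power const0_power flip: power_mult)
  have s: "inO s" "(const0 s)\<^sup>2 = 1"
    unfolding s_def using P sg by (simp_all add: inO_mult inO_inverse const0_mult const0_inverse)
  have e: "vK ^ ?L * R la (Zelt n la (X la) i j) k l = s * (\<Sum>m=1..?d. (vK ^ ?L * R la ?A k m) * (vK ^ ?L * R la ?B m l))"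
  proof -
    have "R la (Zelt n la (X la) i j) k l = scal la * (\<Sum>m=1..?d. R la ?A k m * R la ?B m l)"
      unfolding Zelt_eq[OF la i j] st R_smult R_hmul[OF la AB] MM_def ..
    also have "\<dots> = s * (\<Sum>m=1..?d. R la ?A k m * (vK ^ ?L * R la ?B m l))"
      unfolding scal_def s_def sum_distrib_left by (intro sum.cong refl) (simp only: mult_ac)
    finally have "R la (Zelt n la (X la) i j) k l = s * (\<Sum>m=1..?d. R la ?A k m * (vK ^ ?L * R la ?B m l))" .
    then show ?thesis by (simp only: sum_distrib_left) (intro sum.cong refl, simp only: mult_ac)
  qed
  have t: "inO ((vK ^ ?L * R la ?A k m) * (vK ^ ?L * R la ?B m l))"
    "const0 ((vK ^ ?L * R la ?A k m) * (vK ^ ?L * R la ?B m l)) = lead la (wb la i 1) k m * lead la (wb la 1 j) m l"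
    if m: "m \<in> {1..?d}" for m
    using R_KL_lead[OF la k m w(1)] R_KL_lead[OF la m l w(2)] by (simp_all add: inO_mult const0_mult)
  let ?S = "\<Sum>m=1..?d. (vK ^ ?L * R la ?A k m) * (vK ^ ?L * R la ?B m l)"
  have SO: "inO ?S" using t by (intro inO_sum)
  have "const0 ?S = (\<Sum>m=1..?d. lead la (wb la i 1) k m * lead la (wb la 1 j) m l)" using t by (subst const0_sum) auto
  also have "\<dots> = (\<Sum>m=1..?d. if m = 1 then (if k = i \<and> l = j then lead la (wb la i 1) i 1 * lead la (wb la 1 j) 1 j else 0) else 0)"
  proof (rule sum.cong[OF refl])
    fix m assume m: "m \<in> {1..?d}"
    have a: "lead la (wb la i 1) k m = 0" if "\<not> (k = i \<and> m = 1)"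
      using lead_zero[OF la k m w(1)] wb_inj[OF la i one la k m] that by auto
    have b: "lead la (wb la 1 j) m l = 0" if "\<not> (m = 1 \<and> l = j)"
      using lead_zero[OF la m l w(2)] wb_inj[OF la one j la m l] that by auto
    show "lead la (wb la i 1) k m * lead la (wb la 1 j) m l =
      (if m = 1 then (if k = i \<and> l = j then lead la (wb la i 1) i 1 * lead la (wb la 1 j) 1 j else 0) else 0)"
      using a b by auto
  qed
  also have "\<dots> = (if k = i \<and> l = j then lead la (wb la i 1) i 1 * lead la (wb la 1 j) 1 j else 0)"
    using one by (simp add: sum.delta)
  finally have S: "(const0 ?S)\<^sup>2 = (if k = i \<and> l = j then 1 else 0)"
    using wb_lead[OF la i one] wb_lead[OF la one j] by (simp add: power_mult_distrib)
  show "inO (vK ^ ?L * R la (Zelt n la (X la) i j) k l)" unfolding e by (rule inO_mult[OF s(1) SO])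
  show "(const0 (vK ^ ?L * R la (Zelt n la (X la) i j) k l))\<^sup>2 = (if k = i \<and> l = j then 1 else 0)"
    unfolding e const0_mult[OF s(1) SO] power_mult_distrib s(2) S by simp
qed

section \<open>Downward induction on the dominance order\<close>

definition above :: "nat list \<Rightarrow> nat list set" where
  "above la = {mu \<in> Pt. la \<lhd> mu}"

text \<open>Vanishing is what makes the coefficients outside higher cells readable; membership
  identifies the remaining terms as elements of the ideal. Each is needed at all higher partitions
  to obtain either at \<open>la\<close>.\<close>

definition KL_good :: "nat list \<Rightarrow> bool" where
  "KL_good la \<longleftrightarrow> (\<forall>y\<in>Cell la. vanishes_below la (KL n y) \<and> KL n y \<in> Nideal n la)"

lemma upset_above:
  assumes la: "la \<in> Pt" and g: "\<And>mu. mu \<in> above la \<Longrightarrow> KL_good mu"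
  shows "upset (above la)"
  unfolding upset_def
proof (intro conjI ballI impI)
  fix mu nu assume "mu \<in> above la" "nu \<in> Pt" "mu \<unlhd> nu"
  then show "nu \<in> above la"
    using dominates_trans[of la mu nu] dominates_antisym[OF la, of mu] by (auto simp: above_def sdominates_def)
qed (use g in \<open>auto simp: above_def KL_good_def\<close>)

lemma Zelt_KL:
  assumes la: "la \<in> Pt" and U: "upset (above la)" and i: "i \<in> {1..d la}" and j: "j \<in> {1..d la}"
  obtains \<eta> a where "\<eta> = 1 \<or> \<eta> = -1" "\<And>y. inA (a y)"
    "Zelt n la (X la) i j = (\<lambda>z. \<eta> * KL n (wb la i j) z + (\<Sum>y\<in>Sym n - outer (above la). a y * KL n y z))"
proof -
  let ?Z = "Zelt n la (X la) i j" and ?U = "above la"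
  obtain a where a: "\<And>w. inA (a w)" "?Z = (\<lambda>y. \<Sum>w\<in>Sym n. a w * KL n w y)" using KL_expand_A[OF Zelt_inH[OF la i j]] by blast
  have UP: "?U \<subseteq> Pt" "la \<notin> ?U" by (auto simp: above_def sdominates_def)
  \<comment> \<open>A partition not strictly above \<open>la\<close> and different from it does not
    dominate \<open>la\<close>, so Z_w acts as zero there; only \<open>la\<close> itself contributes
    leading terms.\<close>
  have nuc: "nu = la \<or> R nu ?Z = (\<lambda>i j. 0)" if "nu \<in> Pt - ?U" for nu
    using that Zelt_vanishes[OF la i j] by (auto simp: above_def sdominates_def vanishes_below_def)
  have O: "inO (vK ^ Lw nu * R nu ?Z k l)" if "nu \<in> Pt - ?U" "k \<in> {1..d nu}" "l \<in> {1..d nu}" for nu k l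
    using nuc[OF that(1)] Zelt_lead(1)[OF la i j, of k l] that by auto
  note oc = outer_coefficients[OF U a(2) O]
  have const: "a y = Kpoly [:const0 (a y):]" if "y \<in> outer ?U" for y
    using bar_invariant_const[OF a(1) oc(1)[OF _ _ _ that]] KL_coeff_bar[OF a(2) Zelt_bar[OF la i j], of y] that by (auto simp: outer_def)
  have zero: "a y = 0" if y: "y \<in> outer ?U" "y \<noteq> wb la i j" for y
  proof -
    obtain nu k l where nu: "nu \<in> Pt" "k \<in> {1..d nu}" "l \<in> {1..d nu}" "y = wb nu k l" using wb_surj[of y] y(1) by (auto simp: outer_def)
    have nuU: "nu \<in> Pt - ?U" using wb_outer[OF UP(1) nu(1-3)] y nu by simp
    have "const0 (a y) * lead nu y k l = const0 (vK ^ Lw nu * R nu ?Z k l)"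
      using oc(2)[OF _ _ _ nuU nu(2,3)] nu(4) by simp
    also have "\<dots> = 0"
    proof (cases "nu = la")
      case True
      then have "\<not> (k = i \<and> l = j)" using nu y by auto
      then have "(const0 (vK ^ Lw la * R la ?Z k l))\<^sup>2 = 0"
        using Zelt_lead(2)[OF la i j, of k l] nu True by (simp only: if_False)
      then show ?thesis using True by simp
    next
      case False
      then show ?thesis using nuc[OF nuU] by auto
    qed
    finally have "const0 (a y) = 0" using wb_lead_nonzero[OF nu(1-3)] nu(4) by simp
    then show ?thesis using const[OF y(1)] by simp
  qed
  let ?w = "wb la i j"
  have wo: "?w \<in> outer ?U" using wb_outer[OF UP(1) la i j] UP(2) by simp
  have "const0 (a ?w) * lead la ?w i j = const0 (vK ^ Lw la * R la ?Z i j)"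
    using oc(2)[OF _ _ _ _ i j] la UP(2) by simp
  then have "(const0 (a ?w) * lead la ?w i j)\<^sup>2 = 1" using Zelt_lead(2)[OF la i j i j] by simp
  then have "(const0 (a ?w))\<^sup>2 = 1" using wb_lead[OF la i j] by (simp add: power_mult_distrib)
  then have "const0 (a ?w) = 1 \<or> const0 (a ?w) = -1" by (simp add: power2_eq_1_iff)
  moreover have "Kpoly [:1:] = 1" "Kpoly [:-1:] = -1"
    by (simp flip: one_pCons, metis Kpoly_simps(2) Kpoly_simps(5) minus_pCons minus_zero one_pCons)
  ultimately have eta: "a ?w = 1 \<or> a ?w = -1" using const[OF wo] by metis
  have sub: "outer ?U \<subseteq> Sym n" by (auto simp: outer_def)
  have "?Z z = a ?w * KL n ?w z + (\<Sum>y\<in>Sym n - outer ?U. a y * KL n y z)" for z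
  proof -
    have "?Z z = (\<Sum>y\<in>Sym n. a y * KL n y z)" using fun_cong[OF a(2), of z] .
    also have "\<dots> = (\<Sum>y\<in>Sym n - outer ?U. a y * KL n y z) + (\<Sum>y\<in>outer ?U. a y * KL n y z)"
      by (rule sum.subset_diff[OF sub finite_Sym])
    also have "(\<Sum>y\<in>outer ?U. a y * KL n y z) = (\<Sum>y\<in>{?w}. a y * KL n y z)"
      using wo zero finite_subset[OF sub finite_Sym] by (intro sum.mono_neutral_right) auto
    finally show ?thesis by simp
  qed
  then have "?Z = (\<lambda>z. a ?w * KL n ?w z + (\<Sum>y\<in>Sym n - outer ?U. a y * KL n y z))" by (rule ext)
  then show thesis by (rule that[OF eta a(1)])
qed

lemma above_sum_Nhat:
  assumes la: "la \<in> Pt" and g: "\<And>mu. mu \<in> above la \<Longrightarrow> KL_good mu" and a: "\<And>y. inA (a y)"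
  shows "(\<lambda>z. \<Sum>y\<in>Sym n - outer (above la). a y * KL n y z) \<in> Nhat n la"
  unfolding Nhat_def
proof (rule spanA_sum[OF a], fold Nhat_def)
  fix y assume "y \<in> Sym n - outer (above la)"
  then obtain mu where mu: "mu \<in> above la" "y \<in> Cell mu" by (auto simp: outer_def)
  then have "KL n y \<in> Nideal n mu" using g by (auto simp: KL_good_def)
  then show "KL n y \<in> Nhat n la" using Nideal_Nhat[OF la, of mu] mu(1) by (auto simp: above_def)
qed

text \<open>This turns identities in representations into congruences: if all representations not
  strictly above \<open>la\<close> kill an integral element, its coefficients outside the higher
  cells vanish.\<close>

lemma vanishing_Nhat:
  assumes la: "la \<in> Pt" and g: "\<And>mu. mu \<in> above la \<Longrightarrow> KL_good mu"
    and h: "inH n h" "\<And>nu. nu \<in> Pt \<Longrightarrow> \<not> la \<lhd> nu \<Longrightarrow> R nu h = (\<lambda>i j. 0)"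
  shows "h \<in> Nhat n la"
proof -
  obtain a where a: "\<And>w. inA (a w)" "h = (\<lambda>y. \<Sum>w\<in>Sym n. a w * KL n w y)" using KL_expand_A[OF h(1)] by blast
  have z: "a y = 0" if "y \<in> outer (above la)" for y
    by (rule outer_coefficients_zero[OF upset_above[OF la g] a(2) _ that]) (use h(2) in \<open>auto simp: above_def\<close>)
  have "h = (\<lambda>z. \<Sum>y\<in>Sym n - outer (above la). a y * KL n y z)"
    unfolding a(2) using z by (intro ext sum.mono_neutral_right) (auto simp: outer_def)
  then show ?thesis using above_sum_Nhat[OF la g a(1)] by simp
qed

definition stdx :: "nat list \<Rightarrow> perm set" where
  "stdx la = {x \<in> XJ n (Jl la). std_perm la x}"

text \<open>A column violation yields a Garnir relation whose other terms belong to strictly shorter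
  coset representatives, so induction on length applies. The coefficients b are the same for all
  representations considered, and they stay in A since \<open>qv\<close> is a unit of A.\<close>

lemma straightening:
  assumes la: "la \<in> Pt" and x: "x \<in> XJ n (Jl la)"
  shows "\<exists>b. (\<forall>y. inA (b y)) \<and> (\<forall>nu\<in>Pt. \<not> la \<lhd> nu \<longrightarrow>
    (\<forall>i j. R nu (hmul n (hT x) (El la)) i j = (\<Sum>y\<in>stdx la. b y * R nu (hmul n (hT y) (El la)) i j)))"
  using x
proof (induction "len n x" arbitrary: x rule: less_induct)
  case less
  let ?E = "El la" and ?J = "Jl la"
  note J = youngJ_subset[of n la]
  have fin: "finite (stdx la)" using finite_XJ[OF J] by (simp add: stdx_def)
  show ?case
  proof (cases "std_perm la x")
    case True
    then have xs: "x \<in> stdx la" using less.prems by (simp add: stdx_def)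
    show ?thesis
    proof (intro exI[of _ "\<lambda>y. if y = x then 1 else 0"] conjI allI ballI impI)
      fix nu i j
      have "(\<Sum>y\<in>stdx la. (if y = x then 1 else 0) * R nu (hmul n (hT y) ?E) i j) = (\<Sum>y\<in>stdx la. if y = x then R nu (hmul n (hT x) ?E) i j else 0)"
        by (intro sum.cong refl) auto
      then show "R nu (hmul n (hT x) ?E) i j = (\<Sum>y\<in>stdx la. (if y = x then 1 else 0) * R nu (hmul n (hT y) ?E) i j)"
        using xs fin by (simp add: sum.delta)
    qed simp
  next
    case False
    then obtain r c where rc: "Suc r < length la" "1 \<le> c" "c \<le> la ! Suc r" "\<not> x (stl la r + c) < x (stl la (Suc r) + c)"
      by (auto simp: std_perm_def)
    have xS: "x \<in> Sym n" using XJ_Sym[OF J less.prems] .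
    have "stl la r + c \<noteq> stl la (Suc r) + c"
      using stl_Suc[of r la] partitions_pos[OF la, of r] rc(1) by simp
    then have viol: "x (stl la (Suc r) + c) < x (stl la r + c)"
      using rc(4) Sym_inj[OF xS, of "stl la r + c" "stl la (Suc r) + c"] by linarith
    obtain y g0 G where G: "y \<in> Sym n" "finite G" "g0 \<in> G" "x = y \<circ> g0"
      "\<And>g. g \<in> G \<Longrightarrow> y \<circ> g \<in> Sym n \<and> len n (y \<circ> g) = len n y + len n g"
      "\<And>g. g \<in> G \<Longrightarrow> g \<noteq> g0 \<Longrightarrow> len n g < len n g0"
      "\<And>nu. nu \<in> Pt \<Longrightarrow> \<not> la \<lhd> nu \<Longrightarrow> R nu (\<lambda>z. \<Sum>g\<in>G. qv ^ len n g * hmul n (hT (y \<circ> g)) ?E z) = (\<lambda>i j. 0)"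
      using garnir_relation[OF la less.prems rc(1-3) viol] by blast
    have "\<exists>x' u. x' \<in> XJ n ?J \<and> u \<in> WJ ?J \<and> y \<circ> g = x' \<circ> u" if "g \<in> G" for g
      using XJ_WJ_decomp[OF J] G(5)[OF that] by metis
    then obtain x' u where xu: "\<And>g. g \<in> G \<Longrightarrow> x' g \<in> XJ n ?J" "\<And>g. g \<in> G \<Longrightarrow> u g \<in> WJ ?J" "\<And>g. g \<in> G \<Longrightarrow> y \<circ> g = x' g \<circ> u g"
      by metis
    have sh: "len n (x' g) < len n x" if g: "g \<in> G" "g \<noteq> g0" for g
      using G(5)[OF g(1)] G(5)[OF G(3)] G(6)[OF g] len_XJ_WJ[OF J xu(1,2)[OF g(1)]] xu(3)[OF g(1)] G(4) by simp
    define Q where "Q = (\<lambda>g b. (\<forall>y. inA (b y)) \<and> (\<forall>nu\<in>Pt. \<not> la \<lhd> nu \<longrightarrow>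
        (\<forall>i j. R nu (hmul n (hT (x' g)) ?E) i j = (\<Sum>y\<in>stdx la. b y * R nu (hmul n (hT y) ?E) i j))))"
    have "\<forall>g\<in>G - {g0}. \<exists>b. Q g b"
    proof
      fix g assume "g \<in> G - {g0}"
      then have g: "g \<in> G" "g \<noteq> g0" by auto
      show "\<exists>b. Q g b" unfolding Q_def by (rule less.hyps[OF sh[OF g] xu(1)[OF g(1)]])
    qed
    then obtain b where Q: "\<forall>g\<in>G - {g0}. Q g (b g)" by (rule bchoice[THEN exE])
    have b: "\<And>g y. g \<in> G - {g0} \<Longrightarrow> inA (b g y)"
      "\<And>g nu i j. g \<in> G - {g0} \<Longrightarrow> nu \<in> Pt \<Longrightarrow> \<not> la \<lhd> nu \<Longrightarrow>
         R nu (hmul n (hT (x' g)) ?E) i j = (\<Sum>y\<in>stdx la. b g y * R nu (hmul n (hT y) ?E) i j)"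
      using Q unfolding Q_def by simp_all
    \<comment> \<open>Solving the Garnir relation for g0 gives the sign and the inverse power; the
      last factor comes from absorbing the Young subgroup part of y g into E.\<close>
    define cf where "cf = (\<lambda>g. - (inverse qv ^ len n g0 * (qv ^ len n g * qv ^ len n (u g))))"
    have cfA: "inA (cf g)" for g
      unfolding cf_def inverse_qv by (intro inA_uminus inA_mult inA_power) (simp_all add: inA_uminus)
    show ?thesis
    proof (intro exI[of _ "\<lambda>y. \<Sum>g\<in>G - {g0}. cf g * b g y"] conjI allI ballI impI)
      show "inA (\<Sum>g\<in>G - {g0}. cf g * b g y)" for y using cfA b(1) by (intro inA_sum inA_mult) auto
    next
      fix nu i j assume nu: "nu \<in> Pt" "\<not> la \<lhd> nu"
      let ?R = "\<lambda>w. R nu (hmul n (hT w) ?E) i j"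
      have "0 = (\<Sum>g\<in>G. qv ^ len n g * ?R (y \<circ> g))"
        using fun_cong[OF fun_cong[OF G(7)[OF nu]], of i j] by (simp add: R_sum)
      also have "\<dots> = qv ^ len n g0 * ?R x + (\<Sum>g\<in>G - {g0}. qv ^ len n g * ?R (y \<circ> g))"
        using G(2,3,4) by (simp add: sum.remove)
      finally have "qv ^ len n g0 * ?R x = - (\<Sum>g\<in>G - {g0}. qv ^ len n g * ?R (y \<circ> g))" by (simp add: eq_neg_iff_add_eq_0)
      then have "inverse qv ^ len n g0 * (qv ^ len n g0 * ?R x) = - (inverse qv ^ len n g0 * (\<Sum>g\<in>G - {g0}. qv ^ len n g * ?R (y \<circ> g)))" by simp
      moreover have "inverse qv ^ len n g0 * (qv ^ len n g0 * ?R x) = ?R x" by (simp add: mult.assoc[symmetric] flip: power_mult_distrib)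
      ultimately have "?R x = - (inverse qv ^ len n g0 * (\<Sum>g\<in>G - {g0}. qv ^ len n g * ?R (y \<circ> g)))" by simp
      also have "\<dots> = (\<Sum>g\<in>G - {g0}. cf g * ?R (x' g))"
        unfolding sum_distrib_left sum_negf[symmetric]
      proof (rule sum.cong[OF refl])
        fix g assume g: "g \<in> G - {g0}"
        have "?R (y \<circ> g) = qv ^ len n (u g) * ?R (x' g)"
          using hmul_hT_leig[OF J leig_EJ[OF J] xu(1,2)] xu(3) g by (simp add: R_smult)
        then show "- (inverse qv ^ len n g0 * (qv ^ len n g * ?R (y \<circ> g))) = cf g * ?R (x' g)" by (simp add: cf_def mult.assoc)
      qed
      also have "\<dots> = (\<Sum>g\<in>G - {g0}. cf g * (\<Sum>y\<in>stdx la. b g y * ?R y))"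
        using b(2)[OF _ nu] by (intro sum.cong refl) simp
      also have "\<dots> = (\<Sum>g\<in>G - {g0}. \<Sum>y\<in>stdx la. cf g * b g y * ?R y)" by (simp add: sum_distrib_left mult.assoc)
      also have "\<dots> = (\<Sum>y\<in>stdx la. \<Sum>g\<in>G - {g0}. cf g * b g y * ?R y)" by (rule sum.swap)
      finally show "?R x = (\<Sum>y\<in>stdx la. (\<Sum>g\<in>G - {g0}. cf g * b g y) * ?R y)" by (simp add: sum_distrib_right)
    qed
  qed
qed

lemma KL_column_straightening:
  assumes la: "la \<in> Pt" and i: "i \<in> {1..d la}"
  obtains B where "\<And>y. inA (B y)"
    "\<And>nu. nu \<in> Pt \<Longrightarrow> \<not> la \<lhd> nu \<Longrightarrow> R nu (KL n (wb la i 1)) = R nu (\<lambda>z. \<Sum>y\<in>stdx la. B y * hmul n (hT y) (Cl la) z)"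
proof -
  let ?J = "Jl la"
  have one: "1 \<in> {1..d la}" using d_pos[OF la] by simp
  define Q where "Q = (\<lambda>x b. (\<forall>y. inA (b y)) \<and> (\<forall>nu\<in>Pt. \<not> la \<lhd> nu \<longrightarrow>
    (\<forall>i j. R nu (hmul n (hT x) (El la)) i j = (\<Sum>y\<in>stdx la. b y * R nu (hmul n (hT y) (El la)) i j))))"
  have "\<forall>x\<in>XJ n ?J. \<exists>b. Q x b" unfolding Q_def using straightening[OF la] by (intro ballI)
  then obtain b where Q: "\<forall>x\<in>XJ n ?J. Q x (b x)" by (rule bchoice[THEN exE])
  have b: "\<And>x y. x \<in> XJ n ?J \<Longrightarrow> inA (b x y)"
    "\<And>x nu i j. x \<in> XJ n ?J \<Longrightarrow> nu \<in> Pt \<Longrightarrow> \<not> la \<lhd> nu \<Longrightarrow>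
      R nu (hmul n (hT x) (El la)) i j = (\<Sum>y\<in>stdx la. b x y * R nu (hmul n (hT y) (El la)) i j)"
    using Q unfolding Q_def by simp_all
  have bC: "R nu (hmul n (hT x) (Cl la)) i j = (\<Sum>y\<in>stdx la. b x y * R nu (hmul n (hT y) (Cl la)) i j)"
    if "x \<in> XJ n ?J" "nu \<in> Pt" "\<not> la \<lhd> nu" for x nu i j
    unfolding Cl_EJ hmul_smult_right R_smult b(2)[OF that] sum_distrib_left by (intro sum.cong refl) (simp only: mult_ac)
  define a where "a = (\<lambda>x. KL n (wb la i 1) (x \<circ> wlong n la))"
  define B where "B = (\<lambda>y. \<Sum>x\<in>XJ n ?J. a x * b x y)"
  have "inA (B y)" for y
    unfolding B_def a_def using KL_inH[OF wb_Sym[OF la i one]] b(1) by (intro inA_sum inA_mult) (auto simp: inH_def)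
  moreover have "R nu (KL n (wb la i 1)) = R nu (\<lambda>z. \<Sum>y\<in>stdx la. B y * hmul n (hT y) (Cl la) z)"
    if nu: "nu \<in> Pt" "\<not> la \<lhd> nu" for nu
  proof (intro ext)
    fix k l
    let ?R = "\<lambda>y. R nu (hmul n (hT y) (Cl la)) k l"
    have "R nu (KL n (wb la i 1)) k l = (\<Sum>x\<in>XJ n ?J. a x * ?R x)"
      by (subst KL_column_factor[OF la i]) (simp only: R_sum a_def)
    also have "\<dots> = (\<Sum>x\<in>XJ n ?J. a x * (\<Sum>y\<in>stdx la. b x y * ?R y))" using bC[OF _ nu] by (intro sum.cong refl) simp
    also have "\<dots> = (\<Sum>x\<in>XJ n ?J. \<Sum>y\<in>stdx la. a x * b x y * ?R y)" by (simp add: sum_distrib_left mult.assoc)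
    also have "\<dots> = (\<Sum>y\<in>stdx la. \<Sum>x\<in>XJ n ?J. a x * b x y * ?R y)" by (rule sum.swap)
    also have "\<dots> = (\<Sum>y\<in>stdx la. B y * ?R y)" by (simp add: B_def sum_distrib_right)
    also have "\<dots> = R nu (\<lambda>z. \<Sum>y\<in>stdx la. B y * hmul n (hT y) (Cl la) z) k l" by (simp only: R_sum)
    finally show "R nu (KL n (wb la i 1)) k l = R nu (\<lambda>z. \<Sum>y\<in>stdx la. B y * hmul n (hT y) (Cl la) z) k l" .
  qed
  ultimately show thesis by (rule that)
qed

lemma R_hstar_cong:
  assumes nu: "nu \<in> Pt" and h: "g \<in> HK n" "h \<in> HK n" "R nu g = R nu h"
  shows "R nu (hstar n g) = R nu (hstar n h)"
proof (intro ext)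
  fix i j
  show "R nu (hstar n g) i j = R nu (hstar n h) i j"
    using R_hstar[OF nu h(1), of i j] R_hstar[OF nu h(2), of i j] h(3) R_outside[of i nu j]
    by (cases "i \<in> {1..d nu} \<and> j \<in> {1..d nu}") auto
qed

text \<open>Straightening both columns replaces Z_w by a combination Y of the elements
  \<open>ytilde\<close>. The two agree only in the representations not strictly above
  \<open>la\<close>, but both are integral, so their difference lies in \<open>Nhat\<close>.\<close>

lemma Zelt_Nideal:
  assumes la: "la \<in> Pt" and g: "\<And>mu. mu \<in> above la \<Longrightarrow> KL_good mu" and i: "i \<in> {1..d la}" and j: "j \<in> {1..d la}"
  shows "Zelt n la (X la) i j \<in> Nideal n la"
proof -
  let ?Z = "Zelt n la (X la) i j" and ?C = "Cl la"
  have one: "1 \<in> {1..d la}" using d_pos[OF la] by simp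
  obtain B where B: "\<And>y. inA (B y)"
    "\<And>nu. nu \<in> Pt \<Longrightarrow> \<not> la \<lhd> nu \<Longrightarrow> R nu (KL n (wb la i 1)) = R nu (\<lambda>z. \<Sum>y\<in>stdx la. B y * hmul n (hT y) ?C z)"
    using KL_column_straightening[OF la i] by blast
  obtain B' where B': "\<And>y. inA (B' y)"
    "\<And>nu. nu \<in> Pt \<Longrightarrow> \<not> la \<lhd> nu \<Longrightarrow> R nu (KL n (wb la j 1)) = R nu (\<lambda>z. \<Sum>y\<in>stdx la. B' y * hmul n (hT y) ?C z)"
    using KL_column_straightening[OF la j] by blast
  let ?S = "\<lambda>z. \<Sum>y\<in>stdx la. B y * hmul n (hT y) ?C z" and ?S' = "\<lambda>z. \<Sum>y\<in>stdx la. B' y * hmul n (hT y) ?C z"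
  have sS: "x \<in> Sym n" if "x \<in> stdx la" for x using that XJ_Sym[OF youngJ_subset] by (auto simp: stdx_def)
  have S: "?S \<in> HK n" "?S' \<in> HK n" by (intro HK_sum hmul_HK Cl_HK)+
  \<comment> \<open>The factor \<open>scal\<close> again cancels one middle C_(w_la), so each
    product of two standard terms becomes a single \<open>ytilde\<close> with coefficients in
    A.\<close>
  define Y where "Y = (\<lambda>z. scal la * hmul n ?S (hstar n ?S') z)"
  have prod: "(\<lambda>z. scal la * hmul n (hmul n (hT x) ?C) (hstar n (hmul n (hT y) ?C)) z) = hmul n (hmul n (hT x) ?C) (hT (inv y))"
    if "x \<in> stdx la" "y \<in> stdx la" for x y
    using scal_product[OF hT_HK[OF sS[OF that(1)]] hT_HK[OF sS[OF that(2)]], of la] sS[OF that(2)] by (simp add: hstar_hT)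
  have Yeq: "Y = (\<lambda>z. \<Sum>x\<in>stdx la. B x * (\<Sum>y\<in>stdx la. B' y * hmul n (hmul n (hT x) ?C) (hT (inv y)) z))"
  proof
    fix z
    have "Y z = (\<Sum>x\<in>stdx la. B x * (\<Sum>y\<in>stdx la. B' y * (scal la * hmul n (hmul n (hT x) ?C) (hstar n (hmul n (hT y) ?C)) z)))"
      unfolding Y_def hlin_sum[OF hlin_hstar] hmul_sum_left hmul_sum_right sum_distrib_left
      by (intro sum.cong refl) (simp only: mult_ac)
    also have "\<dots> = (\<Sum>x\<in>stdx la. B x * (\<Sum>y\<in>stdx la. B' y * hmul n (hmul n (hT x) ?C) (hT (inv y)) z))"
      using prod by (intro sum.cong refl arg_cong2[where f = times]) (auto dest!: fun_cong)
    finally show "Y z = (\<Sum>x\<in>stdx la. B x * (\<Sum>y\<in>stdx la. B' y * hmul n (hmul n (hT x) ?C) (hT (inv y)) z))" .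
  qed
  have yt: "hmul n (hmul n (hT x) ?C) (hT (inv y)) \<in> Nideal n la" if "x \<in> stdx la" "y \<in> stdx la" for x y
  proof -
    obtain s where s: "s \<in> std_tableaux n la" "dtab n la s = x" using std_perm_tableau[OF la, of x] \<open>x \<in> stdx la\<close> by (auto simp: stdx_def)
    obtain t where t: "t \<in> std_tableaux n la" "dtab n la t = y" using std_perm_tableau[OF la, of y] \<open>y \<in> stdx la\<close> by (auto simp: stdx_def)
    have "hmul n (hmul n (hT x) ?C) (hT (inv y)) = ytilde n la s t" by (simp add: ytilde_def s t)
    moreover have "ytilde n la s t \<in> {ytilde n mu s t |mu s t. mu \<in> Pt \<and> la \<unlhd> mu \<and> s \<in> std_tableaux n mu \<and> t \<in> std_tableaux n mu}"
      using s(1) t(1) la dominates_refl[of la] by blast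
    ultimately show ?thesis unfolding Nideal_def by (simp only: spanA_superset)
  qed
  have YN: "Y \<in> Nideal n la"
    unfolding Yeq Nideal_def by (intro spanA_sum B(1) B'(1)) (fold Nideal_def, rule yt)
  have YH: "inH n Y"
    unfolding Yeq using B(1) B'(1) sS by (intro inH_sum inH_hmul inH_hT) (auto intro: Sym_inv)
  have KK: "KL n (wb la i 1) \<in> HK n" "KL n (wb la j 1) \<in> HK n" using KL_HK wb_Sym[OF la] i j one by auto
  have "R nu (\<lambda>z. ?Z z - Y z) = (\<lambda>i j. 0)" if nu: "nu \<in> Pt" "\<not> la \<lhd> nu" for nu
  proof -
    have "R nu (hmul n (KL n (wb la i 1)) (hstar n (KL n (wb la j 1)))) = R nu (hmul n ?S (hstar n ?S'))"
      unfolding R_hmul[OF nu(1) KK(1) hstar_HK] R_hmul[OF nu(1) S(1) hstar_HK]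
        B(2)[OF nu] R_hstar_cong[OF nu(1) KK(2) S(2) B'(2)[OF nu]] ..
    then show ?thesis unfolding Zelt_eq[OF la i j] Y_def by (simp add: R_diff R_smult fun_eq_iff)
  qed
  then have "(\<lambda>z. ?Z z - Y z) \<in> Nhat n la"
    by (intro vanishing_Nhat[OF la g] inH_diff Zelt_inH[OF la i j] YH)
  then have "(\<lambda>z. ?Z z - Y z) \<in> Nideal n la" using Nhat_Nideal by blast
  from spanA_add[OF this[unfolded Nideal_def] YN[unfolded Nideal_def]] show ?thesis
    unfolding Nideal_def by simp
qed

text \<open>The relation between Z_w and C_w is solved for C_w; the sign is its own inverse. Both
  required properties hold for Z_w and, by hypothesis, for the basis elements of higher
  cells.\<close>

lemma KL_good_step:
  assumes la: "la \<in> Pt" and g: "\<And>mu. mu \<in> above la \<Longrightarrow> KL_good mu"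
  shows "KL_good la"
  unfolding KL_good_def
proof
  fix y assume "y \<in> Cell la"
  then obtain i j where ij: "i \<in> {1..d la}" "j \<in> {1..d la}" "y = wb la i j" by (auto simp: Cell_iff)
  let ?Z = "Zelt n la (X la) i j"
  obtain \<eta> a where z: "\<eta> = 1 \<or> \<eta> = -1" "\<And>y. inA (a y)"
    "?Z = (\<lambda>z. \<eta> * KL n (wb la i j) z + (\<Sum>y\<in>Sym n - outer (above la). a y * KL n y z))"
    using Zelt_KL[OF la upset_above[OF la g] ij(1,2)] by blast
  let ?T = "\<lambda>z. \<Sum>y\<in>Sym n - outer (above la). a y * KL n y z"
  have eq: "KL n y = (\<lambda>z. \<eta> * ?Z z + (- \<eta>) * ?T z)"
    using z(1) unfolding z(3) ij(3) by (auto simp: algebra_simps)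
  have eA: "inA \<eta>" "inA (- \<eta>)" using z(1) by auto
  have "?T \<in> Nideal n la" using above_sum_Nhat[OF la g, of a] z(2) Nhat_Nideal by blast
  then have "KL n y \<in> Nideal n la"
    unfolding eq using spanA_add[OF spanA_smult[OF eA(1)] spanA_smult[OF eA(2)]] Zelt_Nideal[OF la g ij(1,2)]
    by (simp only: Nideal_def)
  moreover have "vanishes_below la (KL n y)"
    unfolding vanishes_below_def
  proof (intro ballI impI ext)
    fix nu k l assume nu: "nu \<in> Pt" "\<not> la \<unlhd> nu"
    have "R nu (KL n y') k l = 0" if y': "y' \<in> Sym n - outer (above la)" for y'
    proof -
      from y' obtain mu where mu: "mu \<in> above la" "y' \<in> Cell mu" by (auto simp: outer_def)
      then have "vanishes_below mu (KL n y')" using g by (auto simp: KL_good_def)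
      moreover have "\<not> mu \<unlhd> nu" using nu mu dominates_trans[of la mu nu] by (auto simp: above_def sdominates_def)
      ultimately show ?thesis using nu by (simp add: vanishes_below_def)
    qed
    then have "R nu ?T k l = 0" by (simp add: R_sum)
    moreover have "R nu ?Z k l = 0" using Zelt_vanishes[OF la ij(1,2)] nu by (simp add: vanishes_below_def)
    ultimately show "R nu (KL n y) k l = 0" unfolding eq R_add R_smult by simp
  qed
  ultimately show "vanishes_below la (KL n y) \<and> KL n y \<in> Nideal n la" by blast
qed

text \<open>The induction terminates because l(w_la) strictly increases along dominance and is
  bounded on the finite set of partitions.\<close>

lemma KL_good_all: "la \<in> Pt \<Longrightarrow> KL_good la"
proof (induction "Max (Lw ` Pt) - Lw la" arbitrary: la rule: less_induct)
  case less
  show ?case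
  proof (rule KL_good_step[OF less.prems])
    fix mu assume "mu \<in> above la"
    then have mu: "mu \<in> Pt" "la \<lhd> mu" by (auto simp: above_def)
    have "Lw la < Lw mu" by (rule len_wlong_strict_mono[OF less.prems mu])
    moreover have "Lw mu \<le> Max (Lw ` Pt)" using mu finite_partitions by auto
    ultimately show "KL_good mu" using less.hyps[of mu] mu by simp
  qed
qed

text \<open>One inclusion is membership from \<open>KL_good\<close>. For the other, a
  \<open>ytilde\<close> of a partition \<open>mu\<close> above \<open>la\<close> is killed by every
  representation outside the up-set of \<open>la\<close>, so its expansion involves only the cells
  in that up-set.\<close>

lemma Nideal_KL:
  assumes la: "la \<in> Pt"
  shows "Nideal n la = spanA {KL n w | w mu. mu \<in> Pt \<and> la \<unlhd> mu \<and> w \<in> Cell mu}" (is "_ = spanA ?S")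
proof
  show "spanA ?S \<subseteq> Nideal n la"
    unfolding Nideal_def
  proof (rule spanA_least, fold Nideal_def)
    fix b assume "b \<in> ?S"
    then obtain w mu where "b = KL n w" "mu \<in> Pt" "la \<unlhd> mu" "w \<in> Cell mu" by blast
    then show "b \<in> Nideal n la" using KL_good_all[of mu] Nideal_mono[of la mu] by (auto simp: KL_good_def)
  qed
  show "Nideal n la \<subseteq> spanA ?S"
    unfolding Nideal_def
  proof (rule spanA_least)
    fix h assume "h \<in> {ytilde n mu s t |mu s t. mu \<in> Pt \<and> la \<unlhd> mu \<and> s \<in> std_tableaux n mu \<and> t \<in> std_tableaux n mu}"
    then obtain mu s t where h: "h = ytilde n mu s t" "mu \<in> Pt" "la \<unlhd> mu" "s \<in> std_tableaux n mu" "t \<in> std_tableaux n mu" by blast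
    have st: "dtab n mu s \<in> Sym n" "dtab n mu t \<in> Sym n"
      using dtab_std[OF h(2)] h(4,5) XJ_Sym[OF youngJ_subset] by auto
    have hH: "inH n h" unfolding h(1) ytilde_def using st by (intro inH_hmul inH_hT Sym_inv) auto
    let ?U = "{mu \<in> Pt. la \<unlhd> mu}"
    have U: "upset ?U"
      unfolding upset_def using dominates_trans KL_good_all by (auto simp: KL_good_def)
    have z: "R nu h = (\<lambda>i j. 0)" if "nu \<in> Pt - ?U" for nu
    proof -
      have nu: "nu \<in> Pt" "\<not> mu \<unlhd> nu" using that h(3) dominates_trans by auto
      have "R nu (hmul n (hT (dtab n mu s)) (Cl mu)) = (\<lambda>i j. 0)"
        using R_zero_right[OF nu(1) hT_HK[OF st(1)] Cl_HK R_Cl_zero[OF h(2) nu]] .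
      then show ?thesis unfolding h(1) ytilde_def
        by (rule R_zero_left[OF nu(1) hmul_HK[OF Cl_HK] hT_HK[OF Sym_inv[OF st(2)]]])
    qed
    obtain a where a: "\<And>w. inA (a w)" "h = (\<lambda>y. \<Sum>w\<in>Sym n. a w * KL n w y)" using KL_expand_A[OF hH] by blast
    have "h = (\<lambda>z. \<Sum>y\<in>Sym n - outer ?U. a y * KL n y z)"
      unfolding a(2) using outer_coefficients_zero[OF U a(2) z] by (intro ext sum.mono_neutral_right) (auto simp: outer_def)
    moreover have "(\<lambda>z. \<Sum>y\<in>Sym n - outer ?U. a y * KL n y z) \<in> spanA ?S"
      by (intro spanA_sum a(1) spanA_superset) (auto simp: outer_def)
    ultimately show "h \<in> spanA ?S" by simp
  qed
qed

end

theorem theorem4p10: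
  fixes n :: nat and d :: "nat list \<Rightarrow> nat" and X :: "nat list \<Rightarrow> matrep" and la :: "nat list"
  assumes "standing_setup n d X"
    and "la \<in> partitions n"
  shows "(\<forall>i\<in>{1..d la}. \<forall>j\<in>{1..d la}. \<exists>\<eta>::K. (\<eta> = 1 \<or> \<eta> = -1) \<and>
            hsmul \<eta> (KL n (wbold n la (X la) i j)) \<in> {hadd (Zelt n la (X la) i j) h | h. h \<in> Nhat n la} \<and>
            {hadd (Zelt n la (X la) i j) h | h. h \<in> Nhat n la} \<subseteq> Nideal n la)
       \<and> Nideal n la = spanA {KL n w | w mu. mu \<in> partitions n \<and> la \<unlhd> mu \<and> w \<in> Rcell n mu (d mu) (X mu)}"
proof -
  interpret hecke_reps n d X by unfold_locales (rule assms(1))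
  note la = assms(2)
  have good: "KL_good mu" if "mu \<in> above la" for mu using that KL_good_all by (simp add: above_def)
  show ?thesis
  proof (intro conjI ballI)
    fix i j assume ij: "i \<in> {1..d la}" "j \<in> {1..d la}"
    let ?Z = "Zelt n la (X la) i j"
    obtain \<eta> a where z: "\<eta> = 1 \<or> \<eta> = -1" "\<And>y. inA (a y)"
      "?Z = (\<lambda>z. \<eta> * KL n (wbold n la (X la) i j) z + (\<Sum>y\<in>Sym n - outer (above la). a y * KL n y z))"
      using Zelt_KL[OF la upset_above[OF la good] ij] by blast
    \<comment> \<open>The sum over the higher cells in \<open>Zelt_KL\<close>, moved to the other
      side.\<close>
    let ?h = "\<lambda>z. (-1) * (\<Sum>y\<in>Sym n - outer (above la). a y * KL n y z)"
    have h: "?h \<in> Nhat n la"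
      unfolding Nhat_def by (rule spanA_smult, simp, fold Nhat_def) (rule above_sum_Nhat[OF la good z(2)])
    have "hsmul \<eta> (KL n (wbold n la (X la) i j)) = hadd ?Z ?h"
      unfolding z(3) by (simp add: hsmul_def hadd_def)
    moreover have "{hadd ?Z h | h. h \<in> Nhat n la} \<subseteq> Nideal n la"
    proof
      fix g assume "g \<in> {hadd ?Z h | h. h \<in> Nhat n la}"
      then obtain k where k: "k \<in> Nhat n la" "g = hadd ?Z k" by blast
      have "k \<in> Nideal n la" using k(1) Nhat_Nideal by blast
      from spanA_add[OF Zelt_Nideal[OF la good ij, unfolded Nideal_def] this[unfolded Nideal_def]]
      show "g \<in> Nideal n la" unfolding k(2) hadd_def Nideal_def .
    qed
    ultimately show "\<exists>\<eta>::K. (\<eta> = 1 \<or> \<eta> = -1) \<and>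
            hsmul \<eta> (KL n (wbold n la (X la) i j)) \<in> {hadd ?Z h | h. h \<in> Nhat n la} \<and>
            {hadd ?Z h | h. h \<in> Nhat n la} \<subseteq> Nideal n la"
      using z(1) h by blast
  qed (use Nideal_KL[OF la] in \<open>simp add: Cell_def\<close>)
qed

end
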